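(* Assume (A1)-(A4), let $u\in H^1_0(\Omega)$ be the positive $L^2$-normalized ground state, let $\tau>0$ be an arbitrary step size, and let $u^n\in H^1_0(\Omega)$ denote the GFDN iterations $$u^{n+1}:=\frac{(\mathcal{I}+\tau\mathcal{A}_{u^n})^{-1}\mathcal{I}u^n}{\|(\mathcal{I}+\tau\mathcal{A}_{u^n})^{-1}\mathcal{I}u^n\|},\qquad n\ge 0 .$$ Then there exist a neighborhood $S\subset H^1_0(\Omega)$ of $u$ and a constant $C>0$ such that $$\|u^n-u\|_{H^1(\Omega)}\le C\,\Big|\frac{1+\tau\lambda_1}{1+\tau\lambda_2}\Big|^n\,\|u^0-u\|_{H^1(\Omega)}$$ for all $L^2$-normalized starting values $u^0\in S$ and all $n\ge 1$, where $\lambda_1$ and $\lambda_2$ are the first and second eigenvalue of the linearized eigenvalue problem.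
   Context: All functions are real-valued and $\|\cdot\|:=\|\cdot\|_{L^2(\Omega)}$. Assumptions: (A1) $\Omega\subset\mathbb{R}^d$ is a bounded convex domain, $d\in\{1,2,3\}$. (A2) $V\in L^\infty(\Omega)$ with $V\ge 0$ a.e. in $\Omega$. (A3) $\beta\ge 0$ is a real constant. (A4) For all $x\in\Omega$ and $\varepsilon>0$: $\|V\|_{L^\infty(\Omega\cap B_\varepsilon(x))}>0$, where $B_\varepsilon(x)$ is the ball of radius $\varepsilon$ around $x$. Energy: $E(v):=\frac12\int_\Omega \frac12|\nabla v|^2+V|v|^2+\frac{\beta}{2}|v|^4\,dx$ for $v\in H^1_0(\Omega)$. The ground state $u$ is the unique positive minimizer of $E$ over $\{v\in H^1_0(\Omega):\|v\|=1\}$ (under (A1)-(A3) it is known that exactly two minimizers exist, $u>0$ and $-u$, and $u\in H^2(\Omega)\cap C^{0,\alpha}(\overline\Omega)$ for some $0<\alpha<1$). For $z\in H^1_0(\Omega)$ let $a_z(w,v):=\frac12(\nabla w,\nabla v)_{L^2(\Omega)}+(Vw,v)_{L^2(\Omega)}+\beta(|z|^2w,v)_{L^2(\Omega)}$ for $w,v\in H^1_0(\Omega)$. The ground state eigenvalue $\lambda>0$ is the number with $a_u(u,v)=\lambda(u,v)_{L^2(\Omega)}$ for all $v\in H^1_0(\Omega)$. Linearized eigenvalue problem: find $\lambda_i\in\mathbb{R}$ and $u_i\in H^1_0(\Omega)$, $\|u_i\|=1$, with $a_u(u_i,v)=\lambda_i(u_i,v)_{L^2(\Omega)}$ for all $v\in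 H^1_0(\Omega)$. Its eigenvalues, ordered with multiplicity, are $0<\lambda_1<\lambda_2\le\lambda_3\le\dots\to\infty$, and it is known that $\lambda_1=\lambda$ is simple with eigenfunction $u$. The operators $\mathcal{A}_v,\mathcal{I}:H^1_0(\Omega)\to H^{-1}(\Omega)$ are $\mathcal{A}_vw:=a_v(w,\cdot)$ (for $v\in H^1_0(\Omega)$) and $\mathcal{I}w:=(w,\cdot)_{L^2(\Omega)}$. "Neighborhood" is with respect to the $H^1$-norm. *)

theory Defs
  imports "HOL-Analysis.Analysis" "HOL-Probability.Essential_Supremum"
begin

text \<open>
  The space \<open>\<real>\<^sup>d\<close> is a Euclidean space type \<open>'a\<close>.  Elements of the function spaces are
  represented by functions \<open>'a \<Rightarrow> real\<close>; only their values on \<open>\<Omega>\<close>, up to Lebesgue null sets, matter.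
\<close>

definition L2 :: "'a::euclidean_space set \<Rightarrow> ('a \<Rightarrow> real) set" where
  "L2 \<Omega> = {f. f \<in> borel_measurable (lebesgue_on \<Omega>) \<and> integrable (lebesgue_on \<Omega>) (\<lambda>x. (f x)\<^sup>2)}"

definition L2_inner :: "'a::euclidean_space set \<Rightarrow> ('a \<Rightarrow> real) \<Rightarrow> ('a \<Rightarrow> real) \<Rightarrow> real" where
  "L2_inner \<Omega> f g = (LINT x|lebesgue_on \<Omega>. f x * g x)"

definition L2_norm :: "'a::euclidean_space set \<Rightarrow> ('a \<Rightarrow> real) \<Rightarrow> real" where
  "L2_norm \<Omega> f = sqrt (LINT x|lebesgue_on \<Omega>. (f x)\<^sup>2)"

definition Linf_norm :: "'a::euclidean_space set \<Rightarrow> ('a \<Rightarrow> real) \<Rightarrow> ereal" where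
  "Linf_norm \<Omega> f = esssup (lebesgue_on \<Omega>) (\<lambda>x. ereal \<bar>f x\<bar>)"

definition Linf :: "'a::euclidean_space set \<Rightarrow> ('a \<Rightarrow> real) set" where
  "Linf \<Omega> = {f. f \<in> borel_measurable (lebesgue_on \<Omega>) \<and> Linf_norm \<Omega> f < \<infinity>}"

definition partial_deriv :: "'a::euclidean_space \<Rightarrow> ('a \<Rightarrow> real) \<Rightarrow> 'a \<Rightarrow> real" where
  "partial_deriv b f = (\<lambda>x. frechet_derivative f (at x) b)"

primrec Ck :: "nat \<Rightarrow> ('a::euclidean_space \<Rightarrow> real) \<Rightarrow> bool" where
  "Ck 0 f \<longleftrightarrow> continuous_on UNIV f"
| "Ck (Suc k) f \<longleftrightarrow> f differentiable_on UNIV \<and> (\<forall>b\<in>Basis. Ck k (partial_deriv b f))"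

text \<open>The space \<open>C_c^\<infinity>(\<Omega>)\<close>; its elements are extended by zero to the whole space.\<close>

definition test_functions :: "'a::euclidean_space set \<Rightarrow> ('a \<Rightarrow> real) set" where
  "test_functions \<Omega> =
    {\<phi>. (\<forall>k. Ck k \<phi>) \<and> compact (closure {x. \<phi> x \<noteq> 0}) \<and> closure {x. \<phi> x \<noteq> 0} \<subseteq> \<Omega>}"

definition is_weak_gradient ::
  "'a::euclidean_space set \<Rightarrow> ('a \<Rightarrow> real) \<Rightarrow> ('a \<Rightarrow> 'a) \<Rightarrow> bool" where
  "is_weak_gradient \<Omega> f g \<longleftrightarrow>
    (\<forall>K. compact K \<and> K \<subseteq> \<Omega> \<longrightarrow> integrable (lebesgue_on K) f \<and> integrable (lebesgue_on K) g) \<and>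
    (\<forall>\<phi>\<in>test_functions \<Omega>. \<forall>b\<in>Basis.
      (LINT x|lebesgue_on \<Omega>. f x * partial_deriv b \<phi> x) = - (LINT x|lebesgue_on \<Omega>. (g x \<bullet> b) * \<phi> x))"

text \<open>For open \<open>\<Omega>\<close> the weak gradient is unique almost everywhere on \<open>\<Omega>\<close>, so the choice is immaterial.\<close>

definition weak_grad :: "'a::euclidean_space set \<Rightarrow> ('a \<Rightarrow> real) \<Rightarrow> 'a \<Rightarrow> 'a" where
  "weak_grad \<Omega> f = (SOME g. is_weak_gradient \<Omega> f g)"

definition H1 :: "'a::euclidean_space set \<Rightarrow> ('a \<Rightarrow> real) set" where
  "H1 \<Omega> = {f \<in> L2 \<Omega>. \<exists>g. is_weak_gradient \<Omega> f g \<and> integrable (lebesgue_on \<Omega>) (\<lambda>x. (norm (g x))\<^sup>2)}"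

definition grad_inner :: "'a::euclidean_space set \<Rightarrow> ('a \<Rightarrow> real) \<Rightarrow> ('a \<Rightarrow> real) \<Rightarrow> real" where
  "grad_inner \<Omega> f g = (LINT x|lebesgue_on \<Omega>. weak_grad \<Omega> f x \<bullet> weak_grad \<Omega> g x)"

definition H1_norm :: "'a::euclidean_space set \<Rightarrow> ('a \<Rightarrow> real) \<Rightarrow> real" where
  "H1_norm \<Omega> f = sqrt ((L2_norm \<Omega> f)\<^sup>2 + (LINT x|lebesgue_on \<Omega>. (norm (weak_grad \<Omega> f x))\<^sup>2))"

text \<open>The closure of \<open>C_c^\<infinity>(\<Omega>)\<close> in \<open>H\<^sup>1(\<Omega>)\<close>.\<close>

definition H10 :: "'a::euclidean_space set \<Rightarrow> ('a \<Rightarrow> real) set" where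
  "H10 \<Omega> = {f \<in> H1 \<Omega>. \<forall>\<epsilon>>0. \<exists>\<phi>\<in>test_functions \<Omega>. H1_norm \<Omega> (\<lambda>x. f x - \<phi> x) < \<epsilon>}"

definition H10_neighborhood ::
  "'a::euclidean_space set \<Rightarrow> ('a \<Rightarrow> real) \<Rightarrow> ('a \<Rightarrow> real) set \<Rightarrow> bool" where
  "H10_neighborhood \<Omega> u S \<longleftrightarrow> S \<subseteq> H10 \<Omega> \<and>
    (\<exists>\<delta>>0. \<forall>v\<in>H10 \<Omega>. H1_norm \<Omega> (\<lambda>x. v x - u x) < \<delta> \<longrightarrow> v \<in> S)"

definition energy :: "'a::euclidean_space set \<Rightarrow> ('a \<Rightarrow> real) \<Rightarrow> real \<Rightarrow> ('a \<Rightarrow> real) \<Rightarrow> real" where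
  "energy \<Omega> V \<beta> v = 1/2 * (LINT x|lebesgue_on \<Omega>.
     1/2 * (norm (weak_grad \<Omega> v x))\<^sup>2 + V x * \<bar>v x\<bar>\<^sup>2 + \<beta>/2 * \<bar>v x\<bar>^4)"

definition positive_ground_state ::
  "'a::euclidean_space set \<Rightarrow> ('a \<Rightarrow> real) \<Rightarrow> real \<Rightarrow> ('a \<Rightarrow> real) \<Rightarrow> bool" where
  "positive_ground_state \<Omega> V \<beta> u \<longleftrightarrow>
    u \<in> H10 \<Omega> \<and> L2_norm \<Omega> u = 1 \<and> (AE x in lebesgue_on \<Omega>. u x > 0) \<and>
    (\<forall>v\<in>H10 \<Omega>. L2_norm \<Omega> v = 1 \<longrightarrow> energy \<Omega> V \<beta> u \<le> energy \<Omega> V \<beta> v)"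

definition a_form :: "'a::euclidean_space set \<Rightarrow> ('a \<Rightarrow> real) \<Rightarrow> real \<Rightarrow> ('a \<Rightarrow> real)
    \<Rightarrow> ('a \<Rightarrow> real) \<Rightarrow> ('a \<Rightarrow> real) \<Rightarrow> real" where
  "a_form \<Omega> V \<beta> z w v = 1/2 * grad_inner \<Omega> w v + L2_inner \<Omega> (\<lambda>x. V x * w x) v
     + \<beta> * L2_inner \<Omega> (\<lambda>x. \<bar>z x\<bar>\<^sup>2 * w x) v"

definition eigenspace :: "'a::euclidean_space set \<Rightarrow> ('a \<Rightarrow> real) \<Rightarrow> real \<Rightarrow> ('a \<Rightarrow> real)
    \<Rightarrow> real \<Rightarrow> ('a \<Rightarrow> real) set" where
  "eigenspace \<Omega> V \<beta> z \<mu> = {w \<in> H10 \<Omega>. \<forall>v\<in>H10 \<Omega>. a_form \<Omega> V \<beta> z w v = \<mu> * L2_inner \<Omega> w v}"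

text \<open>\<open>W\<close> has dimension \<open>m\<close> modulo equality almost everywhere: there is a basis \<open>e 0, \<dots>, e (m - 1)\<close>.\<close>

definition has_dimension_ae :: "'a::euclidean_space set \<Rightarrow> ('a \<Rightarrow> real) set \<Rightarrow> nat \<Rightarrow> bool" where
  "has_dimension_ae \<Omega> W m \<longleftrightarrow> (\<exists>e :: nat \<Rightarrow> 'a \<Rightarrow> real.
     (\<forall>i<m. e i \<in> W) \<and>
     (\<forall>c :: nat \<Rightarrow> real. (AE x in lebesgue_on \<Omega>. (\<Sum>i<m. c i * e i x) = 0) \<longrightarrow> (\<forall>i<m. c i = 0)) \<and>
     (\<forall>w\<in>W. \<exists>c :: nat \<Rightarrow> real. AE x in lebesgue_on \<Omega>. w x = (\<Sum>i<m. c i * e i x)))"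

text \<open>
  \<open>lam 1 \<le> lam 2 \<le> \<dots>\<close> are the eigenvalues of \<open>a_z\<close> on \<open>H\<^sup>1\<^sub>0(\<Omega>)\<close> counted with multiplicity: every real
  \<open>\<mu>\<close> occurs as often as the dimension of its eigenspace, which is 0 if \<open>\<mu>\<close> is not an eigenvalue.
  The value \<open>lam 0\<close> is unused.
\<close>

definition ordered_eigenvalues :: "'a::euclidean_space set \<Rightarrow> ('a \<Rightarrow> real) \<Rightarrow> real \<Rightarrow> ('a \<Rightarrow> real)
    \<Rightarrow> (nat \<Rightarrow> real) \<Rightarrow> bool" where
  "ordered_eigenvalues \<Omega> V \<beta> z lam \<longleftrightarrow> mono_on {1..} lam \<and>
     (\<forall>\<mu>. finite {i. 1 \<le> i \<and> lam i = \<mu>} \<and>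
          has_dimension_ae \<Omega> (eigenspace \<Omega> V \<beta> z \<mu>) (card {i. 1 \<le> i \<and> lam i = \<mu>}))"

text \<open>Functionals on \<open>H\<^sup>1\<^sub>0(\<Omega>)\<close> are represented by functions that are \<open>undefined\<close> outside of it.\<close>

definition A_op :: "'a::euclidean_space set \<Rightarrow> ('a \<Rightarrow> real) \<Rightarrow> real \<Rightarrow> ('a \<Rightarrow> real)
    \<Rightarrow> ('a \<Rightarrow> real) \<Rightarrow> ('a \<Rightarrow> real) \<Rightarrow> real" where
  "A_op \<Omega> V \<beta> z w = (\<lambda>v\<in>H10 \<Omega>. a_form \<Omega> V \<beta> z w v)"

definition I_op :: "'a::euclidean_space set \<Rightarrow> ('a \<Rightarrow> real) \<Rightarrow> ('a \<Rightarrow> real) \<Rightarrow> real" where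
  "I_op \<Omega> w = (\<lambda>v\<in>H10 \<Omega>. L2_inner \<Omega> w v)"

definition I_plus_tau_A :: "'a::euclidean_space set \<Rightarrow> ('a \<Rightarrow> real) \<Rightarrow> real \<Rightarrow> real \<Rightarrow> ('a \<Rightarrow> real)
    \<Rightarrow> ('a \<Rightarrow> real) \<Rightarrow> ('a \<Rightarrow> real) \<Rightarrow> real" where
  "I_plus_tau_A \<Omega> V \<beta> \<tau> z w = (\<lambda>v\<in>H10 \<Omega>. I_op \<Omega> w v + \<tau> * A_op \<Omega> V \<beta> z w v)"

text \<open>
  The operator \<open>\<I> + \<tau> \<A>_z\<close> is bijective from \<open>H\<^sup>1\<^sub>0(\<Omega>)\<close> to its dual only modulo equality almost
  everywhere; \<open>inv_into\<close> selects one representative of the preimage.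
\<close>

definition gfdn_step :: "'a::euclidean_space set \<Rightarrow> ('a \<Rightarrow> real) \<Rightarrow> real \<Rightarrow> real
    \<Rightarrow> ('a \<Rightarrow> real) \<Rightarrow> 'a \<Rightarrow> real" where
  "gfdn_step \<Omega> V \<beta> \<tau> z =
    (let w = inv_into (H10 \<Omega>) (I_plus_tau_A \<Omega> V \<beta> \<tau> z) (I_op \<Omega> z)
     in (\<lambda>x. w x / L2_norm \<Omega> w))"

primrec gfdn :: "'a::euclidean_space set \<Rightarrow> ('a \<Rightarrow> real) \<Rightarrow> real \<Rightarrow> real
    \<Rightarrow> ('a \<Rightarrow> real) \<Rightarrow> nat \<Rightarrow> 'a \<Rightarrow> real" where
  "gfdn \<Omega> V \<beta> \<tau> u0 0 = u0"
| "gfdn \<Omega> V \<beta> \<tau> u0 (Suc n) = gfdn_step \<Omega> V \<beta> \<tau> (gfdn \<Omega> V \<beta> \<tau> u0 n)"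

end

theory Submission
  imports Defs "HOL-Library.Function_Algebras" "HOL-Complex_Analysis.Great_Picard"
    "HOL-Probability.Giry_Monad"
begin

text \<open>
  Let \<open>\<Lambda>\<^sub>1 = 1 + \<tau> \<lambda>\<close>, where \<open>\<lambda>\<close> is the ground state eigenvalue, let \<open>\<Lambda>\<^sub>2\<close> be the minimum of the
  Rayleigh quotient of \<open>B = \<I> + \<tau> \<A>\<^sub>u\<close> on the \<open>L\<^sup>2\<close>-orthogonal complement of \<open>u\<close>, and measure errors in
  the norm of \<open>B\<close>.  Write an iterate as \<open>\<alpha> u + r\<close> with \<open>r\<close> orthogonal to \<open>u\<close>.  The Euler--Lagrange
  equation tested with \<open>(u - k)\<^sup>+\<close>, suitably bounded, gives \<open>0 \<le> \<beta> u\<^sup>2 \<le> \<lambda>\<close>; hence the derivative at \<open>u\<close> of the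
  right-hand side of the iteration is multiplication by a function with values in \<open>[-1, 1]\<close>, and one step
  maps \<open>r\<close> to \<open>r'\<close> with \<open>\<parallel>r'\<parallel> \<le> (\<Lambda>\<^sub>1 / \<Lambda>\<^sub>2) \<parallel>r\<parallel> + K \<parallel>r\<parallel>\<^sup>2\<close>.  The quadratic terms sum up to a bounded factor,
  so that the rate is exactly \<open>\<Lambda>\<^sub>1 / \<Lambda>\<^sub>2\<close>.

  The gap \<open>\<Lambda>\<^sub>1 < \<Lambda>\<^sub>2\<close> follows from the strong maximum principle, which is obtained from the logarithmic
  gradient estimate for nonnegative eigenfunctions: the logarithm of \<open>v + \<epsilon>\<close> has locally bounded
  \<open>H\<^sup>1\<close> seminorm uniformly in \<open>\<epsilon>\<close>, and by the Poincare inequality \<open>v\<close> cannot vanish on a set of positive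
  measure and be positive on another one.  The bound on the quartic term uses Ladyzhenskaya's inequality, and Rellich's
  theorem for \<open>H\<^sup>1\<^sub>0\<close> is obtained by averaging over the cells of a grid.
\<close>

section \<open>Quadratic forms on a vector space\<close>

text \<open>The exact rate arises from three factors. Testing the equation of one step with the
  component of the new iterate orthogonal to \<open>u\<close> leaves, to first order, the weight 1 -
  2\<tau>\<beta>u^2/\<Lambda>_1 between the old and the new component. The bound \<beta>u^2 \<le>
  \<lambda> keeps this weight above -1 for every step size, so a plain L2 Cauchy-Schwarz inequality
  loses nothing. Passing from L2 to the norm of B gains \<Lambda>_2^(-1/2) for each of the two
  components, and division by the L2 norm of the unnormalized iterate, which is close to
  1/\<Lambda>_1, supplies \<Lambda>_1.

  In the statement the eigenvalues are given by counting multiplicities, whereas \<Lambda>_2 is a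
  minimum; the two are linked by 1 + \<tau>\<lambda>_2 \<le> \<Lambda>_2, which is the favourable
  direction.

  Functions are not identified modulo null sets. Hence all forms are semidefinite, and equality
  almost everywhere takes the place of equality. All information on \<open>u\<close> is drawn from
  the weak formulation, by composing Sobolev functions with C1 functions of one variable.\<close>

instantiation "fun" :: (type, scaleR) scaleR
begin
definition "scaleR c f = (\<lambda>x. c *\<^sub>R f x)"
instance ..
end

lemma scaleR_fun_apply [simp]: "(c *\<^sub>R f) x = c *\<^sub>R f x"
  by (simp add: scaleR_fun_def)

instance "fun" :: (type, real_vector) real_vector
  by standard (auto simp: fun_eq_iff algebra_simps)

text \<open>A quadratic polynomial without negative values has nonpositive discriminant. No sign of
  \<open>A\<close> or \<open>C\<close> is assumed and both may vanish, so the lemma serves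
  semidefinite forms. It yields every Cauchy-Schwarz inequality below and the variational equation
  in \<open>Riesz\<close>.\<close>

lemma discriminant_bound:
  fixes A B C :: real
  assumes "\<And>t. 0 \<le> A + 2 * t * B + t\<^sup>2 * C"
  shows "B\<^sup>2 \<le> A * C"
proof (cases "C = 0")
  case True
  have "B = 0"
  proof (rule ccontr)
    assume "B \<noteq> 0"
    \<comment> \<open>At this \<open>t\<close> the polynomial takes the value -1.\<close>
    with assms[of "- (A + 1) / (2 * B)"] True show False by (simp add: field_simps)
  qed
  then show ?thesis using True by simp
next
  case False
  have "C \<ge> 0"
  proof (rule ccontr)
    assume "\<not> C \<ge> 0"
    then have C: "C < 0" by simp
    \<comment> \<open>Chosen such that t^2 C = -(A + 1); adding the inequalities at \<open>t\<close>
      and \<open>- t\<close> cancels the linear term.\<close>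
    define t where "t = sqrt ((A + 1) / - C)"
    have "A \<ge> 0" using assms[of 0] by simp
    then have "t\<^sup>2 * C = - (A + 1)"
      using C by (simp add: t_def zero_le_divide_iff divide_simps)
    moreover have "0 \<le> A + t\<^sup>2 * C" using assms[of t] assms[of "- t"] by simp
    ultimately show False by simp
  qed
  with False have C: "C > 0" by simp
  from assms[of "- B / C"] have "0 \<le> A - B\<^sup>2 / C"
    using C by (simp add: power2_eq_square field_simps)
  then show ?thesis using C by (simp add: field_simps)
qed

text \<open>Semidefinite, and only on a carrier \<open>H\<close>: the intended vectors are
  functions, and a form may vanish at a function that is zero merely almost everywhere.\<close>

locale psd_form =
  fixes H :: "'v::real_vector set" and B :: "'v \<Rightarrow> 'v \<Rightarrow> real"
  assumes sub: "subspace H"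
    and sym: "\<And>x y. x \<in> H \<Longrightarrow> y \<in> H \<Longrightarrow> B x y = B y x"
    and add_left: "\<And>x y z. x \<in> H \<Longrightarrow> y \<in> H \<Longrightarrow> z \<in> H \<Longrightarrow> B (x + y) z = B x z + B y z"
    and scale_left: "\<And>c x y. x \<in> H \<Longrightarrow> y \<in> H \<Longrightarrow> B (c *\<^sub>R x) y = c * B x y"
    and nonneg: "\<And>x. x \<in> H \<Longrightarrow> 0 \<le> B x x"
begin

lemma mem [intro, simp]:
  "x \<in> H \<Longrightarrow> y \<in> H \<Longrightarrow> x + y \<in> H" "x \<in> H \<Longrightarrow> y \<in> H \<Longrightarrow> x - y \<in> H"
  "x \<in> H \<Longrightarrow> c *\<^sub>R x \<in> H" "x \<in> H \<Longrightarrow> - x \<in> H"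
  using sub by (auto intro: subspace_add subspace_diff subspace_scale subspace_neg)

lemma diff_left: "x \<in> H \<Longrightarrow> y \<in> H \<Longrightarrow> z \<in> H \<Longrightarrow> B (x - y) z = B x z - B y z"
  using add_left[of x "(-1) *\<^sub>R y" z] scale_left[of y z "-1"] by simp

lemma add_right: "x \<in> H \<Longrightarrow> y \<in> H \<Longrightarrow> z \<in> H \<Longrightarrow> B z (x + y) = B z x + B z y"
  using add_left sym by simp

lemma diff_right: "x \<in> H \<Longrightarrow> y \<in> H \<Longrightarrow> z \<in> H \<Longrightarrow> B z (x - y) = B z x - B z y"
  using diff_left sym by simp

lemma scale_right: "x \<in> H \<Longrightarrow> y \<in> H \<Longrightarrow> B x (c *\<^sub>R y) = c * B x y"
  using scale_left sym by simp

lemmas linear_simps = add_left add_right diff_left diff_right scale_left scale_right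

lemma expand: "x \<in> H \<Longrightarrow> y \<in> H \<Longrightarrow>
    B (x + t *\<^sub>R y) (x + t *\<^sub>R y) = B x x + 2 * t * B x y + t\<^sup>2 * B y y"
  by (simp add: linear_simps sym[of y x] power2_eq_square algebra_simps)

lemma Cauchy_Schwarz: "x \<in> H \<Longrightarrow> y \<in> H \<Longrightarrow> (B x y)\<^sup>2 \<le> B x x * B y y"
  by (rule discriminant_bound) (metis expand nonneg mem)

lemma Cauchy_Schwarz_sqrt: "x \<in> H \<Longrightarrow> y \<in> H \<Longrightarrow> \<bar>B x y\<bar> \<le> sqrt (B x x) * sqrt (B y y)"
  using Cauchy_Schwarz[of x y] by (metis real_sqrt_abs real_sqrt_le_iff real_sqrt_mult)

lemma parallelogram: "x \<in> H \<Longrightarrow> y \<in> H \<Longrightarrow>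
    B (x - y) (x - y) + B (x + y) (x + y) = 2 * B x x + 2 * B y y"
  by (simp add: linear_simps sym[of y x])

lemma diff_le: "x \<in> H \<Longrightarrow> y \<in> H \<Longrightarrow> B (x - y) (x - y) \<le> 2 * B x x + 2 * B y y"
  using parallelogram[of x y] nonneg[of "x + y"] by simp

lemma triangle: "x \<in> H \<Longrightarrow> y \<in> H \<Longrightarrow> sqrt (B (x + y) (x + y)) \<le> sqrt (B x x) + sqrt (B y y)"
proof -
  assume xy: "x \<in> H" "y \<in> H"
  have "B (x + y) (x + y) = B x x + 2 * B x y + B y y"
    using expand[OF xy, of 1] by simp
  also have "\<dots> \<le> B x x + 2 * (sqrt (B x x) * sqrt (B y y)) + B y y"
    using Cauchy_Schwarz_sqrt[OF xy] by linarith
  also have "\<dots> = (sqrt (B x x) + sqrt (B y y))\<^sup>2"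
    using nonneg xy by (simp add: power2_sum)
  finally show ?thesis
    using nonneg xy by (intro real_le_lsqrt) auto
qed

lemma norm_scale: "x \<in> H \<Longrightarrow> sqrt (B (c *\<^sub>R x) (c *\<^sub>R x)) = \<bar>c\<bar> * sqrt (B x x)"
  using real_sqrt_mult[of "c\<^sup>2" "B x x"]
  by (simp add: scale_left scale_right power2_eq_square mult.assoc)

lemma tendsto_left:
  assumes "\<And>n. X n \<in> H" "x \<in> H" "v \<in> H" "(\<lambda>n. B (X n - x) (X n - x)) \<longlonglongrightarrow> 0"
  shows "(\<lambda>n. B (X n) v) \<longlonglongrightarrow> B x v"
proof -
  have "(\<lambda>n. B (X n) v - B x v) \<longlonglongrightarrow> 0"
  proof (rule Lim_null_comparison)
    show "\<forall>\<^sub>F n in sequentially. norm (B (X n) v - B x v) \<le> sqrt (B (X n - x) (X n - x)) * sqrt (B v v)"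
      using Cauchy_Schwarz_sqrt[of "X _ - x" v] assms by (simp add: diff_left)
    show "(\<lambda>n. sqrt (B (X n - x) (X n - x)) * sqrt (B v v)) \<longlonglongrightarrow> 0"
      using tendsto_mult[OF tendsto_real_sqrt[OF assms(4)] tendsto_const[of "sqrt (B v v)"]] by simp
  qed
  then show ?thesis by (simp add: LIM_zero_iff)
qed

lemma tendsto_diag:
  assumes "\<And>n. X n \<in> H" "x \<in> H" "(\<lambda>n. B (X n - x) (X n - x)) \<longlonglongrightarrow> 0"
  shows "(\<lambda>n. B (X n) (X n)) \<longlonglongrightarrow> B x x"
proof -
  have "B (X n) (X n) = B (X n - x) (X n - x) + 2 * B (X n) x - B x x" for n
    using assms by (simp add: linear_simps sym[of x "X n"])
  moreover have "(\<lambda>n. B (X n - x) (X n - x) + 2 * B (X n) x - B x x) \<longlonglongrightarrow> 0 + 2 * B x x - B x x"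
    by (intro tendsto_intros tendsto_left assms)
  ultimately show ?thesis by simp
qed

end

text \<open>\<open>G\<close> is the form of the energy norm, which is complete on \<open>H\<close>, and \<open>ip\<close> is a weaker inner
  product for which \<open>G\<close>-bounded sets are relatively compact.\<close>

locale compact_pair = G: psd_form H G + ip: psd_form H ip
  for H :: "'v::real_vector set" and G ip :: "'v \<Rightarrow> 'v \<Rightarrow> real" +
  assumes ip_le: "\<And>x. x \<in> H \<Longrightarrow> ip x x \<le> G x x"
    and complete: "\<And>X. (\<And>n. X n \<in> H) \<Longrightarrow>
       (\<And>e. e > 0 \<Longrightarrow> \<exists>N. \<forall>m\<ge>N. \<forall>n\<ge>N. G (X m - X n) (X m - X n) < e) \<Longrightarrow>
       \<exists>x\<in>H. (\<lambda>n. G (X n - x) (X n - x)) \<longlonglongrightarrow> 0"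
    and compact: "\<And>X R. (\<And>n. X n \<in> H) \<Longrightarrow> (\<And>n. G (X n) (X n) \<le> R) \<Longrightarrow>
       \<exists>r. strict_mono (r :: nat \<Rightarrow> nat) \<and>
         (\<forall>e>0. \<exists>N. \<forall>m\<ge>N. \<forall>n\<ge>N. ip (X (r m) - X (r n)) (X (r m) - X (r n)) < e)"
begin

text \<open>Direct method for the functional \<open>J\<close>: near-minimizers lie close together by
  the parallelogram law, and their limit solves the equation. The two bounds make \<open>B\<close>
  equivalent to \<open>G\<close>, whose completeness provides the limit.\<close>

lemma Riesz:
  assumes "psd_form H B" and c: "c > 0" "\<And>x. x \<in> H \<Longrightarrow> c * G x x \<le> B x x"
    and C: "\<And>x. x \<in> H \<Longrightarrow> B x x \<le> C * G x x"
    and l: "\<And>x y. x \<in> H \<Longrightarrow> y \<in> H \<Longrightarrow> l (x + y) = l x + l y"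
      "\<And>r x. x \<in> H \<Longrightarrow> l (r *\<^sub>R x) = r * l x"
    and K: "\<And>x. x \<in> H \<Longrightarrow> \<bar>l x\<bar> \<le> K * sqrt (G x x)"
  shows "\<exists>w\<in>H. \<forall>v\<in>H. B w v = l v"
proof -
  interpret B: psd_form H B by fact
  define J where "J v = B v v - 2 * l v" for v
  have J_bound: "J v \<ge> - (K\<^sup>2 / c)" if v: "v \<in> H" for v
  proof -
    let ?g = "sqrt (G v v)"
    have "J v \<ge> c * ?g\<^sup>2 - 2 * (K * ?g)"
      using c(2)[OF v] K[OF v] G.nonneg[OF v] by (simp add: J_def)
    moreover have "c * ?g\<^sup>2 - 2 * (K * ?g) + K\<^sup>2 / c = (c * ?g - K)\<^sup>2 / c"
      using c(1) by (simp add: power2_eq_square field_simps)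
    moreover have "(c * ?g - K)\<^sup>2 / c \<ge> 0" using c(1) by simp
    ultimately show ?thesis by linarith
  qed
  have zero: "0 \<in> H" using G.sub subspace_0 by blast
  define m where "m = Inf (J ` H)"
  have bdd: "bdd_below (J ` H)" by (rule bdd_belowI2) (rule J_bound)
  have m_le: "m \<le> J v" if "v \<in> H" for v
    unfolding m_def using bdd that by (auto intro: cInf_lower)
  have "\<exists>x\<in>H. J x < m + 1 / real (Suc n)" for n
  proof -
    have "Inf (J ` H) < m + 1 / real (Suc n)" by (simp add: m_def)
    then show ?thesis using cInf_lessD[of "J ` H"] zero by blast
  qed
  then obtain X where X: "\<And>n. X n \<in> H" "\<And>n. J (X n) < m + 1 / real (Suc n)" by metis
  have B_diff: "B (X i - X j) (X i - X j) \<le> 2 / real (Suc i) + 2 / real (Suc j)" for i j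
  proof -
    \<comment> \<open>Comparison with the midpoint: since \<open>J z\<close> is at least
      \<open>m\<close>, the parallelogram law bounds the distance of \<open>X i\<close> and
      \<open>X j\<close> by their excesses over \<open>m\<close>.\<close>
    define z where "z = (1/2) *\<^sub>R (X i + X j)"
    have z: "z \<in> H" using X by (simp add: z_def)
    have "X i + X j = 2 *\<^sub>R z" by (simp add: z_def)
    then have "B (X i + X j) (X i + X j) = 4 * B z z" "l (X i) + l (X j) = 2 * l z"
      using z X by (simp_all add: B.linear_simps l flip: l(1))
    then have "B (X i - X j) (X i - X j) = 2 * J (X i) + 2 * J (X j) - 4 * J z"
      using B.parallelogram[of "X i" "X j"] X by (simp add: J_def)
    with m_le[OF z] X(2)[of i] X(2)[of j] show ?thesis by simp
  qed
  have "\<exists>N. \<forall>i\<ge>N. \<forall>j\<ge>N. G (X i - X j) (X i - X j) < e" if e: "e > 0" for e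
  proof -
    obtain N where N: "4 / (c * e) < real N" using reals_Archimedean2 by blast
    have "G (X i - X j) (X i - X j) < e" if "i \<ge> N" "j \<ge> N" for i j
    proof -
      have "0 < 4 / (c * e)" using c(1) e by simp
      then have "real N > 0" using N by linarith
      then have "2 / real (Suc i) \<le> 2 / real N" "2 / real (Suc j) \<le> 2 / real N"
        using that by (auto intro!: divide_left_mono)
      moreover have "c * G (X i - X j) (X i - X j) \<le> 2 / real (Suc i) + 2 / real (Suc j)"
        using B_diff[of i j] c(2)[of "X i - X j"] X by simp
      ultimately have "c * G (X i - X j) (X i - X j) \<le> 2 / real N + 2 / real N" by linarith
      also have "\<dots> = 4 / real N" by simp
      also have "\<dots> < c * e" using N \<open>real N > 0\<close> c(1) e by (simp add: field_simps)
      finally show ?thesis using c(1) by simp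
    qed
    then show ?thesis by blast
  qed
  from complete[OF X(1) this] obtain x where x: "x \<in> H" "(\<lambda>n. G (X n - x) (X n - x)) \<longlonglongrightarrow> 0" by blast
  have "(\<lambda>n. B (X n - x) (X n - x)) \<longlonglongrightarrow> 0"
  proof (rule Lim_null_comparison)
    show "\<forall>\<^sub>F n in sequentially. norm (B (X n - x) (X n - x)) \<le> C * G (X n - x) (X n - x)"
      using C X x B.nonneg by simp
    show "(\<lambda>n. C * G (X n - x) (X n - x)) \<longlonglongrightarrow> 0" using tendsto_mult_right_zero[OF x(2)] by simp
  qed
  note Bx = B.tendsto_left[OF X(1) x(1) _ this]
  have "B x v = l v" if v: "v \<in> H" for v
  proof -
    \<comment> \<open>Moving \<open>X n\<close> along \<open>v\<close> cannot push \<open>J\<close>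
      below \<open>m\<close>. This is a nonnegative quadratic polynomial in \<open>t\<close>, and
      its discriminant bounds the residual of the equation.\<close>
    have "(B (X n) v - l v)\<^sup>2 \<le> 1 / real (Suc n) * B v v" for n
    proof (rule discriminant_bound)
      fix t
      have "m \<le> J (X n + t *\<^sub>R v)" using m_le X v by simp
      also have "\<dots> = J (X n) + 2 * t * (B (X n) v - l v) + t\<^sup>2 * B v v"
        using X v by (simp add: J_def B.expand l algebra_simps)
      finally show "0 \<le> 1 / real (Suc n) + 2 * t * (B (X n) v - l v) + t\<^sup>2 * B v v"
        using X(2)[of n] by linarith
    qed
    moreover have "(\<lambda>n. (B (X n) v - l v)\<^sup>2) \<longlonglongrightarrow> (B x v - l v)\<^sup>2"
      by (intro tendsto_intros Bx v)
    moreover have "(\<lambda>n. 1 / real (Suc n) * B v v) \<longlonglongrightarrow> 0 * B v v"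
      by (intro tendsto_intros LIMSEQ_Suc lim_1_over_n)
    ultimately have "(B x v - l v)\<^sup>2 \<le> 0 * B v v"
      by (intro LIMSEQ_le[of "\<lambda>n. (B (X n) v - l v)\<^sup>2"]) auto
    then show ?thesis by simp
  qed
  with x(1) show ?thesis by blast
qed

text \<open>The form Q = B - m ip is semidefinite. Therefore Q(X n) \<longlonglongrightarrow> 0
  forces the differences to be small in Q; together with the Cauchy property in \<open>ip\<close>
  this gives the Cauchy property in \<open>G\<close>. The limit satisfies Q(x) = 0, and
  Cauchy-Schwarz for Q turns such a vector into an eigenvector. Besides minimizers, this covers the
  modulus of an eigenfunction.\<close>

lemma minimizing_limit:
  assumes "psd_form H B" and c: "c > 0" "\<And>x. x \<in> H \<Longrightarrow> c * G x x \<le> B x x"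
    and C: "\<And>x. x \<in> H \<Longrightarrow> B x x \<le> C * G x x"
    and m: "\<And>x. x \<in> H \<Longrightarrow> m * ip x x \<le> B x x"
    and X: "\<And>n. X n \<in> H" "(\<lambda>n. B (X n) (X n) - m * ip (X n) (X n)) \<longlonglongrightarrow> 0"
    and X_Cauchy: "\<And>e. e > 0 \<Longrightarrow> \<exists>N. \<forall>i\<ge>N. \<forall>j\<ge>N. ip (X i - X j) (X i - X j) < e"
  shows "\<exists>x\<in>H. (\<lambda>n. ip (X n - x) (X n - x)) \<longlonglongrightarrow> 0 \<and> (\<forall>v\<in>H. B x v = m * ip x v)"
proof -
  interpret B: psd_form H B by fact
  interpret Q: psd_form H "\<lambda>x y. B x y - m * ip x y"
    by unfold_locales (use B.sub m in \<open>auto simp: B.sym ip.sym B.linear_simps ip.linear_simps algebra_simps\<close>)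
  let ?Q = "\<lambda>x. B x x - m * ip x x"
  have "\<exists>N. \<forall>i\<ge>N. \<forall>j\<ge>N. G (X i - X j) (X i - X j) < e" if e: "e > 0" for e
  proof -
    have "c * e / 8 > 0" "c * e / (2 * (\<bar>m\<bar> + 1)) > 0" using c e by simp_all
    have "\<exists>N. \<forall>i\<ge>N. ?Q (X i) < c * e / 8"
      using order_tendstoD(2)[OF X(2) \<open>c * e / 8 > 0\<close>] by (simp only: eventually_sequentially)
    then obtain N1 where N1: "\<And>i. i \<ge> N1 \<Longrightarrow> ?Q (X i) < c * e / 8" by blast
    obtain N2 where N2: "\<And>i j. i \<ge> N2 \<Longrightarrow> j \<ge> N2 \<Longrightarrow>
        ip (X i - X j) (X i - X j) < c * e / (2 * (\<bar>m\<bar> + 1))"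
      using X_Cauchy[OF \<open>c * e / (2 * (\<bar>m\<bar> + 1)) > 0\<close>] by meson
    have "G (X i - X j) (X i - X j) < e" if ij: "i \<ge> max N1 N2" "j \<ge> max N1 N2" for i j
    proof -
      let ?d = "X i - X j"
      have d: "?d \<in> H" using X by simp
      have "c * G ?d ?d \<le> ?Q ?d + m * ip ?d ?d" using c(2)[OF d] by simp
      also have "?Q ?d \<le> 2 * ?Q (X i) + 2 * ?Q (X j)" by (rule Q.diff_le) (use X in auto)
      also have "2 * ?Q (X i) + 2 * ?Q (X j) < c * e / 2" using N1[of i] N1[of j] ij by simp
      also have "m * ip ?d ?d \<le> (\<bar>m\<bar> + 1) * ip ?d ?d"
        using ip.nonneg[OF d] by (intro mult_right_mono) auto
      also have "(\<bar>m\<bar> + 1) * ip ?d ?d < (\<bar>m\<bar> + 1) * (c * e / (2 * (\<bar>m\<bar> + 1)))"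
        using N2[of i j] ij by (intro mult_strict_left_mono) auto
      also have "\<dots> = c * e / 2" by (simp add: field_simps)
      finally show ?thesis using c(1) by simp
    qed
    then show ?thesis by blast
  qed
  from complete[OF X(1) this] obtain x where x: "x \<in> H" "(\<lambda>n. G (X n - x) (X n - x)) \<longlonglongrightarrow> 0" by blast
  have lim: "(\<lambda>n. F (X n - x) (X n - x)) \<longlonglongrightarrow> 0"
    if "\<And>v. v \<in> H \<Longrightarrow> 0 \<le> F v v" "\<And>v. v \<in> H \<Longrightarrow> F v v \<le> D * G v v" for F D
  proof (rule Lim_null_comparison)
    show "\<forall>\<^sub>F n in sequentially. norm (F (X n - x) (X n - x)) \<le> D * G (X n - x) (X n - x)"
      using X x that by simp
    show "(\<lambda>n. D * G (X n - x) (X n - x)) \<longlonglongrightarrow> 0" using tendsto_mult_right_zero[OF x(2)] by simp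
  qed
  have ipx: "(\<lambda>n. ip (X n - x) (X n - x)) \<longlonglongrightarrow> 0"
    by (rule lim[where D=1]) (use ip.nonneg ip_le in auto)
  have Bx: "(\<lambda>n. B (X n - x) (X n - x)) \<longlonglongrightarrow> 0"
    by (rule lim[where D=C]) (use B.nonneg C in auto)
  have "(\<lambda>n. ?Q (X n)) \<longlonglongrightarrow> ?Q x"
    by (intro tendsto_intros B.tendsto_diag ip.tendsto_diag X x ipx Bx)
  with X(2) have "?Q x = 0" using LIMSEQ_unique by blast
  then have "B x v = m * ip x v" if "v \<in> H" for v
    using Q.Cauchy_Schwarz[OF x(1) that] by simp
  with x ipx show ?thesis by blast
qed

text \<open>Coercivity bounds a normalized minimizing sequence in \<open>G\<close>, compactness
  makes a subsequence Cauchy in \<open>ip\<close>, and \<open>minimizing_limit\<close> upgrades this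
  to an eigenvector. The norm is preserved because the convergence takes place in \<open>ip\<close>.
  The vector \<open>x0\<close> ensures that the unit sphere is not empty.\<close>

lemma Rayleigh_minimizer:
  assumes B: "psd_form H B" and c: "c > 0" "\<And>x. x \<in> H \<Longrightarrow> c * G x x \<le> B x x"
    and C: "\<And>x. x \<in> H \<Longrightarrow> B x x \<le> C * G x x"
    and x0: "x0 \<in> H" "ip x0 x0 > 0"
  shows "\<exists>x\<in>H. \<exists>m. ip x x = 1 \<and> (\<forall>v\<in>H. m * ip v v \<le> B v v) \<and> (\<forall>v\<in>H. B x v = m * ip x v)"
proof -
  interpret B: psd_form H B by fact
  define U where "U = {x \<in> H. ip x x = 1}"
  have normalize: "(1 / sqrt (ip x x)) *\<^sub>R x \<in> U" if "x \<in> H" "ip x x > 0" for x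
    using that by (simp add: U_def ip.linear_simps field_simps)
  define m where "m = Inf ((\<lambda>x. B x x) ` U)"
  have bdd: "bdd_below ((\<lambda>x. B x x) ` U)"
    by (rule bdd_belowI2[of _ 0]) (auto simp: U_def B.nonneg)
  have m_le: "m * ip v v \<le> B v v" if v: "v \<in> H" for v
  proof (cases "ip v v = 0")
    case False
    then have p: "ip v v > 0" using ip.nonneg[OF v] by simp
    have "m \<le> B ((1 / sqrt (ip v v)) *\<^sub>R v) ((1 / sqrt (ip v v)) *\<^sub>R v)"
      unfolding m_def using bdd normalize[OF v p] by (auto intro: cInf_lower)
    also have "\<dots> = B v v / ip v v" using v p by (simp add: B.linear_simps field_simps)
    finally show ?thesis using p by (simp add: field_simps)
  qed (simp add: B.nonneg v)
  have "\<exists>x\<in>U. B x x < m + 1 / real (Suc n)" for n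
  proof -
    have "Inf ((\<lambda>x. B x x) ` U) < m + 1 / real (Suc n)" by (simp add: m_def)
    then show ?thesis using cInf_lessD[of "(\<lambda>x. B x x) ` U"] normalize[OF x0] by blast
  qed
  then obtain X where X: "\<And>n. X n \<in> U" "\<And>n. B (X n) (X n) < m + 1 / real (Suc n)" by metis
  have XH: "\<And>n. X n \<in> H" and X1: "\<And>n. ip (X n) (X n) = 1" using X(1) by (auto simp: U_def)
  have "G (X n) (X n) \<le> (m + 1) / c" for n
  proof -
    have "c * G (X n) (X n) \<le> m + 1"
    proof -
      have "1 / real (Suc n) \<le> 1" by simp
      then show ?thesis using c(2)[OF XH, of n] X(2)[of n] by linarith
    qed
    then show ?thesis using c(1) by (simp add: pos_le_divide_eq mult.commute)
  qed
  from compact[of X "(m + 1) / c", OF XH this] obtain r where r: "strict_mono (r :: nat \<Rightarrow> nat)"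
    "\<And>e. e > 0 \<Longrightarrow> \<exists>N. \<forall>m\<ge>N. \<forall>n\<ge>N. ip (X (r m) - X (r n)) (X (r m) - X (r n)) < e"
    by meson
  have "(\<lambda>n. B (X n) (X n) - m) \<longlonglongrightarrow> 0"
  proof (rule Lim_null_comparison)
    show "\<forall>\<^sub>F n in sequentially. norm (B (X n) (X n) - m) \<le> 1 / real (Suc n)"
    proof (intro always_eventually allI)
      fix n
      have "m \<le> B (X n) (X n)" using m_le[OF XH, of n] X1 by simp
      then show "norm (B (X n) (X n) - m) \<le> 1 / real (Suc n)" using X(2)[of n] by simp
    qed
    show "(\<lambda>n. 1 / real (Suc n)) \<longlonglongrightarrow> 0" by (intro LIMSEQ_Suc lim_1_over_n)
  qed
  then have "(\<lambda>n. B (X (r n)) (X (r n)) - m * ip (X (r n)) (X (r n))) \<longlonglongrightarrow> 0"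
    using LIMSEQ_subseq_LIMSEQ[OF _ r(1)] X1 by (fastforce simp: o_def)
  note lim = minimizing_limit[of B c C m "\<lambda>n. X (r n)", OF B c C m_le XH this r(2)]
  from lim
  obtain x where x: "x \<in> H" "(\<lambda>n. ip (X (r n) - x) (X (r n) - x)) \<longlonglongrightarrow> 0"
    "\<forall>v\<in>H. B x v = m * ip x v" by blast
  have "(\<lambda>n. ip (X (r n)) (X (r n))) \<longlonglongrightarrow> ip x x"
    by (intro ip.tendsto_diag XH x)
  then have "ip x x = 1" by (simp add: X1 LIMSEQ_const_iff)
  with x m_le show ?thesis by blast
qed

end

section \<open>Convergence of the abstract iteration\<close>

lemma le_if_square_le_mult: "x * x \<le> X * x \<Longrightarrow> 0 \<le> x \<Longrightarrow> 0 \<le> X \<Longrightarrow> x \<le> (X :: real)"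
  by (cases "x = 0") auto

text \<open>Two passes over the recursion. With the slightly worse rate \<open>p\<close> the
  sequence is seen to be summable. Rewriting a step as multiplication by q (1 + K/q \<rho> n), the
  product of the correction factors is then bounded by the exponential of that sum, and the rate
  \<open>q\<close> itself survives. The bound by \<open>d\<close> is part of the conclusion because
  it shows that the small ball is invariant.\<close>

lemma perturbed_geometric_decay:
  fixes q K d0 :: real
  assumes q: "0 < q" "q < 1" and K: "0 \<le> K" and d0: "0 < d0"
  shows "\<exists>d>0. \<exists>C>0. d \<le> d0 \<and> (\<forall>\<rho> :: nat \<Rightarrow> real. (\<forall>n. 0 \<le> \<rho> n) \<and> \<rho> 0 \<le> d \<and>
      (\<forall>n. \<rho> n \<le> d \<longrightarrow> \<rho> (Suc n) \<le> q * \<rho> n + K * (\<rho> n)\<^sup>2) \<longrightarrow>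
      (\<forall>n. \<rho> n \<le> d \<and> \<rho> n \<le> C * q ^ n * \<rho> 0))"
proof -
  \<comment> \<open>Any number strictly between \<open>q\<close> and 1 would do; \<open>d\<close> is
    then taken so small that q + K d \<le> p.\<close>
  define p where "p = (1 + q) / 2"
  have p: "q < p" "p < 1" "0 < p" using q by (auto simp: p_def)
  define d where "d = min d0 ((p - q) / (K + 1))"
  have d: "d > 0" "d \<le> d0" using d0 p K by (auto simp: d_def)
  have Kd: "q + K * d \<le> p"
  proof -
    have "K * d \<le> (K + 1) * ((p - q) / (K + 1))"
      using K d p by (intro mult_mono) (auto simp: d_def)
    also have "\<dots> = p - q" using K by (simp add: field_simps)
    finally show ?thesis by simp
  qed
  \<comment> \<open>Exponential of K/q times the geometric series with first term \<open>d\<close>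
    and ratio \<open>p\<close>.\<close>
  define C where "C = exp (K / q * d / (1 - p))"
  have main: "\<rho> n \<le> d \<and> \<rho> n \<le> C * q ^ n * \<rho> 0"
    if nn: "\<forall>n. 0 \<le> \<rho> n" and r0: "\<rho> 0 \<le> d"
      and step: "\<forall>n. \<rho> n \<le> d \<longrightarrow> \<rho> (Suc n) \<le> q * \<rho> n + K * (\<rho> n)\<^sup>2" for \<rho> :: "nat \<Rightarrow> real" and n
  proof -
    have A: "\<rho> n \<le> p ^ n * d" for n
    proof (induction n)
      case (Suc n)
      have "p ^ n * d \<le> 1 * d" using p d by (intro mult_right_mono power_le_one) auto
      with Suc have nd: "\<rho> n \<le> d" by simp
      have "\<rho> (Suc n) \<le> (q + K * \<rho> n) * \<rho> n"
        using step nd by (simp add: power2_eq_square algebra_simps)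
      also have "\<dots> \<le> p * \<rho> n"
        using Kd mult_left_mono[OF nd K] nn by (intro mult_right_mono) auto
      also have "\<dots> \<le> p * (p ^ n * d)" using Suc p by (intro mult_left_mono) auto
      finally show ?case by simp
    qed (use r0 in simp)
    have le_d: "\<rho> n \<le> d" for n
    proof -
      have "p ^ n * d \<le> 1 * d" using p d by (intro mult_right_mono power_le_one) auto
      with A[of n] show ?thesis by simp
    qed
    have B: "\<rho> n \<le> exp (K / q * (\<Sum>i<n. p ^ i * d)) * q ^ n * \<rho> 0" for n
    proof (induction n)
      case (Suc n)
      have "\<rho> (Suc n) \<le> (1 + K / q * \<rho> n) * q * \<rho> n"
      proof -
        have "(1 + K / q * \<rho> n) * q * \<rho> n = q * \<rho> n + K * (\<rho> n)\<^sup>2"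
          using q by (simp add: power2_eq_square field_simps)
        then show ?thesis using step le_d by simp
      qed
      also have "\<dots> \<le> exp (K / q * (p ^ n * d)) * q * \<rho> n"
      proof (intro mult_right_mono)
        have "K / q * \<rho> n \<le> K / q * (p ^ n * d)" using A K q by (intro mult_left_mono) auto
        then show "1 + K / q * \<rho> n \<le> exp (K / q * (p ^ n * d))"
          using exp_ge_add_one_self[of "K / q * (p ^ n * d)"] by linarith
      qed (use q nn in auto)
      also have "\<dots> \<le> exp (K / q * (p ^ n * d)) * q * (exp (K / q * (\<Sum>i<n. p ^ i * d)) * q ^ n * \<rho> 0)"
        using Suc q by (intro mult_left_mono) auto
      also have "\<dots> = exp (K / q * (\<Sum>i<Suc n. p ^ i * d)) * q ^ Suc n * \<rho> 0"
        by (simp add: exp_add distrib_left algebra_simps)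
      finally show ?case .
    qed simp
    have "(\<Sum>i<n. p ^ i * d) \<le> d / (1 - p)"
    proof -
      have "(\<Sum>i<n. p ^ i * d) = (1 - p ^ n) / (1 - p) * d"
        using p by (simp add: sum_gp_strict flip: sum_distrib_right)
      also have "\<dots> \<le> 1 / (1 - p) * d"
        using p d by (intro mult_right_mono divide_right_mono) auto
      finally show ?thesis by simp
    qed
    then have "K / q * (\<Sum>i<n. p ^ i * d) \<le> K / q * (d / (1 - p))" using K q by (intro mult_left_mono) auto
    then have "exp (K / q * (\<Sum>i<n. p ^ i * d)) * q ^ n * \<rho> 0 \<le> C * q ^ n * \<rho> 0"
      using q nn by (intro mult_right_mono) (auto simp: C_def)
    with B[of n] le_d show ?thesis by fastforce
  qed
  have "C > 0" by (simp add: C_def)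
  moreover have "\<forall>\<rho> :: nat \<Rightarrow> real. (\<forall>n. 0 \<le> \<rho> n) \<and> \<rho> 0 \<le> d \<and>
      (\<forall>n. \<rho> n \<le> d \<longrightarrow> \<rho> (Suc n) \<le> q * \<rho> n + K * (\<rho> n)\<^sup>2) \<longrightarrow>
      (\<forall>n. \<rho> n \<le> d \<and> \<rho> n \<le> C * q ^ n * \<rho> 0)"
  proof (intro allI impI)
    fix \<rho> :: "nat \<Rightarrow> real" and n
    assume *: "(\<forall>n. 0 \<le> \<rho> n) \<and> \<rho> 0 \<le> d \<and>
      (\<forall>n. \<rho> n \<le> d \<longrightarrow> \<rho> (Suc n) \<le> q * \<rho> n + K * (\<rho> n)\<^sup>2)"
    show "\<rho> n \<le> d \<and> \<rho> n \<le> C * q ^ n * \<rho> 0"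
      by (rule main[OF conjunct1[OF *] conjunct1[OF conjunct2[OF *]] conjunct2[OF conjunct2[OF *]]])
  qed
  ultimately show ?thesis using d by blast
qed

text \<open>\<open>B\<close> plays the role of \<open>(\<cdot>,\<cdot>) + \<tau> a\<^sub>u\<close> and \<open>T\<close> that of \<open>\<tau> \<beta> \<integral> a b c d\<close>; \<open>L1\<close> and \<open>L2\<close> are
  \<open>1 + \<tau> \<lambda>\<close> for the first two eigenvalues.  Assumption \<open>lin\<close>, which encodes
  \<open>0 \<le> \<beta> u\<^sup>2 \<le> \<lambda>\<close>, controls the linearisation of the iteration at \<open>u\<close>.\<close>

locale normalized_flow = B: psd_form H B + ip: psd_form H ip
  for H :: "'v::real_vector set" and B ip :: "'v \<Rightarrow> 'v \<Rightarrow> real" +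
  fixes T :: "'v \<Rightarrow> 'v \<Rightarrow> 'v \<Rightarrow> 'v \<Rightarrow> real" and u :: 'v and L1 L2 K :: real
  assumes ip_le: "\<And>x. x \<in> H \<Longrightarrow> ip x x \<le> B x x"
    and u: "u \<in> H" "ip u u = 1" and eig: "\<And>v. v \<in> H \<Longrightarrow> B u v = L1 * ip u v"
    and L: "1 \<le> L1" "L1 < L2"
    and gap: "\<And>r. r \<in> H \<Longrightarrow> ip r u = 0 \<Longrightarrow> L2 * ip r r \<le> B r r"
    and T_add: "\<And>a b c d e. a \<in> H \<Longrightarrow> b \<in> H \<Longrightarrow> c \<in> H \<Longrightarrow> d \<in> H \<Longrightarrow> e \<in> H \<Longrightarrow>
        T (a + b) c d e = T a c d e + T b c d e"
    and T_scale: "\<And>x a b c d. a \<in> H \<Longrightarrow> b \<in> H \<Longrightarrow> c \<in> H \<Longrightarrow> d \<in> H \<Longrightarrow>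
        T (x *\<^sub>R a) b c d = x * T a b c d"
    and T_12: "\<And>a b c d. T a b c d = T b a c d"
    and T_13: "\<And>a b c d. T a b c d = T c b a d"
    and K: "0 \<le> K"
    and T_bound: "\<And>a b c d. a \<in> H \<Longrightarrow> b \<in> H \<Longrightarrow> c \<in> H \<Longrightarrow> d \<in> H \<Longrightarrow>
        \<bar>T a b c d\<bar> \<le> K * sqrt (B a a) * sqrt (B b b) * sqrt (B c c) * sqrt (B d d)"
    and lin: "\<And>r s. r \<in> H \<Longrightarrow> s \<in> H \<Longrightarrow>
        \<bar>ip r s - 2 / L1 * T u u r s\<bar> \<le> sqrt (ip r r) * sqrt (ip s s)"
begin

abbreviation nB :: "'v \<Rightarrow> real" where "nB x \<equiv> sqrt (B x x)"

definition perp :: "'v \<Rightarrow> 'v" where "perp x = x - ip x u *\<^sub>R u"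

lemma perp: "x \<in> H \<Longrightarrow> perp x \<in> H" "x \<in> H \<Longrightarrow> ip (perp x) u = 0" "x \<in> H \<Longrightarrow> ip u (perp x) = 0"
  "x \<in> H \<Longrightarrow> x = ip x u *\<^sub>R u + perp x"
  using u by (auto simp: perp_def ip.linear_simps ip.sym[of u x])

lemma nB_u: "nB u = sqrt L1"
  using eig[OF u(1)] u by simp

lemma B_u_perp: "x \<in> H \<Longrightarrow> B u (perp x) = 0"
  using eig perp by simp

lemma Pythagoras: "x \<in> H \<Longrightarrow> ip x x = (ip x u)\<^sup>2 + ip (perp x) (perp x)"
  using u perp(1)[of x] unfolding perp_def 
  by (simp add: ip.linear_simps ip.sym[of u x] power2_eq_square algebra_simps)

text \<open>Since \<open>u\<close> is an eigenvector, its orthogonal complements with respect to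
  \<open>ip\<close> and to \<open>B\<close> agree, so Pythagoras holds in \<open>B\<close> as
  well.\<close>

lemma B_perp_le:
  assumes "x \<in> H" shows "nB (perp x) \<le> nB (x - u)"
proof -
  let ?a = "ip x u - 1"
  have eq: "x - u = perp x + ?a *\<^sub>R u" by (simp add: perp_def algebra_simps)
  have "B (x - u) (x - u) = B (perp x) (perp x) + ?a\<^sup>2 * L1"
    unfolding eq using assms u perp[OF assms] B_u_perp[OF assms] B.sym[of u "perp x"] eig[OF u(1)]
    by (simp add: B.expand)
  then show ?thesis using L by simp
qed

text \<open>On the unit sphere the coefficient along \<open>u\<close> is determined by the
  orthogonal part and differs from 1 only to second order. The whole error is therefore controlled
  by the orthogonal part, once the sign condition has selected \<open>u\<close> instead of
  \<open>- u\<close>.\<close>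

lemma alpha_bounds:
  assumes z: "z \<in> H" "ip z z = 1" "0 \<le> ip z u"
  shows "ip z u \<le> 1" "1 - ip z u \<le> (nB (perp z))\<^sup>2" "1 - ip z u \<le> nB (perp z)"
    "nB (z - u) \<le> (1 + sqrt L1) * nB (perp z)"
proof -
  let ?a = "ip z u" and ?r = "perp z"
  have r: "?r \<in> H" by (rule perp(1)[OF z(1)])
  have P: "?a\<^sup>2 + ip ?r ?r = 1" using Pythagoras[OF z(1)] z(2) by simp
  then have "?a\<^sup>2 \<le> 1" using ip.nonneg[OF r] by simp
  then show a1: "?a \<le> 1" by (simp add: abs_square_le_1)
  have "?a\<^sup>2 \<le> ?a" using a1 z(3) by (simp add: power2_eq_square mult_left_le)
  then have "1 - ?a \<le> ip ?r ?r" using P by simp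
  also have le: "\<dots> \<le> (nB ?r)\<^sup>2" using ip_le[OF r] B.nonneg[OF r] by simp
  finally show A: "1 - ?a \<le> (nB ?r)\<^sup>2" .
  have "(1 - ?a)\<^sup>2 \<le> 1 - ?a" using a1 z(3) by (simp add: power2_eq_square mult_left_le)
  then have "(1 - ?a)\<^sup>2 \<le> (nB ?r)\<^sup>2" using A by simp
  then show C: "1 - ?a \<le> nB ?r" using B.nonneg[OF r] by (intro power2_le_imp_le[OF _ real_sqrt_ge_zero])
  have eq: "z - u = ?r + (?a - 1) *\<^sub>R u" by (simp add: perp_def algebra_simps)
  have "nB (z - u) \<le> nB ?r + nB ((?a - 1) *\<^sub>R u)"
    unfolding eq using r u by (intro B.triangle) auto
  also have "\<dots> = nB ?r + (1 - ?a) * sqrt L1" using a1 u nB_u by (simp only: B.norm_scale) simp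
  also have "\<dots> \<le> nB ?r + nB ?r * sqrt L1" using C L by (simp add: mult_right_mono)
  finally show "nB (z - u) \<le> (1 + sqrt L1) * nB ?r" by (simp add: algebra_simps)
qed

lemma T_add_simps:
  assumes "a \<in> H" "b \<in> H" "c \<in> H" "d \<in> H" "e \<in> H"
  shows "T (a + b) c d e = T a c d e + T b c d e" "T c (a + b) d e = T c a d e + T c b d e"
    "T c d (a + b) e = T c d a e + T c d b e"
proof -
  show "T (a + b) c d e = T a c d e + T b c d e" using assms by (simp add: T_add)
  show "T c (a + b) d e = T c a d e + T c b d e" using assms by (simp add: T_add T_12[of c])
  show "T c d (a + b) e = T c d a e + T c d b e" using assms by (simp add: T_add T_13[of c])
qed

lemma T_scale_simps:
  assumes "a \<in> H" "c \<in> H" "d \<in> H" "e \<in> H"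
  shows "T (x *\<^sub>R a) c d e = x * T a c d e" "T c (x *\<^sub>R a) d e = x * T c a d e"
    "T c d (x *\<^sub>R a) e = x * T c d a e"
proof -
  show "T (x *\<^sub>R a) c d e = x * T a c d e" using assms by (simp add: T_scale)
  show "T c (x *\<^sub>R a) d e = x * T c a d e" using assms by (simp add: T_scale T_12[of c])
  show "T c d (x *\<^sub>R a) e = x * T c d a e" using assms by (simp add: T_scale T_13[of c])
qed

lemmas T_simps = T_add_simps T_scale_simps

text \<open>Exact expansion of the square of u + (z - u). The factor 2 of the linear term is the one
  that appears in assumption \<open>lin\<close>.\<close>

lemma T_diff:
  assumes "z \<in> H" "w \<in> H" "v \<in> H"
  shows "T z z w v - T u u w v = T (z - u) (z - u) w v + 2 * T (z - u) u w v"
proof -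
  have z: "z = u + (z - u)" by simp
  have "T z z w v = T (u + (z - u)) (u + (z - u)) w v" by simp
  also have "\<dots> = T u u w v + T (z - u) (z - u) w v + T (z - u) u w v + T u (z - u) w v"
    using assms u by (simp only: T_simps B.mem)
  finally show ?thesis using T_12[of u "z - u"] by simp
qed

text \<open>The equation is tested with \<open>s = perp w\<close>. Since
  \<open>B w s = B s s\<close> and \<open>ip z s = ip r s\<close>, there remain the form of
  \<open>lin\<close> and terms quadratic in \<rho>. Bounding the former by \<open>lin\<close> and
  applying \<open>gap\<close> to both \<open>r\<close> and \<open>s\<close> gives the factor 1/L2;
  after division by \<open>nB s\<close> one has \<open>nB s\<close> \<le> \<rho>/L2 + O(\<rho>^2).
  The L2 norm of \<open>w\<close> is at least \<open>ip w u\<close>, which is 1/L1 up to O(\<rho>);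
  measuring \<open>s\<close> relative to it produces L1/L2.\<close>

lemma step_estimate:
  "\<exists>d>0. \<exists>C\<ge>0. \<forall>z\<in>H. \<forall>w\<in>H. ip z z = 1 \<longrightarrow> 0 \<le> ip z u \<longrightarrow> nB (perp z) \<le> d \<longrightarrow>
     (\<forall>v\<in>H. B w v + (T z z w v - T u u w v) = ip z v) \<longrightarrow>
     0 < ip w w \<and> 0 < ip w u \<and>
     nB (perp w) \<le> sqrt (ip w w) * (L1 / L2 * nB (perp z) + C * (nB (perp z))\<^sup>2)"
proof -
  define l where "l = sqrt L1"
  have l: "1 \<le> l" "l\<^sup>2 = L1" "0 \<le> l" using L by (auto simp: l_def)
  \<comment> \<open>\<open>c1\<close> bounds \<open>z - u\<close> relative to \<rho>,
    \<open>M\<close> the perturbation of the form, \<open>K2\<close> the deviation of L1 g from 1,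
    \<open>K3\<close> is a crude first bound for \<open>s\<close>, and \<open>K4\<close> collects
    the four quadratic remainders.\<close>
  define c1 where "c1 = 1 + l"
  define M where "M = K * (c1 * (c1 + 2 * l))"
  define K2 where "K2 = 2 * M * l + 1"
  define K3 where "K3 = 1 + 2 * M"
  define K4 where "K4 = 2 * K2 * (K * l * l) + 2 * (1 + K2) * (K * l * l * l) +
     2 * (K * c1 * l * K3) + K * c1 * c1 * 2"
  have pos: "0 \<le> c1" "0 \<le> M" "1 \<le> K2" "0 \<le> K3" "0 \<le> K4"
    using l K by (auto simp: c1_def M_def K2_def K3_def K4_def)
  \<comment> \<open>The three entries give \<rho> \<le> 1, allow the perturbation to be absorbed
    into \<open>B w w\<close>, and keep the coefficient of \<open>w\<close> along \<open>u\<close>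
    positive.\<close>
  define d where "d = min 1 (min (1 / (2 * (M + 1))) (1 / (2 * K2)))"
  have d: "d > 0" "d \<le> 1" using pos by (auto simp: d_def)
  have Md: "M * d \<le> 1 / 2"
  proof -
    have "M * d \<le> (M + 1) * (1 / (2 * (M + 1)))"
      using pos d by (intro mult_mono) (auto simp: d_def)
    also have "\<dots> = 1 / 2" using pos by (simp add: field_simps)
    finally show ?thesis .
  qed
  have K2d: "K2 * d \<le> 1 / 2"
  proof -
    have "K2 * d \<le> K2 * (1 / (2 * K2))"
      using pos d by (intro mult_mono) (auto simp: d_def)
    then show ?thesis using pos by simp
  qed
  \<comment> \<open>Even after multiplication by (1 - K2 \<rho>)/L1 \<ge> 1/(2 L1), the term C
    \<rho>^2 still covers K4 \<rho>^2 and the loss K2 \<rho>^2 / L2 in the linear term.\<close>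
  define C where "C = 2 * L1 * (K2 + K4)"
  have C: "C \<ge> 0" using pos L by (simp add: C_def)
  have main: "0 < ip w w \<and> 0 < ip w u \<and>
     nB (perp w) \<le> sqrt (ip w w) * (L1 / L2 * nB (perp z) + C * (nB (perp z))\<^sup>2)"
    if z: "z \<in> H" and w: "w \<in> H" and z1: "ip z z = 1" "0 \<le> ip z u" and zd: "nB (perp z) \<le> d"
      and eq: "\<forall>v\<in>H. B w v + (T z z w v - T u u w v) = ip z v" for z w
  proof -
    define \<rho> where "\<rho> = nB (perp z)"
    define a where "a = ip z u"
    define g where "g = ip w u"
    define s where "s = perp w"
    define r where "r = perp z"
    define e where "e = z - u"
    note ab = alpha_bounds[OF z z1, folded \<rho>_def a_def e_def l_def, folded c1_def]
    have "0 \<le> \<rho>" using B.nonneg[OF perp(1)[OF z]] by (simp add: \<rho>_def)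
    moreover have "\<rho> \<le> d" using zd by (simp only: \<rho>_def)
    ultimately have \<rho>: "0 \<le> \<rho>" "\<rho> \<le> d" "\<rho> \<le> 1" using d by linarith+
    have M\<rho>: "M * \<rho> \<le> 1 / 2" using Md mult_left_mono[OF \<rho>(2) pos(2)] by linarith
    have K2\<rho>: "K2 * \<rho> \<le> 1 / 2" using K2d mult_left_mono[OF \<rho>(2), of K2] pos(3) by linarith
    have mem: "r \<in> H" "s \<in> H" "e \<in> H" "u \<in> H" using perp z w u by (auto simp: r_def s_def e_def)
    have nn: "0 \<le> nB x" if "x \<in> H" for x using B.nonneg[OF that] by simp
    have sq: "(nB x)\<^sup>2 = B x x" if "x \<in> H" for x using B.nonneg[OF that] by simp
    have nu: "nB u = l" using nB_u by (simp add: l_def)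
    have E: "\<bar>T z z w v - T u u w v\<bar> \<le> M * \<rho> * nB w * nB v" if v: "v \<in> H" for v
    proof -
      have "\<bar>T z z w v - T u u w v\<bar> \<le> \<bar>T e e w v\<bar> + 2 * \<bar>T e u w v\<bar>"
        unfolding T_diff[OF z w v] e_def by linarith
      also have "\<dots> \<le> K * nB e * nB e * nB w * nB v + 2 * (K * nB e * nB u * nB w * nB v)"
        using T_bound[of e e w v] T_bound[of e u w v] mem w v by simp
      also have "\<dots> = K * (nB e * (nB e + 2 * l)) * (nB w * nB v)" by (simp add: nu algebra_simps)
      also have "\<dots> \<le> K * ((c1 * \<rho>) * (c1 + 2 * l)) * (nB w * nB v)"
      proof (intro mult_right_mono mult_left_mono mult_mono)
        have "c1 * \<rho> \<le> c1 * 1" using \<rho> pos by (intro mult_left_mono) auto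
        then show "nB e + 2 * l \<le> c1 + 2 * l" using ab(4) by simp
      qed (use ab(4) nn[OF mem(3)] nn[OF w] nn[OF v] K l pos \<rho> in auto)
      also have "\<dots> = M * \<rho> * nB w * nB v" by (simp add: M_def)
      finally show ?thesis .
    qed
    have CS: "\<bar>ip x y\<bar> \<le> nB x * nB y" if "x \<in> H" "y \<in> H" for x y
    proof -
      have "\<bar>ip x y\<bar> \<le> sqrt (ip x x) * sqrt (ip y y)" by (rule ip.Cauchy_Schwarz_sqrt[OF that])
      also have "\<dots> \<le> nB x * nB y" using ip_le that ip.nonneg B.nonneg by (intro mult_mono) auto
      finally show ?thesis .
    qed
    \<comment> \<open>Testing with \<open>w\<close> itself: the perturbation takes at most half of
      \<open>B w w\<close>, and the right-hand side is at most \<open>nB w\<close> because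
      \<open>z\<close> is normalized.\<close>
    have w2: "nB w \<le> 2"
    proof -
      have 1: "ip z w \<le> nB w"
      proof -
        have "ip z w \<le> sqrt (ip z z) * sqrt (ip w w)"
          by (rule order_trans[OF abs_ge_self ip.Cauchy_Schwarz_sqrt[OF z w]])
        also have "\<dots> = sqrt (ip w w)" using z1 by simp
        also have "\<dots> \<le> nB w" using ip_le[OF w] by simp
        finally show ?thesis .
      qed
      have 2: "B w w + (T z z w w - T u u w w) = ip z w" by (rule eq[rule_format, OF w])
      have 3: "M * \<rho> * nB w * nB w \<le> 1 / 2 * (nB w * nB w)"
        using mult_right_mono[OF M\<rho>, of "nB w * nB w"] mult_nonneg_nonneg[OF nn[OF w] nn[OF w]]
        by (simp only: mult.assoc)
      have 4: "B w w = nB w * nB w" by (rule sq[OF w, unfolded power2_eq_square, symmetric])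
      have "b \<le> 2 * n" if "x \<le> n" "c + X = x" "a \<le> 1 / 2 * b" "c = b" "\<bar>X\<bar> \<le> a" for a b c n x X :: real
        using that by linarith
      from this[OF 1 2 3 4 E[OF w]] have "nB w * nB w \<le> 2 * nB w" .
      then show ?thesis using nn[OF w] by (rule le_if_square_le_mult) simp
    qed
    have E2: "\<bar>T z z w v - T u u w v\<bar> \<le> 2 * M * \<rho> * nB v" if v: "v \<in> H" for v
    proof -
      have "M * \<rho> * nB w * nB v \<le> M * \<rho> * 2 * nB v"
        using w2 pos \<rho> nn[OF v] by (intro mult_right_mono mult_left_mono) auto
      then show ?thesis using E[OF v] by (simp add: algebra_simps)
    qed
    \<comment> \<open>Testing with \<open>u\<close>: by the eigenvalue equation L1 g equals
      \<open>ip z u\<close> up to the perturbation.\<close>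
    have g1: "\<bar>L1 * g - 1\<bar> \<le> K2 * \<rho>"
    proof -
      have "B w u = L1 * g" using eig[OF w] B.sym[OF w mem(4)] ip.sym[OF w mem(4)] by (simp add: g_def)
      then have "L1 * g - 1 = (a - 1) - (T z z w u - T u u w u)"
        using eq[rule_format, OF mem(4)] unfolding a_def by linarith
      moreover have "\<bar>T z z w u - T u u w u\<bar> \<le> 2 * M * \<rho> * l" using E2[OF mem(4)] nu by simp
      ultimately have "\<bar>L1 * g - 1\<bar> \<le> \<rho> + 2 * M * \<rho> * l" using ab(1,3) by linarith
      then show ?thesis by (simp add: K2_def algebra_simps)
    qed
    have g2: "\<bar>g - 1 / L1\<bar> \<le> K2 * \<rho>"
    proof -
      have "\<bar>g - 1 / L1\<bar> = \<bar>L1 * g - 1\<bar> / L1" using L by (simp add: field_simps abs_divide flip: abs_mult_pos)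
      also have "\<dots> \<le> \<bar>L1 * g - 1\<bar> / 1" using L by (intro divide_left_mono) auto
      finally show ?thesis using g1 by simp
    qed
    have g3: "\<bar>g\<bar> \<le> 1 + K2"
    proof -
      have "1 / L1 \<le> 1" "0 \<le> 1 / L1" using L by auto
      moreover have "K2 * \<rho> \<le> K2 * 1" using \<rho> pos by (intro mult_left_mono) auto
      ultimately show ?thesis using g2 by linarith
    qed
    have gpos: "(1 - K2 * \<rho>) / L1 \<le> g" "0 < g"
    proof -
      have "1 - K2 * \<rho> \<le> L1 * g" using g1 by linarith
      then show *: "(1 - K2 * \<rho>) / L1 \<le> g" using L by (simp add: field_simps)
      have "0 < (1 - K2 * \<rho>) / L1" using K2\<rho> L by simp
      with * show "0 < g" by simp
    qed
    have w_eq: "w = g *\<^sub>R u + s" using perp(4)[OF w] by (simp add: g_def s_def)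
    have z_eq: "z = a *\<^sub>R u + r" using perp(4)[OF z] by (simp add: a_def r_def)
    have us: "B u s = 0" "ip u s = 0" using B_u_perp[OF w] perp(3)[OF w] by (auto simp: s_def)
    have Bws: "B w s = B s s" unfolding w_eq using mem us by (simp add: B.linear_simps)
    have ipzs: "ip z s = ip r s" unfolding z_eq using mem us by (simp add: ip.linear_simps)
    have Bss: "B s s = ip r s - (T z z w s - T u u w s)" using eq mem(2) Bws ipzs by (metis add_diff_cancel_right')
    have nr: "nB r = \<rho>" by (simp add: r_def \<rho>_def)
    have cancel: "nB s \<le> X" if "nB s * nB s \<le> X * nB s" "0 \<le> X" for X
      using le_if_square_le_mult[OF that(1) nn[OF mem(2)] that(2)] .
    have ss: "nB s * nB s = B s s" using sq[OF mem(2)] by (simp add: power2_eq_square)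
    have s1: "nB s \<le> K3 * \<rho>"
    proof (rule cancel)
      have "nB s * nB s \<le> \<rho> * nB s + 2 * M * \<rho> * nB s"
        using CS[OF mem(1,2), unfolded nr] E2[OF mem(2)] Bss ss by linarith
      then show "nB s * nB s \<le> K3 * \<rho> * nB s" by (simp add: K3_def algebra_simps)
    qed (use pos \<rho> in auto)
    have s2: "nB s \<le> \<rho> / L2 + K4 * \<rho>\<^sup>2"
    proof (rule cancel)
      have e_eq: "e = r + (a - 1) *\<^sub>R u" using z_eq by (simp add: e_def algebra_simps)
      have Teu: "T e u w s = g * T r u u s + g * (a - 1) * T u u u s + T e u s s"
      proof -
        have "T e u w s = g * T e u u s + T e u s s" by (subst w_eq) (simp add: T_simps mem)
        also have "T e u u s = T r u u s + (a - 1) * T u u u s"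
          by (subst e_eq) (simp add: T_simps mem)
        finally show ?thesis by (simp add: algebra_simps)
      qed
      have Truus: "T r u u s = T u u r s" by (rule T_13)
      \<comment> \<open>The coefficient g is replaced by its limit 1/L1 in front of the linear term;
        the difference and all remaining terms carry two factors of order \<rho> besides
        \<open>nB s\<close>.\<close>
      have "B s s = (ip r s - 2 / L1 * T u u r s) - 2 * (g - 1 / L1) * T r u u s
          + 2 * g * (1 - a) * T u u u s - 2 * T e u s s - T e e w s"
        unfolding Bss T_diff[OF z w mem(2)] e_def[symmetric] Teu Truus
        by (simp add: algebra_simps)
      moreover have "\<bar>ip r s - 2 / L1 * T u u r s\<bar> \<le> \<rho> / L2 * nB s"
      proof -
        have half: "sqrt L2 * sqrt (ip x x) \<le> nB x" if "x \<in> H" "ip x u = 0" for x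
          using gap[OF that] L by (simp flip: real_sqrt_mult)
        have "\<bar>ip r s - 2 / L1 * T u u r s\<bar> \<le> sqrt (ip r r) * sqrt (ip s s)" by (rule lin[OF mem(1,2)])
        moreover have "(sqrt L2 * sqrt (ip r r)) * (sqrt L2 * sqrt (ip s s)) \<le> \<rho> * nB s"
          using half[OF mem(1)] half[OF mem(2)] perp(2)[OF z] perp(2)[OF w] nr nn mem ip.nonneg L \<rho>
          by (intro mult_mono) (auto simp: r_def s_def)
        moreover have "(sqrt L2 * sqrt (ip r r)) * (sqrt L2 * sqrt (ip s s)) = L2 * (sqrt (ip r r) * sqrt (ip s s))"
          using L by (simp add: algebra_simps)
        ultimately have "\<bar>ip r s - 2 / L1 * T u u r s\<bar> \<le> sqrt (ip r r) * sqrt (ip s s)"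
          "L2 * (sqrt (ip r r) * sqrt (ip s s)) \<le> \<rho> * nB s" by simp_all
        moreover from this(2) have "sqrt (ip r r) * sqrt (ip s s) \<le> \<rho> * nB s / L2"
          using L by (simp only: pos_le_divide_eq mult.commute)
        ultimately show ?thesis by simp
      qed
      moreover have "\<bar>2 * (g - 1 / L1) * T r u u s\<bar> \<le> 2 * K2 * (K * l * l) * \<rho>\<^sup>2 * nB s"
      proof -
        have "\<bar>2 * (g - 1 / L1) * T r u u s\<bar> = 2 * (\<bar>g - 1 / L1\<bar> * \<bar>T r u u s\<bar>)"
          by (simp only: abs_mult abs_numeral mult.assoc)
        also have "\<dots> \<le> 2 * ((K2 * \<rho>) * (K * \<rho> * l * l * nB s))"
          using T_bound[of r u u s] mem nr nu g2 pos \<rho> by (intro mult_left_mono mult_mono) auto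
        finally show ?thesis by (simp add: power2_eq_square algebra_simps)
      qed
      moreover have "\<bar>2 * g * (1 - a) * T u u u s\<bar> \<le> 2 * (1 + K2) * (K * l * l * l) * \<rho>\<^sup>2 * nB s"
      proof -
        have "\<bar>2 * g * (1 - a) * T u u u s\<bar> = 2 * (\<bar>g\<bar> * ((1 - a) * \<bar>T u u u s\<bar>))"
          using ab(1) by (simp add: abs_mult)
        also have "\<dots> \<le> 2 * ((1 + K2) * (\<rho>\<^sup>2 * (K * l * l * l * nB s)))"
          using T_bound[of u u u s] mem nu g3 ab pos \<rho> by (intro mult_left_mono mult_mono) auto
        finally show ?thesis by (simp add: power2_eq_square algebra_simps)
      qed
      moreover have "\<bar>2 * T e u s s\<bar> \<le> 2 * (K * c1 * l * K3) * \<rho>\<^sup>2 * nB s"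
      proof -
        have "\<bar>T e u s s\<bar> \<le> K * nB e * l * nB s * nB s" using T_bound[of e u s s] mem nu by simp
        also have "\<dots> \<le> K * (c1 * \<rho>) * l * (K3 * \<rho>) * nB s"
          using ab(4) s1 K l pos \<rho> nn mem by (intro mult_mono) auto
        finally show ?thesis by (simp add: power2_eq_square algebra_simps)
      qed
      moreover have "\<bar>T e e w s\<bar> \<le> K * c1 * c1 * 2 * \<rho>\<^sup>2 * nB s"
      proof -
        have "\<bar>T e e w s\<bar> \<le> K * nB e * nB e * nB w * nB s" using T_bound[of e e w s] mem w by simp
        also have "\<dots> \<le> K * (c1 * \<rho>) * (c1 * \<rho>) * 2 * nB s"
          using ab(4) w2 K l pos \<rho> nn mem w by (intro mult_mono) auto
        finally show ?thesis by (simp add: power2_eq_square algebra_simps)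
      qed
      ultimately have "B s s \<le> \<rho> / L2 * nB s + 2 * K2 * (K * l * l) * \<rho>\<^sup>2 * nB s
          + 2 * (1 + K2) * (K * l * l * l) * \<rho>\<^sup>2 * nB s + 2 * (K * c1 * l * K3) * \<rho>\<^sup>2 * nB s
          + K * c1 * c1 * 2 * \<rho>\<^sup>2 * nB s" by linarith
      also have "\<dots> = (\<rho> / L2 + K4 * \<rho>\<^sup>2) * nB s" by (simp add: K4_def algebra_simps)
      finally show "nB s * nB s \<le> (\<rho> / L2 + K4 * \<rho>\<^sup>2) * nB s" using ss by simp
    qed (use pos \<rho> L in auto)
    have gw: "g \<le> sqrt (ip w w)"
      using ip.Cauchy_Schwarz_sqrt[OF w mem(4)] u by (simp add: g_def)
    then have wpos: "0 < ip w w" using gpos(2) by (metis less_le_trans real_sqrt_gt_0_iff)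
    let ?R = "L1 / L2 * \<rho> + C * \<rho>\<^sup>2"
    have "\<rho> / L2 + K4 * \<rho>\<^sup>2 \<le> (1 - K2 * \<rho>) / L1 * ?R"
    proof -
      have "(1 - K2 * \<rho>) / L1 * ?R = \<rho> / L2 - K2 * \<rho>\<^sup>2 / L2 + (1 - K2 * \<rho>) * (2 * (K2 + K4)) * \<rho>\<^sup>2"
        using L by (simp add: C_def field_simps power2_eq_square)
      moreover have "1 / 2 * (2 * (K2 + K4)) * \<rho>\<^sup>2 \<le> (1 - K2 * \<rho>) * (2 * (K2 + K4)) * \<rho>\<^sup>2"
        using K2\<rho> pos by (intro mult_right_mono) auto
      moreover have "K2 * \<rho>\<^sup>2 / L2 \<le> K2 * \<rho>\<^sup>2 / 1" using L pos by (intro divide_left_mono) auto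
      ultimately show ?thesis by (simp add: algebra_simps)
    qed
    also have "\<dots> \<le> sqrt (ip w w) * ?R"
      using gpos(1) gw C L \<rho> by (intro mult_right_mono) auto
    finally have "nB s \<le> sqrt (ip w w) * ?R" using s2 by linarith
    then show ?thesis using wpos gpos(2) by (simp add: s_def g_def \<rho>_def)
  qed
  show ?thesis by (rule exI[of _ d], intro conjI exI[of _ C] ballI impI main d C) auto
qed

text \<open>The step estimate holds only for iterates near \<open>u\<close>, so the decay and the
  fact that no iterate leaves the neighbourhood have to be proved together. The scalar lemma wants a
  recursion for all indices; it is applied to sequences that are set to zero beyond the range where
  the recursion is known.\<close>

theorem normalized_flow_converges:
  "\<exists>d>0. \<exists>C>0. \<forall>z. z 0 \<in> H \<longrightarrow> ip (z 0) (z 0) = 1 \<longrightarrow> nB (z 0 - u) < d \<longrightarrow>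
     (\<forall>n. z n \<in> H \<longrightarrow> ip (z n) (z n) = 1 \<longrightarrow>
        (\<exists>w\<in>H. (\<forall>v\<in>H. B w v + (T (z n) (z n) w v - T u u w v) = ip (z n) v) \<and>
           z (Suc n) = (1 / sqrt (ip w w)) *\<^sub>R w)) \<longrightarrow>
     (\<forall>n. z n \<in> H \<and> nB (z n - u) \<le> C * (L1 / L2) ^ n * nB (z 0 - u))"
proof -
  obtain d0 K' where d0: "d0 > 0" "K' \<ge> 0"
    and step: "\<And>z w. z \<in> H \<Longrightarrow> w \<in> H \<Longrightarrow> ip z z = 1 \<Longrightarrow> 0 \<le> ip z u \<Longrightarrow> nB (perp z) \<le> d0 \<Longrightarrow>
     (\<forall>v\<in>H. B w v + (T z z w v - T u u w v) = ip z v) \<Longrightarrow>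
     0 < ip w w \<and> 0 < ip w u \<and>
     nB (perp w) \<le> sqrt (ip w w) * (L1 / L2 * nB (perp z) + K' * (nB (perp z))\<^sup>2)"
    using step_estimate by blast
  have q: "0 < L1 / L2" "L1 / L2 < 1" using L by auto
  obtain d C where d: "d > 0" "C > 0" "d \<le> d0"
    and decay0: "\<forall>\<rho> :: nat \<Rightarrow> real. (\<forall>n. 0 \<le> \<rho> n) \<and> \<rho> 0 \<le> d \<and>
      (\<forall>n. \<rho> n \<le> d \<longrightarrow> \<rho> (Suc n) \<le> L1 / L2 * \<rho> n + K' * (\<rho> n)\<^sup>2) \<longrightarrow>
      (\<forall>n. \<rho> n \<le> d \<and> \<rho> n \<le> C * (L1 / L2) ^ n * \<rho> 0)"
    using perturbed_geometric_decay[OF q d0(2,1)] by blast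
  have decay: "\<forall>n. \<rho> n \<le> d \<and> \<rho> n \<le> C * (L1 / L2) ^ n * \<rho> 0"
    if "\<forall>n. 0 \<le> \<rho> n" "\<rho> 0 \<le> d" 
      "\<forall>n. \<rho> n \<le> d \<longrightarrow> \<rho> (Suc n) \<le> L1 / L2 * \<rho> n + K' * (\<rho> n)\<^sup>2" for \<rho> :: "nat \<Rightarrow> real"
    by (rule decay0[THEN spec, THEN mp, OF conjI[OF that(1) conjI[OF that(2,3)]]])
  \<comment> \<open>A radius of at most 1 forces \<open>ip (z 0) u\<close> to be at least 1/2, which
    fixes the sign. The factor 1 + sqrt L1 leads back from the orthogonal part to the full
    error.\<close>
  let ?D = "min d 1" and ?C = "(1 + sqrt L1) * C"
  have main: "z n \<in> H \<and> nB (z n - u) \<le> ?C * (L1 / L2) ^ n * nB (z 0 - u)"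
    if z0: "z 0 \<in> H" "ip (z 0) (z 0) = 1" "nB (z 0 - u) < ?D"
    and it: "\<forall>n. z n \<in> H \<longrightarrow> ip (z n) (z n) = 1 \<longrightarrow>
        (\<exists>w\<in>H. (\<forall>v\<in>H. B w v + (T (z n) (z n) w v - T u u w v) = ip (z n) v) \<and>
           z (Suc n) = (1 / sqrt (ip w w)) *\<^sub>R w)" for z n
  proof -
    define good where "good x \<longleftrightarrow> x \<in> H \<and> ip x x = 1 \<and> 0 \<le> ip x u \<and> nB (perp x) \<le> d" for x
    have good0: "good (z 0)"
    proof -
      have "ip (z 0 - u) (z 0 - u) = 2 - 2 * ip (z 0) u"
        using z0 u by (simp add: ip.linear_simps ip.sym[of u "z 0"])
      moreover have "ip (z 0 - u) (z 0 - u) \<le> B (z 0 - u) (z 0 - u)"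
        using ip_le z0 u by simp
      moreover have "B (z 0 - u) (z 0 - u) \<le> 1"
        using z0(3) by simp
      ultimately have "0 \<le> ip (z 0) u" by linarith
      moreover have "nB (perp (z 0)) \<le> d" using B_perp_le[OF z0(1)] z0(3) by linarith
      ultimately show ?thesis using z0 by (simp add: good_def)
    qed
    have gstep: "good (z (Suc n)) \<or> True" "z (Suc n) \<in> H" "ip (z (Suc n)) (z (Suc n)) = 1" "0 \<le> ip (z (Suc n)) u"
      "nB (perp (z (Suc n))) \<le> L1 / L2 * nB (perp (z n)) + K' * (nB (perp (z n)))\<^sup>2"
      if g: "good (z n)" for n
    proof -
      from g it obtain w where w: "w \<in> H" "\<forall>v\<in>H. B w v + (T (z n) (z n) w v - T u u w v) = ip (z n) v"
        and z': "z (Suc n) = (1 / sqrt (ip w w)) *\<^sub>R w" unfolding good_def by blast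
      have s: "0 < ip w w" "0 < ip w u"
        "nB (perp w) \<le> sqrt (ip w w) * (L1 / L2 * nB (perp (z n)) + K' * (nB (perp (z n)))\<^sup>2)"
        using step[of "z n" w] g w d unfolding good_def by auto
      show "z (Suc n) \<in> H" "ip (z (Suc n)) (z (Suc n)) = 1" "0 \<le> ip (z (Suc n)) u"
        using w s u by (auto simp: z' ip.linear_simps)
      have "perp (z (Suc n)) = (1 / sqrt (ip w w)) *\<^sub>R perp w"
        using w u by (simp add: z' perp_def ip.linear_simps scaleR_diff_right)
      then have "nB (perp (z (Suc n))) = nB (perp w) / sqrt (ip w w)"
        using B.norm_scale[OF perp(1)[OF w(1)]] s by simp
      then show "nB (perp (z (Suc n))) \<le> L1 / L2 * nB (perp (z n)) + K' * (nB (perp (z n)))\<^sup>2"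
        using s by (simp add: pos_divide_le_eq mult.commute)
    qed simp
    \<comment> \<open>Cut off at the first bad iterate: a zero trivially satisfies the
      recursion.\<close>
    define \<rho> where "\<rho> n = (if \<forall>k\<le>n. good (z k) then nB (perp (z n)) else 0)" for n
    have \<rho>nn: "\<forall>n. 0 \<le> \<rho> n" using B.nonneg perp by (auto simp: \<rho>_def good_def)
    have dec: "\<forall>n. \<rho> n \<le> d \<and> \<rho> n \<le> C * (L1 / L2) ^ n * \<rho> 0"
    proof (rule decay[OF \<rho>nn])
      show "\<rho> 0 \<le> d" using good0 by (simp add: \<rho>_def good_def)
      show "\<forall>n. \<rho> n \<le> d \<longrightarrow> \<rho> (Suc n) \<le> L1 / L2 * \<rho> n + K' * (\<rho> n)\<^sup>2"
      proof (intro allI impI)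
        fix n
        show "\<rho> (Suc n) \<le> L1 / L2 * \<rho> n + K' * (\<rho> n)\<^sup>2"
        proof (cases "\<forall>k\<le>Suc n. good (z k)")
          case True
          then have "\<rho> (Suc n) = nB (perp (z (Suc n)))" "\<rho> n = nB (perp (z n))" "good (z n)"
            by (auto simp: \<rho>_def)
          then show ?thesis using gstep(5) by simp
        next
          case False
          then have "\<rho> (Suc n) = 0" unfolding \<rho>_def by (rule if_not_P)
          moreover have "0 \<le> L1 / L2 * \<rho> n + K' * (\<rho> n)\<^sup>2"
            using \<rho>nn q d0 by (intro add_nonneg_nonneg mult_nonneg_nonneg less_imp_le[OF q(1)]) auto
          ultimately show ?thesis by simp
        qed
      qed
    qed
    have all: "good (z n)" for n
    proof (induction n rule: less_induct)
      case (less n)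
      show ?case
      proof (cases n)
        case (Suc k)
        then have gk: "\<forall>j\<le>k. good (z j)" using less by simp
        then have "good (z k)" by simp
        note gs = gstep(2-5)[OF this]
        \<comment> \<open>Follows the iterates one step further than their goodness is known. The
          step from \<open>k\<close> to \<open>Suc k\<close> is covered by \<open>gstep\<close>, so
          \<sigma> obeys the recursion, and its bound by \<open>d\<close> is what is missing for
          \<open>z (Suc k)\<close> to be good.\<close>
        define \<sigma> where "\<sigma> j = (if j \<le> k then \<rho> j else if j = Suc k then nB (perp (z (Suc k))) else 0)" for j
        have "\<forall>n. \<sigma> n \<le> d \<and> \<sigma> n \<le> C * (L1 / L2) ^ n * \<sigma> 0"
        proof (rule decay)
          show "\<forall>n. 0 \<le> \<sigma> n" using \<rho>nn B.nonneg[OF perp(1)[OF gs(1)]] by (auto simp: \<sigma>_def)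
          show "\<sigma> 0 \<le> d" using dec by (simp add: \<sigma>_def)
          show "\<forall>n. \<sigma> n \<le> d \<longrightarrow> \<sigma> (Suc n) \<le> L1 / L2 * \<sigma> n + K' * (\<sigma> n)\<^sup>2"
          proof (intro allI impI)
            fix n
            consider "Suc n \<le> k" | "n = k" | "n > k" by linarith
            then show "\<sigma> (Suc n) \<le> L1 / L2 * \<sigma> n + K' * (\<sigma> n)\<^sup>2"
            proof cases
              case 1
              then have "\<sigma> (Suc n) = nB (perp (z (Suc n)))" "\<sigma> n = nB (perp (z n))" "good (z n)"
                using gk by (auto simp: \<sigma>_def \<rho>_def)
              then show ?thesis using gstep(5) by simp
            next
              case 2
              then have "\<sigma> (Suc n) = nB (perp (z (Suc n)))" "\<sigma> n = nB (perp (z n))"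
                using gk by (auto simp: \<sigma>_def \<rho>_def)
              then show ?thesis using gs 2 by simp
            next
              case 3
              then have "\<sigma> (Suc n) = 0" "0 \<le> \<sigma> n"
                using B.nonneg[OF perp(1)[OF gs(1)]] by (auto simp: \<sigma>_def)
              moreover from this(2) have "0 \<le> L1 / L2 * \<sigma> n + K' * (\<sigma> n)\<^sup>2"
                using d0 by (intro add_nonneg_nonneg mult_nonneg_nonneg less_imp_le[OF q(1)]) auto
              ultimately show ?thesis by simp
            qed
          qed
        qed
        then have "\<sigma> (Suc k) \<le> d" by blast
        then show ?thesis using gs Suc by (simp add: good_def \<sigma>_def)
      qed (use good0 in simp)
    qed
    then have gn: "good (z n)" by simp
    have \<rho>_eq: "\<rho> n = nB (perp (z n))" "\<rho> 0 = nB (perp (z 0))" using all by (auto simp: \<rho>_def)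
    have "nB (z n - u) \<le> (1 + sqrt L1) * nB (perp (z n))"
      using alpha_bounds(4) gn by (simp add: good_def)
    also have "\<dots> \<le> (1 + sqrt L1) * (C * (L1 / L2) ^ n * nB (perp (z 0)))"
      using dec \<rho>_eq L by (intro mult_left_mono) (metis, simp)
    also have "\<dots> \<le> (1 + sqrt L1) * (C * (L1 / L2) ^ n * nB (z 0 - u))"
      using B_perp_le[OF z0(1)] L d q by (intro mult_left_mono) auto
    finally show ?thesis using gn by (simp add: good_def mult.assoc)
  qed
  show ?thesis
  proof (rule exI[of _ ?D], rule conjI, goal_cases)
    case 2
    show ?case
    proof (rule exI[of _ ?C], rule conjI, goal_cases)
      case 2
      show ?case
      proof (intro allI impI)
        fix z n
        assume "z 0 \<in> H" "ip (z 0) (z 0) = 1" "nB (z 0 - u) < ?D"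
          "\<forall>n. z n \<in> H \<longrightarrow> ip (z n) (z n) = 1 \<longrightarrow>
            (\<exists>w\<in>H. (\<forall>v\<in>H. B w v + (T (z n) (z n) w v - T u u w v) = ip (z n) v) \<and>
             z (Suc n) = (1 / sqrt (ip w w)) *\<^sub>R w)"
        then show "z n \<in> H \<and> nB (z n - u) \<le> ?C * (L1 / L2) ^ n * nB (z 0 - u)" by (rule main)
      qed
    qed (use d L in \<open>auto intro!: mult_pos_pos add_pos_nonneg\<close>)
  qed (use d in simp)
qed

end

section \<open>Square integrable functions\<close>

text \<open>The codomain is a Euclidean space so that functions and gradient fields share one L2
  theory.\<close>

definition sq_int :: "'a measure \<Rightarrow> ('a \<Rightarrow> 'b::euclidean_space) \<Rightarrow> bool" where
  "sq_int M f \<longleftrightarrow> f \<in> borel_measurable M \<and> integrable M (\<lambda>x. (norm (f x))\<^sup>2)"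

definition nsq :: "'a measure \<Rightarrow> ('a \<Rightarrow> 'b::euclidean_space) \<Rightarrow> real" where
  "nsq M f = (LINT x|M. (norm (f x))\<^sup>2)"

lemma nsq_nonneg [simp]: "0 \<le> nsq M f"
  by (simp add: nsq_def)

lemma sq_int_measurable [measurable_dest]: "sq_int M f \<Longrightarrow> f \<in> borel_measurable M"
  by (simp add: sq_int_def)

lemma sq_int_integrable: "sq_int M f \<Longrightarrow> integrable M (\<lambda>x. (norm (f x))\<^sup>2)"
  by (simp add: sq_int_def)

lemma norm_add_sq_le: "(norm (a + b))\<^sup>2 \<le> 2 * (norm a)\<^sup>2 + 2 * (norm (b :: 'b::real_inner))\<^sup>2"
proof -
  have "(norm (a + b))\<^sup>2 + (norm (a - b))\<^sup>2 = 2 * (norm a)\<^sup>2 + 2 * (norm b)\<^sup>2"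
    by (simp add: power2_norm_eq_inner inner_simps inner_commute)
  then show ?thesis by (smt (verit) zero_le_power2)
qed

lemma norm_diff_sq_le: "(norm (a - b))\<^sup>2 \<le> 2 * (norm a)\<^sup>2 + 2 * (norm (b :: 'b::real_inner))\<^sup>2"
  using norm_add_sq_le[of a "- b"] by simp

lemma sq_int_bound:
  fixes f :: "'a \<Rightarrow> 'b::euclidean_space" and g :: "'a \<Rightarrow> 'c::euclidean_space"
  assumes "f \<in> borel_measurable M" "sq_int M g" "AE x in M. norm (f x) \<le> c * norm (g x)"
  shows "sq_int M f" "nsq M f \<le> c\<^sup>2 * nsq M g"
proof -
  have i: "integrable M (\<lambda>x. c\<^sup>2 * (norm (g x))\<^sup>2)"
    using assms(2) by (simp add: sq_int_def)
  have le: "AE x in M. (norm (f x))\<^sup>2 \<le> c\<^sup>2 * (norm (g x))\<^sup>2"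
    using assms(3)
  proof eventually_elim
    case (elim x)
    then have "(norm (f x))\<^sup>2 \<le> (c * norm (g x))\<^sup>2" by (intro power_mono) auto
    then show ?case by (simp add: power_mult_distrib)
  qed
  have "integrable M (\<lambda>x. (norm (f x))\<^sup>2)"
    by (rule Bochner_Integration.integrable_bound[OF i]) (use assms le in auto)
  then show "sq_int M f" using assms by (simp add: sq_int_def)
  have "nsq M f \<le> (LINT x|M. c\<^sup>2 * (norm (g x))\<^sup>2)"
    unfolding nsq_def by (rule integral_mono_AE) (fact | rule i le)+
  then show "nsq M f \<le> c\<^sup>2 * nsq M g" by (simp add: nsq_def)
qed

lemma sq_int_zero [simp]: "sq_int M (\<lambda>x. 0)"
  by (simp add: sq_int_def)

lemma sq_int_add: "sq_int M f \<Longrightarrow> sq_int M g \<Longrightarrow> sq_int M (\<lambda>x. f x + g x)"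
  unfolding sq_int_def
proof (elim conjE, intro conjI)
  assume fg: "integrable M (\<lambda>x. (norm (f x))\<^sup>2)" "integrable M (\<lambda>x. (norm (g x))\<^sup>2)"
    and [measurable]: "f \<in> borel_measurable M" "g \<in> borel_measurable M"
  show "f \<in> borel_measurable M \<Longrightarrow> (\<lambda>x. f x + g x) \<in> borel_measurable M" by measurable
  show "integrable M (\<lambda>x. (norm (f x + g x))\<^sup>2)"
  proof (rule Bochner_Integration.integrable_bound)
    show "integrable M (\<lambda>x. 2 * (norm (f x))\<^sup>2 + 2 * (norm (g x))\<^sup>2)" using fg by simp
    show "AE x in M. norm ((norm (f x + g x))\<^sup>2) \<le> norm (2 * (norm (f x))\<^sup>2 + 2 * (norm (g x))\<^sup>2)"
      using norm_add_sq_le by (intro AE_I2) simp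
  qed measurable
qed

lemma sq_int_scaleR: "sq_int M f \<Longrightarrow> sq_int M (\<lambda>x. c *\<^sub>R f x)"
  by (rule sq_int_bound(1)[where g = f and c = "\<bar>c\<bar>"]) (auto simp: sq_int_def)

lemma sq_int_diff: "sq_int M f \<Longrightarrow> sq_int M g \<Longrightarrow> sq_int M (\<lambda>x. f x - g x)"
  using sq_int_add[of M f "\<lambda>x. (-1) *\<^sub>R g x"] sq_int_scaleR[of M g "-1"] by simp

lemma sq_int_inner:
  assumes "sq_int M f" "sq_int M g"
  shows "integrable M (\<lambda>x. f x \<bullet> g x)"
proof (rule Bochner_Integration.integrable_bound)
  show "integrable M (\<lambda>x. (norm (f x))\<^sup>2 + (norm (g x))\<^sup>2)"
    using assms by (simp add: sq_int_def)
  show "AE x in M. norm (f x \<bullet> g x) \<le> norm ((norm (f x))\<^sup>2 + (norm (g x))\<^sup>2)"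
  proof (intro AE_I2)
    fix x
    have "\<bar>f x \<bullet> g x\<bar> \<le> norm (f x) * norm (g x)" by (rule Cauchy_Schwarz_ineq2)
    also have "\<dots> \<le> (norm (f x))\<^sup>2 + (norm (g x))\<^sup>2"
      using sum_squares_bound[of "norm (f x)" "norm (g x)"]
        mult_nonneg_nonneg[OF norm_ge_zero[of "f x"] norm_ge_zero[of "g x"]] by linarith
    finally show "norm (f x \<bullet> g x) \<le> norm ((norm (f x))\<^sup>2 + (norm (g x))\<^sup>2)" by simp
  qed
qed (use assms in \<open>auto simp: sq_int_def\<close>)

lemma sq_int_mult: "sq_int M f \<Longrightarrow> sq_int M g \<Longrightarrow> integrable M (\<lambda>x. f x * g x :: real)"
  using sq_int_inner[of M f g] by simp

lemma nsq_add_scaled: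
  assumes "sq_int M f" "sq_int M g"
  shows "nsq M (\<lambda>x. f x + t *\<^sub>R g x) = nsq M f + 2 * t * (LINT x|M. f x \<bullet> g x) + t\<^sup>2 * nsq M g"
proof -
  have "nsq M (\<lambda>x. f x + t *\<^sub>R g x) =
      (LINT x|M. (norm (f x))\<^sup>2 + 2 * t * (f x \<bullet> g x) + t\<^sup>2 * (norm (g x))\<^sup>2)"
    unfolding nsq_def
    by (intro Bochner_Integration.integral_cong refl)
      (simp only: power2_norm_eq_inner, simp add: inner_simps inner_commute power2_eq_square algebra_simps)
  also have "\<dots> = nsq M f + 2 * t * (LINT x|M. f x \<bullet> g x) + t\<^sup>2 * nsq M g"
    using assms sq_int_inner[OF assms] by (simp add: nsq_def sq_int_def)
  finally show ?thesis .
qed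

lemma L2_Cauchy_Schwarz:
  assumes "sq_int M f" "sq_int M g"
  shows "(LINT x|M. f x \<bullet> g x)\<^sup>2 \<le> nsq M f * nsq M g"
  by (rule discriminant_bound) (metis nsq_add_scaled[OF assms] nsq_nonneg)

lemma L2_Cauchy_Schwarz_sqrt:
  assumes "sq_int M f" "sq_int M g"
  shows "\<bar>LINT x|M. f x \<bullet> g x\<bar> \<le> sqrt (nsq M f) * sqrt (nsq M g)"
  using L2_Cauchy_Schwarz[OF assms] by (metis real_sqrt_abs real_sqrt_le_iff real_sqrt_mult)

lemma nsq_add_le:
  assumes "sq_int M f" "sq_int M g"
  shows "nsq M (\<lambda>x. f x + g x) \<le> 2 * nsq M f + 2 * nsq M g"
proof -
  have "nsq M (\<lambda>x. f x + g x) \<le> (LINT x|M. 2 * (norm (f x))\<^sup>2 + 2 * (norm (g x))\<^sup>2)"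
    unfolding nsq_def using assms sq_int_add[OF assms] norm_add_sq_le
    by (intro integral_mono) (auto simp: sq_int_def)
  also have "\<dots> = 2 * nsq M f + 2 * nsq M g" using assms by (simp add: nsq_def sq_int_def)
  finally show ?thesis .
qed

lemma nsq_minus_commute: "nsq M (\<lambda>x. f x - g x) = nsq M (\<lambda>x. g x - f x)"
  by (simp add: nsq_def norm_minus_commute)

lemma nsq_triangle:
  assumes "sq_int M f" "sq_int M g" "sq_int M h"
  shows "nsq M (\<lambda>x. f x - h x) \<le> 2 * nsq M (\<lambda>x. f x - g x) + 2 * nsq M (\<lambda>x. g x - h x)"
  using nsq_add_le[OF sq_int_diff[OF assms(1,2)] sq_int_diff[OF assms(2,3)]] by simp

lemma nsq_cong_AE:
  assumes "f \<in> borel_measurable M" "g \<in> borel_measurable M" "AE x in M. f x = g x"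
  shows "nsq M f = nsq M g"
  unfolding nsq_def by (rule integral_cong_AE) (use assms in auto)

lemma sq_int_cong_AE:
  assumes "sq_int M f" "g \<in> borel_measurable M" "AE x in M. f x = g x"
  shows "sq_int M g"
  by (rule sq_int_bound(1)[where g = f and c = 1]) (use assms in auto)

lemma nsq_eq_0_iff: "sq_int M f \<Longrightarrow> nsq M f = 0 \<longleftrightarrow> (AE x in M. f x = 0)"
  unfolding nsq_def by (subst integral_nonneg_eq_0_iff_AE) (auto simp: sq_int_def)

lemma nn_integral_norm_sq: "sq_int M f \<Longrightarrow> (\<integral>\<^sup>+ x. ennreal ((norm (f x))\<^sup>2) \<partial>M) = ennreal (nsq M f)"
  unfolding nsq_def by (intro nn_integral_eq_integral) (auto simp: sq_int_def)

lemma sq_int_nn: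
  assumes f: "f \<in> borel_measurable M" and c: "0 \<le> c"
    and le: "(\<integral>\<^sup>+ x. ennreal ((norm (f x))\<^sup>2) \<partial>M) \<le> ennreal c"
  shows "sq_int M f" "nsq M f \<le> c"
proof -
  have "integrable M (\<lambda>x. (norm (f x))\<^sup>2)"
    using le_less_trans[OF le] f by (intro integrableI_bounded) auto
  then show "sq_int M f" using f by (simp add: sq_int_def)
  from nn_integral_norm_sq[OF this] le c show "nsq M f \<le> c" by simp
qed

lemma L2_tendsto_AE_subseq:
  assumes F: "\<And>n. sq_int M (F n)" "sq_int M f" and lim: "(\<lambda>n. nsq M (\<lambda>x. F n x - f x)) \<longlonglongrightarrow> 0"
  shows "\<exists>r. strict_mono r \<and> (AE x in M. (\<lambda>n. F (r n) x) \<longlonglongrightarrow> f x)"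
proof -
  have "\<exists>r::nat\<Rightarrow>nat. strict_mono r \<and> (AE x in M. (\<lambda>n. (norm (F (r n) x - f x))\<^sup>2) \<longlonglongrightarrow> 0)"
    by (rule tendsto_L1_AE_subseq)
      (use F lim sq_int_diff in \<open>auto simp: sq_int_def nsq_def\<close>)
  then obtain r :: "nat \<Rightarrow> nat" where r: "strict_mono r" "AE x in M. (\<lambda>n. (norm (F (r n) x - f x))\<^sup>2) \<longlonglongrightarrow> 0"
    by blast
  from r(2) have "AE x in M. (\<lambda>n. F (r n) x) \<longlonglongrightarrow> f x"
  proof eventually_elim
    case (elim x)
    from tendsto_real_sqrt[OF this] have "(\<lambda>n. norm (F (r n) x - f x)) \<longlonglongrightarrow> 0" by simp
    then show ?case by (simp add: tendsto_norm_zero_iff LIM_zero_iff)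
  qed
  with r show ?thesis by blast
qed

lemma L2_dominated_convergence:
  assumes F: "\<And>n. F n \<in> borel_measurable M" and f: "f \<in> borel_measurable M"
    and g: "sq_int M (g :: _ \<Rightarrow> real)" and le: "\<And>n. AE x in M. norm (F n x) \<le> g x"
    and lim: "AE x in M. (\<lambda>n. F n x) \<longlonglongrightarrow> f x"
  shows "sq_int M f" "(\<lambda>n. nsq M (\<lambda>x. F n x - f x)) \<longlonglongrightarrow> 0"
proof -
  have le': "AE x in M. \<forall>n. norm (F n x) \<le> g x" using le by (simp add: AE_all_countable)
  have fg: "AE x in M. norm (f x) \<le> g x"
    using le' lim by eventually_elim (metis tendsto_norm LIMSEQ_le_const2)
  then show "sq_int M f"
    by (intro sq_int_bound(1)[OF f g, of 1]) auto
  have "(\<lambda>n. LINT x|M. (norm (F n x - f x))\<^sup>2) \<longlonglongrightarrow> (LINT x|M. 0)"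
  proof (rule integral_dominated_convergence[where w = "\<lambda>x. 4 * (norm (g x))\<^sup>2"])
    show "integrable M (\<lambda>x. 4 * (norm (g x))\<^sup>2)" using g by (simp add: sq_int_def)
    show "AE x in M. (\<lambda>n. (norm (F n x - f x))\<^sup>2) \<longlonglongrightarrow> 0"
      using lim by eventually_elim (auto intro!: tendsto_eq_intros simp: LIM_zero_iff)
    show "AE x in M. norm ((norm (F n x - f x))\<^sup>2) \<le> 4 * (norm (g x))\<^sup>2" for n
      using le' fg
    proof eventually_elim
      case (elim x)
      then have "norm (F n x - f x) \<le> 2 * g x" by (smt (verit) norm_triangle_ineq4)
      then have "(norm (F n x - f x))\<^sup>2 \<le> (2 * g x)\<^sup>2" by (intro power_mono) auto
      then show ?case by (simp add: power_mult_distrib)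
    qed
  qed (use F f in auto)
  then show "(\<lambda>n. nsq M (\<lambda>x. F n x - f x)) \<longlonglongrightarrow> 0" by (simp add: nsq_def)
qed

lemma L2_tendsto_inner:
  assumes F: "\<And>n. sq_int M (F n)" "sq_int M f" "(\<lambda>n. nsq M (\<lambda>x. F n x - f x)) \<longlonglongrightarrow> 0"
    and G: "\<And>n. sq_int M (G n)" "sq_int M g" "(\<lambda>n. nsq M (\<lambda>x. G n x - g x)) \<longlonglongrightarrow> 0"
  shows "(\<lambda>n. LINT x|M. F n x \<bullet> G n x) \<longlonglongrightarrow> (LINT x|M. f x \<bullet> g x)"
proof -
  let ?f = "\<lambda>n x. F n x - f x" and ?g = "\<lambda>n x. G n x - g x"
  have eq: "(LINT x|M. F n x \<bullet> G n x) - (LINT x|M. f x \<bullet> g x) =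
      (LINT x|M. ?f n x \<bullet> ?g n x) + (LINT x|M. ?f n x \<bullet> g x) + (LINT x|M. f x \<bullet> ?g n x)" for n
  proof -
    have "(LINT x|M. F n x \<bullet> G n x) - (LINT x|M. f x \<bullet> g x) = (LINT x|M. F n x \<bullet> G n x - f x \<bullet> g x)"
      using F G by (simp add: sq_int_inner)
    also have "\<dots> = (LINT x|M. ?f n x \<bullet> ?g n x + ?f n x \<bullet> g x + f x \<bullet> ?g n x)"
      by (simp add: inner_simps)
    finally show ?thesis using F G by (simp add: sq_int_inner sq_int_diff)
  qed
  have "(\<lambda>n. (LINT x|M. F n x \<bullet> G n x) - (LINT x|M. f x \<bullet> g x)) \<longlonglongrightarrow> 0"
  proof (rule Lim_null_comparison)
    show "\<forall>\<^sub>F n in sequentially. norm ((LINT x|M. F n x \<bullet> G n x) - (LINT x|M. f x \<bullet> g x))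
      \<le> sqrt (nsq M (?f n)) * sqrt (nsq M (?g n)) + sqrt (nsq M (?f n)) * sqrt (nsq M g) + sqrt (nsq M f) * sqrt (nsq M (?g n))"
    proof (intro always_eventually allI)
      fix n
      show "norm ((LINT x|M. F n x \<bullet> G n x) - (LINT x|M. f x \<bullet> g x))
      \<le> sqrt (nsq M (?f n)) * sqrt (nsq M (?g n)) + sqrt (nsq M (?f n)) * sqrt (nsq M g) + sqrt (nsq M f) * sqrt (nsq M (?g n))"
        unfolding eq real_norm_def
        using L2_Cauchy_Schwarz_sqrt[of M "?f n" "?g n"] L2_Cauchy_Schwarz_sqrt[of M "?f n" g]
          L2_Cauchy_Schwarz_sqrt[of M f "?g n"] F G
        by (simp add: sq_int_diff)
    qed
    show "(\<lambda>n. sqrt (nsq M (?f n)) * sqrt (nsq M (?g n)) + sqrt (nsq M (?f n)) * sqrt (nsq M g) + sqrt (nsq M f) * sqrt (nsq M (?g n))) \<longlonglongrightarrow> 0"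
      using F(3) G(3) by (auto intro!: tendsto_eq_intros)
  qed
  then show ?thesis by (simp add: LIM_zero_iff)
qed

lemma L2_tendsto_nsq:
  assumes F: "\<And>n. sq_int M (F n)" "sq_int M f" "(\<lambda>n. nsq M (\<lambda>x. F n x - f x)) \<longlonglongrightarrow> 0"
  shows "(\<lambda>n. nsq M (F n)) \<longlonglongrightarrow> nsq M f"
  using L2_tendsto_inner[OF F F] by (simp add: nsq_def power2_norm_eq_inner)

text \<open>A subsequence with increments at most 4^(-k) in squared norm is taken. After weighting
  with 2^k the integrals of the squared increments are still summable, so the weighted sum is finite
  almost everywhere; this bounds the increments pointwise by a multiple of 2^(-k/2), which gives
  pointwise convergence. Fatou's lemma turns it into L2 convergence of the full sequence.\<close>

lemma L2_complete:
  fixes F :: "nat \<Rightarrow> 'a \<Rightarrow> 'b::euclidean_space"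
  assumes F: "\<And>n. sq_int M (F n)"
    and Cauchy: "\<And>e. e > 0 \<Longrightarrow> \<exists>N. \<forall>m\<ge>N. \<forall>n\<ge>N. nsq M (\<lambda>x. F m x - F n x) < e"
  shows "\<exists>f. sq_int M f \<and> (\<lambda>n. nsq M (\<lambda>x. F n x - f x)) \<longlonglongrightarrow> 0"
proof -
  have [measurable]: "F n \<in> borel_measurable M" for n using F by (simp add: sq_int_def)
  have "\<exists>N. \<forall>m\<ge>N. \<forall>n\<ge>N. nsq M (\<lambda>x. F m x - F n x) < (1/4)^k" for k :: nat
    using Cauchy[of "(1/4)^k"] by simp
  then obtain N where N: "\<And>k m n. m \<ge> N k \<Longrightarrow> n \<ge> N k \<Longrightarrow> nsq M (\<lambda>x. F m x - F n x) < (1/4)^k"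
    by metis
  \<comment> \<open>The partial sum makes both \<open>r k\<close> and \<open>r (Suc k)\<close> at
    least \<open>N k\<close>; the summand \<open>k\<close> drives the indices to infinity.\<close>
  define r where "r k = (\<Sum>i\<le>k. N i) + k" for k
  have rN: "N k \<le> r k" "N k \<le> r (Suc k)" for k
  proof -
    have "N k \<le> (\<Sum>i\<le>k. N i)" by (rule member_le_sum) auto
    then show "N k \<le> r k" "N k \<le> r (Suc k)" by (auto simp: r_def)
  qed
  have rk: "k \<le> r k" for k by (simp add: r_def)
  define D where "D k x = F (r (Suc k)) x - F (r k) x" for k x
  have [measurable]: "D k \<in> borel_measurable M" for k unfolding D_def by measurable
  have D: "sq_int M (D k)" "nsq M (D k) \<le> (1/4)^k" for k
    using F N[OF rN(2) rN(1), of k] by (auto simp: D_def[abs_def] sq_int_diff less_imp_le)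
  have "(\<integral>\<^sup>+ x. (\<Sum>k. ennreal (2^k * (norm (D k x))\<^sup>2)) \<partial>M) = (\<Sum>k. \<integral>\<^sup>+ x. ennreal (2^k * (norm (D k x))\<^sup>2) \<partial>M)"
    by (intro nn_integral_suminf) measurable
  also have "\<dots> \<le> (\<Sum>k. ennreal ((1/2)^k))"
  proof (rule suminf_le)
    fix k :: nat
    have "(\<integral>\<^sup>+ x. ennreal (2^k * (norm (D k x))\<^sup>2) \<partial>M) = (\<integral>\<^sup>+ x. ennreal (2^k) * ennreal ((norm (D k x))\<^sup>2) \<partial>M)"
      by (simp add: ennreal_mult)
    also have "\<dots> = ennreal (2^k) * ennreal (nsq M (D k))"
      by (subst nn_integral_cmult) (auto simp: nn_integral_norm_sq[OF D(1)])
    also have "\<dots> = ennreal (2^k * nsq M (D k))" by (simp add: ennreal_mult)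
    also have "\<dots> \<le> ennreal (2^k * (1/4)^k)" using D(2) by (intro ennreal_leI mult_left_mono) auto
    also have "2^k * (1/4)^k = (1/2::real)^k" by (simp flip: power_mult_distrib)
    finally show "(\<integral>\<^sup>+ x. ennreal (2^k * (norm (D k x))\<^sup>2) \<partial>M) \<le> ennreal ((1/2)^k)" .
  qed auto
  also have "\<dots> = ennreal (\<Sum>k. (1/2)^k)"
    by (rule suminf_ennreal_eq) (auto intro!: summable_sums summable_geometric)
  also have "\<dots> < \<infinity>" by simp
  finally have "(\<integral>\<^sup>+ x. (\<Sum>k. ennreal (2^k * (norm (D k x))\<^sup>2)) \<partial>M) \<noteq> \<infinity>" by simp
  then have "AE x in M. (\<Sum>k. ennreal (2^k * (norm (D k x))\<^sup>2)) \<noteq> \<infinity>"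
    by (intro nn_integral_noteq_infinite) measurable
  then have conv: "AE x in M. (\<lambda>k. F (r k) x) \<longlonglongrightarrow> lim (\<lambda>k. F (r k) x)"
  proof eventually_elim
    case (elim x)
    define c where "c = enn2real (\<Sum>k. ennreal (2^k * (norm (D k x))\<^sup>2))"
    have "(\<Sum>k. ennreal (2^k * (norm (D k x))\<^sup>2)) < top"
      using elim by (simp only: less_top infinity_ennreal_def)
    from ennreal_enn2real[OF this]
    have c: "c \<ge> 0" "(\<Sum>k. ennreal (2^k * (norm (D k x))\<^sup>2)) = ennreal c"
      by (simp_all only: c_def enn2real_nonneg)
    have bound: "norm (D k x) \<le> sqrt c * (sqrt (1/2))^k" for k
    proof -
      have "ennreal (2^k * (norm (D k x))\<^sup>2) \<le> ennreal c"
      proof -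
        define h where "h k = ennreal (2^k * (norm (D k x))\<^sup>2)" for k
        have "sum h {k} \<le> suminf h" by (rule sum_le_suminf) auto
        then have "h k \<le> suminf h" by simp
        then show ?thesis unfolding c(2)[symmetric] by (simp only: h_def[abs_def])
      qed
      then have "2^k * (norm (D k x))\<^sup>2 \<le> c" using c by simp
      then have "(norm (D k x))\<^sup>2 \<le> c * (1/2)^k" by (simp add: field_simps power_divide)
      also have "\<dots> = (sqrt c * (sqrt (1/2))^k)\<^sup>2"
      proof -
        have "(sqrt (1/2) ^ k)\<^sup>2 = ((sqrt (1/2))\<^sup>2) ^ k" by (simp only: power_mult[symmetric] mult.commute)
        also have "\<dots> = (1/2) ^ k" by simp
        finally show ?thesis using c(1) by (simp only: power_mult_distrib real_sqrt_pow2)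
      qed
      finally show ?thesis by (rule power2_le_imp_le) (simp add: c(1))
    qed
    have "summable (\<lambda>k. D k x)"
    proof (rule summable_comparison_test)
      show "\<exists>N. \<forall>n\<ge>N. norm (D n x) \<le> sqrt c * (sqrt (1/2))^n" using bound by blast
      have "sqrt (1/2) < (1::real)" by (simp add: real_sqrt_divide)
      then show "summable (\<lambda>k. sqrt c * (sqrt (1/2))^k)"
        by (intro summable_mult summable_geometric) simp
    qed
    then have "convergent (\<lambda>n. \<Sum>k<n. D k x)" by (simp add: summable_iff_convergent)
    moreover have "(\<Sum>k<n. D k x) = F (r n) x - F (r 0) x" for n
      unfolding D_def by (rule sum_lessThan_telescope)
    ultimately have "convergent (\<lambda>n. F (r n) x - F (r 0) x)" by simp
    then have "convergent (\<lambda>n. F (r n) x)"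
      using convergent_add[OF _ convergent_const[of "F (r 0) x"]] by fastforce
    then show ?case by (simp add: convergent_LIMSEQ_iff)
  qed
  \<comment> \<open>The default value of \<open>lim\<close> is taken at most on the null set where
    the subsequence diverges.\<close>
  define f where "f x = lim (\<lambda>k. F (r k) x)" for x
  have [measurable]: "f \<in> borel_measurable M" unfolding f_def by measurable
  have est: "sq_int M (\<lambda>x. F n x - f x) \<and> nsq M (\<lambda>x. F n x - f x) \<le> e"
    if e: "e > 0" and n: "\<forall>m\<ge>n0. \<forall>n\<ge>n0. nsq M (\<lambda>x. F m x - F n x) < e" "n \<ge> n0" for e n n0
  proof -
    have "(\<integral>\<^sup>+ x. ennreal ((norm (F n x - f x))\<^sup>2) \<partial>M)
        \<le> (\<integral>\<^sup>+ x. liminf (\<lambda>k. ennreal ((norm (F n x - F (r k) x))\<^sup>2)) \<partial>M)"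
    proof (rule nn_integral_mono_AE)
      show "AE x in M. ennreal ((norm (F n x - f x))\<^sup>2) \<le> liminf (\<lambda>k. ennreal ((norm (F n x - F (r k) x))\<^sup>2))"
        using conv
      proof eventually_elim
        case (elim x)
        then have "(\<lambda>k. ennreal ((norm (F n x - F (r k) x))\<^sup>2)) \<longlonglongrightarrow> ennreal ((norm (F n x - f x))\<^sup>2)"
          unfolding f_def by (intro tendsto_intros tendsto_ennrealI)
        from lim_imp_Liminf[OF trivial_limit_sequentially this] show ?case by (simp only: order_refl)
      qed
    qed
    also have "\<dots> \<le> liminf (\<lambda>k. \<integral>\<^sup>+ x. ennreal ((norm (F n x - F (r k) x))\<^sup>2) \<partial>M)"
      by (rule nn_integral_liminf) measurable
    also have "\<dots> \<le> liminf (\<lambda>k::nat. ennreal e)"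
    proof (rule Liminf_mono)
      show "\<forall>\<^sub>F k in sequentially. (\<integral>\<^sup>+ x. ennreal ((norm (F n x - F (r k) x))\<^sup>2) \<partial>M) \<le> ennreal e"
        using eventually_ge_at_top[of n0]
      proof eventually_elim
        case (elim k)
        then have "n0 \<le> r k" using rk[of k] by simp
        then have "nsq M (\<lambda>x. F n x - F (r k) x) \<le> e" using n by (simp add: less_imp_le)
        then show ?case using nn_integral_norm_sq[OF sq_int_diff[OF F F], of n "r k"] by (simp add: ennreal_leI)
      qed
    qed
    also have "\<dots> = ennreal e" by (simp add: Liminf_const)
    finally show ?thesis using sq_int_nn[of "\<lambda>x. F n x - f x" M e] e by simp
  qed
  obtain n0 where "\<forall>m\<ge>n0. \<forall>n\<ge>n0. nsq M (\<lambda>x. F m x - F n x) < 1" using Cauchy[of 1] by auto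
  from est[OF _ this order_refl] have "sq_int M (\<lambda>x. F n0 x - f x)" by simp
  from sq_int_diff[OF F[of n0] this] have f: "sq_int M f" by simp
  have "(\<lambda>n. nsq M (\<lambda>x. F n x - f x)) \<longlonglongrightarrow> 0"
  proof (rule LIMSEQ_I)
    fix e :: real assume e: "e > 0"
    then obtain n0 where "\<forall>m\<ge>n0. \<forall>n\<ge>n0. nsq M (\<lambda>x. F m x - F n x) < e / 2" using Cauchy[of "e/2"] by auto
    from est[OF _ this] e have "nsq M (\<lambda>x. F n x - f x) < e" if "n \<ge> n0" for n using that by fastforce
    then show "\<exists>no. \<forall>n\<ge>no. norm (nsq M (\<lambda>x. F n x - f x) - 0) < e" by auto
  qed
  with f show ?thesis by blast
qed

section \<open>Smooth functions and test functions\<close>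

lemma Ck_differentiable: "Ck (Suc k) f \<Longrightarrow> f differentiable (at x)"
  by (simp add: differentiable_on_def)

lemma Ck_continuous: "Ck k f \<Longrightarrow> continuous_on UNIV f"
  by (cases k) (auto intro: differentiable_imp_continuous_on)

lemma Ck_Suc_imp: "Ck (Suc k) f \<Longrightarrow> Ck k f"
proof (induction k arbitrary: f)
  case 0
  then show ?case by (auto intro: differentiable_imp_continuous_on)
next
  case (Suc k)
  then show ?case by (metis Ck.simps(2))
qed

lemma partial_deriv_eq: "(f has_derivative f') (at x) \<Longrightarrow> partial_deriv b f x = f' b"
  unfolding partial_deriv_def using frechet_derivative_at by metis

lemma differentiable_has_derivative:
  assumes "f differentiable (at x)"
  shows "(f has_derivative (\<lambda>h. \<Sum>b\<in>Basis. (h \<bullet> b) * partial_deriv b f x)) (at x)"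
proof -
  let ?D = "frechet_derivative f (at x)"
  have D: "(f has_derivative ?D) (at x)" using assms frechet_derivative_works by blast
  then have lin: "linear ?D" by (rule has_derivative_linear)
  have "?D h = (\<Sum>b\<in>Basis. (h \<bullet> b) * partial_deriv b f x)" for h
  proof -
    have "?D h = ?D (\<Sum>b\<in>Basis. (h \<bullet> b) *\<^sub>R b)" by (simp add: euclidean_representation)
    also have "\<dots> = (\<Sum>b\<in>Basis. (h \<bullet> b) * ?D b)"
      using lin by (simp add: linear_sum linear_cmul)
    finally show ?thesis by (simp add: partial_deriv_def)
  qed
  then have "?D = (\<lambda>h. \<Sum>b\<in>Basis. (h \<bullet> b) * partial_deriv b f x)" by (rule ext)
  with D show ?thesis by simp
qed

lemma partial_deriv_const [simp]: "partial_deriv b (\<lambda>x. c) = (\<lambda>x. 0)"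
  by (simp add: partial_deriv_def)

lemma Ck_const [simp]: "Ck k (\<lambda>x. c)"
  by (induction k arbitrary: c) (auto simp: differentiable_on_def)

lemma partial_deriv_add:
  assumes "f differentiable (at x)" "g differentiable (at x)"
  shows "partial_deriv b (\<lambda>x. f x + g x) x = partial_deriv b f x + partial_deriv b g x"
  by (subst partial_deriv_eq[OF has_derivative_add[OF assms[unfolded frechet_derivative_works]]])
    (simp add: partial_deriv_def)

lemma Ck_add: "Ck k f \<Longrightarrow> Ck k g \<Longrightarrow> Ck k (\<lambda>x. f x + g x)"
proof (induction k arbitrary: f g)
  case (Suc k)
  have d: "f differentiable (at x)" "g differentiable (at x)" for x
    using Suc.prems Ck_differentiable by blast+
  have "partial_deriv b (\<lambda>x. f x + g x) = (\<lambda>x. partial_deriv b f x + partial_deriv b g x)" for b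
    using partial_deriv_add[OF d] by (simp add: fun_eq_iff)
  then show ?case using Suc d by (auto simp: differentiable_on_def)
qed (auto intro: continuous_intros)

lemma partial_deriv_mult:
  assumes "f differentiable (at x)" "g differentiable (at x)"
  shows "partial_deriv b (\<lambda>x. f x * g x) x = f x * partial_deriv b g x + partial_deriv b f x * g x"
  by (subst partial_deriv_eq[OF has_derivative_mult[OF assms[unfolded frechet_derivative_works]]])
    (simp add: partial_deriv_def)

lemma Ck_mult: "Ck k f \<Longrightarrow> Ck k g \<Longrightarrow> Ck k (\<lambda>x. f x * g x)"
proof (induction k arbitrary: f g)
  case (Suc k)
  have d: "f differentiable (at x)" "g differentiable (at x)" for x
    using Suc.prems Ck_differentiable by blast+
  have "partial_deriv b (\<lambda>x. f x * g x) = (\<lambda>x. f x * partial_deriv b g x + partial_deriv b f x * g x)" for b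
    using partial_deriv_mult[OF d] by (simp add: fun_eq_iff)
  moreover have "Ck k (\<lambda>x. f x * partial_deriv b g x + partial_deriv b f x * g x)" if "b \<in> Basis" for b
  proof -
    have "Ck k f" "Ck k g" by (rule Ck_Suc_imp[OF Suc.prems(1)], rule Ck_Suc_imp[OF Suc.prems(2)])
    moreover have "Ck k (partial_deriv b f)" "Ck k (partial_deriv b g)" using Suc.prems that by auto
    ultimately show ?thesis by (intro Ck_add Suc.IH)
  qed
  ultimately show ?case using d by (auto simp: differentiable_on_def)
qed (auto intro: continuous_intros)

lemma Ck_cmult: "Ck k f \<Longrightarrow> Ck k (\<lambda>x. c * f x)"
  by (rule Ck_mult) auto

lemma Ck_diff: "Ck k f \<Longrightarrow> Ck k g \<Longrightarrow> Ck k (\<lambda>x. f x - g x)"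
  using Ck_add[of k f "\<lambda>x. -1 * g x"] Ck_cmult[of k g "-1"] by simp

lemma Ck_sum: "(\<And>i. i \<in> I \<Longrightarrow> Ck k (f i)) \<Longrightarrow> Ck k (\<lambda>x. \<Sum>i\<in>I. f i x)"
  by (induction I rule: infinite_finite_induct) (auto intro: Ck_add)

lemma Ck_inner: "Ck k (\<lambda>x. x \<bullet> v)"
proof (cases k)
  case (Suc k)
  have "partial_deriv b (\<lambda>x. x \<bullet> v) = (\<lambda>x. b \<bullet> v)" for b
    by (auto simp: fun_eq_iff intro!: partial_deriv_eq derivative_eq_intros)
  then show ?thesis using Suc by (auto simp: differentiable_on_def)
qed (auto intro: continuous_intros)

lemma Ck_compose:
  fixes g :: "'a::euclidean_space \<Rightarrow> real" and f :: "real \<Rightarrow> real"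
  shows "Ck k f \<Longrightarrow> Ck k g \<Longrightarrow> Ck k (\<lambda>x. f (g x))"
proof (induction k arbitrary: f g)
  case 0
  then show ?case by (auto intro: continuous_on_compose2[of UNIV f])
next
  case (Suc k)
  have d: "f differentiable (at y)" "g differentiable (at x)" for x y
    using Suc.prems Ck_differentiable by blast+
  have D: "((\<lambda>x. f (g x)) has_derivative (\<lambda>h. (\<Sum>b\<in>Basis. (h \<bullet> b) * partial_deriv b g x) * partial_deriv 1 f (g x))) (at x)" for x
    using has_derivative_compose[OF differentiable_has_derivative[OF d(2), of x] differentiable_has_derivative[OF d(1), of "g x"]]
    by simp
  have "partial_deriv b (\<lambda>x. f (g x)) = (\<lambda>x. partial_deriv b g x * partial_deriv 1 f (g x))" if b: "b \<in> Basis" for b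
  proof
    fix x
    have "(\<Sum>c\<in>Basis. (b \<bullet> c) * partial_deriv c g x) = partial_deriv b g x"
      using b by (simp add: inner_Basis if_distrib if_distribR sum.delta cong: if_cong)
    then show "partial_deriv b (\<lambda>x. f (g x)) x = partial_deriv b g x * partial_deriv 1 f (g x)"
      using partial_deriv_eq[OF D, of b] by simp
  qed
  moreover have "Ck k (\<lambda>x. partial_deriv b g x * partial_deriv 1 f (g x))" if "b \<in> Basis" for b
  proof (rule Ck_mult)
    show "Ck k (partial_deriv b g)" using Suc.prems that by simp
    show "Ck k (\<lambda>x. partial_deriv 1 f (g x))"
    proof (rule Suc.IH[of "partial_deriv 1 f" g])
      show "Ck k (partial_deriv 1 f)" using Suc.prems(1) by simp
    qed (rule Ck_Suc_imp[OF Suc.prems(2)])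
  qed
  ultimately show ?case using D by (auto simp: differentiable_on_def differentiable_def)
qed

section \<open>A family of functions that are flat at zero\<close>

definition flat_exp :: "nat \<Rightarrow> real \<Rightarrow> real" where
  "flat_exp n t = (if t > 0 then (1 / t) ^ n * exp (- (1 / t)) else 0)"

lemma flat_exp_tendsto_0: "((\<lambda>t. flat_exp n t / t) \<longlongrightarrow> 0) (at 0)"
proof -
  have "((\<lambda>t::real. (1 / t) ^ Suc n * exp (- (1 / t))) \<longlongrightarrow> 0) (at_right 0)"
    by real_asymp
  then have "((\<lambda>t. flat_exp n t / t) \<longlongrightarrow> 0) (at_right 0)"
    by (rule Lim_transform_eventually)
      (auto simp: flat_exp_def eventually_at_filter divide_simps intro!: always_eventually)
  moreover have "((\<lambda>t. flat_exp n t / t) \<longlongrightarrow> 0) (at_left 0)"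
    by (rule Lim_transform_eventually[OF tendsto_const])
      (auto simp: flat_exp_def eventually_at_filter intro!: always_eventually)
  ultimately show ?thesis by (simp add: filterlim_split_at)
qed

text \<open>The powers of 1/t close the family under differentiation: each derivative is a
  combination of two other members. Smoothness of all members then follows by one induction on the
  order.\<close>

lemma flat_exp_deriv:
  "(flat_exp n has_real_derivative (flat_exp (n + 2) t - real n * flat_exp (n + 1) t)) (at t)"
proof -
  consider "t > 0" | "t < 0" | "t = 0" by linarith
  then show ?thesis
  proof cases
    case 1
    have d1: "((\<lambda>t. 1 / t) has_real_derivative - (1 / t\<^sup>2)) (at t)"
      using 1 by (auto intro!: derivative_eq_intros simp: power2_eq_square)
    have d2: "((\<lambda>t. exp (- (1 / t))) has_real_derivative exp (- (1 / t)) * (1 / t\<^sup>2)) (at t)"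
      using DERIV_chain2[OF DERIV_exp DERIV_minus[OF d1]] by simp
    have e: "real n * (- (1 / t\<^sup>2) * (1 / t) ^ (n - Suc 0)) * exp (- (1 / t)) + exp (- (1 / t)) * (1 / t\<^sup>2) * (1 / t) ^ n
       = flat_exp (n + 2) t - real n * flat_exp (n + 1) t"
      using 1 by (cases n) (simp_all add: flat_exp_def power2_eq_square algebra_simps)
    have "((\<lambda>t. (1 / t) ^ n * exp (- (1 / t))) has_real_derivative
       (flat_exp (n + 2) t - real n * flat_exp (n + 1) t)) (at t)"
      using DERIV_mult[OF DERIV_power[OF d1, of n] d2] unfolding e .
    then show ?thesis
      by (rule DERIV_cong_ev[THEN iffD1, rotated -1, OF _ refl _ refl])
        (use 1 in \<open>auto simp: flat_exp_def eventually_nhds intro!: exI[of _ "{0<..}"]\<close>)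
  next
    case 2
    have "((\<lambda>t. 0) has_real_derivative 0) (at t)" by simp
    then have "(flat_exp n has_real_derivative 0) (at t)"
      by (rule DERIV_cong_ev[THEN iffD1, rotated -1, OF _ refl _ refl])
        (use 2 in \<open>auto simp: flat_exp_def eventually_nhds intro!: exI[of _ "{..<0}"]\<close>)
    then show ?thesis using 2 by (simp add: flat_exp_def)
  next
    case 3
    then show ?thesis using flat_exp_tendsto_0[of n]
      by (simp add: has_field_derivative_iff flat_exp_def[of _ 0])
  qed
qed

lemma Ck_flat_exp: "Ck k (flat_exp n)"
proof (induction k arbitrary: n)
  case 0
  show ?case using DERIV_isCont[OF flat_exp_deriv]
    by (simp add: continuous_at_imp_continuous_on)
next
  case (Suc k)
  have "partial_deriv 1 (flat_exp n) = (\<lambda>t. flat_exp (n + 2) t - real n * flat_exp (n + 1) t)"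
    by (rule ext, subst partial_deriv_eq[OF flat_exp_deriv[unfolded has_field_derivative_def]]) simp
  moreover have "flat_exp n differentiable_on UNIV"
    unfolding differentiable_on_def
    by (intro ballI, rule differentiableI, rule has_field_derivative_imp_has_derivative, simp, rule flat_exp_deriv)
  ultimately show ?case using Ck_diff[OF Suc[of "n + 2"] Ck_cmult[OF Suc[of "n + 1"]]] by simp
qed

section \<open>Closure properties of test functions\<close>

lemma test_functionsI:
  assumes "\<And>k. Ck k f" "compact K" "K \<subseteq> \<Omega>" "\<And>x. x \<notin> K \<Longrightarrow> f x = 0"
  shows "f \<in> test_functions \<Omega>"
proof -
  have "closure {x. f x \<noteq> 0} \<subseteq> K"
    using assms by (intro closure_minimal) (auto intro: compact_imp_closed)
  moreover from this have "compact (closure {x. f x \<noteq> 0})"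
    using compact_Int_closed[OF assms(2) closed_closure[of "{x. f x \<noteq> 0}"]] by (simp add: Int_absorb1)
  ultimately show ?thesis using assms unfolding test_functions_def by auto
qed

lemma test_functionsD:
  assumes "f \<in> test_functions \<Omega>"
  shows "\<exists>K. (\<forall>k. Ck k f) \<and> compact K \<and> K \<subseteq> \<Omega> \<and> (\<forall>x. x \<notin> K \<longrightarrow> f x = 0)"
  using assms closure_subset[of "{x. f x \<noteq> 0}"] unfolding test_functions_def by blast

lemma test_function_zero: "(\<lambda>x. 0) \<in> test_functions \<Omega>"
  by (rule test_functionsI[where K = "{}"]) auto

lemma test_function_add:
  assumes "f \<in> test_functions \<Omega>" "g \<in> test_functions \<Omega>"
  shows "(\<lambda>x. f x + g x) \<in> test_functions \<Omega>"
proof -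
  obtain K where "\<And>k. Ck k f" "compact K" "K \<subseteq> \<Omega>" "\<And>x. x \<notin> K \<Longrightarrow> f x = 0"
    using test_functionsD[OF assms(1)] by blast
  moreover obtain L where "\<And>k. Ck k g" "compact L" "L \<subseteq> \<Omega>" "\<And>x. x \<notin> L \<Longrightarrow> g x = 0"
    using test_functionsD[OF assms(2)] by blast
  ultimately show ?thesis by (intro test_functionsI[where K = "K \<union> L"] Ck_add) auto
qed

lemma test_function_mult_Ck:
  assumes "f \<in> test_functions \<Omega>" "\<And>k. Ck k g"
  shows "(\<lambda>x. f x * g x) \<in> test_functions \<Omega>"
proof -
  obtain K where "\<And>k. Ck k f" "compact K" "K \<subseteq> \<Omega>" "\<And>x. x \<notin> K \<Longrightarrow> f x = 0"
    using test_functionsD[OF assms(1)] by blast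
  then show ?thesis using assms(2) by (intro test_functionsI[where K = K] Ck_mult) auto
qed

lemma test_function_Ck: "f \<in> test_functions \<Omega> \<Longrightarrow> Ck k f"
  by (simp add: test_functions_def)

lemma test_function_mult:
  "f \<in> test_functions \<Omega> \<Longrightarrow> g \<in> test_functions \<Omega> \<Longrightarrow> (\<lambda>x. f x * g x) \<in> test_functions \<Omega>"
  by (intro test_function_mult_Ck test_function_Ck)

lemma test_function_cmult: "f \<in> test_functions \<Omega> \<Longrightarrow> (\<lambda>x. c * f x) \<in> test_functions \<Omega>"
  using test_function_mult_Ck[of f \<Omega> "\<lambda>x. c"] by (simp add: mult.commute)

lemma test_function_diff:
  "f \<in> test_functions \<Omega> \<Longrightarrow> g \<in> test_functions \<Omega> \<Longrightarrow> (\<lambda>x. f x - g x) \<in> test_functions \<Omega>"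
  using test_function_add[of f \<Omega> "\<lambda>x. -1 * g x"] test_function_cmult[of g \<Omega> "-1"] by simp

lemma test_function_partial_deriv:
  assumes "f \<in> test_functions \<Omega>" "b \<in> Basis"
  shows "partial_deriv b f \<in> test_functions \<Omega>"
proof -
  obtain K where K: "\<And>k. Ck k f" "compact K" "K \<subseteq> \<Omega>" "\<And>x. x \<notin> K \<Longrightarrow> f x = 0"
    using test_functionsD[OF assms(1)] by blast
  show ?thesis
  proof (rule test_functionsI[OF _ K(2,3)])
    show "Ck k (partial_deriv b f)" for k using K(1)[of "Suc k"] assms(2) by simp
    show "partial_deriv b f x = 0" if "x \<notin> K" for x
    proof -
      have "open (- K)" using K(2) by (simp add: compact_imp_closed open_Compl)
      have "((\<lambda>x. 0) has_derivative (\<lambda>h. 0)) (at x)" by simp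
      then have "(f has_derivative (\<lambda>h. 0)) (at x)"
        by (rule has_derivative_transform_within_open[OF _ \<open>open (- K)\<close>]) (use that K in auto)
      then show ?thesis by (rule partial_deriv_eq)
    qed
  qed
qed

section \<open>The classical gradient\<close>

definition tgrad :: "('a::euclidean_space \<Rightarrow> real) \<Rightarrow> 'a \<Rightarrow> 'a" where
  "tgrad f x = (\<Sum>b\<in>Basis. partial_deriv b f x *\<^sub>R b)"

lemma tgrad_inner_Basis: "b \<in> Basis \<Longrightarrow> tgrad f x \<bullet> b = partial_deriv b f x"
  by (simp add: tgrad_def inner_sum_left inner_Basis if_distrib sum.delta cong: if_cong)

lemma has_derivative_tgrad:
  assumes "Ck (Suc k) f"
  shows "(f has_derivative (\<lambda>h. tgrad f x \<bullet> h)) (at x)"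
proof -
  have "tgrad f x \<bullet> h = (\<Sum>b\<in>Basis. (h \<bullet> b) * partial_deriv b f x)" for h
    by (simp add: tgrad_def inner_sum_left inner_commute[of h] mult.commute)
  then show ?thesis
    using differentiable_has_derivative[OF Ck_differentiable[OF assms], of x] by simp
qed

lemma continuous_tgrad: "Ck (Suc k) f \<Longrightarrow> continuous_on UNIV (tgrad f)"
  unfolding tgrad_def[abs_def]
  by (intro continuous_on_sum continuous_on_scaleR continuous_on_const Ck_continuous[of k]) simp

lemma tgrad_unique:
  assumes "(f has_derivative (\<lambda>h. g \<bullet> h)) (at x)"
  shows "tgrad f x = g"
  by (rule euclidean_eqI) (simp add: tgrad_inner_Basis partial_deriv_eq[OF assms])

lemma tgrad_outside:
  assumes "compact K" "\<And>x. x \<notin> K \<Longrightarrow> f x = 0" "x \<notin> K"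
  shows "tgrad f x = 0"
proof -
  have "open (- K)" using assms by (simp add: compact_imp_closed open_Compl)
  have "((\<lambda>x. 0) has_derivative (\<lambda>h. 0)) (at x)" by simp
  then have "(f has_derivative (\<lambda>h. 0)) (at x)"
    by (rule has_derivative_transform_within_open[OF _ \<open>open (- K)\<close>]) (use assms in auto)
  then show ?thesis by (intro tgrad_unique) simp
qed

lemma tgrad_add: "Ck (Suc k) f \<Longrightarrow> Ck (Suc l) g \<Longrightarrow> tgrad (\<lambda>x. f x + g x) x = tgrad f x + tgrad g x"
  by (intro tgrad_unique)
    (auto intro!: derivative_eq_intros has_derivative_tgrad simp: inner_simps)

lemma tgrad_diff: "Ck (Suc k) f \<Longrightarrow> Ck (Suc l) g \<Longrightarrow> tgrad (\<lambda>x. f x - g x) x = tgrad f x - tgrad g x"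
  by (intro tgrad_unique)
    (auto intro!: derivative_eq_intros has_derivative_tgrad simp: inner_simps)

lemma tgrad_cmult: "Ck (Suc k) f \<Longrightarrow> tgrad (\<lambda>x. c * f x) x = c *\<^sub>R tgrad f x"
  by (intro tgrad_unique)
    (auto intro!: derivative_eq_intros has_derivative_tgrad simp: inner_simps)

lemma tgrad_mult:
  "Ck (Suc k) f \<Longrightarrow> Ck (Suc l) g \<Longrightarrow> tgrad (\<lambda>x. f x * g x) x = f x *\<^sub>R tgrad g x + g x *\<^sub>R tgrad f x"
  by (intro tgrad_unique)
    (auto intro!: derivative_eq_intros has_derivative_tgrad simp: inner_simps algebra_simps)

section \<open>The inequality of Ladyzhenskaya\<close>

lemma measurable_curried3:
  assumes "(\<lambda>(x, y, z). F x y z) \<in> borel_measurable (borel \<Otimes>\<^sub>M borel \<Otimes>\<^sub>M borel)"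
    and "a \<in> borel_measurable N" "b \<in> borel_measurable N" "c \<in> borel_measurable N"
  shows "(\<lambda>w. F (a w) (b w) (c w)) \<in> borel_measurable N"
  using measurable_compose[OF measurable_Pair[OF assms(2) measurable_Pair[OF assms(3,4)]] assms(1)] by simp

text \<open>On a slice of fixed \<open>z\<close> the power F^4 splits into F^2 F^2. Bounding one
  factor by an integral over the first axis and the other by one over the second axis leaves a
  function of \<open>y\<close> times a function of \<open>x\<close>, so the slice integral is at
  most a product \<open>g1 z * g2 z\<close>. Cauchy-Schwarz separates the slice mass
  \<open>A\<close> of F^2 from each of them, and the third axis bounds this mass uniformly in
  \<open>z\<close>. All values are extended nonnegative reals, and the result is stated in squared
  form to avoid roots.\<close>

lemma Ladyzhenskaya_iterated:
  fixes F D1 D2 D3 :: "real \<Rightarrow> real \<Rightarrow> real \<Rightarrow> ennreal"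
  assumes sf: "sigma_finite_measure M1" "sigma_finite_measure M2" "sigma_finite_measure M3"
    and sets [measurable_cong]: "sets M1 = sets borel" "sets M2 = sets borel" "sets M3 = sets borel"
    and meas: "(\<lambda>(x, y, z). F x y z) \<in> borel_measurable (borel \<Otimes>\<^sub>M borel \<Otimes>\<^sub>M borel)"
      "(\<lambda>(x, y, z). D1 x y z) \<in> borel_measurable (borel \<Otimes>\<^sub>M borel \<Otimes>\<^sub>M borel)"
      "(\<lambda>(x, y, z). D2 x y z) \<in> borel_measurable (borel \<Otimes>\<^sub>M borel \<Otimes>\<^sub>M borel)"
      "(\<lambda>(x, y, z). D3 x y z) \<in> borel_measurable (borel \<Otimes>\<^sub>M borel \<Otimes>\<^sub>M borel)"
    and b1: "\<And>x y z. (F x y z)\<^sup>2 \<le> (\<integral>\<^sup>+ s. F s y z * D1 s y z \<partial>M1)"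
    and b2: "\<And>x y z. (F x y z)\<^sup>2 \<le> (\<integral>\<^sup>+ s. F x s z * D2 x s z \<partial>M2)"
    and b3: "\<And>x y z. (F x y z)\<^sup>2 \<le> (\<integral>\<^sup>+ s. F x y s * D3 x y s \<partial>M3)"
  defines "I G \<equiv> (\<integral>\<^sup>+ z. \<integral>\<^sup>+ y. \<integral>\<^sup>+ x. (G x y z :: ennreal) \<partial>M1 \<partial>M2 \<partial>M3)"
  shows "(I (\<lambda>x y z. F x y z ^ 4))\<^sup>2 \<le>
    I (\<lambda>x y z. (F x y z)\<^sup>2) * I (\<lambda>x y z. (D1 x y z)\<^sup>2) * I (\<lambda>x y z. (D2 x y z)\<^sup>2) * I (\<lambda>x y z. (D3 x y z)\<^sup>2)"
proof -
  interpret M1: sigma_finite_measure M1 by fact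
  interpret M2: sigma_finite_measure M2 by fact
  interpret M3: sigma_finite_measure M3 by fact
  interpret P21: pair_sigma_finite M2 M1 by unfold_locales
  interpret P31: pair_sigma_finite M3 M1 by unfold_locales
  interpret P32: pair_sigma_finite M3 M2 by unfold_locales
  note [measurable (raw)] = meas[THEN measurable_curried3]
  have CS2: "(\<integral>\<^sup>+ y. \<integral>\<^sup>+ x. f x y * g x y \<partial>M1 \<partial>M2)\<^sup>2 \<le>
      (\<integral>\<^sup>+ y. \<integral>\<^sup>+ x. (f x y)\<^sup>2 \<partial>M1 \<partial>M2) * (\<integral>\<^sup>+ y. \<integral>\<^sup>+ x. (g x y)\<^sup>2 \<partial>M1 \<partial>M2)"
    if [measurable]: "(\<lambda>(y, x). f x y) \<in> borel_measurable (borel \<Otimes>\<^sub>M borel)" "(\<lambda>(y, x). g x y) \<in> borel_measurable (borel \<Otimes>\<^sub>M borel)"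
    for f g :: "real \<Rightarrow> real \<Rightarrow> ennreal"
    using Cauchy_Schwarz_nn_integral[of "\<lambda>p. f (snd p) (fst p)" "M2 \<Otimes>\<^sub>M M1" "\<lambda>p. g (snd p) (fst p)"]
    by (simp add: M1.nn_integral_fst[symmetric] measurable_split_conv)
  define A where "A z = (\<integral>\<^sup>+ y. \<integral>\<^sup>+ x. (F x y z)\<^sup>2 \<partial>M1 \<partial>M2)" for z
  define g1 where "g1 z = (\<integral>\<^sup>+ y. \<integral>\<^sup>+ x. F x y z * D1 x y z \<partial>M1 \<partial>M2)" for z
  define g2 where "g2 z = (\<integral>\<^sup>+ y. \<integral>\<^sup>+ x. F x y z * D2 x y z \<partial>M1 \<partial>M2)" for z
  define e1 where "e1 z = (\<integral>\<^sup>+ y. \<integral>\<^sup>+ x. (D1 x y z)\<^sup>2 \<partial>M1 \<partial>M2)" for z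
  define e2 where "e2 z = (\<integral>\<^sup>+ y. \<integral>\<^sup>+ x. (D2 x y z)\<^sup>2 \<partial>M1 \<partial>M2)" for z
  have [measurable]: "A \<in> borel_measurable borel" "g1 \<in> borel_measurable borel" "g2 \<in> borel_measurable borel"
    "e1 \<in> borel_measurable borel" "e2 \<in> borel_measurable borel"
    unfolding A_def[abs_def] g1_def[abs_def] g2_def[abs_def] e1_def[abs_def] e2_def[abs_def] by measurable
  define a where "a = I (\<lambda>x y z. F x y z * D3 x y z)"
  have slice: "(\<integral>\<^sup>+ y. \<integral>\<^sup>+ x. F x y z ^ 4 \<partial>M1 \<partial>M2) \<le> g1 z * g2 z" for z
  proof -
    have "(\<integral>\<^sup>+ y. \<integral>\<^sup>+ x. F x y z ^ 4 \<partial>M1 \<partial>M2) \<le>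
        (\<integral>\<^sup>+ y. \<integral>\<^sup>+ x. (\<integral>\<^sup>+ s. F s y z * D1 s y z \<partial>M1) * (\<integral>\<^sup>+ s. F x s z * D2 x s z \<partial>M2) \<partial>M1 \<partial>M2)"
    proof (intro nn_integral_mono)
      fix x y
      have "F x y z ^ 4 = (F x y z)\<^sup>2 * (F x y z)\<^sup>2" by (simp flip: power_add)
      also have "\<dots> \<le> (\<integral>\<^sup>+ s. F s y z * D1 s y z \<partial>M1) * (\<integral>\<^sup>+ s. F x s z * D2 x s z \<partial>M2)"
        by (intro mult_mono b1 b2) auto
      finally show "F x y z ^ 4 \<le> \<dots>" .
    qed
    also have "\<dots> = (\<integral>\<^sup>+ y. (\<integral>\<^sup>+ s. F s y z * D1 s y z \<partial>M1) * (\<integral>\<^sup>+ x. (\<integral>\<^sup>+ s. F x s z * D2 x s z \<partial>M2) \<partial>M1) \<partial>M2)"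
      by (intro nn_integral_cong nn_integral_cmult) measurable
    also have "\<dots> = g1 z * (\<integral>\<^sup>+ x. (\<integral>\<^sup>+ s. F x s z * D2 x s z \<partial>M2) \<partial>M1)"
      unfolding g1_def by (intro nn_integral_multc) measurable
    also have "(\<integral>\<^sup>+ x. (\<integral>\<^sup>+ s. F x s z * D2 x s z \<partial>M2) \<partial>M1) = g2 z"
      unfolding g2_def by (rule P21.Fubini') measurable
    finally show ?thesis .
  qed
  \<comment> \<open>The right-hand side of \<open>b3\<close> does not depend on the point of the
    third axis, so integrating it over the other two bounds every slice alike.\<close>
  have A_le: "A z \<le> a" for z
  proof -
    have "A z \<le> (\<integral>\<^sup>+ y. \<integral>\<^sup>+ x. (\<integral>\<^sup>+ s. F x y s * D3 x y s \<partial>M3) \<partial>M1 \<partial>M2)"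
      unfolding A_def by (intro nn_integral_mono b3)
    also have "\<dots> = (\<integral>\<^sup>+ y. \<integral>\<^sup>+ s. \<integral>\<^sup>+ x. F x y s * D3 x y s \<partial>M1 \<partial>M3 \<partial>M2)"
      by (intro nn_integral_cong P31.Fubini') measurable
    also have "\<dots> = a" unfolding a_def I_def by (rule P32.Fubini') measurable
    finally show ?thesis .
  qed
  have unroll: "(\<integral>\<^sup>+ p. G (snd (snd p)) (fst (snd p)) (fst p) \<partial>(M3 \<Otimes>\<^sub>M M2 \<Otimes>\<^sub>M M1)) = I G"
    if G: "(\<lambda>(x, y, z). G x y z) \<in> borel_measurable (borel \<Otimes>\<^sub>M borel \<Otimes>\<^sub>M borel)" for G
  proof -
    note [measurable (raw)] = measurable_curried3[OF G]
    have "(\<integral>\<^sup>+ p. G (snd p) (fst p) z \<partial>(M2 \<Otimes>\<^sub>M M1)) = (\<integral>\<^sup>+ y. \<integral>\<^sup>+ x. G x y z \<partial>M1 \<partial>M2)" for z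
    proof -
      have "(\<lambda>p. G (snd p) (fst p) z) \<in> borel_measurable (M2 \<Otimes>\<^sub>M M1)" by measurable
      from M1.nn_integral_fst[OF this] show ?thesis by simp
    qed
    moreover have "(\<lambda>p. G (snd (snd p)) (fst (snd p)) (fst p)) \<in> borel_measurable (M3 \<Otimes>\<^sub>M M2 \<Otimes>\<^sub>M M1)"
      by measurable
    from P21.P.nn_integral_fst[OF this] show ?thesis unfolding I_def by (simp add: calculation)
  qed
  have a_sq: "a\<^sup>2 \<le> I (\<lambda>x y z. (F x y z)\<^sup>2) * I (\<lambda>x y z. (D3 x y z)\<^sup>2)"
  proof -
    let ?f = "\<lambda>G p. G (snd (snd p)) (fst (snd p)) (fst p)"
    have "(\<integral>\<^sup>+ p. ?f F p * ?f D3 p \<partial>(M3 \<Otimes>\<^sub>M M2 \<Otimes>\<^sub>M M1))\<^sup>2 \<le>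
        (\<integral>\<^sup>+ p. (?f F p)\<^sup>2 \<partial>(M3 \<Otimes>\<^sub>M M2 \<Otimes>\<^sub>M M1)) * (\<integral>\<^sup>+ p. (?f D3 p)\<^sup>2 \<partial>(M3 \<Otimes>\<^sub>M M2 \<Otimes>\<^sub>M M1))"
      by (rule Cauchy_Schwarz_nn_integral) measurable
    then show ?thesis
      using unroll[of "\<lambda>x y z. F x y z * D3 x y z"] unroll[of "\<lambda>x y z. (F x y z)\<^sup>2"] unroll[of "\<lambda>x y z. (D3 x y z)\<^sup>2"]
      unfolding a_def by simp
  qed
  have "I (\<lambda>x y z. F x y z ^ 4) \<le> (\<integral>\<^sup>+ z. g1 z * g2 z \<partial>M3)"
    unfolding I_def by (intro nn_integral_mono slice)
  then have "(I (\<lambda>x y z. F x y z ^ 4))\<^sup>2 \<le> (\<integral>\<^sup>+ z. g1 z * g2 z \<partial>M3)\<^sup>2" by (intro power_mono) auto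
  also have "\<dots> \<le> (\<integral>\<^sup>+ z. (g1 z)\<^sup>2 \<partial>M3) * (\<integral>\<^sup>+ z. (g2 z)\<^sup>2 \<partial>M3)"
    by (rule Cauchy_Schwarz_nn_integral) measurable
  also have "\<dots> \<le> (\<integral>\<^sup>+ z. a * e1 z \<partial>M3) * (\<integral>\<^sup>+ z. a * e2 z \<partial>M3)"
  proof (intro mult_mono nn_integral_mono)
    fix z
    have "(g1 z)\<^sup>2 \<le> A z * e1 z" unfolding g1_def A_def e1_def by (rule CS2) measurable
    also have "\<dots> \<le> a * e1 z" by (intro mult_right_mono A_le) auto
    finally show "(g1 z)\<^sup>2 \<le> a * e1 z" .
    have "(g2 z)\<^sup>2 \<le> A z * e2 z" unfolding g2_def A_def e2_def by (rule CS2) measurable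
    also have "\<dots> \<le> a * e2 z" by (intro mult_right_mono A_le) auto
    finally show "(g2 z)\<^sup>2 \<le> a * e2 z" .
  qed auto
  also have "\<dots> = (a * I (\<lambda>x y z. (D1 x y z)\<^sup>2)) * (a * I (\<lambda>x y z. (D2 x y z)\<^sup>2))"
    by (simp add: nn_integral_cmult I_def e1_def[abs_def, symmetric] e2_def[abs_def, symmetric] flip: e1_def e2_def)
  also have "\<dots> = a\<^sup>2 * (I (\<lambda>x y z. (D1 x y z)\<^sup>2) * I (\<lambda>x y z. (D2 x y z)\<^sup>2))"
    by (simp add: power2_eq_square mult_ac)
  also have "\<dots> \<le> (I (\<lambda>x y z. (F x y z)\<^sup>2) * I (\<lambda>x y z. (D3 x y z)\<^sup>2)) * (I (\<lambda>x y z. (D1 x y z)\<^sup>2) * I (\<lambda>x y z. (D2 x y z)\<^sup>2))"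
    by (intro mult_right_mono a_sq) auto
  finally show ?thesis by (simp add: mult_ac)
qed

text \<open>Dimensions one and two are treated as dimension three, with point masses in the missing directions.\<close>

definition axis_measure :: "real measure \<Rightarrow> 'a::euclidean_space \<Rightarrow> bool" where
  "axis_measure M v \<longleftrightarrow> M = lborel \<and> v \<in> Basis \<or> M = return borel 0 \<and> v = 0"

lemma axis_measure_sets: "axis_measure M v \<Longrightarrow> sets M = sets borel"
  by (auto simp: axis_measure_def)

lemma axis_measure_sigma_finite: "axis_measure M v \<Longrightarrow> sigma_finite_measure M"
proof -
  have "sigma_finite_measure (return borel (0::real))"
    by (intro prob_space_imp_sigma_finite prob_space_return) simp
  then show "axis_measure M v \<Longrightarrow> sigma_finite_measure M"
    by (auto simp: axis_measure_def lborel.sigma_finite_measure_axioms)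
qed

text \<open>Lebesgue measure is determined by its values on boxes, and the preimage of a box is a
  product of intervals. In a direction with a point mass the interval is replaced by
  \<open>UNIV\<close>, which has measure 1. Thus \<open>gen\<close> leaves only a computation on
  boxes for each dimension.\<close>

lemma lborel_three_axes_exist:
  assumes "DIM('a::euclidean_space) \<in> {1, 2, 3}"
  shows "\<exists>(i::'a) j k M1 M2 M3. axis_measure M1 i \<and> axis_measure M2 j \<and> axis_measure M3 k \<and>
    lborel = distr (M3 \<Otimes>\<^sub>M M2 \<Otimes>\<^sub>M M1) borel (\<lambda>(z, y, x). x *\<^sub>R i + y *\<^sub>R j + z *\<^sub>R k)"
proof -
  have gen: ?thesis
    if ax: "axis_measure M1 i" "axis_measure M2 j" "axis_measure M3 k"
      and box: "\<And>l u. (\<And>b. b \<in> Basis \<Longrightarrow> l \<bullet> b \<le> u \<bullet> b) \<Longrightarrow> \<exists>A\<in>sets borel. \<exists>B\<in>sets borel. \<exists>C\<in>sets borel.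
        {(z, y, x). x *\<^sub>R i + y *\<^sub>R j + z *\<^sub>R k \<in> box l u} = C \<times> B \<times> A \<and>
        emeasure M3 C * (emeasure M2 B * emeasure M1 A) = (\<Prod>b\<in>Basis. (u - l) \<bullet> b)"
    for M1 M2 M3 and i j k :: 'a
  proof -
    have [measurable_cong]: "sets M1 = sets borel" "sets M2 = sets borel" "sets M3 = sets borel"
      using ax axis_measure_sets by auto
    interpret M1: sigma_finite_measure M1 using ax axis_measure_sigma_finite by blast
    interpret M2: sigma_finite_measure M2 using ax axis_measure_sigma_finite by blast
    interpret M3: sigma_finite_measure M3 using ax axis_measure_sigma_finite by blast
    interpret P21: pair_sigma_finite M2 M1 by unfold_locales
    let ?h = "\<lambda>(z, y, x). x *\<^sub>R i + y *\<^sub>R j + z *\<^sub>R k"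
    have [measurable]: "?h \<in> borel_measurable (M3 \<Otimes>\<^sub>M M2 \<Otimes>\<^sub>M M1)" by measurable
    have sp: "space M1 = UNIV" "space M2 = UNIV" "space M3 = UNIV"
      using ax[THEN axis_measure_sets, THEN sets_eq_imp_space_eq] by simp_all
    have "lborel = distr (M3 \<Otimes>\<^sub>M M2 \<Otimes>\<^sub>M M1) borel ?h"
    proof (rule lborel_eqI)
      fix l u :: 'a assume "\<And>b. b \<in> Basis \<Longrightarrow> l \<bullet> b \<le> u \<bullet> b"
      from box[OF this] obtain A B C where ABC [measurable]: "A \<in> sets borel" "B \<in> sets borel" "C \<in> sets borel"
        and eq: "{(z, y, x). x *\<^sub>R i + y *\<^sub>R j + z *\<^sub>R k \<in> box l u} = C \<times> B \<times> A"
        "emeasure M3 C * (emeasure M2 B * emeasure M1 A) = (\<Prod>b\<in>Basis. (u - l) \<bullet> b)" by blast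
      have "emeasure (distr (M3 \<Otimes>\<^sub>M M2 \<Otimes>\<^sub>M M1) borel ?h) (box l u)
          = emeasure (M3 \<Otimes>\<^sub>M M2 \<Otimes>\<^sub>M M1) (?h -` box l u \<inter> space (M3 \<Otimes>\<^sub>M M2 \<Otimes>\<^sub>M M1))"
        by (rule emeasure_distr) auto
      also have "?h -` box l u \<inter> space (M3 \<Otimes>\<^sub>M M2 \<Otimes>\<^sub>M M1) = C \<times> B \<times> A"
        using eq(1)[symmetric] by (simp add: space_pair_measure sp vimage_def split_def)
      also have "emeasure (M3 \<Otimes>\<^sub>M M2 \<Otimes>\<^sub>M M1) (C \<times> B \<times> A) = emeasure M3 C * (emeasure M2 B * emeasure M1 A)"
        by (simp add: P21.P.emeasure_pair_measure_Times M1.emeasure_pair_measure_Times)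
      finally show "emeasure (distr (M3 \<Otimes>\<^sub>M M2 \<Otimes>\<^sub>M M1) borel ?h) (box l u) = (\<Prod>b\<in>Basis. (u - l) \<bullet> b)"
        using eq(2) by simp
    qed simp
    with ax show ?thesis by blast
  qed
  consider "card (Basis :: 'a set) = 1" | "card (Basis :: 'a set) = 2" | "card (Basis :: 'a set) = 3"
    using assms by auto
  then show ?thesis
  proof cases
    case 1
    then obtain i :: 'a where B0: "Basis = {i}" by (rule card_1_singletonE)
    note B = B0 refl[of i]
    from B0 have mem: "i \<in> Basis" by blast
    then have ii: "i \<bullet> i = 1" by (rule inner_same_Basis)
    show ?thesis
    proof(rule gen[of lborel i "return borel 0" 0 "return borel 0" 0])
      fix l u :: 'a assume le: "\<And>b. b \<in> Basis \<Longrightarrow> l \<bullet> b \<le> u \<bullet> b"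
      show "\<exists>A\<in>sets borel. \<exists>B\<in>sets borel. \<exists>C\<in>sets borel.
        {(z, y, x). x *\<^sub>R i + y *\<^sub>R 0 + z *\<^sub>R 0 \<in> box l u} = C \<times> B \<times> A \<and>
        emeasure (return borel 0) C * (emeasure (return borel 0) B * emeasure lborel A) = (\<Prod>b\<in>Basis. (u - l) \<bullet> b)"
      proof (rule bexI[of _ "{l \<bullet> i <..< u \<bullet> i}"], rule bexI[of _ "UNIV"], rule bexI[of _ "UNIV"], rule conjI)
        have bx: "x \<in> box l u \<longleftrightarrow> l \<bullet> i < x \<bullet> i \<and> x \<bullet> i < u \<bullet> i" for x
          unfolding mem_box B(1) by simp
        have pr: "(\<Prod>b\<in>Basis. (u - l) \<bullet> b) = ((u - l) \<bullet> i)"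
          unfolding B(1) using B(2-) by (simp add: mult_ac)
        have le': "l \<bullet> i \<le> u \<bullet> i"
          using le[of i] unfolding B(1) by auto
        show "{(z, y, x). x *\<^sub>R i + y *\<^sub>R 0 + z *\<^sub>R 0 \<in> box l u} = UNIV \<times> UNIV \<times> {l \<bullet> i <..< u \<bullet> i}"
          unfolding bx by (auto simp: inner_simps ii)
        show "emeasure (return borel 0) UNIV * (emeasure (return borel 0) UNIV * emeasure lborel {l \<bullet> i <..< u \<bullet> i}) = (\<Prod>b\<in>Basis. (u - l) \<bullet> b)"
          unfolding pr using le' by (simp add: inner_simps ennreal_mult[symmetric] mult_ac)
      qed simp_all
    qed (simp_all add: axis_measure_def mem)
  next
    case 2
    then obtain i j :: 'a where B: "Basis = {i, j}" "i \<noteq> j" by (auto simp: card_2_iff)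
    have mem: "i \<in> Basis" "j \<in> Basis" using B(1) by blast+
    have ii: "i \<bullet> i = 1" "j \<bullet> j = 1" "i \<bullet> j = 0" "j \<bullet> i = 0"
      using mem B(2-) by (simp_all add: inner_Basis)
    show ?thesis
    proof(rule gen[of lborel i lborel j "return borel 0" 0])
      fix l u :: 'a assume le: "\<And>b. b \<in> Basis \<Longrightarrow> l \<bullet> b \<le> u \<bullet> b"
      show "\<exists>A\<in>sets borel. \<exists>B\<in>sets borel. \<exists>C\<in>sets borel.
        {(z, y, x). x *\<^sub>R i + y *\<^sub>R j + z *\<^sub>R 0 \<in> box l u} = C \<times> B \<times> A \<and>
        emeasure (return borel 0) C * (emeasure lborel B * emeasure lborel A) = (\<Prod>b\<in>Basis. (u - l) \<bullet> b)"
      proof (rule bexI[of _ "{l \<bullet> i <..< u \<bullet> i}"], rule bexI[of _ "{l \<bullet> j <..< u \<bullet> j}"], rule bexI[of _ "UNIV"], rule conjI)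
        have bx: "x \<in> box l u \<longleftrightarrow> l \<bullet> i < x \<bullet> i \<and> x \<bullet> i < u \<bullet> i \<and> l \<bullet> j < x \<bullet> j \<and> x \<bullet> j < u \<bullet> j" for x
          unfolding mem_box B(1) by simp
        have pr: "(\<Prod>b\<in>Basis. (u - l) \<bullet> b) = ((u - l) \<bullet> i) * ((u - l) \<bullet> j)"
          unfolding B(1) using B(2-) by (simp add: mult_ac)
        have le': "l \<bullet> i \<le> u \<bullet> i \<and> l \<bullet> j \<le> u \<bullet> j"
          using le[of i] le[of j] unfolding B(1) by auto
        show "{(z, y, x). x *\<^sub>R i + y *\<^sub>R j + z *\<^sub>R 0 \<in> box l u} = UNIV \<times> {l \<bullet> j <..< u \<bullet> j} \<times> {l \<bullet> i <..< u \<bullet> i}"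
          unfolding bx by (auto simp: inner_simps ii)
        show "emeasure (return borel 0) UNIV * (emeasure lborel {l \<bullet> j <..< u \<bullet> j} * emeasure lborel {l \<bullet> i <..< u \<bullet> i}) = (\<Prod>b\<in>Basis. (u - l) \<bullet> b)"
          unfolding pr using le' by (simp add: inner_simps ennreal_mult[symmetric] mult_ac)
      qed simp_all
    qed (simp_all add: axis_measure_def mem)
  next
    case 3
    then obtain i j k :: 'a where B: "Basis = {i, j, k}" "i \<noteq> j" "j \<noteq> k" "i \<noteq> k" by (auto simp: card_3_iff)
    have mem: "i \<in> Basis" "j \<in> Basis" "k \<in> Basis" using B(1) by blast+
    have ii: "i \<bullet> i = 1" "j \<bullet> j = 1" "k \<bullet> k = 1" "i \<bullet> j = 0" "j \<bullet> i = 0" "i \<bullet> k = 0" "k \<bullet> i = 0" "j \<bullet> k = 0" "k \<bullet> j = 0"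
      using mem B(2-) by (simp_all add: inner_Basis)
    show ?thesis
    proof(rule gen[of lborel i lborel j lborel k])
      fix l u :: 'a assume le: "\<And>b. b \<in> Basis \<Longrightarrow> l \<bullet> b \<le> u \<bullet> b"
      show "\<exists>A\<in>sets borel. \<exists>B\<in>sets borel. \<exists>C\<in>sets borel.
        {(z, y, x). x *\<^sub>R i + y *\<^sub>R j + z *\<^sub>R k \<in> box l u} = C \<times> B \<times> A \<and>
        emeasure lborel C * (emeasure lborel B * emeasure lborel A) = (\<Prod>b\<in>Basis. (u - l) \<bullet> b)"
      proof (rule bexI[of _ "{l \<bullet> i <..< u \<bullet> i}"], rule bexI[of _ "{l \<bullet> j <..< u \<bullet> j}"], rule bexI[of _ "{l \<bullet> k <..< u \<bullet> k}"], rule conjI)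
        have bx: "x \<in> box l u \<longleftrightarrow> l \<bullet> i < x \<bullet> i \<and> x \<bullet> i < u \<bullet> i \<and> l \<bullet> j < x \<bullet> j \<and> x \<bullet> j < u \<bullet> j \<and> l \<bullet> k < x \<bullet> k \<and> x \<bullet> k < u \<bullet> k" for x
          unfolding mem_box B(1) by simp
        have pr: "(\<Prod>b\<in>Basis. (u - l) \<bullet> b) = ((u - l) \<bullet> i) * ((u - l) \<bullet> j) * ((u - l) \<bullet> k)"
          unfolding B(1) using B(2-) by (simp add: mult_ac)
        have le': "l \<bullet> i \<le> u \<bullet> i \<and> l \<bullet> j \<le> u \<bullet> j \<and> l \<bullet> k \<le> u \<bullet> k"
          using le[of i] le[of j] le[of k] unfolding B(1) by auto
        show "{(z, y, x). x *\<^sub>R i + y *\<^sub>R j + z *\<^sub>R k \<in> box l u} = {l \<bullet> k <..< u \<bullet> k} \<times> {l \<bullet> j <..< u \<bullet> j} \<times> {l \<bullet> i <..< u \<bullet> i}"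
          unfolding bx by (auto simp: inner_simps ii)
        show "emeasure lborel {l \<bullet> k <..< u \<bullet> k} * (emeasure lborel {l \<bullet> j <..< u \<bullet> j} * emeasure lborel {l \<bullet> i <..< u \<bullet> i}) = (\<Prod>b\<in>Basis. (u - l) \<bullet> b)"
          unfolding pr using le' by (simp add: inner_simps ennreal_mult[symmetric] mult_ac)
      qed simp_all
    qed (simp_all add: axis_measure_def mem)
  qed
qed

text \<open>Fundamental theorem of calculus for f^2, started to the left of the support. Enlarging
  the domain to the whole line makes the bound independent of \<open>x\<close>, as the iterated
  estimate requires.\<close>

lemma square_le_line_integral:
  fixes f f' :: "real \<Rightarrow> real"
  assumes d: "\<And>t. (f has_real_derivative f' t) (at t)" and c: "continuous_on UNIV f'"
    and R: "\<And>t. t < - R \<Longrightarrow> f t = 0"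
  shows "ennreal ((f x)\<^sup>2) \<le> (\<integral>\<^sup>+ t. ennreal \<bar>f t\<bar> * ennreal (2 * \<bar>f' t\<bar>) \<partial>lborel)"
proof (cases "x < - R")
  case False
  have cf: "isCont f t" for t using d DERIV_isCont by blast
  have cf': "isCont f' t" for t using c by (simp add: continuous_on_eq_continuous_at)
  \<comment> \<open>\<open>f\<close> is known to vanish strictly below -R only, so the integration
    starts at -R - 1.\<close>
  have "has_bochner_integral lborel (\<lambda>t. (2 * f t * f' t) * indicator {- R - 1..x} t) ((f x)\<^sup>2 - (f (- R - 1))\<^sup>2)"
  proof (rule has_bochner_integral_FTC_Icc_real)
    show "((\<lambda>t. (f t)\<^sup>2) has_real_derivative 2 * f t * f' t) (at t)" for t
      using d[of t] by (auto intro!: derivative_eq_intros)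
    show "isCont (\<lambda>t. 2 * f t * f' t) t" for t by (intro continuous_intros cf cf')
  qed (use False in simp)
  then have i: "integrable lborel (\<lambda>t. (2 * f t * f' t) * indicator {- R - 1..x} t)"
    and e: "(LINT t|lborel. (2 * f t * f' t) * indicator {- R - 1..x} t) = (f x)\<^sup>2"
    using R by (auto simp: has_bochner_integral_iff)
  have "ennreal ((f x)\<^sup>2) = ennreal (norm (LINT t|lborel. (2 * f t * f' t) * indicator {- R - 1..x} t))"
    unfolding e by simp
  also have "\<dots> \<le> (\<integral>\<^sup>+ t. ennreal (norm ((2 * f t * f' t) * indicator {- R - 1..x} t)) \<partial>lborel)"
    by (rule integral_norm_bound_ennreal[OF i])
  also have "\<dots> \<le> (\<integral>\<^sup>+ t. ennreal \<bar>f t\<bar> * ennreal (2 * \<bar>f' t\<bar>) \<partial>lborel)"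
    by (intro nn_integral_mono) (auto simp: abs_mult indicator_def ennreal_mult[symmetric] intro!: ennreal_leI)
  finally show ?thesis .
qed (use R in simp)

text \<open>Fundamental theorem along the segment, followed by Cauchy-Schwarz against the indicator
  of the unit interval.\<close>

lemma increment_square_le:
  assumes f: "\<And>k. Ck k f"
  shows "ennreal ((f (x + h) - f x)\<^sup>2) \<le> ennreal ((norm h)\<^sup>2) *
    (\<integral>\<^sup>+ t. ennreal ((norm (tgrad f (x + t *\<^sub>R h)))\<^sup>2) * indicator {0..1} t \<partial>lborel)"
proof -
  let ?g = "\<lambda>t. tgrad f (x + t *\<^sub>R h) \<bullet> h"
  have d: "((\<lambda>t. f (x + t *\<^sub>R h)) has_real_derivative ?g t) (at t)" for t
  proof -
    have "((\<lambda>t. x + t *\<^sub>R h) has_derivative (\<lambda>s. s *\<^sub>R h)) (at t)" by (auto intro!: derivative_eq_intros)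
    from has_derivative_compose[OF this has_derivative_tgrad[OF f]]
    show ?thesis unfolding has_field_derivative_def
      by (rule has_derivative_eq_rhs) (auto simp: fun_eq_iff)
  qed
  have ct: "continuous_on UNIV (tgrad f)" using continuous_tgrad f by blast
  have cl: "continuous_on UNIV (\<lambda>t. tgrad f (x + t *\<^sub>R h))"
    by (intro continuous_on_compose2[OF ct] continuous_intros) auto
  have [measurable]: "(\<lambda>t. tgrad f (x + t *\<^sub>R h)) \<in> borel_measurable borel"
    by (intro borel_measurable_continuous_onI cl)
  have "continuous_on UNIV ?g" by (intro continuous_intros cl)
  then have c: "isCont ?g t" for t by (simp add: continuous_on_eq_continuous_at)
  have "has_bochner_integral lborel (\<lambda>t. ?g t * indicator {0..1} t) (f (x + 1 *\<^sub>R h) - f (x + 0 *\<^sub>R h))"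
    by (rule has_bochner_integral_FTC_Icc_real[of 0 1 "\<lambda>t. f (x + t *\<^sub>R h)"]) (auto intro: d c)
  then have i: "integrable lborel (\<lambda>t. ?g t * indicator {0..1} t)"
    and e: "(LINT t|lborel. ?g t * indicator {0..1} t) = f (x + h) - f x"
    by (auto simp: has_bochner_integral_iff)
  have "ennreal \<bar>f (x + h) - f x\<bar> \<le> (\<integral>\<^sup>+ t. ennreal (norm (?g t * indicator {0..1} t)) \<partial>lborel)"
    using integral_norm_bound_ennreal[OF i] unfolding e by simp
  also have "\<dots> = (\<integral>\<^sup>+ t. (ennreal \<bar>?g t\<bar> * indicator {0..1} t) * indicator {0..1} t \<partial>lborel)"
    by (intro nn_integral_cong) (auto simp: indicator_def)
  finally have "(ennreal \<bar>f (x + h) - f x\<bar>)\<^sup>2 \<le> \<dots>\<^sup>2" by (intro power_mono) auto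
  also have "\<dots> \<le> (\<integral>\<^sup>+ t. (ennreal \<bar>?g t\<bar> * indicator {0..1} t)\<^sup>2 \<partial>lborel) * (\<integral>\<^sup>+ t. (indicator {0..1::real} t)\<^sup>2 \<partial>lborel)"
    by (rule Cauchy_Schwarz_nn_integral) measurable
  also have "(\<integral>\<^sup>+ t. (indicator {0..1::real} t)\<^sup>2 \<partial>lborel) = (1::ennreal)"
  proof -
    have "(\<integral>\<^sup>+ t. (indicator {0..1::real} t)\<^sup>2 \<partial>lborel) = (\<integral>\<^sup>+ t. indicator {0..1::real} t \<partial>lborel)"
      by (intro nn_integral_cong) (auto simp: indicator_def)
    then show ?thesis by simp
  qed
  also have "(\<integral>\<^sup>+ t. (ennreal \<bar>?g t\<bar> * indicator {0..1} t)\<^sup>2 \<partial>lborel) * 1 \<le>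
     (\<integral>\<^sup>+ t. ennreal ((norm h)\<^sup>2) * (ennreal ((norm (tgrad f (x + t *\<^sub>R h)))\<^sup>2) * indicator {0..1} t) \<partial>lborel)"
    unfolding mult_1_right
  proof (intro nn_integral_mono)
    fix t :: real
    have "\<bar>?g t\<bar>\<^sup>2 \<le> (norm (tgrad f (x + t *\<^sub>R h)) * norm h)\<^sup>2"
      by (intro power_mono Cauchy_Schwarz_ineq2) auto
    then show "(ennreal \<bar>?g t\<bar> * indicator {0..1} t)\<^sup>2 \<le>
       ennreal ((norm h)\<^sup>2) * (ennreal ((norm (tgrad f (x + t *\<^sub>R h)))\<^sup>2) * indicator {0..1} t)"
      by (auto simp: indicator_def ennreal_power ennreal_mult[symmetric] power_mult_distrib mult.commute intro!: ennreal_leI)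
  qed
  also have "\<dots> = ennreal ((norm h)\<^sup>2) * (\<integral>\<^sup>+ t. ennreal ((norm (tgrad f (x + t *\<^sub>R h)))\<^sup>2) * indicator {0..1} t \<partial>lborel)"
    by (intro nn_integral_cmult) measurable
  finally show ?thesis by (simp add: ennreal_power)
qed

section \<open>Bump functions and smooth approximation of boxes\<close>

lemma Ck_prod: "(\<And>i. i \<in> I \<Longrightarrow> Ck k (f i)) \<Longrightarrow> Ck k (\<lambda>x. \<Prod>i\<in>I. f i x)"
  by (induction I rule: infinite_finite_induct) (auto intro: Ck_mult)

definition box_bump :: "'a::euclidean_space \<Rightarrow> 'a \<Rightarrow> 'a \<Rightarrow> real" where
  "box_bump a b x = (\<Prod>i\<in>Basis. flat_exp 0 (x \<bullet> i - a \<bullet> i) * flat_exp 0 (b \<bullet> i - x \<bullet> i))"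

lemma Ck_box_bump: "Ck k (box_bump a b)"
  unfolding box_bump_def[abs_def]
  by (intro Ck_prod Ck_mult Ck_compose[OF Ck_flat_exp] Ck_diff[OF Ck_inner Ck_const] Ck_diff[OF Ck_const Ck_inner])

lemma flat_exp_0: "0 \<le> flat_exp 0 t" "flat_exp 0 t \<le> 1" "0 < flat_exp 0 t \<longleftrightarrow> 0 < t"
  by (auto simp: flat_exp_def)

lemma box_bump_range: "0 \<le> box_bump a b x" "box_bump a b x \<le> 1"
  by (auto simp: box_bump_def flat_exp_0 intro!: prod_nonneg prod_le_1 mult_le_one)

lemma box_bump_pos: "x \<in> box a b \<Longrightarrow> 0 < box_bump a b x"
  unfolding box_bump_def by (intro prod_pos) (simp add: mem_box flat_exp_0)

lemma box_bump_zero: "x \<notin> box a b \<Longrightarrow> box_bump a b x = 0"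
  by (auto simp: box_bump_def mem_box flat_exp_def)

lemma test_function_box_bump: "cbox a b \<subseteq> \<Omega> \<Longrightarrow> box_bump a b \<in> test_functions \<Omega>"
  by (rule test_functionsI[OF Ck_box_bump compact_cbox, of a b \<Omega>])
    (use box_bump_zero box_subset_cbox in blast)+

text \<open>A bump with values in [0, 1] that is positive exactly on the open box makes these
  functions tend to the indicator of the box. They are polynomials in the bump without constant
  term, so the compact support is kept.\<close>

lemma box_indicator_approx_test:
  assumes "cbox a b \<subseteq> \<Omega>"
  shows "(\<lambda>x. 1 - (1 - box_bump a b x) ^ n) \<in> test_functions \<Omega>"
proof (induction n)
  case 0
  then show ?case by (simp add: test_function_zero)
next
  case (Suc n)
  let ?c = "\<lambda>x. 1 - (1 - box_bump a b x) ^ n"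
  have "(\<lambda>x. ?c x + (box_bump a b x - box_bump a b x * ?c x)) \<in> test_functions \<Omega>"
    by (rule test_function_add[OF Suc.IH test_function_diff[OF test_function_box_bump[OF assms]
          test_function_mult[OF test_function_box_bump[OF assms] Suc.IH]]])
  moreover have "(\<lambda>x. ?c x + (box_bump a b x - box_bump a b x * ?c x)) = (\<lambda>x. 1 - (1 - box_bump a b x) ^ Suc n)"
    by (simp add: fun_eq_iff algebra_simps)
  ultimately show ?case by simp
qed

lemma box_indicator_approx_limit:
  "(\<lambda>n. 1 - (1 - box_bump a b x) ^ n) \<longlonglongrightarrow> indicator (box a b) x"
proof (cases "x \<in> box a b")
  case True
  then have "(\<lambda>n. (1 - box_bump a b x) ^ n) \<longlonglongrightarrow> 0"
    using box_bump_pos[OF True] box_bump_range(2)[of a b x] by (intro LIMSEQ_realpow_zero) auto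
  then show ?thesis using True tendsto_diff[OF tendsto_const, of _ 0 sequentially "1::real"] by simp
qed (simp add: box_bump_zero)

lemma box_indicator_approx_bound: "\<bar>1 - (1 - box_bump a b x) ^ n\<bar> \<le> indicator (cbox a b) x"
proof (cases "x \<in> box a b")
  case True
  then have "x \<in> cbox a b" using box_subset_cbox by blast
  moreover have "0 \<le> (1 - box_bump a b x) ^ n" "(1 - box_bump a b x) ^ n \<le> 1"
    using box_bump_range[of a b x] by (auto intro: power_le_one)
  ultimately show ?thesis by simp
qed (simp add: box_bump_zero)

text \<open>Boxes form an intersection-stable generator of the Borel sets, so the integrals vanish
  over every Borel set and the density is zero.\<close>

lemma AE_zero_if_box_integrals_zero:
  fixes G :: "'a::euclidean_space \<Rightarrow> real"
  assumes G: "integrable lborel G"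
    and box: "\<And>l u. (LINT x|lborel. indicator (box l u) x * G x) = 0"
  shows "AE x in lborel. G x = 0"
proof -
  have [measurable]: "G \<in> borel_measurable borel" using borel_measurable_integrable[OF G] by simp
  have iG: "integrable lborel (\<lambda>x. indicator A x * G x)" if "A \<in> sets borel" for A
    using integrable_mult_indicator[of A lborel G] that G by simp
  \<comment> \<open>The total integral, obtained by exhausting the space with boxes, is what the
    complement step of the induction uses.\<close>
  have all: "(LINT x|lborel. G x) = 0"
  proof -
    have "(\<lambda>n. LINT x|lborel. indicator (box (- (real n *\<^sub>R One)) (real n *\<^sub>R One)) x * G x) \<longlonglongrightarrow> (LINT x|lborel. G x)"
    proof (rule integral_dominated_convergence[where w = "\<lambda>x. \<bar>G x\<bar>"])
      show "AE x in lborel. (\<lambda>n. indicator (box (- (real n *\<^sub>R One)) (real n *\<^sub>R One)) x * G x) \<longlonglongrightarrow> G x"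
      proof (rule AE_I2)
        fix x :: 'a
        obtain n0 :: nat where n0: "norm x < real n0" using reals_Archimedean2 by blast
        have inb: "x \<in> box (- (real n *\<^sub>R One)) (real n *\<^sub>R One)" if "n \<ge> n0" for n
        proof -
          have "\<bar>x \<bullet> i\<bar> < real n" if "i \<in> Basis" for i
            using Basis_le_norm[OF that, of x] n0 \<open>n \<ge> n0\<close> by linarith
          then show ?thesis by (force simp: mem_box abs_less_iff)
        qed
        then have "eventually (\<lambda>n. indicator (box (- (real n *\<^sub>R One)) (real n *\<^sub>R One)) x * G x = G x) sequentially"
          by (intro eventually_sequentiallyI[of n0]) (simp only: inb indicator_simps mult_1)
        then show "(\<lambda>n. indicator (box (- (real n *\<^sub>R One)) (real n *\<^sub>R One)) x * G x) \<longlonglongrightarrow> G x"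
          by (rule tendsto_eventually)
      qed
    qed (use G in \<open>auto simp: indicator_def\<close>)
    then show ?thesis by (simp add: box LIMSEQ_const_iff)
  qed
  have borel0: "(LINT x|lborel. indicator A x * G x) = 0" if "A \<in> sets borel" for A
  proof -
    have "Int_stable (range (\<lambda>(a, b). box a b :: 'a set))" by (auto simp: Int_stable_def box_Int_box)
    moreover have "(range (\<lambda>(a, b). box a b)) \<subseteq> Pow (UNIV :: 'a set)" by auto
    moreover have "A \<in> sigma_sets UNIV (range (\<lambda>(a, b). box a b))"
      using that unfolding borel_eq_box by simp
    ultimately show ?thesis
    proof (induction rule: sigma_sets_induct_disjoint)
      case (basic A)
      then show ?case using box by auto
    next
      case empty
      show ?case by simp
    next
      case (compl A)
      then have A: "A \<in> sets borel" by (simp add: borel_eq_box)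
      have "(LINT x|lborel. indicator (UNIV - A) x * G x) = (LINT x|lborel. G x - indicator A x * G x)"
        by (intro Bochner_Integration.integral_cong) (auto simp: indicator_def)
      also have "\<dots> = 0" using all compl G iG[OF A] by simp
      finally show ?case .
    next
      case (union F)
      then have F: "\<And>i. F i \<in> sets lborel" by (auto simp: borel_eq_box subset_eq)
      then have "(\<Union>i. F i) \<in> sets borel" by auto
      then have "set_lebesgue_integral lborel (\<Union>i. F i) G = (\<Sum>i. set_lebesgue_integral lborel (F i) G)"
        using F union(1) iG
        by (intro lebesgue_integral_countable_add)
          (auto simp: disjoint_family_on_def set_integrable_def)
      then show ?case using union by (simp add: set_lebesgue_integral_def)
    qed
  qed
  show ?thesis
    by (rule density_unique_real[OF G, of "\<lambda>x. 0"])
      (use borel0 in \<open>auto simp: set_lebesgue_integral_def\<close>)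
qed

lemma test_integrable:
  fixes f :: "'a::euclidean_space \<Rightarrow> 'b::euclidean_space"
  assumes "continuous_on UNIV f" "compact K" "\<And>x. x \<notin> K \<Longrightarrow> f x = 0"
  shows "integrable lborel f" "\<exists>C. \<forall>x. norm (f x) \<le> C"
proof -
  have "integrable lborel (\<lambda>x. indicator K x *\<^sub>R f x)"
    using assms by (intro borel_integrable_compact) (auto intro: continuous_on_subset)
  moreover have "(\<lambda>x. indicator K x *\<^sub>R f x) = f" using assms(3) by (auto simp: indicator_def fun_eq_iff)
  ultimately show "integrable lborel f" by simp
  have "bounded (f ` K)" using assms by (intro compact_imp_bounded compact_continuous_image) (auto intro: continuous_on_subset)
  then obtain C where "\<forall>x\<in>K. norm (f x) \<le> C" unfolding bounded_iff by auto
  then have "norm (f x) \<le> max C 0" for x using assms(3)[of x] by (cases "x \<in> K") auto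
  then show "\<exists>C. \<forall>x. norm (f x) \<le> C" by blast
qed

text \<open>Translation invariance makes the integral of every difference quotient zero, and
  dominated convergence passes to the derivative.\<close>

lemma integral_partial_deriv_eq_0:
  fixes f :: "'a::euclidean_space \<Rightarrow> real"
  assumes f: "f \<in> test_functions \<Omega>" and b: "b \<in> Basis"
  shows "(LINT x|lborel. partial_deriv b f x) = 0"
proof -
  obtain K where K: "\<And>k. Ck k f" "compact K" "\<And>x. x \<notin> K \<Longrightarrow> f x = 0"
    using test_functionsD[OF f] by blast
  have cf: "continuous_on UNIV f" by (rule Ck_continuous[OF K(1)[of 0]])
  then have [measurable]: "f \<in> borel_measurable borel" by (rule borel_measurable_continuous_onI)
  have if0: "integrable lborel f" by (rule test_integrable(1)[OF cf K(2,3)])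
  have cg: "continuous_on UNIV (tgrad f)" by (rule continuous_tgrad[OF K(1)])
  obtain C where C: "\<And>x. norm (tgrad f x) \<le> C"
    using test_integrable(2)[OF cg K(2) tgrad_outside[OF K(2,3)]] by blast
  have C0: "0 \<le> C" using C[of 0] norm_ge_zero order_trans by blast
  let ?h = "\<lambda>n. 1 / real (Suc n)"
  let ?Q = "\<lambda>n x. (f (x + ?h n *\<^sub>R b) - f x) / ?h n"
  \<comment> \<open>The support enlarged by the unit ball: it contains the supports of all
    difference quotients, whose steps have length at most 1.\<close>
  define K' where "K' = (\<lambda>(x, y). x + y) ` (K \<times> cball 0 1)"
  have K': "compact K'" unfolding K'_def
    by (intro compact_continuous_image compact_Times K(2) compact_cball)
      (auto simp: split_def intro!: continuous_intros)
  have lip: "\<bar>?Q n x\<bar> \<le> C" for n x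
  proof -
    have "ennreal ((f (x + ?h n *\<^sub>R b) - f x)\<^sup>2) \<le> ennreal ((norm (?h n *\<^sub>R b))\<^sup>2) *
      (\<integral>\<^sup>+ t. ennreal ((norm (tgrad f (x + t *\<^sub>R (?h n *\<^sub>R b))))\<^sup>2) * indicator {0..1} t \<partial>lborel)"
      by (rule increment_square_le[OF K(1)])
    also have "\<dots> \<le> ennreal ((?h n)\<^sup>2) * (\<integral>\<^sup>+ t. ennreal (C\<^sup>2) * indicator {0..1::real} t \<partial>lborel)"
      using b C by (intro mult_mono nn_integral_mono mult_right_mono ennreal_leI power_mono) auto
    also have "\<dots> = ennreal ((?h n * C)\<^sup>2)"
    proof -
      have "(\<integral>\<^sup>+ t. ennreal (C\<^sup>2) * indicator {0..1::real} t \<partial>lborel) = ennreal (C\<^sup>2)"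
        by (simp add: nn_integral_cmult)
      then show ?thesis by (simp only: power_mult_distrib) (rule ennreal_mult[symmetric], simp_all)
    qed
    finally have "(f (x + ?h n *\<^sub>R b) - f x)\<^sup>2 \<le> (?h n * C)\<^sup>2" by (subst (asm) ennreal_le_iff) simp
    then have A: "\<bar>f (x + ?h n *\<^sub>R b) - f x\<bar> \<le> ?h n * C"
      using C0 by (intro power2_le_imp_le[of "\<bar>_\<bar>"]) (simp_all del: of_nat_Suc)
    have "\<bar>A / c\<bar> \<le> C" if "\<bar>A\<bar> \<le> c * C" "0 < c" for A c :: real
      using that by (simp add: pos_divide_le_eq mult.commute)
    from this[OF A] show ?thesis by simp
  qed
  have supp: "?Q n x = 0" if "x \<notin> K'" for n x
  proof -
    have "x \<notin> K"
    proof
      assume "x \<in> K"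
      then have "x + 0 \<in> K'" unfolding K'_def by (force intro: image_eqI[of _ _ "(x, 0)"])
      with that show False by simp
    qed
    moreover have "x + ?h n *\<^sub>R b \<notin> K"
    proof
      assume *: "x + ?h n *\<^sub>R b \<in> K"
      have "norm (- (?h n *\<^sub>R b)) \<le> 1" using b by (simp del: of_nat_Suc)
      then have "(x + ?h n *\<^sub>R b) + - (?h n *\<^sub>R b) \<in> K'" unfolding K'_def
        using * by (intro image_eqI[of _ _ "(x + ?h n *\<^sub>R b, - (?h n *\<^sub>R b))"]) (auto simp del: of_nat_Suc)
      with that show False by simp
    qed
    ultimately show ?thesis using K(3) by simp
  qed
  have "(\<lambda>n. LINT x|lborel. ?Q n x) \<longlonglongrightarrow> (LINT x|lborel. partial_deriv b f x)"
  proof (rule integral_dominated_convergence[where w = "\<lambda>x. C * indicator K' x"])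
    have "tgrad f x \<bullet> b = partial_deriv b f x" for x using b by (rule tgrad_inner_Basis)
    moreover have "(\<lambda>x. tgrad f x \<bullet> b) \<in> borel_measurable lborel"
      using borel_measurable_continuous_onI[OF cg] by simp
    ultimately show "partial_deriv b f \<in> borel_measurable lborel" by simp
    show "integrable lborel (\<lambda>x. C * indicator K' x)"
      using K' emeasure_compact_finite by (intro integrable_mult_right integrable_real_indicator) (auto simp: compact_imp_closed less_top)
    show "AE x in lborel. (\<lambda>n. ?Q n x) \<longlonglongrightarrow> partial_deriv b f x"
    proof (rule AE_I2)
      fix x
      have "((\<lambda>t. x + t *\<^sub>R b) has_derivative (\<lambda>s. s *\<^sub>R b)) (at 0)" by (auto intro!: derivative_eq_intros)
      from has_derivative_compose[OF this has_derivative_tgrad[OF K(1)]]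
      have "((\<lambda>t. f (x + t *\<^sub>R b)) has_real_derivative partial_deriv b f x) (at 0)"
        unfolding has_field_derivative_def
        by (rule has_derivative_eq_rhs) (auto simp: fun_eq_iff tgrad_inner_Basis[OF b])
      then have L: "((\<lambda>h. (f (x + h *\<^sub>R b) - f x) / h) \<longlongrightarrow> partial_deriv b f x) (at 0)"
        by (simp add: has_field_derivative_iff)
      have "filterlim ?h (at 0) sequentially"
        by (rule filterlim_atI) (use LIMSEQ_Suc[OF lim_1_over_n] in auto)
      from filterlim_compose[OF L this] show "(\<lambda>n. ?Q n x) \<longlonglongrightarrow> partial_deriv b f x" .
    qed
    show "AE x in lborel. norm (?Q n x) \<le> C * indicator K' x" for n
    proof (rule AE_I2)
      fix x
      show "norm (?Q n x) \<le> C * indicator K' x"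
        using lip[of x n] supp[of x n] by (cases "x \<in> K'") (simp_all only: indicator_simps real_norm_def mult_1_right, simp)
    qed
  qed measurable
  moreover have "(LINT x|lborel. ?Q n x) = 0" for n
  proof -
    have d: "distr lborel borel ((+) (?h n *\<^sub>R b)) = lborel" by (rule lborel_distr_plus)
    have "(LINT x|lborel. f x) = (LINT x|lborel. f (?h n *\<^sub>R b + x))"
      by (subst d[symmetric], subst integral_distr) auto
    moreover have "integrable lborel (\<lambda>x. f (?h n *\<^sub>R b + x))"
      using if0 by (subst (asm) d[symmetric], subst (asm) integrable_distr_eq) auto
    ultimately show ?thesis using if0 by (simp add: add.commute del: of_nat_Suc)
  qed
  ultimately show ?thesis by (simp add: LIMSEQ_const_iff)
qed

text \<open>Integrating the increment bound over all pairs of points yields both the Poincare inequality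
  on a convex set and the compactness of the embedding into \<open>L\<^sup>2\<close>.\<close>

lemma double_integral_increment_le:
  fixes f :: "'a::euclidean_space \<Rightarrow> real"
  assumes f: "f \<in> test_functions \<Omega>" and [measurable]: "E \<in> sets (borel \<Otimes>\<^sub>M borel)" "B \<in> sets borel"
    and E: "\<And>x y t. (x, y) \<in> E \<Longrightarrow> 0 \<le> t \<Longrightarrow> t \<le> 1 \<Longrightarrow> x + t *\<^sub>R (y - x) \<in> B"
      "\<And>x y. (x, y) \<in> E \<Longrightarrow> norm (y - x) \<le> \<rho>"
  shows "(\<integral>\<^sup>+ x. \<integral>\<^sup>+ y. indicator E (x, y) * ennreal ((f x - f y)\<^sup>2) \<partial>lborel \<partial>lborel) \<le>
    ennreal (\<rho>\<^sup>2) * emeasure lborel (cball (0::'a) \<rho>) * (\<integral>\<^sup>+ x. indicator B x * ennreal ((norm (tgrad f x))\<^sup>2) \<partial>lborel)"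
proof -
  obtain K where K: "\<And>k. Ck k f" using test_functionsD[OF f] by blast
  have [measurable]: "f \<in> borel_measurable borel"
    by (rule borel_measurable_continuous_onI[OF Ck_continuous[OF K[of 0]]])
  have [measurable]: "tgrad f \<in> borel_measurable borel"
    by (rule borel_measurable_continuous_onI[OF continuous_tgrad[OF K]])
  have [measurable]: "cball (0 :: 'a) \<rho> \<in> sets borel" by simp
  define g where "g x = indicator B x * ennreal ((norm (tgrad f x))\<^sup>2)" for x
  have [measurable]: "g \<in> borel_measurable borel" unfolding g_def by measurable
  have trans: "(\<integral>\<^sup>+ y. F y \<partial>lborel) = (\<integral>\<^sup>+ h. F (c + h) \<partial>lborel)" if [measurable]: "F \<in> borel_measurable borel"
    for F :: "'a \<Rightarrow> ennreal" and c
  proof -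
    have "(\<integral>\<^sup>+ y. F y \<partial>lborel) = (\<integral>\<^sup>+ y. F y \<partial>distr lborel borel ((+) c))" by (simp add: lborel_distr_plus)
    also have "\<dots> = (\<integral>\<^sup>+ h. F (c + h) \<partial>lborel)" by (rule nn_integral_distr) auto
    finally show ?thesis .
  qed
  \<comment> \<open>With y = x + h the increment is bounded by an integral over the segment. Once
    the integral over \<open>x\<close> is innermost, the translation by t h can be undone; the
    \<open>h\<close> integral then contributes the volume of the ball and the \<open>t\<close>
    integral the factor 1.\<close>
  have pt: "indicator E (x, x + h) * ennreal ((f x - f (x + h))\<^sup>2) \<le>
      (\<integral>\<^sup>+ t. (indicator (cball 0 \<rho>) h * ennreal (\<rho>\<^sup>2)) * (indicator {0..1::real} t * g (x + t *\<^sub>R h)) \<partial>lborel)" for x h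
  proof (cases "(x, x + h) \<in> E")
    case True
    then have h: "norm h \<le> \<rho>" using E(2) by fastforce
    have "ennreal ((f x - f (x + h))\<^sup>2) \<le> ennreal ((norm h)\<^sup>2) *
      (\<integral>\<^sup>+ t. ennreal ((norm (tgrad f (x + t *\<^sub>R h)))\<^sup>2) * indicator {0..1} t \<partial>lborel)"
      using increment_square_le[OF K, of x h] by (simp add: power2_commute)
    also have "\<dots> \<le> ennreal (\<rho>\<^sup>2) * (\<integral>\<^sup>+ t. indicator {0..1::real} t * g (x + t *\<^sub>R h) \<partial>lborel)"
    proof (rule mult_mono)
      show "ennreal ((norm h)\<^sup>2) \<le> ennreal (\<rho>\<^sup>2)" using h by (intro ennreal_leI power_mono) auto
      show "(\<integral>\<^sup>+ t. ennreal ((norm (tgrad f (x + t *\<^sub>R h)))\<^sup>2) * indicator {0..1} t \<partial>lborel)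
        \<le> (\<integral>\<^sup>+ t. indicator {0..1::real} t * g (x + t *\<^sub>R h) \<partial>lborel)"
      proof (rule nn_integral_mono)
        fix t :: real
        show "ennreal ((norm (tgrad f (x + t *\<^sub>R h)))\<^sup>2) * indicator {0..1} t \<le> indicator {0..1} t * g (x + t *\<^sub>R h)"
          using E(1)[OF True, of t] by (auto simp: indicator_def g_def)
      qed
    qed auto
    also have "\<dots> = (\<integral>\<^sup>+ t. ennreal (\<rho>\<^sup>2) * (indicator {0..1::real} t * g (x + t *\<^sub>R h)) \<partial>lborel)"
      by (intro nn_integral_cmult[symmetric]) measurable
    finally show ?thesis using True h by simp
  qed simp
  have "(\<integral>\<^sup>+ x. \<integral>\<^sup>+ y. indicator E (x, y) * ennreal ((f x - f y)\<^sup>2) \<partial>lborel \<partial>lborel) =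
      (\<integral>\<^sup>+ x. \<integral>\<^sup>+ h. indicator E (x, x + h) * ennreal ((f x - f (x + h))\<^sup>2) \<partial>lborel \<partial>lborel)"
    by (intro nn_integral_cong trans) measurable
  also have "\<dots> \<le> (\<integral>\<^sup>+ x. \<integral>\<^sup>+ h. \<integral>\<^sup>+ t. (indicator (cball 0 \<rho>) h * ennreal (\<rho>\<^sup>2)) * (indicator {0..1::real} t * g (x + t *\<^sub>R h)) \<partial>lborel \<partial>lborel \<partial>lborel)"
    by (intro nn_integral_mono pt)
  also have "\<dots> = (\<integral>\<^sup>+ h. \<integral>\<^sup>+ x. \<integral>\<^sup>+ t. (indicator (cball 0 \<rho>) h * ennreal (\<rho>\<^sup>2)) * (indicator {0..1::real} t * g (x + t *\<^sub>R h)) \<partial>lborel \<partial>lborel \<partial>lborel)"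
    by (rule lborel_pair.Fubini') measurable
  also have "\<dots> = (\<integral>\<^sup>+ h. \<integral>\<^sup>+ t. \<integral>\<^sup>+ x. (indicator (cball 0 \<rho>) h * ennreal (\<rho>\<^sup>2)) * (indicator {0..1::real} t * g (x + t *\<^sub>R h)) \<partial>lborel \<partial>lborel \<partial>lborel)"
    by (intro nn_integral_cong lborel_pair.Fubini') measurable
  also have "\<dots> = (\<integral>\<^sup>+ h. \<integral>\<^sup>+ t. (indicator (cball (0::'a) \<rho>) h * ennreal (\<rho>\<^sup>2)) * (indicator {0..1::real} t * (\<integral>\<^sup>+ x. g x \<partial>lborel)) \<partial>lborel \<partial>lborel)"
  proof (intro nn_integral_cong)
    fix h :: 'a and t :: real
    have "(\<integral>\<^sup>+ x. g (x + t *\<^sub>R h) \<partial>lborel) = (\<integral>\<^sup>+ x. g x \<partial>lborel)"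
      using trans[of g "t *\<^sub>R h"] by (simp add: add.commute)
    then show "(\<integral>\<^sup>+ x. (indicator (cball 0 \<rho>) h * ennreal (\<rho>\<^sup>2)) * (indicator {0..1::real} t * g (x + t *\<^sub>R h)) \<partial>lborel)
        = (indicator (cball (0::'a) \<rho>) h * ennreal (\<rho>\<^sup>2)) * (indicator {0..1::real} t * (\<integral>\<^sup>+ x. g x \<partial>lborel))"
      by (simp add: nn_integral_cmult)
  qed
  also have "\<dots> = ennreal (\<rho>\<^sup>2) * emeasure lborel (cball (0::'a) \<rho>) * (\<integral>\<^sup>+ x. g x \<partial>lborel)"
    by (simp add: nn_integral_cmult nn_integral_multc mult_ac)
  finally show ?thesis unfolding g_def .
qed

lemma ennreal_square_le_imp_le:
  assumes "x\<^sup>2 \<le> y\<^sup>2"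
  shows "x \<le> (y :: ennreal)"
proof (rule ccontr)
  assume "\<not> x \<le> y"
  then have yx: "y < x" by simp
  then obtain b where b: "y = ennreal b" "0 \<le> b" by (cases y) auto
  show False
  proof (cases x)
    case (real r)
    then have "b < r" using yx b by (simp add: ennreal_less_iff)
    then have "b\<^sup>2 < r\<^sup>2" using b(2) by (intro power_strict_mono) auto
    moreover have "ennreal (r\<^sup>2) \<le> ennreal (b\<^sup>2)"
      using assms by (simp only: real b(1) ennreal_power[OF real(1)] ennreal_power[OF b(2)])
    ultimately show False by simp
  next
    case top
    then have "top \<le> ennreal (b\<^sup>2)"
      using assms by (simp add: b ennreal_power power2_eq_square[of top])
    then show False by (simp add: top_unique)
  qed
qed

text \<open>The iterated inequality is applied to the modulus of \<open>f\<close> along the three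
  axes. Each of its four factors is at most 4N, where N is the squared H1 norm, and (4N)^4 = (16
  N^2)^2 explains the constant.\<close>

lemma L4_bound_test_function:
  fixes f :: "'a::euclidean_space \<Rightarrow> real"
  assumes dim: "DIM('a) \<in> {1, 2, 3}" and f: "f \<in> test_functions \<Omega>"
  shows "(\<integral>\<^sup>+ x. ennreal (f x ^ 4) \<partial>lborel) \<le> 16 * (\<integral>\<^sup>+ x. ennreal ((f x)\<^sup>2 + (norm (tgrad f x))\<^sup>2) \<partial>lborel)\<^sup>2"
proof -
  obtain K where K: "\<And>k. Ck k f" "compact K" "\<And>x. x \<notin> K \<Longrightarrow> f x = 0"
    using test_functionsD[OF f] by blast
  have cf: "continuous_on UNIV f" by (rule Ck_continuous[OF K(1)[of 0]])
  have ct: "continuous_on UNIV (tgrad f)" by (rule continuous_tgrad[OF K(1)])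
  have [measurable]: "f \<in> borel_measurable borel" "tgrad f \<in> borel_measurable borel"
    using cf ct by (auto intro: borel_measurable_continuous_onI)
  obtain i j k :: 'a and M1 M2 M3 where ax: "axis_measure M1 i" "axis_measure M2 j" "axis_measure M3 k"
    and lb: "(lborel :: 'a measure) = distr (M3 \<Otimes>\<^sub>M M2 \<Otimes>\<^sub>M M1) borel (\<lambda>(z, y, x). x *\<^sub>R i + y *\<^sub>R j + z *\<^sub>R k)"
    using lborel_three_axes_exist[OF dim] by blast
  have [measurable_cong]: "sets M1 = sets borel" "sets M2 = sets borel" "sets M3 = sets borel"
    using ax axis_measure_sets by auto
  interpret M1: sigma_finite_measure M1 using ax axis_measure_sigma_finite by blast
  interpret M2: sigma_finite_measure M2 using ax axis_measure_sigma_finite by blast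
  interpret M3: sigma_finite_measure M3 using ax axis_measure_sigma_finite by blast
  interpret P21: pair_sigma_finite M2 M1 by unfold_locales
  \<comment> \<open>Along a basis vector this is twice the directional derivative, from
    differentiating f^2. Along the zero vector the line integral is evaluation at a point, and the
    modulus of \<open>f\<close> satisfies the required bound with equality.\<close>
  define D where "D v x = (if v \<in> Basis then 2 * \<bar>tgrad f x \<bullet> v\<bar> else \<bar>f x\<bar>)" for v x
  have [measurable]: "D v \<in> borel_measurable borel" for v unfolding D_def by measurable
  have line: "(ennreal \<bar>f (p + s *\<^sub>R v)\<bar>)\<^sup>2 \<le> (\<integral>\<^sup>+ t. ennreal \<bar>f (p + t *\<^sub>R v)\<bar> * ennreal (D v (p + t *\<^sub>R v)) \<partial>M)"
    if "axis_measure M v" for M v p s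
    using that unfolding axis_measure_def
  proof (elim disjE conjE)
    assume M: "M = lborel" and v: "v \<in> Basis"
    obtain R where R: "\<And>x. x \<in> K \<Longrightarrow> norm x \<le> R" using compact_imp_bounded[OF K(2)] unfolding bounded_iff by auto
    have "ennreal ((f (p + s *\<^sub>R v))\<^sup>2) \<le> (\<integral>\<^sup>+ t. ennreal \<bar>f (p + t *\<^sub>R v)\<bar> * ennreal (2 * \<bar>tgrad f (p + t *\<^sub>R v) \<bullet> v\<bar>) \<partial>lborel)"
    proof (rule square_le_line_integral[where R = "\<bar>R\<bar> + norm p"])
      fix t
      have "((\<lambda>t. p + t *\<^sub>R v) has_derivative (\<lambda>s. s *\<^sub>R v)) (at t)" by (auto intro!: derivative_eq_intros)
      from has_derivative_compose[OF this has_derivative_tgrad[OF K(1)]]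
      show "((\<lambda>t. f (p + t *\<^sub>R v)) has_real_derivative tgrad f (p + t *\<^sub>R v) \<bullet> v) (at t)"
        unfolding has_field_derivative_def by (rule has_derivative_eq_rhs) (auto simp: fun_eq_iff)
      assume "t < - (\<bar>R\<bar> + norm p)"
      then have "norm (t *\<^sub>R v) > \<bar>R\<bar> + norm p" using v by simp
      moreover have "norm (t *\<^sub>R v) \<le> norm (p + t *\<^sub>R v) + norm p"
        using norm_triangle_ineq4[of "p + t *\<^sub>R v" p] by simp
      ultimately have "p + t *\<^sub>R v \<notin> K" using R[of "p + t *\<^sub>R v"] by auto
      then show "f (p + t *\<^sub>R v) = 0" by (rule K(3))
    next
      show "continuous_on UNIV (\<lambda>t. tgrad f (p + t *\<^sub>R v) \<bullet> v)"
        by (intro continuous_intros continuous_on_compose2[OF ct]) auto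
    qed
    then show ?thesis using v by (simp add: M D_def ennreal_power)
  next
    assume M: "M = return borel 0" and v: "v = 0"
    have "(0::'a) \<notin> Basis" using nonzero_Basis by blast
    then show ?thesis unfolding M v
      by (subst nn_integral_return) (auto simp: D_def power2_eq_square)
  qed
  define I where "I G = (\<integral>\<^sup>+ z. \<integral>\<^sup>+ y. \<integral>\<^sup>+ x. (G x y z :: ennreal) \<partial>M1 \<partial>M2 \<partial>M3)" for G
  let ?p = "\<lambda>x y z. x *\<^sub>R i + y *\<^sub>R j + z *\<^sub>R k"
  have unroll: "(\<integral>\<^sup>+ x. G x \<partial>lborel) = I (\<lambda>x y z. G (?p x y z))" if [measurable]: "G \<in> borel_measurable borel" for G
  proof -
    have "(\<integral>\<^sup>+ x. G x \<partial>lborel) = (\<integral>\<^sup>+ w. G (case w of (z, y, x) \<Rightarrow> ?p x y z) \<partial>(M3 \<Otimes>\<^sub>M M2 \<Otimes>\<^sub>M M1))"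
      by (subst lb, subst nn_integral_distr) auto
    also have "\<dots> = (\<integral>\<^sup>+ z. \<integral>\<^sup>+ w. G (case w of (y, x) \<Rightarrow> ?p x y z) \<partial>(M2 \<Otimes>\<^sub>M M1) \<partial>M3)"
      by (subst P21.P.nn_integral_fst[symmetric]) (auto simp: split_def)
    also have "\<dots> = I (\<lambda>x y z. G (?p x y z))" unfolding I_def
      by (intro nn_integral_cong, subst M1.nn_integral_fst[symmetric]) (auto simp: split_def)
    finally show ?thesis .
  qed
  define N where "N = (\<integral>\<^sup>+ x. ennreal ((f x)\<^sup>2 + (norm (tgrad f x))\<^sup>2) \<partial>lborel)"
  have "(I (\<lambda>x y z. (ennreal \<bar>f (?p x y z)\<bar>) ^ 4))\<^sup>2 \<le> I (\<lambda>x y z. (ennreal \<bar>f (?p x y z)\<bar>)\<^sup>2) *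
      I (\<lambda>x y z. (ennreal (D i (?p x y z)))\<^sup>2) * I (\<lambda>x y z. (ennreal (D j (?p x y z)))\<^sup>2) * I (\<lambda>x y z. (ennreal (D k (?p x y z)))\<^sup>2)"
    unfolding I_def
  proof (rule Ladyzhenskaya_iterated)
    fix x y z
    show "(ennreal \<bar>f (?p x y z)\<bar>)\<^sup>2 \<le> (\<integral>\<^sup>+ s. ennreal \<bar>f (?p s y z)\<bar> * ennreal (D i (?p s y z)) \<partial>M1)"
      using line[OF ax(1), of "y *\<^sub>R j + z *\<^sub>R k" x] by (simp add: add_ac)
    show "(ennreal \<bar>f (?p x y z)\<bar>)\<^sup>2 \<le> (\<integral>\<^sup>+ s. ennreal \<bar>f (?p x s z)\<bar> * ennreal (D j (?p x s z)) \<partial>M2)"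
      using line[OF ax(2), of "x *\<^sub>R i + z *\<^sub>R k" y] by (simp add: add_ac)
    show "(ennreal \<bar>f (?p x y z)\<bar>)\<^sup>2 \<le> (\<integral>\<^sup>+ s. ennreal \<bar>f (?p x y s)\<bar> * ennreal (D k (?p x y s)) \<partial>M3)"
      using line[OF ax(3), of "x *\<^sub>R i + y *\<^sub>R j" z] by (simp add: add_ac)
  qed (use ax axis_measure_sets in \<open>auto intro: M1.sigma_finite_measure_axioms M2.sigma_finite_measure_axioms M3.sigma_finite_measure_axioms\<close>)
  moreover have DN: "I (\<lambda>x y z. (ennreal (D v (?p x y z)))\<^sup>2) \<le> 4 * N" for v
  proof -
    have "I (\<lambda>x y z. (ennreal (D v (?p x y z)))\<^sup>2) = (\<integral>\<^sup>+ x. (ennreal (D v x))\<^sup>2 \<partial>lborel)"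
      by (subst unroll) auto
    also have "\<dots> \<le> (\<integral>\<^sup>+ x. 4 * ennreal ((f x)\<^sup>2 + (norm (tgrad f x))\<^sup>2) \<partial>lborel)"
    proof (intro nn_integral_mono)
      fix x
      have "(D v x)\<^sup>2 \<le> 4 * ((f x)\<^sup>2 + (norm (tgrad f x))\<^sup>2)"
      proof (cases "v \<in> Basis")
        case True
        have "\<bar>tgrad f x \<bullet> v\<bar>\<^sup>2 \<le> (norm (tgrad f x))\<^sup>2"
          using Basis_le_norm[OF True] by (intro power_mono) auto
        then have "(tgrad f x \<bullet> v)\<^sup>2 \<le> (norm (tgrad f x))\<^sup>2" by simp
        moreover have "0 \<le> (f x)\<^sup>2" by simp
        ultimately have "4 * (tgrad f x \<bullet> v)\<^sup>2 \<le> 4 * ((f x)\<^sup>2 + (norm (tgrad f x))\<^sup>2)"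
          by (intro mult_left_mono) linarith+
        then show ?thesis using True by (simp add: D_def power_mult_distrib)
      qed (simp add: D_def)
      then have "ennreal ((D v x)\<^sup>2) \<le> ennreal (4 * ((f x)\<^sup>2 + (norm (tgrad f x))\<^sup>2))" by (rule ennreal_leI)
      moreover have "0 \<le> D v x" by (simp add: D_def)
      ultimately show "(ennreal (D v x))\<^sup>2 \<le> 4 * ennreal ((f x)\<^sup>2 + (norm (tgrad f x))\<^sup>2)"
        by (simp only: ennreal_power ennreal_mult'' ennreal_numeral) 
          (simp add: ennreal_mult)
    qed
    also have "\<dots> = 4 * N" unfolding N_def by (rule nn_integral_cmult) measurable
    finally show ?thesis .
  qed
  moreover have "I (\<lambda>x y z. (ennreal \<bar>f (?p x y z)\<bar>)\<^sup>2) \<le> 4 * N"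
  proof -
    \<comment> \<open>Zero is not a basis vector, so the factor with F^2 is itself of the form
      \<open>D v\<close> and obeys the same bound.\<close>
    have "D 0 = (\<lambda>x. \<bar>f x\<bar>)" using nonzero_Basis[of 0] by (auto simp: D_def fun_eq_iff)
    then show ?thesis using DN[of 0] by simp
  qed
  ultimately have "(I (\<lambda>x y z. (ennreal \<bar>f (?p x y z)\<bar>) ^ 4))\<^sup>2 \<le> (4 * N) * (4 * N) * (4 * N) * (4 * N)"
    by (elim order_trans) (intro mult_mono; simp)
  also have "\<dots> = (16 * N\<^sup>2)\<^sup>2" by (simp add: power2_eq_square mult_ac)
  finally have "I (\<lambda>x y z. (ennreal \<bar>f (?p x y z)\<bar>) ^ 4) \<le> 16 * N\<^sup>2" by (rule ennreal_square_le_imp_le)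
  moreover have "(\<integral>\<^sup>+ x. ennreal (f x ^ 4) \<partial>lborel) = I (\<lambda>x y z. (ennreal \<bar>f (?p x y z)\<bar>) ^ 4)"
    by (subst unroll) (auto simp: ennreal_power power_even_abs)
  ultimately show ?thesis by (simp add: N_def)
qed

section \<open>Compactness of the embedding into L2\<close>

text \<open>The integer index of the cell of side \<open>d\<close> that contains a point. Cells are
  the fibres of this map, so they partition the space without an enumeration.\<close>

definition grid :: "real \<Rightarrow> 'a::euclidean_space \<Rightarrow> 'a" where
  "grid d x = (\<Sum>b\<in>Basis. of_int \<lfloor>(x \<bullet> b) / d\<rfloor> *\<^sub>R b)"

lemma grid_inner: "b \<in> Basis \<Longrightarrow> grid d x \<bullet> b = of_int \<lfloor>(x \<bullet> b) / d\<rfloor>"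
  by (simp add: grid_def inner_sum_left inner_Basis if_distrib sum.delta cong: if_cong)

lemma borel_measurable_grid [measurable]: "grid d \<in> borel_measurable borel"
  unfolding grid_def[abs_def] by measurable

lemma grid_eq_imp_norm_le:
  assumes "0 < d" "grid d x = grid d (y::'a::euclidean_space)"
  shows "norm (y - x) \<le> real DIM('a) * d"
proof -
  have "\<bar>(y - x) \<bullet> b\<bar> \<le> d" if b: "b \<in> Basis" for b
  proof -
    have "\<lfloor>(x \<bullet> b) / d\<rfloor> = \<lfloor>(y \<bullet> b) / d\<rfloor>"
      using arg_cong[OF assms(2), of "\<lambda>v. v \<bullet> b"] by (simp add: grid_inner[OF b])
    then have "\<bar>(y \<bullet> b) / d - (x \<bullet> b) / d\<bar> \<le> 1" by linarith
    also have "(y \<bullet> b) / d - (x \<bullet> b) / d = ((y - x) \<bullet> b) / d" by (simp add: inner_simps diff_divide_distrib)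
    finally show ?thesis using assms(1) by (simp add: abs_divide pos_divide_le_eq)
  qed
  then have "(\<Sum>b\<in>Basis. \<bar>(y - x) \<bullet> b\<bar>) \<le> (\<Sum>b\<in>(Basis::'a set). d)" by (intro sum_mono)
  then show ?thesis using norm_le_l1[of "y - x"] by simp
qed

lemma finite_grid_image:
  assumes "bounded S" "0 < d"
  shows "finite (grid d ` (S :: 'a::euclidean_space set))"
proof -
  obtain R where R: "\<And>x. x \<in> S \<Longrightarrow> norm x \<le> R" using assms(1) unfolding bounded_iff by auto
  define I where "I = {\<lfloor>- (\<bar>R\<bar> / d)\<rfloor>..\<lfloor>\<bar>R\<bar> / d\<rfloor>}"
  have "grid d ` S \<subseteq> (\<lambda>v. \<Sum>b\<in>Basis. of_int (v b) *\<^sub>R b) ` (Pi\<^sub>E Basis (\<lambda>_. I))"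
  proof (rule image_subsetI)
    fix x assume x: "x \<in> S"
    have "\<lfloor>(x \<bullet> b) / d\<rfloor> \<in> I" if "b \<in> Basis" for b
    proof -
      have "\<bar>x \<bullet> b\<bar> \<le> \<bar>R\<bar>" using Basis_le_norm[OF that, of x] R[OF x] by linarith
      then have "(x \<bullet> b) / d \<le> \<bar>R\<bar> / d" "- (\<bar>R\<bar> / d) \<le> (x \<bullet> b) / d"
        using assms(2) by (auto simp: field_simps abs_le_iff)
      then show ?thesis unfolding I_def by (auto intro: floor_mono)
    qed
    then have "restrict (\<lambda>b. \<lfloor>(x \<bullet> b) / d\<rfloor>) Basis \<in> Pi\<^sub>E Basis (\<lambda>_. I)" by auto
    moreover have "grid d x = (\<Sum>b\<in>Basis. of_int (restrict (\<lambda>b. \<lfloor>(x \<bullet> b) / d\<rfloor>) Basis b) *\<^sub>R b)"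
      by (simp add: grid_def)
    ultimately show "grid d x \<in> (\<lambda>v. \<Sum>b\<in>Basis. of_int (v b) *\<^sub>R b) ` (Pi\<^sub>E Basis (\<lambda>_. I))" by blast
  qed
  moreover have "finite (Pi\<^sub>E (Basis :: 'a set) (\<lambda>_. I))" by (intro finite_PiE) (auto simp: I_def)
  ultimately show ?thesis by (meson finite_imageI finite_subset)
qed

text \<open>A cell is a half-open box and lies between the open and the closed box with the same
  corners, which have equal measure.\<close>

lemma emeasure_grid_cell:
  fixes x :: "'a::euclidean_space"
  assumes d: "0 < d"
  shows "emeasure lborel {y. grid d y = grid d x} = ennreal (d ^ DIM('a))"
proof -
  let ?l = "d *\<^sub>R grid d x" and ?u = "d *\<^sub>R (grid d x + One)"
  have iff: "grid d y = grid d x \<longleftrightarrow> (\<forall>b\<in>Basis. ?l \<bullet> b \<le> y \<bullet> b \<and> y \<bullet> b < ?u \<bullet> b)" for y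
  proof -
    have "grid d y = grid d x \<longleftrightarrow> (\<forall>b\<in>Basis. \<lfloor>(y \<bullet> b) / d\<rfloor> = \<lfloor>(x \<bullet> b) / d\<rfloor>)"
      unfolding euclidean_eq_iff[of "grid d y"] by (simp add: grid_inner)
    also have "\<dots> \<longleftrightarrow> (\<forall>b\<in>Basis. ?l \<bullet> b \<le> y \<bullet> b \<and> y \<bullet> b < ?u \<bullet> b)"
    proof (intro ball_cong refl)
      fix b :: 'a assume b: "b \<in> Basis"
      have "?l \<bullet> b = d * of_int \<lfloor>(x \<bullet> b) / d\<rfloor>" "?u \<bullet> b = d * (of_int \<lfloor>(x \<bullet> b) / d\<rfloor> + 1)"
        using b by (simp_all add: grid_inner inner_simps)
      moreover have "\<lfloor>(y \<bullet> b) / d\<rfloor> = \<lfloor>(x \<bullet> b) / d\<rfloor> \<longleftrightarrow>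
          of_int \<lfloor>(x \<bullet> b) / d\<rfloor> \<le> (y \<bullet> b) / d \<and> (y \<bullet> b) / d < of_int \<lfloor>(x \<bullet> b) / d\<rfloor> + 1"
        by (rule floor_eq_iff)
      ultimately show "\<lfloor>(y \<bullet> b) / d\<rfloor> = \<lfloor>(x \<bullet> b) / d\<rfloor> \<longleftrightarrow> ?l \<bullet> b \<le> y \<bullet> b \<and> y \<bullet> b < ?u \<bullet> b"
        using d by (simp add: pos_le_divide_eq pos_divide_less_eq mult.commute)
    qed
    finally show ?thesis .
  qed
  have lu: "\<forall>b\<in>Basis. ?l \<bullet> b \<le> ?u \<bullet> b" using d by (simp add: inner_simps)
  have "(\<Prod>b\<in>Basis. (?u - ?l) \<bullet> b) = (\<Prod>b\<in>(Basis :: 'a set). d)"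
    by (intro prod.cong refl) (simp add: inner_simps algebra_simps)
  also have "\<dots> = d ^ DIM('a)" by simp
  finally have P: "(\<Prod>b\<in>Basis. (?u - ?l) \<bullet> b) = d ^ DIM('a)" .
  have [measurable]: "{y. grid d y = grid d x} \<in> sets lborel" by measurable
  have "emeasure lborel (box ?l ?u) = ennreal (d ^ DIM('a))" "emeasure lborel (cbox ?l ?u) = ennreal (d ^ DIM('a))"
    by (simp_all only: emeasure_lborel_box_eq emeasure_lborel_cbox_eq if_P[OF lu] P)
  moreover have "emeasure lborel (box ?l ?u) \<le> emeasure lborel {y. grid d y = grid d x}"
    by (rule emeasure_mono) (auto simp: iff mem_box less_imp_le)
  moreover have "emeasure lborel {y. grid d y = grid d x} \<le> emeasure lborel (cbox ?l ?u)"
    by (rule emeasure_mono) (auto simp: iff mem_box less_imp_le)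
  ultimately show ?thesis by simp
qed

text \<open>The variance identity on a set of measure \<open>m\<close>. It separates the
  oscillation, which a gradient controls, from the mean value, which is a single number per cell and
  hence suited to compactness.\<close>

lemma second_moment_split:
  fixes g :: "'a \<Rightarrow> real"
  assumes [measurable]: "Q \<in> sets M" and Q: "emeasure M Q = ennreal m" "0 < m"
    and g: "integrable M g" "integrable M (\<lambda>x. (g x)\<^sup>2)"
  shows "ennreal (2 * m * (LINT x|M. indicator Q x * (g x)\<^sup>2)) =
    (\<integral>\<^sup>+ x. \<integral>\<^sup>+ y. indicator Q x * indicator Q y * ennreal ((g x - g y)\<^sup>2) \<partial>M \<partial>M) +
    ennreal (2 * (LINT x|M. indicator Q x * g x)\<^sup>2)"
proof -
  have [measurable]: "g \<in> borel_measurable M" using g by auto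
  define I1 where "I1 = (LINT x|M. indicator Q x * g x)"
  define I2 where "I2 = (LINT x|M. indicator Q x * (g x)\<^sup>2)"
  have i0: "integrable M (indicator Q :: 'a \<Rightarrow> real)" "(LINT x|M. indicator Q x) = m"
    using Q by (auto simp: integrable_indicator_iff measure_def less_top intro!: integrable_real_indicator)
  have i1: "integrable M (\<lambda>x. indicator Q x * g x)" "integrable M (\<lambda>x. indicator Q x * (g x)\<^sup>2)"
    using integrable_mult_indicator[OF assms(1) g(1)] integrable_mult_indicator[OF assms(1) g(2)] by simp_all
  have eq: "indicator Q y * (g x - g y)\<^sup>2 = (g x)\<^sup>2 * indicator Q y - 2 * g x * (indicator Q y * g y) + indicator Q y * (g y)\<^sup>2" for x y
    by (simp add: power2_diff algebra_simps)
  have inner_int: "integrable M (\<lambda>y. indicator Q y * (g x - g y)\<^sup>2)" for x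
    unfolding eq using i0 i1 by simp
  have inner: "(LINT y|M. indicator Q y * (g x - g y)\<^sup>2) = m * (g x)\<^sup>2 - 2 * g x * I1 + I2" for x
    unfolding eq using i0 i1 by (simp add: I1_def I2_def)
  have nni: "(\<integral>\<^sup>+ y. indicator Q x * indicator Q y * ennreal ((g x - g y)\<^sup>2) \<partial>M) =
      ennreal (indicator Q x * (m * (g x)\<^sup>2 - 2 * g x * I1 + I2))" for x
  proof -
    have "(\<integral>\<^sup>+ y. indicator Q x * indicator Q y * ennreal ((g x - g y)\<^sup>2) \<partial>M) =
      indicator Q x * (\<integral>\<^sup>+ y. ennreal (indicator Q y * (g x - g y)\<^sup>2) \<partial>M)"
      by (subst nn_integral_cmult[symmetric]) (auto intro!: nn_integral_cong simp: indicator_def)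
    also have "(\<integral>\<^sup>+ y. ennreal (indicator Q y * (g x - g y)\<^sup>2) \<partial>M) = ennreal (m * (g x)\<^sup>2 - 2 * g x * I1 + I2)"
      unfolding inner[symmetric] by (rule nn_integral_eq_integral[OF inner_int]) simp
    finally show ?thesis by (simp add: indicator_def)
  qed
  have nn: "0 \<le> m * (g x)\<^sup>2 - 2 * g x * I1 + I2" for x
    unfolding inner[symmetric] by (rule integral_nonneg_AE) simp
  have eq2: "indicator Q x * (m * (g x)\<^sup>2 - 2 * g x * I1 + I2) =
     m * (indicator Q x * (g x)\<^sup>2) - 2 * I1 * (indicator Q x * g x) + I2 * indicator Q x" for x
    by (simp add: algebra_simps)
  have i2: "integrable M (\<lambda>x. indicator Q x * (m * (g x)\<^sup>2 - 2 * g x * I1 + I2))"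
    unfolding eq2 using i0 i1 by simp
  have "(LINT x|M. indicator Q x * (m * (g x)\<^sup>2 - 2 * g x * I1 + I2)) = 2 * m * I2 - 2 * I1\<^sup>2"
  proof -
    have "(LINT x|M. indicator Q x * (m * (g x)\<^sup>2 - 2 * g x * I1 + I2)) = m * I2 - 2 * I1 * I1 + I2 * m"
      unfolding eq2 using i0 i1 by (simp add: I1_def[symmetric] I2_def[symmetric])
    then show ?thesis by (simp add: power2_eq_square)
  qed
  then have "(\<integral>\<^sup>+ x. \<integral>\<^sup>+ y. indicator Q x * indicator Q y * ennreal ((g x - g y)\<^sup>2) \<partial>M \<partial>M) = ennreal (2 * m * I2 - 2 * I1\<^sup>2)"
    unfolding nni using nn_integral_eq_integral[OF i2] nn by simp
  moreover have "0 \<le> 2 * m * I2 - 2 * I1\<^sup>2"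
  proof -
    have "0 \<le> (LINT x|M. indicator Q x * (m * (g x)\<^sup>2 - 2 * g x * I1 + I2))"
      using nn by (intro integral_nonneg_AE) simp
    then show ?thesis using \<open>_ = 2 * m * I2 - 2 * I1\<^sup>2\<close> by simp
  qed
  ultimately show ?thesis
    unfolding I1_def[symmetric] I2_def[symmetric] by (simp add: ennreal_plus[symmetric] del: ennreal_plus)
qed

lemma test_function_sq_int:
  assumes "f \<in> test_functions \<Omega>"
  shows "sq_int lborel f" "sq_int lborel (tgrad f)" "integrable lborel f" "continuous_on UNIV f" "continuous_on UNIV (tgrad f)"
    "\<exists>C. \<forall>x. \<bar>f x\<bar> \<le> C" "\<exists>C. \<forall>x. norm (tgrad f x) \<le> C"
proof -
  obtain K where K: "\<And>k. Ck k f" "compact K" "\<And>x. x \<notin> K \<Longrightarrow> f x = 0"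
    using test_functionsD[OF assms] by blast
  show cf: "continuous_on UNIV f" by (rule Ck_continuous[OF K(1)[of 0]])
  show cg: "continuous_on UNIV (tgrad f)" by (rule continuous_tgrad[OF K(1)])
  have K': "tgrad f x = 0" if "x \<notin> K" for x using tgrad_outside[OF K(2,3) that] .
  show "integrable lborel f" "\<exists>C. \<forall>x. \<bar>f x\<bar> \<le> C" using test_integrable[OF cf K(2,3)] by auto
  show "\<exists>C. \<forall>x. norm (tgrad f x) \<le> C" by (rule test_integrable(2)[OF cg K(2) K'])
  have "integrable lborel (\<lambda>x. (norm (f x))\<^sup>2)"
    by (rule test_integrable(1)[OF _ K(2)]) (auto intro!: continuous_intros cf simp: K(3))
  then show "sq_int lborel f" using borel_measurable_continuous_onI[OF cf] by (simp add: sq_int_def)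
  have "integrable lborel (\<lambda>x. (norm (tgrad f x))\<^sup>2)"
    by (rule test_integrable(1)[OF _ K(2)]) (auto intro!: continuous_intros cg simp: K')
  then show "sq_int lborel (tgrad f)" using borel_measurable_continuous_onI[OF cg] by (simp add: sq_int_def)
qed

text \<open>The variance identity is summed over the cells that meet the domain. Points of one cell
  are at distance at most \<rho> = DIM d, so the oscillation is bounded by the gradient; the ball of
  radius \<rho> is enclosed in a cube of side 2\<rho>. After division by the cell volume the
  gradient term is of order d^2, which is the gain from a fine mesh.\<close>

lemma grid_estimate:
  fixes f :: "'a::euclidean_space \<Rightarrow> real"
  assumes f: "f \<in> test_functions \<Omega>" and \<Omega>: "bounded \<Omega>" and d: "0 < d"
  shows "2 * d ^ DIM('a) * nsq lborel f \<le>
    (real DIM('a) * d)\<^sup>2 * (2 * (real DIM('a) * d)) ^ DIM('a) * nsq lborel (tgrad f) +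
    2 * (\<Sum>v\<in>grid d ` \<Omega>. (LINT x|lborel. indicator {y. grid d y = v} x * f x)\<^sup>2)"
proof -
  let ?V = "grid d ` \<Omega>" and ?Q = "\<lambda>v. {y. grid d y = v}" and ?m = "d ^ DIM('a)"
  define \<rho> where "\<rho> = real DIM('a) * d"
  have \<rho>: "0 \<le> \<rho>" using d by (simp add: \<rho>_def)
  have fin: "finite ?V" by (rule finite_grid_image[OF \<Omega> d])
  note tf = test_function_sq_int[OF f]
  have [measurable]: "f \<in> borel_measurable borel" using tf(1) by (simp add: sq_int_def)
  have [measurable]: "?Q v \<in> sets lborel" for v by measurable
  have f2: "integrable lborel (\<lambda>x. (f x)\<^sup>2)" using tf(1) by (simp add: sq_int_def)
  obtain K where K: "K \<subseteq> \<Omega>" "\<And>x. x \<notin> K \<Longrightarrow> f x = 0" using test_functionsD[OF f] by blast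
  have part: "(\<Sum>v\<in>?V. indicator (?Q v) x * (f x)\<^sup>2) = (f x)\<^sup>2" for x
  proof (cases "x \<in> \<Omega>")
    case True
    have "(\<Sum>v\<in>?V. indicator (?Q v) x * (f x)\<^sup>2) = (\<Sum>v\<in>?V. if grid d x = v then (f x)\<^sup>2 else 0)"
      by (intro sum.cong) (auto simp: indicator_def)
    then show ?thesis using fin True by (simp add: sum.delta)
  next
    case False
    then have "f x = 0" using K by blast
    then show ?thesis by simp
  qed
  have "2 * ?m * nsq lborel f = (\<Sum>v\<in>?V. 2 * ?m * (LINT x|lborel. indicator (?Q v) x * (f x)\<^sup>2))"
  proof -
    have "nsq lborel f = (LINT x|lborel. (\<Sum>v\<in>?V. indicator (?Q v) x * (f x)\<^sup>2))"
      unfolding part by (simp add: nsq_def)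
    also have "\<dots> = (\<Sum>v\<in>?V. (LINT x|lborel. indicator (?Q v) x * (f x)\<^sup>2))"
      using integrable_mult_indicator[OF _ f2] by (intro Bochner_Integration.integral_sum) simp
    finally show ?thesis by (simp add: sum_distrib_left)
  qed
  then have "ennreal (2 * ?m * nsq lborel f) = (\<Sum>v\<in>?V. ennreal (2 * ?m * (LINT x|lborel. indicator (?Q v) x * (f x)\<^sup>2)))"
    using d by (simp add: sum_ennreal integral_nonneg_AE)
  also have "\<dots> = (\<Sum>v\<in>?V. (\<integral>\<^sup>+ x. \<integral>\<^sup>+ y. indicator (?Q v) x * indicator (?Q v) y * ennreal ((f x - f y)\<^sup>2) \<partial>lborel \<partial>lborel) +
      ennreal (2 * (LINT x|lborel. indicator (?Q v) x * f x)\<^sup>2))"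
  proof (intro sum.cong refl second_moment_split tf f2)
    fix v assume "v \<in> ?V"
    then obtain x where "v = grid d x" by blast
    then show "emeasure lborel (?Q v) = ennreal ?m" using emeasure_grid_cell[OF d, of x] by simp
  qed (use d in auto)
  also have "\<dots> = (\<Sum>v\<in>?V. (\<integral>\<^sup>+ x. \<integral>\<^sup>+ y. indicator (?Q v) x * indicator (?Q v) y * ennreal ((f x - f y)\<^sup>2) \<partial>lborel \<partial>lborel)) +
      ennreal (2 * (\<Sum>v\<in>?V. (LINT x|lborel. indicator (?Q v) x * f x)\<^sup>2))"
    by (simp add: sum.distrib sum_ennreal sum_distrib_left)
  also have "(\<Sum>v\<in>?V. (\<integral>\<^sup>+ x. \<integral>\<^sup>+ y. indicator (?Q v) x * indicator (?Q v) y * ennreal ((f x - f y)\<^sup>2) \<partial>lborel \<partial>lborel)) =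
     (\<integral>\<^sup>+ x. \<integral>\<^sup>+ y. (\<Sum>v\<in>?V. indicator (?Q v) x * indicator (?Q v) y * ennreal ((f x - f y)\<^sup>2)) \<partial>lborel \<partial>lborel)"
    by (simp add: nn_integral_sum)
  also have "\<dots> \<le> (\<integral>\<^sup>+ x. \<integral>\<^sup>+ y. indicator {(x, y). grid d x = grid d y} (x, y) * ennreal ((f x - f y)\<^sup>2) \<partial>lborel \<partial>lborel)"
  proof (intro nn_integral_mono)
    fix x y
    have "(\<Sum>v\<in>?V. indicator (?Q v) x * indicator (?Q v) y * ennreal ((f x - f y)\<^sup>2)) =
      (\<Sum>v\<in>?V. if grid d x = v then indicator {(x, y). grid d x = grid d y} (x, y) * ennreal ((f x - f y)\<^sup>2) else 0)"
      by (intro sum.cong) (auto simp: indicator_def)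
    then show "(\<Sum>v\<in>?V. indicator (?Q v) x * indicator (?Q v) y * ennreal ((f x - f y)\<^sup>2)) \<le>
      indicator {(x, y). grid d x = grid d y} (x, y) * ennreal ((f x - f y)\<^sup>2)"
      using fin by (simp add: sum.delta)
  qed
  also have "\<dots> \<le> ennreal (\<rho>\<^sup>2) * emeasure lborel (cball (0::'a) \<rho>) * (\<integral>\<^sup>+ x. indicator UNIV x * ennreal ((norm (tgrad f x))\<^sup>2) \<partial>lborel)"
  proof (rule double_integral_increment_le[OF f])
    show "{(x, y :: 'a). grid d x = grid d y} \<in> sets (borel \<Otimes>\<^sub>M borel)"
    proof -
      have "{w \<in> space (borel \<Otimes>\<^sub>M borel). grid d (fst w) = grid d (snd w :: 'a)} \<in> sets (borel \<Otimes>\<^sub>M borel)"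
        by measurable
      then show ?thesis by (simp add: space_pair_measure split_def)
    qed
    show "norm (y - x) \<le> \<rho>" if "(x, y) \<in> {(x, y :: 'a). grid d x = grid d y}" for x y
      using grid_eq_imp_norm_le[OF d, of x y] that by (simp add: \<rho>_def)
  qed auto
  also have "\<dots> \<le> ennreal (\<rho>\<^sup>2) * ennreal ((2 * \<rho>) ^ DIM('a)) * ennreal (nsq lborel (tgrad f))"
  proof (intro mult_mono)
    have "cball (0::'a) \<rho> \<subseteq> cbox (- (\<rho> *\<^sub>R One)) (\<rho> *\<^sub>R One)"
    proof
      fix x :: 'a assume "x \<in> cball 0 \<rho>"
      then have "\<bar>x \<bullet> b\<bar> \<le> \<rho>" if "b \<in> Basis" for b using Basis_le_norm[OF that, of x] by simp
      then show "x \<in> cbox (- (\<rho> *\<^sub>R One)) (\<rho> *\<^sub>R One)" by (force simp: mem_box abs_le_iff)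
    qed
    then have "emeasure lborel (cball (0::'a) \<rho>) \<le> emeasure lborel (cbox (- (\<rho> *\<^sub>R One)) (\<rho> *\<^sub>R One :: 'a))"
      by (intro emeasure_mono) auto
    also have "\<dots> = ennreal (\<Prod>b\<in>(Basis::'a set). (\<rho> *\<^sub>R One - (- (\<rho> *\<^sub>R One))) \<bullet> b)"
      using \<rho> by (subst emeasure_lborel_cbox_eq) (simp add: inner_simps)
    also have "(\<Prod>b\<in>(Basis::'a set). (\<rho> *\<^sub>R One - (- (\<rho> *\<^sub>R One))) \<bullet> b) = (\<Prod>b\<in>(Basis::'a set). 2 * \<rho>)"
      by (intro prod.cong refl) (simp add: inner_simps)
    finally show "emeasure lborel (cball (0::'a) \<rho>) \<le> ennreal ((2 * \<rho>) ^ DIM('a))" by simp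
    show "(\<integral>\<^sup>+ x. indicator UNIV x * ennreal ((norm (tgrad f x))\<^sup>2) \<partial>lborel) \<le> ennreal (nsq lborel (tgrad f))"
      using nn_integral_norm_sq[OF tf(2)] by simp
  qed auto
  also have "\<dots> = ennreal (\<rho>\<^sup>2 * (2 * \<rho>) ^ DIM('a) * nsq lborel (tgrad f))"
    using \<rho> by (simp add: ennreal_mult)
  finally have "ennreal (2 * ?m * nsq lborel f) \<le> ennreal (\<rho>\<^sup>2 * (2 * \<rho>) ^ DIM('a) * nsq lborel (tgrad f)) +
      ennreal (2 * (\<Sum>v\<in>?V. (LINT x|lborel. indicator (?Q v) x * f x)\<^sup>2))"
    by (simp add: add_right_mono)
  also have "\<dots> = ennreal (\<rho>\<^sup>2 * (2 * \<rho>) ^ DIM('a) * nsq lborel (tgrad f) + 2 * (\<Sum>v\<in>?V. (LINT x|lborel. indicator (?Q v) x * f x)\<^sup>2))"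
    using \<rho> by (intro ennreal_plus[symmetric] mult_nonneg_nonneg sum_nonneg) auto
  finally have "2 * ?m * nsq lborel f \<le> \<rho>\<^sup>2 * (2 * \<rho>) ^ DIM('a) * nsq lborel (tgrad f) + 2 * (\<Sum>v\<in>?V. (LINT x|lborel. indicator (?Q v) x * f x)\<^sup>2)"
    using \<rho> by (subst (asm) ennreal_le_iff) (auto intro!: add_nonneg_nonneg mult_nonneg_nonneg sum_nonneg)
  then show ?thesis by (simp add: \<rho>_def)
qed

text \<open>The cell integrals for all mesh sizes 1/(k+1) form a countable family of bounded
  sequences, so a single subsequence makes all of them converge. For a given tolerance a fine mesh
  makes the gradient part small, and then only finitely many convergent cell integrals
  remain.\<close>

lemma Rellich_test_functions:
  fixes \<phi> :: "nat \<Rightarrow> 'a::euclidean_space \<Rightarrow> real"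
  assumes \<phi>: "\<And>n. \<phi> n \<in> test_functions \<Omega>" and \<Omega>: "bounded \<Omega>"
    and R: "\<And>n. nsq lborel (\<phi> n) + nsq lborel (tgrad (\<phi> n)) \<le> R"
  shows "\<exists>r. strict_mono (r :: nat \<Rightarrow> nat) \<and>
    (\<forall>e>0. \<exists>N. \<forall>m\<ge>N. \<forall>n\<ge>N. nsq lborel (\<lambda>x. \<phi> (r m) x - \<phi> (r n) x) < e)"
proof -
  let ?D = "DIM('a)"
  let ?Q = "\<lambda>d v. {y. grid d y = (v :: 'a)}"
  define dl where "dl k = 1 / real (Suc k)" for k
  have dl: "0 < dl k" "dl k \<le> 1" for k by (auto simp: dl_def)
  define S where "S = (SIGMA k:UNIV. grid (dl k) ` \<Omega>)"
  define F where "F n w = (LINT x|lborel. indicator (?Q (dl (fst w)) (snd w)) x * \<phi> n x)" for n w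
  have R0: "0 \<le> R" using R[of 0] by (smt (verit) nsq_nonneg)
  have cS: "countable S" unfolding S_def
    by (intro countable_SIGMA) (auto intro: countable_finite finite_grid_image[OF \<Omega> dl(1)])
  have Fb: "norm (F n w) \<le> sqrt R" if wS: "w \<in> S" for n w
  proof -
    obtain k x where w: "w = (k, grid (dl k) x)" using wS unfolding S_def by auto
    let ?I = "indicator (?Q (dl k) (grid (dl k) x)) :: 'a \<Rightarrow> real"
    have [measurable]: "?Q (dl k) (grid (dl k) x) \<in> sets lborel" by measurable
    have em: "emeasure lborel (?Q (dl k) (grid (dl k) x)) = ennreal (dl k ^ ?D)" by (rule emeasure_grid_cell[OF dl(1)])
    have "(\<integral>\<^sup>+ y. ennreal ((norm (?I y))\<^sup>2) \<partial>lborel) = (\<integral>\<^sup>+ y. indicator (?Q (dl k) (grid (dl k) x)) y \<partial>lborel)"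
      by (intro nn_integral_cong) (simp add: indicator_def)
    also have "\<dots> = ennreal (dl k ^ ?D)" using em by simp
    also have "\<dots> \<le> ennreal 1" using dl by (intro ennreal_leI power_le_one) (auto intro: less_imp_le)
    finally have I: "sq_int lborel ?I" "nsq lborel ?I \<le> 1" using sq_int_nn[of ?I lborel 1] by auto
    have "\<bar>F n w\<bar> \<le> sqrt (nsq lborel ?I) * sqrt (nsq lborel (\<phi> n))"
      using L2_Cauchy_Schwarz_sqrt[OF I(1) test_function_sq_int(1)[OF \<phi>]] by (simp add: F_def w)
    also have "\<dots> \<le> 1 * sqrt R"
    proof -
      have "nsq lborel (\<phi> n) \<le> R" using R[of n] nsq_nonneg[of lborel "tgrad (\<phi> n)"] by linarith
      then show ?thesis using I(2) by (intro mult_mono) auto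
    qed
    finally show ?thesis by simp
  qed
  obtain r where r: "strict_mono (r :: nat \<Rightarrow> nat)" "\<And>w. w \<in> S \<Longrightarrow> \<exists>l. (\<lambda>n. F (r n) w) \<longlonglongrightarrow> l"
    using function_convergent_subsequence[of S F "sqrt R", OF cS Fb] by blast
  have "\<exists>N. \<forall>m\<ge>N. \<forall>n\<ge>N. nsq lborel (\<lambda>x. \<phi> (r m) x - \<phi> (r n) x) < e" if e: "e > 0" for e
  proof -
    \<comment> \<open>Coefficient of d^2 in the gradient term of \<open>grid_estimate\<close>,
      relative to the cell volume; 4R bounds the squared gradient norm of a difference of two
      members.\<close>
    define C where "C = (real ?D)\<^sup>2 * (2 * real ?D) ^ ?D * (4 * R)"
    have C0: "0 \<le> C" using R0 by (simp add: C_def)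
    obtain k where k: "C / e < real k" using reals_Archimedean2 by blast
    define d where "d = dl k"
    have d: "0 < d" "d \<le> 1" using dl by (auto simp: d_def)
    have Cd: "C * d < e"
    proof -
      have "C < real (Suc k) * e" using k e by (simp add: field_simps)
      then show ?thesis by (simp add: d_def dl_def field_simps)
    qed
    let ?V = "grid d ` \<Omega>"
    have fin: "finite ?V" by (rule finite_grid_image[OF \<Omega> d(1)])
    have "\<exists>l. \<forall>v\<in>?V. (\<lambda>n. F (r n) (k, v)) \<longlonglongrightarrow> l v"
      using r(2) unfolding S_def d_def by (intro bchoice) auto
    then obtain l where l: "\<And>v. v \<in> ?V \<Longrightarrow> (\<lambda>n. F (r n) (k, v)) \<longlonglongrightarrow> l v" by blast
    have "(\<lambda>n. \<Sum>v\<in>?V. (F (r n) (k, v) - l v)\<^sup>2) \<longlonglongrightarrow> (\<Sum>v\<in>?V. (l v - l v)\<^sup>2)"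
      by (intro tendsto_intros l)
    then have "(\<lambda>n. \<Sum>v\<in>?V. (F (r n) (k, v) - l v)\<^sup>2) \<longlonglongrightarrow> 0" by simp
    moreover have "0 < e * d ^ ?D / 8" using e d by simp
    ultimately have "eventually (\<lambda>n. (\<Sum>v\<in>?V. (F (r n) (k, v) - l v)\<^sup>2) < e * d ^ ?D / 8) sequentially"
      by (rule order_tendstoD(2))
    then obtain N where N: "\<And>n. n \<ge> N \<Longrightarrow> (\<Sum>v\<in>?V. (F (r n) (k, v) - l v)\<^sup>2) < e * d ^ ?D / 8"
      unfolding eventually_sequentially by blast
    have "nsq lborel (\<lambda>x. \<phi> (r m) x - \<phi> (r n) x) < e" if mn: "m \<ge> N" "n \<ge> N" for m n
    proof -
      let ?g = "\<lambda>x. \<phi> (r m) x - \<phi> (r n) x"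
      have g: "?g \<in> test_functions \<Omega>" by (intro test_function_diff \<phi>)
      note t = test_function_sq_int[OF \<phi>]
      have "tgrad ?g = (\<lambda>x. tgrad (\<phi> (r m)) x - tgrad (\<phi> (r n)) x)"
        using tgrad_diff[OF test_function_Ck[OF \<phi>] test_function_Ck[OF \<phi>]] by blast
      then have "nsq lborel (tgrad ?g) \<le> 2 * nsq lborel (tgrad (\<phi> (r m))) + 2 * nsq lborel (tgrad (\<phi> (r n)))"
        using nsq_triangle[OF t(2)[of "r m"] sq_int_zero t(2)[of "r n"]] by (simp add: nsq_def)
      also have "\<dots> \<le> 4 * R" using R[of "r m"] R[of "r n"] nsq_nonneg[of lborel "\<phi> (r m)"] nsq_nonneg[of lborel "\<phi> (r n)"]
        by linarith
      finally have tg: "nsq lborel (tgrad ?g) \<le> 4 * R" .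
      have Fg: "(LINT x|lborel. indicator (?Q d v) x * ?g x) = F (r m) (k, v) - F (r n) (k, v)" for v
      proof -
        have [measurable]: "?Q d v \<in> sets lborel" by measurable
        have "integrable lborel (\<lambda>x. indicator (?Q d v) x * \<phi> n x)" for n
          using integrable_mult_indicator[OF _ t(3)[of n], of "?Q d v"] by simp
        then show ?thesis by (simp add: F_def d_def[symmetric] right_diff_distrib)
      qed
      have "2 * d ^ ?D * nsq lborel ?g \<le>
        (real ?D * d)\<^sup>2 * (2 * (real ?D * d)) ^ ?D * nsq lborel (tgrad ?g) +
        2 * (\<Sum>v\<in>?V. (F (r m) (k, v) - F (r n) (k, v))\<^sup>2)"
        using grid_estimate[OF g \<Omega> d(1)] unfolding Fg .
      also have "(real ?D * d)\<^sup>2 * (2 * (real ?D * d)) ^ ?D * nsq lborel (tgrad ?g) \<le>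
        (real ?D * d)\<^sup>2 * (2 * (real ?D * d)) ^ ?D * (4 * R)"
        using tg d by (intro mult_left_mono) auto
      also have "\<dots> = C * d\<^sup>2 * d ^ ?D" by (simp add: C_def power_mult_distrib)
      also have "\<dots> \<le> C * d * d ^ ?D"
        using C0 d by (intro mult_right_mono mult_left_mono) (auto simp: power2_eq_square mult_left_le)
      also have "(\<Sum>v\<in>?V. (F (r m) (k, v) - F (r n) (k, v))\<^sup>2) \<le>
         (\<Sum>v\<in>?V. 2 * (F (r m) (k, v) - l v)\<^sup>2 + 2 * (F (r n) (k, v) - l v)\<^sup>2)"
      proof (intro sum_mono)
        fix v
        show "(F (r m) (k, v) - F (r n) (k, v))\<^sup>2 \<le> 2 * (F (r m) (k, v) - l v)\<^sup>2 + 2 * (F (r n) (k, v) - l v)\<^sup>2"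
          using norm_diff_sq_le[of "F (r m) (k, v) - l v" "F (r n) (k, v) - l v"] by simp
      qed
      also have "\<dots> \<le> e * d ^ ?D / 2"
        using N[OF mn(1)] N[OF mn(2)] by (simp add: sum.distrib flip: sum_distrib_left)
      finally have "2 * d ^ ?D * nsq lborel ?g \<le> C * d * d ^ ?D + 2 * (e * d ^ ?D / 2)" by simp
      also have "\<dots> < e * d ^ ?D + e * d ^ ?D" using Cd d(1) by simp
      also have "\<dots> = (2 * d ^ ?D) * e" by simp
      finally have "(2 * d ^ ?D) * nsq lborel ?g < (2 * d ^ ?D) * e" .
      then show ?thesis using d(1) by (simp add: mult_less_cancel_left)
    qed
    then show ?thesis by blast
  qed
  with r(1) show ?thesis by blast
qed

section \<open>The Sobolev space with zero boundary values\<close>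

lemma open_Union_cbox_countable:
  assumes "open (\<Omega> :: 'a::euclidean_space set)"
  shows "\<exists>D. countable D \<and> (\<forall>(a, b)\<in>D. cbox a b \<subseteq> \<Omega>) \<and> (\<Union>(a, b)\<in>D. box a b) = \<Omega>"
proof -
  define P where "P = {(a, b). cbox a b \<subseteq> \<Omega>}"
  define F where "F = (\<lambda>(a, b). box a b) ` P"
  have "\<Union>F = \<Omega>"
  proof
    show "\<Union>F \<subseteq> \<Omega>" using box_subset_cbox by (force simp: F_def P_def)
    show "\<Omega> \<subseteq> \<Union>F"
    proof
      fix x assume x: "x \<in> \<Omega>"
      obtain a b where "cbox a b \<subseteq> \<Omega>" "x \<in> box a b"
        by (rule open_contains_cbox[OF assms x])
      then show "x \<in> \<Union>F" by (auto simp: F_def P_def)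
    qed
  qed
  moreover have op: "open S" if "S \<in> F" for S using that by (auto simp: F_def)
  obtain F' where F': "F' \<subseteq> F" "countable F'" "\<Union>F' = \<Union>F"
    by (rule Lindelof[OF op])
  moreover obtain D where "D \<subseteq> P" "F' = (\<lambda>(a, b). box a b) ` D" "countable D"
    using countable_subset_image[of F' "\<lambda>(a, b). box a b" P] F' unfolding F_def by blast
  ultimately show ?thesis by (intro exI[of _ D]) (auto simp: P_def)
qed

lemma lebesgue_on_integral_test:
  fixes F :: "'a::euclidean_space \<Rightarrow> 'b::euclidean_space"
  assumes "\<Omega> \<in> sets lebesgue" "F \<in> borel_measurable borel" "\<And>x. x \<notin> \<Omega> \<Longrightarrow> F x = 0"
  shows "(LINT x|lebesgue_on \<Omega>. F x) = (LINT x|lborel. F x)"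
    "integrable (lebesgue_on \<Omega>) F \<longleftrightarrow> integrable lborel F"
proof -
  have eq: "(\<lambda>x. indicator \<Omega> x *\<^sub>R F x) = F" using assms(3) by (auto simp: indicator_def fun_eq_iff)
  show "(LINT x|lebesgue_on \<Omega>. F x) = (LINT x|lborel. F x)"
    using assms(1,2) by (simp add: integral_restrict_space eq integral_completion)
  show "integrable (lebesgue_on \<Omega>) F \<longleftrightarrow> integrable lborel F"
    using assms(1,2) by (simp add: integrable_restrict_space eq integrable_completion)
qed

lemma AE_lebesgue_on_iff:
  "\<Omega> \<in> sets lebesgue \<Longrightarrow> (AE x in lebesgue_on \<Omega>. P x) \<longleftrightarrow> (AE x in lebesgue. x \<in> \<Omega> \<longrightarrow> P x)"
  by (subst AE_restrict_space_iff) auto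

text \<open>An empty open box may have corners whose closed box is not empty and leaves the domain.
  In that case it is replaced by a box whose closed version is empty too.\<close>

lemma box_Int_box_subset_cbox:
  fixes a b l u :: "'a::euclidean_space"
  assumes "cbox a b \<subseteq> \<Omega>"
  shows "\<exists>l' u'. box l u \<inter> box a b = box l' u' \<and> cbox l' u' \<subseteq> \<Omega>"
proof -
  obtain l' u' where lu: "box l u \<inter> box a b = box l' u'" using box_Int_box by blast
  show ?thesis
  proof (cases "box l' u' = {}")
    case True
    then show ?thesis proof (intro exI conjI)
      have "box One (0 :: 'a) = {}" "cbox One (0 :: 'a) = {}"
        unfolding box_eq_empty by (rule bexI[OF _ SOME_Basis], simp add: SOME_Basis)+
      then show "box l u \<inter> box a b = box One 0" "cbox One (0 :: 'a) \<subseteq> \<Omega>"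
        using lu True by auto
    qed
  next
    case False
    have "cbox l' u' = closure (box l' u')" using closure_box[OF False] by simp
    also have "\<dots> \<subseteq> cbox a b"
      using lu box_subset_cbox[of a b] by (intro closure_minimal closed_cbox) blast
    finally show ?thesis using lu assms by blast
  qed
qed

text \<open>Smooth approximations of box indicators show that the integral of \<open>G\<close>
  vanishes over every box whose closure lies in the domain. Cut off to one such box,
  \<open>G\<close> is integrable on the whole space and hence zero almost everywhere there;
  countably many boxes cover the domain.\<close>

lemma fundamental_lemma_variations:
  fixes G :: "'a::euclidean_space \<Rightarrow> real"
  assumes \<Omega>: "open \<Omega>"
    and int: "\<And>K. compact K \<Longrightarrow> K \<subseteq> \<Omega> \<Longrightarrow> integrable (lebesgue_on K) G"
    and zero: "\<And>\<phi>. \<phi> \<in> test_functions \<Omega> \<Longrightarrow> (LINT x|lebesgue_on \<Omega>. G x * \<phi> x) = 0"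
  shows "AE x in lebesgue_on \<Omega>. G x = 0"
proof -
  have [simp]: "\<Omega> \<in> sets lebesgue" using \<Omega> by (simp add: borel_open)
  have lebc: "cbox a b \<in> sets lebesgue" for a b :: 'a by simp
  have intc: "integrable lebesgue (\<lambda>x. indicator (cbox a b) x * G x)" if "cbox a b \<subseteq> \<Omega>" for a b
    using int[OF compact_cbox that] integrable_restrict_space[of "cbox a b" lebesgue G] by simp
  have box0: "(LINT x|lebesgue. indicator (box a b) x * G x) = 0" if ab: "cbox a b \<subseteq> \<Omega>" for a b
  proof -
    let ?c = "\<lambda>n x. 1 - (1 - box_bump a b x) ^ n"
    have [measurable]: "box_bump a b \<in> borel_measurable borel"
      by (rule borel_measurable_continuous_onI[OF Ck_continuous[OF Ck_box_bump[of 0]]])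
    have mc: "?c n \<in> borel_measurable lebesgue" for n
      by (rule measurable_completion) measurable
    have mG: "(\<lambda>x. indicator (cbox a b) x * G x) \<in> borel_measurable lebesgue"
      using intc[OF ab] by auto
    have eq: "?c n x * (indicator (cbox a b) x * G x) = ?c n x * G x" for n x
      using box_indicator_approx_bound[of a b x n] by (cases "x \<in> cbox a b") auto
    have "(\<lambda>n. LINT x|lebesgue. ?c n x * (indicator (cbox a b) x * G x)) \<longlonglongrightarrow>
        (LINT x|lebesgue. indicator (box a b) x * (indicator (cbox a b) x * G x))"
    proof (rule integral_dominated_convergence[where w = "\<lambda>x. \<bar>indicator (cbox a b) x * G x\<bar>"])
      show "(\<lambda>x. ?c n x * (indicator (cbox a b) x * G x)) \<in> borel_measurable lebesgue" for n
        using mc mG by (rule borel_measurable_times)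
      have "box a b \<in> sets lebesgue" by simp
      then have "(indicator (box a b) :: 'a \<Rightarrow> real) \<in> borel_measurable lebesgue" by (rule borel_measurable_indicator)
      then show "(\<lambda>x. indicator (box a b) x * (indicator (cbox a b) x * G x)) \<in> borel_measurable lebesgue"
        using mG by (rule borel_measurable_times)
      show "integrable lebesgue (\<lambda>x. \<bar>indicator (cbox a b) x * G x\<bar>)" using intc[OF ab] by (rule integrable_abs)
      show "AE x in lebesgue. (\<lambda>n. ?c n x * (indicator (cbox a b) x * G x)) \<longlonglongrightarrow> indicator (box a b) x * (indicator (cbox a b) x * G x)"
        by (intro AE_I2 tendsto_mult box_indicator_approx_limit tendsto_const)
      show "AE x in lebesgue. norm (?c n x * (indicator (cbox a b) x * G x)) \<le> \<bar>indicator (cbox a b) x * G x\<bar>" for n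
      proof (intro AE_I2)
        fix x
        have "\<bar>?c n x\<bar> \<le> 1" using box_indicator_approx_bound[of a b x n] by (cases "x \<in> cbox a b") auto
        then show "norm (?c n x * (indicator (cbox a b) x * G x)) \<le> \<bar>indicator (cbox a b) x * G x\<bar>"
          by (simp only: real_norm_def abs_mult[of "?c n x"]) (rule mult_left_le_one_le; simp)
      qed
    qed
    moreover have "(LINT x|lebesgue. ?c n x * (indicator (cbox a b) x * G x)) = 0" for n
    proof -
      have t: "?c n \<in> test_functions \<Omega>" by (rule box_indicator_approx_test[OF ab])
      have "(LINT x|lebesgue_on \<Omega>. G x * ?c n x) = (LINT x|lebesgue. indicator \<Omega> x *\<^sub>R (G x * ?c n x))"
        by (rule integral_restrict_space) simp
      also have "\<dots> = (LINT x|lebesgue. ?c n x * (indicator (cbox a b) x * G x))"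
      proof (intro Bochner_Integration.integral_cong refl)
        fix x
        show "indicator \<Omega> x *\<^sub>R (G x * ?c n x) = ?c n x * (indicator (cbox a b) x * G x)"
          unfolding eq using box_indicator_approx_bound[of a b x n] ab
          by (cases "x \<in> cbox a b") (auto simp: indicator_def)
      qed
      finally show ?thesis using zero[OF t] by simp
    qed
    ultimately have "(LINT x|lebesgue. indicator (box a b) x * (indicator (cbox a b) x * G x)) = 0"
      by (simp add: LIMSEQ_const_iff)
    moreover have "indicator (box a b) x * (indicator (cbox a b) x * G x) = indicator (box a b) x * G x" for x
      using box_subset_cbox[of a b] by (auto simp: indicator_def)
    ultimately show ?thesis by simp
  qed
  have ae: "AE x in lebesgue. x \<in> box a b \<longrightarrow> G x = 0" if ab: "cbox a b \<subseteq> \<Omega>" for a b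
  proof -
    let ?H = "\<lambda>x. indicator (box a b) x * G x"
    have iH: "integrable lebesgue ?H"
    proof -
      have "integrable lebesgue (\<lambda>x. indicator (box a b) x *\<^sub>R (indicator (cbox a b) x * G x))"
        by (rule integrable_mult_indicator[OF _ intc[OF ab]]) simp
      moreover have "(\<lambda>x. indicator (box a b) x *\<^sub>R (indicator (cbox a b) x * G x)) = ?H"
        using box_subset_cbox[of a b] by (auto simp: indicator_def fun_eq_iff)
      ultimately show ?thesis by simp
    qed
    \<comment> \<open>\<open>G\<close> is only Lebesgue measurable; a Borel representative brings
      the statement back to \<open>lborel\<close>.\<close>
    then obtain H0 where H0: "H0 \<in> borel_measurable lborel" "AE x in lborel. ?H x = H0 x"
      using completion_ex_borel_measurable_real[of ?H lborel] by auto
    have aeH: "AE x in lebesgue. ?H x = H0 x" using AE_completion[OF H0(2)] .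
    have mH0: "H0 \<in> borel_measurable lebesgue" using H0(1) by (rule measurable_completion)
    have "integrable lebesgue H0"
      using integrable_cong_AE[OF borel_measurable_integrable[OF iH] mH0 aeH] iH by simp
    then have iH0: "integrable lborel H0" using integrable_completion[OF H0(1)] by simp
    have "AE x in lborel. H0 x = 0"
    proof (rule AE_zero_if_box_integrals_zero[OF iH0])
      fix l u :: 'a
      obtain l' u' where lu: "box l u \<inter> box a b = box l' u'" "cbox l' u' \<subseteq> \<Omega>"
        using box_Int_box_subset_cbox[OF ab] by blast
      have "(LINT x|lborel. indicator (box l u) x * H0 x) = (LINT x|lebesgue. indicator (box l u) x * H0 x)"
      proof -
        have [measurable]: "H0 \<in> borel_measurable borel" using H0(1) by simp
        show ?thesis by (intro integral_completion[symmetric]) measurable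
      qed
      also have "\<dots> = (LINT x|lebesgue. indicator (box l u) x * ?H x)"
      proof (rule integral_cong_AE)
        have "box l u \<in> sets lebesgue" by simp
        then have ml: "(indicator (box l u) :: 'a \<Rightarrow> real) \<in> borel_measurable lebesgue" by (rule borel_measurable_indicator)
        show "(\<lambda>x. indicator (box l u) x * H0 x) \<in> borel_measurable lebesgue" using ml mH0 by (rule borel_measurable_times)
        show "(\<lambda>x. indicator (box l u) x * ?H x) \<in> borel_measurable lebesgue"
          using ml borel_measurable_integrable[OF iH] by (rule borel_measurable_times)
        show "AE x in lebesgue. indicator (box l u) x * H0 x = indicator (box l u) x * ?H x"
          using aeH by eventually_elim simp
      qed
      also have "\<dots> = (LINT x|lebesgue. indicator (box l' u') x * G x)"
        using lu(1) by (intro Bochner_Integration.integral_cong refl) (auto simp: indicator_def)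
      also have "\<dots> = 0" by (rule box0[OF lu(2)])
      finally show "(LINT x|lborel. indicator (box l u) x * H0 x) = 0" .
    qed
    then have "AE x in lebesgue. H0 x = 0" by (rule AE_completion)
    with aeH show ?thesis by eventually_elim (auto simp: indicator_def split: if_splits)
  qed
  obtain D where D: "countable D" "\<forall>(a, b)\<in>D. cbox a b \<subseteq> \<Omega>" "(\<Union>(a, b)\<in>D. box a b) = \<Omega>"
    using open_Union_cbox_countable[OF \<Omega>] by blast
  have "AE x in lebesgue. \<forall>w\<in>D. x \<in> box (fst w) (snd w) \<longrightarrow> G x = 0"
    using D(1,2) ae by (subst AE_ball_countable) (auto simp: split_beta)
  then have "AE x in lebesgue. x \<in> \<Omega> \<longrightarrow> G x = 0"
  proof eventually_elim
    case (elim x)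
    show ?case
    proof
      assume "x \<in> \<Omega>"
      then obtain w where "w \<in> D" "x \<in> box (fst w) (snd w)"
        unfolding D(3)[symmetric] by (auto simp: split_beta)
      with elim show "G x = 0" by blast
    qed
  qed
  then show ?thesis by (simp add: AE_lebesgue_on_iff)
qed

text \<open>A weak gradient is integrable on compact subsets by definition; measurability on the
  domain is pieced together from a countable cover by closed boxes.\<close>

lemma weak_gradient_measurable:
  assumes \<Omega>: "open \<Omega>" and g: "is_weak_gradient \<Omega> f g"
  shows "f \<in> borel_measurable (lebesgue_on \<Omega>)" "g \<in> borel_measurable (lebesgue_on \<Omega>)"
proof -
  obtain D where D: "countable D" "\<forall>(a, b)\<in>D. cbox a b \<subseteq> \<Omega>" "(\<Union>(a, b)\<in>D. box a b) = \<Omega>"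
    using open_Union_cbox_countable[OF \<Omega>] by blast
  have gen: "F \<in> borel_measurable (lebesgue_on \<Omega>)"
    if F: "\<And>a b. cbox a b \<subseteq> \<Omega> \<Longrightarrow> F \<in> borel_measurable (lebesgue_on (cbox a b))"
    for F :: "'a \<Rightarrow> 'b::euclidean_space"
  proof (rule measurable_piecewise_restrict[of "(\<lambda>(a, b). cbox a b) ` D"])
    show "countable ((\<lambda>(a, b). cbox a b) ` D)" using D(1) by simp
    show "space (lebesgue_on \<Omega>) \<subseteq> \<Union> ((\<lambda>(a, b). cbox a b) ` D)" using D(3) box_subset_cbox by fastforce
    fix X assume "X \<in> (\<lambda>(a, b). cbox a b) ` D"
    then obtain a b where X: "X = cbox a b" "cbox a b \<subseteq> \<Omega>" using D(2) by auto
    have "X \<inter> space (lebesgue_on \<Omega>) = X" using X by auto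
    then show "X \<inter> space (lebesgue_on \<Omega>) \<in> sets (lebesgue_on \<Omega>)"
      using \<Omega> X by (simp add: sets_restrict_space_iff borel_open)
    have "restrict_space (lebesgue_on \<Omega>) X = lebesgue_on (\<Omega> \<inter> X)"
      using \<Omega> X by (intro restrict_restrict_space) (auto simp: borel_open)
    also have "\<Omega> \<inter> X = cbox a b" using X by auto
    finally show "F \<in> borel_measurable (restrict_space (lebesgue_on \<Omega>) X)" using F[OF X(2)] by simp
  qed
  show "f \<in> borel_measurable (lebesgue_on \<Omega>)" "g \<in> borel_measurable (lebesgue_on \<Omega>)"
    by (intro gen; use g compact_cbox in \<open>auto simp: is_weak_gradient_def intro: borel_measurable_integrable\<close>)+
qed

lemma weak_gradient_unique:
  fixes g h :: "'a::euclidean_space \<Rightarrow> 'a"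
  assumes \<Omega>: "open \<Omega>" and g: "is_weak_gradient \<Omega> f g" and h: "is_weak_gradient \<Omega> f h"
  shows "AE x in lebesgue_on \<Omega>. g x = h x"
proof -
  have [simp]: "\<Omega> \<in> sets lebesgue" using \<Omega> by (simp add: borel_open)
  have "AE x in lebesgue_on \<Omega>. (g x - h x) \<bullet> b = 0" if b: "b \<in> Basis" for b
  proof (rule fundamental_lemma_variations[OF \<Omega>])
    fix K assume K: "compact K" "K \<subseteq> \<Omega>"
    then show "integrable (lebesgue_on K) (\<lambda>x. (g x - h x) \<bullet> b)"
      using g h unfolding is_weak_gradient_def by simp
  next
    fix \<phi> assume \<phi>: "\<phi> \<in> test_functions \<Omega>"
    obtain K where K: "compact K" "K \<subseteq> \<Omega>" "\<And>x. x \<notin> K \<Longrightarrow> \<phi> x = 0" and cp: "continuous_on UNIV \<phi>"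
      using test_functionsD[OF \<phi>] Ck_continuous by blast
    obtain C where C: "\<And>x. \<bar>\<phi> x\<bar> \<le> C" using test_integrable(2)[OF cp K(1,3)] by auto
    have [measurable]: "K \<in> sets lebesgue" using K(1) by (simp add: compact_imp_closed)
    have i: "integrable (lebesgue_on \<Omega>) (\<lambda>x. (F x \<bullet> b) * \<phi> x)" if F: "is_weak_gradient \<Omega> f F" for F
    proof -
      have "integrable (lebesgue_on K) (\<lambda>x. F x \<bullet> b)" using F K unfolding is_weak_gradient_def by simp
      then have "integrable lebesgue (\<lambda>x. indicator K x *\<^sub>R (F x \<bullet> b))" by (simp add: integrable_restrict_space)
      then have "integrable lebesgue (\<lambda>x. \<phi> x * (indicator K x *\<^sub>R (F x \<bullet> b)))"
      proof (rule Bochner_Integration.integrable_bound[OF integrable_mult_right[of C]])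
        have "\<phi> \<in> borel_measurable lebesgue"
          using borel_measurable_continuous_onI[OF cp] by (intro measurable_completion) simp
        then show "(\<lambda>x. \<phi> x * (indicator K x *\<^sub>R (F x \<bullet> b))) \<in> borel_measurable lebesgue"
          using borel_measurable_integrable[OF \<open>integrable lebesgue (\<lambda>x. indicator K x *\<^sub>R (F x \<bullet> b))\<close>]
          by (rule borel_measurable_times)
        show "AE x in lebesgue. norm (\<phi> x * (indicator K x *\<^sub>R (F x \<bullet> b))) \<le> norm (C * (indicator K x *\<^sub>R (F x \<bullet> b)))"
          using C by (intro AE_I2) (simp add: abs_mult mult_right_mono order_trans[OF _ abs_ge_self])
      qed
      moreover have "(\<lambda>x. \<phi> x * (indicator K x *\<^sub>R (F x \<bullet> b))) = (\<lambda>x. indicator \<Omega> x *\<^sub>R ((F x \<bullet> b) * \<phi> x))"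
        using K by (auto simp: indicator_def fun_eq_iff)
      ultimately show ?thesis by (simp add: integrable_restrict_space)
    qed
    have "(LINT x|lebesgue_on \<Omega>. (g x - h x) \<bullet> b * \<phi> x) =
        (LINT x|lebesgue_on \<Omega>. (g x \<bullet> b) * \<phi> x) - (LINT x|lebesgue_on \<Omega>. (h x \<bullet> b) * \<phi> x)"
      by (simp add: inner_diff_left left_diff_distrib Bochner_Integration.integral_diff[OF i[OF g] i[OF h]])
    then show "(LINT x|lebesgue_on \<Omega>. (g x - h x) \<bullet> b * \<phi> x) = 0"
      using g[unfolded is_weak_gradient_def, THEN conjunct2, rule_format, OF \<phi> b]
        h[unfolded is_weak_gradient_def, THEN conjunct2, rule_format, OF \<phi> b] by linarith
  qed
  then have "AE x in lebesgue_on \<Omega>. \<forall>b\<in>Basis. (g x - h x) \<bullet> b = 0"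
    by (subst AE_ball_countable) (auto intro: countable_finite)
  then show ?thesis by eventually_elim (auto simp: euclidean_eq_iff[where 'a='a] inner_simps)
qed

section \<open>The closure of test functions, described by pairs of a function and its
  gradient\<close>

locale open_domain =
  fixes \<Omega> :: "'a::euclidean_space set"
  assumes open_\<Omega>: "open \<Omega>"
begin

abbreviation M :: "'a measure" where "M \<equiv> lebesgue_on \<Omega>"

lemma lebesgue_\<Omega> [simp]: "\<Omega> \<in> sets lebesgue"
  using open_\<Omega> by (simp add: borel_open)

lemma borel_measurable_M: "F \<in> borel_measurable borel \<Longrightarrow> F \<in> borel_measurable M"
  by (intro measurable_restrict_space1 measurable_completion) simp

lemma test_M:
  assumes "\<phi> \<in> test_functions \<Omega>"
  shows "sq_int M \<phi>" "sq_int M (tgrad \<phi>)" "nsq M \<phi> = nsq lborel \<phi>" "nsq M (tgrad \<phi>) = nsq lborel (tgrad \<phi>)"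
    "\<And>x. x \<notin> \<Omega> \<Longrightarrow> \<phi> x = 0" "\<And>x. x \<notin> \<Omega> \<Longrightarrow> tgrad \<phi> x = 0"
    "\<phi> \<in> borel_measurable borel" "tgrad \<phi> \<in> borel_measurable borel"
proof -
  obtain K where K: "\<And>k. Ck k \<phi>" "compact K" "K \<subseteq> \<Omega>" "\<And>x. x \<notin> K \<Longrightarrow> \<phi> x = 0"
    using test_functionsD[OF assms] by blast
  note t = test_function_sq_int[OF assms]
  show 0: "\<phi> x = 0" "tgrad \<phi> x = 0" if "x \<notin> \<Omega>" for x
  proof -
    have x: "x \<notin> K" using K(3) that by blast
    show "\<phi> x = 0" by (rule K(4)[OF x])
    show "tgrad \<phi> x = 0" by (rule tgrad_outside[OF K(2) K(4) x])
  qed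
  show m: "\<phi> \<in> borel_measurable borel" "tgrad \<phi> \<in> borel_measurable borel"
    using t by (auto intro: borel_measurable_continuous_onI)
  have [measurable]: "(\<lambda>x. (norm (\<phi> x))\<^sup>2) \<in> borel_measurable borel" "(\<lambda>x. (norm (tgrad \<phi> x))\<^sup>2) \<in> borel_measurable borel"
    using m by measurable
  have gen: "sq_int M F \<and> nsq M F = nsq lborel F"
    if F: "sq_int lborel F" "F \<in> borel_measurable borel" "\<And>x. x \<notin> \<Omega> \<Longrightarrow> F x = 0" for F :: "'a \<Rightarrow> 'b::euclidean_space"
  proof -
    have "(\<lambda>x. (norm (F x))\<^sup>2) \<in> borel_measurable borel" using F(2) by measurable
    moreover have "(norm (F x))\<^sup>2 = 0" if "x \<notin> \<Omega>" for x using F(3)[OF that] by simp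
    ultimately show ?thesis
      using lebesgue_on_integral_test[OF lebesgue_\<Omega>, of "\<lambda>x. (norm (F x))\<^sup>2"] F(1) borel_measurable_M[OF F(2)]
      unfolding sq_int_def nsq_def by blast
  qed
  show "sq_int M \<phi>" "nsq M \<phi> = nsq lborel \<phi>" using gen[OF t(1) m(1) 0(1)] by auto
  show "sq_int M (tgrad \<phi>)" "nsq M (tgrad \<phi>) = nsq lborel (tgrad \<phi>)" using gen[OF t(2) m(2) 0(2)] by auto
qed

lemma test_integration_by_parts:
  assumes \<phi>: "\<phi> \<in> test_functions \<Omega>" and \<psi>: "\<psi> \<in> test_functions \<Omega>" and b: "b \<in> Basis"
  shows "(LINT x|M. \<phi> x * partial_deriv b \<psi> x) = - (LINT x|M. (tgrad \<phi> x \<bullet> b) * \<psi> x)"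
proof -
  have pd: "partial_deriv b \<psi> = (\<lambda>x. tgrad \<psi> x \<bullet> b)" using tgrad_inner_Basis[OF b] by force
  have i1: "integrable M (\<lambda>x. \<phi> x * (tgrad \<psi> x \<bullet> b))"
    by (intro sq_int_mult test_M(1)[OF \<phi>] sq_int_bound(1)[OF _ test_M(2)[OF \<psi>], of _ 1])
      (use borel_measurable_M[OF test_M(8)[OF \<psi>]] Basis_le_norm[OF b] in auto)
  have i2: "integrable M (\<lambda>x. (tgrad \<phi> x \<bullet> b) * \<psi> x)"
    by (intro sq_int_mult test_M(1)[OF \<psi>] sq_int_bound(1)[OF _ test_M(2)[OF \<phi>], of _ 1])
      (use borel_measurable_M[OF test_M(8)[OF \<phi>]] Basis_le_norm[OF b] in auto)
  have eq: "partial_deriv b (\<lambda>x. \<phi> x * \<psi> x) x = \<phi> x * (tgrad \<psi> x \<bullet> b) + (tgrad \<phi> x \<bullet> b) * \<psi> x" for x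
    using tgrad_mult[OF test_function_Ck[OF \<phi>] test_function_Ck[OF \<psi>], of x]
      tgrad_inner_Basis[OF b, of "\<lambda>x. \<phi> x * \<psi> x" x] by (simp add: inner_simps algebra_simps)
  have "0 = (LINT x|lborel. partial_deriv b (\<lambda>x. \<phi> x * \<psi> x) x)"
    using integral_partial_deriv_eq_0[OF test_function_mult[OF \<phi> \<psi>] b] by simp
  also have "\<dots> = (LINT x|M. partial_deriv b (\<lambda>x. \<phi> x * \<psi> x) x)"
    unfolding eq using test_M(5-8)[OF \<phi>] test_M(5-8)[OF \<psi>]
    by (intro lebesgue_on_integral_test(1)[symmetric]) auto
  also have "\<dots> = (LINT x|M. \<phi> x * (tgrad \<psi> x \<bullet> b)) + (LINT x|M. (tgrad \<phi> x \<bullet> b) * \<psi> x)"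
    unfolding eq using i1 i2 by simp
  finally show ?thesis unfolding pd by linarith
qed

text \<open>\<open>h10_pair f g\<close>: \<open>f\<close> is a limit of test functions in \<open>H\<^sup>1\<close>, and \<open>g\<close> is its gradient.\<close>

definition h10_pair :: "('a \<Rightarrow> real) \<Rightarrow> ('a \<Rightarrow> 'a) \<Rightarrow> bool" where
  "h10_pair f g \<longleftrightarrow> sq_int M f \<and> sq_int M g \<and>
    (\<forall>e>0. \<exists>\<phi>\<in>test_functions \<Omega>. nsq M (\<lambda>x. \<phi> x - f x) + nsq M (\<lambda>x. tgrad \<phi> x - g x) < e)"

lemma h10_pairD: "h10_pair f g \<Longrightarrow> sq_int M f" "h10_pair f g \<Longrightarrow> sq_int M g"
  by (simp_all add: h10_pair_def)

text \<open>Almost everywhere convergence requires a subsequence; since \<open>r n\<close> is at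
  least \<open>n\<close>, the rate 1/(n+1) survives it.\<close>

lemma h10_pair_sequence:
  assumes "h10_pair f g"
  shows "\<exists>\<phi>. (\<forall>n. \<phi> n \<in> test_functions \<Omega>) \<and> (\<lambda>n. nsq M (\<lambda>x. \<phi> n x - f x)) \<longlonglongrightarrow> 0 \<and>
    (\<lambda>n. nsq M (\<lambda>x. tgrad (\<phi> n) x - g x)) \<longlonglongrightarrow> 0 \<and> (AE x in M. (\<lambda>n. \<phi> n x) \<longlonglongrightarrow> f x) \<and>
    (\<forall>n. nsq M (\<lambda>x. \<phi> n x - f x) + nsq M (\<lambda>x. tgrad (\<phi> n) x - g x) < 1 / real (Suc n))"
proof -
  have "\<exists>\<phi>\<in>test_functions \<Omega>. nsq M (\<lambda>x. \<phi> x - f x) + nsq M (\<lambda>x. tgrad \<phi> x - g x) < 1 / real (Suc n)" for n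
    using assms unfolding h10_pair_def by simp
  then obtain \<phi> where \<phi>: "\<And>n. \<phi> n \<in> test_functions \<Omega>"
    "\<And>n. nsq M (\<lambda>x. \<phi> n x - f x) + nsq M (\<lambda>x. tgrad (\<phi> n) x - g x) < 1 / real (Suc n)" by metis
  have lim: "(\<lambda>n. X n) \<longlonglongrightarrow> 0" if "\<And>n. 0 \<le> X n" "\<And>n. X n \<le> 1 / real (Suc n)" for X :: "nat \<Rightarrow> real"
    by (rule tendsto_sandwich[OF _ _ tendsto_const LIMSEQ_Suc[OF lim_1_over_n]]) (use that in auto)
  have l1: "(\<lambda>n. nsq M (\<lambda>x. \<phi> n x - f x)) \<longlonglongrightarrow> 0"
  proof (rule lim)
    show "nsq M (\<lambda>x. \<phi> n x - f x) \<le> 1 / real (Suc n)" for n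
      using \<phi>(2)[of n] nsq_nonneg[of M "\<lambda>x. tgrad (\<phi> n) x - g x"] by linarith
  qed simp
  have l2: "(\<lambda>n. nsq M (\<lambda>x. tgrad (\<phi> n) x - g x)) \<longlonglongrightarrow> 0"
  proof (rule lim)
    show "nsq M (\<lambda>x. tgrad (\<phi> n) x - g x) \<le> 1 / real (Suc n)" for n
      using \<phi>(2)[of n] nsq_nonneg[of M "\<lambda>x. \<phi> n x - f x"] by linarith
  qed simp
  obtain r where r: "strict_mono r" "AE x in M. (\<lambda>n. \<phi> (r n) x) \<longlonglongrightarrow> f x"
    using L2_tendsto_AE_subseq[OF test_M(1)[OF \<phi>(1)] h10_pairD(1)[OF assms] l1] by blast
  have "1 / real (Suc (r n)) \<le> 1 / real (Suc n)" for n
    using seq_suble[OF r(1), of n] by (intro divide_left_mono) auto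
  then have "nsq M (\<lambda>x. \<phi> (r n) x - f x) + nsq M (\<lambda>x. tgrad (\<phi> (r n)) x - g x) < 1 / real (Suc n)" for n
    using \<phi>(2)[of "r n"] less_le_trans by blast
  then show ?thesis
    using \<phi> r LIMSEQ_subseq_LIMSEQ[OF l1 r(1)] LIMSEQ_subseq_LIMSEQ[OF l2 r(1)]
    by (intro exI[of _ "\<lambda>n. \<phi> (r n)"]) (simp add: o_def)
qed

lemma h10_pair_test: "\<phi> \<in> test_functions \<Omega> \<Longrightarrow> h10_pair \<phi> (tgrad \<phi>)"
  unfolding h10_pair_def by (auto simp: test_M nsq_def intro!: bexI[of _ \<phi>])

text \<open>The set of pairs is closed in L2. This is how every operation on Sobolev functions below
  is reduced to test functions.\<close>

lemma h10_pair_limit: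
  assumes p: "\<And>n. h10_pair (F n) (G n)" and "sq_int M f" "sq_int M g"
    and "(\<lambda>n. nsq M (\<lambda>x. F n x - f x)) \<longlonglongrightarrow> 0" "(\<lambda>n. nsq M (\<lambda>x. G n x - g x)) \<longlonglongrightarrow> 0"
  shows "h10_pair f g"
  unfolding h10_pair_def
proof (intro conjI allI impI assms(2,3))
  fix e :: real assume e: "e > 0"
  have "(\<lambda>n. nsq M (\<lambda>x. F n x - f x) + nsq M (\<lambda>x. G n x - g x)) \<longlonglongrightarrow> 0 + 0"
    by (intro tendsto_add assms)
  then have "eventually (\<lambda>n. nsq M (\<lambda>x. F n x - f x) + nsq M (\<lambda>x. G n x - g x) < e / 4) sequentially"
    using e by (intro order_tendstoD(2)[where y = "0 + 0"]) auto
  then obtain n where n: "nsq M (\<lambda>x. F n x - f x) + nsq M (\<lambda>x. G n x - g x) < e / 4"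
    unfolding eventually_sequentially by blast
  obtain \<phi> where \<phi>: "\<phi> \<in> test_functions \<Omega>" "nsq M (\<lambda>x. \<phi> x - F n x) + nsq M (\<lambda>x. tgrad \<phi> x - G n x) < e / 4"
  proof -
    have "0 < e / 4" using e by simp
    from p[of n, unfolded h10_pair_def, THEN conjunct2, THEN conjunct2, rule_format, OF this] show ?thesis
      using that by blast
  qed
  have "nsq M (\<lambda>x. \<phi> x - f x) \<le> 2 * nsq M (\<lambda>x. \<phi> x - F n x) + 2 * nsq M (\<lambda>x. F n x - f x)"
    "nsq M (\<lambda>x. tgrad \<phi> x - g x) \<le> 2 * nsq M (\<lambda>x. tgrad \<phi> x - G n x) + 2 * nsq M (\<lambda>x. G n x - g x)"
    using p[of n] assms(2,3) test_M[OF \<phi>(1)] by (auto intro!: nsq_triangle dest: h10_pairD)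
  with n \<phi> show "\<exists>\<phi>\<in>test_functions \<Omega>. nsq M (\<lambda>x. \<phi> x - f x) + nsq M (\<lambda>x. tgrad \<phi> x - g x) < e"
    by (intro bexI[of _ \<phi>]) linarith+
qed

lemma h10_pair_add:
  assumes "h10_pair f g" "h10_pair f' g'"
  shows "h10_pair (\<lambda>x. f x + f' x) (\<lambda>x. g x + g' x)"
proof -
  obtain \<phi> where \<phi>: "\<And>n. \<phi> n \<in> test_functions \<Omega>" "(\<lambda>n. nsq M (\<lambda>x. \<phi> n x - f x)) \<longlonglongrightarrow> 0"
    "(\<lambda>n. nsq M (\<lambda>x. tgrad (\<phi> n) x - g x)) \<longlonglongrightarrow> 0" using h10_pair_sequence[OF assms(1)] by blast
  obtain \<psi> where \<psi>: "\<And>n. \<psi> n \<in> test_functions \<Omega>" "(\<lambda>n. nsq M (\<lambda>x. \<psi> n x - f' x)) \<longlonglongrightarrow> 0"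
    "(\<lambda>n. nsq M (\<lambda>x. tgrad (\<psi> n) x - g' x)) \<longlonglongrightarrow> 0" using h10_pair_sequence[OF assms(2)] by blast
  note d = h10_pairD[OF assms(1)] h10_pairD[OF assms(2)]
  have lim: "(\<lambda>n. nsq M (\<lambda>x. (A n x + B n x) - (a x + b x))) \<longlonglongrightarrow> 0"
    if "\<And>n. sq_int M (A n)" "\<And>n. sq_int M (B n)" "sq_int M a" "sq_int M b"
      "(\<lambda>n. nsq M (\<lambda>x. A n x - a x)) \<longlonglongrightarrow> 0" "(\<lambda>n. nsq M (\<lambda>x. B n x - b x)) \<longlonglongrightarrow> 0"
    for A B :: "nat \<Rightarrow> 'a \<Rightarrow> 'c::euclidean_space" and a b
  proof (rule tendsto_sandwich[OF _ _ tendsto_const])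
    have "nsq M (\<lambda>x. (A n x - a x) + (B n x - b x)) \<le> 2 * nsq M (\<lambda>x. A n x - a x) + 2 * nsq M (\<lambda>x. B n x - b x)" for n
      using that by (intro nsq_add_le sq_int_diff)
    moreover have "(\<lambda>x. (A n x - a x) + (B n x - b x)) = (\<lambda>x. (A n x + B n x) - (a x + b x))" for n
      by (simp add: fun_eq_iff)
    ultimately show "eventually (\<lambda>n. nsq M (\<lambda>x. (A n x + B n x) - (a x + b x)) \<le> 2 * nsq M (\<lambda>x. A n x - a x) + 2 * nsq M (\<lambda>x. B n x - b x)) sequentially"
      by simp
    show "(\<lambda>n. 2 * nsq M (\<lambda>x. A n x - a x) + 2 * nsq M (\<lambda>x. B n x - b x)) \<longlonglongrightarrow> 0"
      using tendsto_add[OF tendsto_mult[OF tendsto_const that(5)] tendsto_mult[OF tendsto_const that(6)], of 2 2] by simp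
  qed simp
  have tg: "tgrad (\<lambda>x. \<phi> n x + \<psi> n x) = (\<lambda>x. tgrad (\<phi> n) x + tgrad (\<psi> n) x)" for n
    using tgrad_add[OF test_function_Ck[OF \<phi>(1)] test_function_Ck[OF \<psi>(1)]] by blast
  show ?thesis
  proof (rule h10_pair_limit[of "\<lambda>n x. \<phi> n x + \<psi> n x" "\<lambda>n. tgrad (\<lambda>x. \<phi> n x + \<psi> n x)"])
    show "h10_pair (\<lambda>x. \<phi> n x + \<psi> n x) (tgrad (\<lambda>x. \<phi> n x + \<psi> n x))" for n
      by (intro h10_pair_test test_function_add \<phi> \<psi>)
    show "(\<lambda>n. nsq M (\<lambda>x. (\<phi> n x + \<psi> n x) - (f x + f' x))) \<longlonglongrightarrow> 0"
      by (intro lim test_M \<phi> \<psi> d)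
    show "(\<lambda>n. nsq M (\<lambda>x. tgrad (\<lambda>x. \<phi> n x + \<psi> n x) x - (g x + g' x))) \<longlonglongrightarrow> 0"
      unfolding tg by (intro lim test_M \<phi> \<psi> d)
  qed (intro sq_int_add d)+
qed

lemma h10_pair_scale:
  assumes "h10_pair f g"
  shows "h10_pair (\<lambda>x. c * f x) (\<lambda>x. c *\<^sub>R g x)"
proof -
  obtain \<phi> where \<phi>: "\<And>n. \<phi> n \<in> test_functions \<Omega>" "(\<lambda>n. nsq M (\<lambda>x. \<phi> n x - f x)) \<longlonglongrightarrow> 0"
    "(\<lambda>n. nsq M (\<lambda>x. tgrad (\<phi> n) x - g x)) \<longlonglongrightarrow> 0" using h10_pair_sequence[OF assms(1)] by blast
  note d = h10_pairD[OF assms(1)]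
  have tg: "tgrad (\<lambda>x. c * \<phi> n x) = (\<lambda>x. c *\<^sub>R tgrad (\<phi> n) x)" for n
    using tgrad_cmult[OF test_function_Ck[OF \<phi>(1)]] by blast
  show ?thesis
  proof (rule h10_pair_limit[of "\<lambda>n x. c * \<phi> n x" "\<lambda>n. tgrad (\<lambda>x. c * \<phi> n x)"])
    show "h10_pair (\<lambda>x. c * \<phi> n x) (tgrad (\<lambda>x. c * \<phi> n x))" for n
      by (intro h10_pair_test test_function_cmult \<phi>)
    have "nsq M (\<lambda>x. c * \<phi> n x - c * f x) = c\<^sup>2 * nsq M (\<lambda>x. \<phi> n x - f x)" for n
      by (simp add: nsq_def power_mult_distrib flip: right_diff_distrib)
    then show "(\<lambda>n. nsq M (\<lambda>x. c * \<phi> n x - c * f x)) \<longlonglongrightarrow> 0"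
      using tendsto_mult[OF tendsto_const \<phi>(2), of "c\<^sup>2"] by simp
    have "nsq M (\<lambda>x. c *\<^sub>R tgrad (\<phi> n) x - c *\<^sub>R g x) = c\<^sup>2 * nsq M (\<lambda>x. tgrad (\<phi> n) x - g x)" for n
      by (simp add: nsq_def power_mult_distrib flip: scaleR_diff_right)
    then show "(\<lambda>n. nsq M (\<lambda>x. tgrad (\<lambda>x. c * \<phi> n x) x - c *\<^sub>R g x)) \<longlonglongrightarrow> 0"
      unfolding tg using tendsto_mult[OF tendsto_const \<phi>(3), of "c\<^sup>2"] by simp
    show "sq_int M (\<lambda>x. c * f x)" using sq_int_scaleR[OF d(1), of c] by simp
  qed (rule sq_int_scaleR[OF d(2)])
qed

lemma sq_int_integrable_compact:
  fixes F :: "'a \<Rightarrow> 'b::euclidean_space"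
  assumes F: "sq_int M F" and K: "compact K" "K \<subseteq> \<Omega>"
  shows "integrable (lebesgue_on K) F"
proof -
  have Ks: "K \<in> sets lebesgue" using K(1) by (simp add: compact_imp_closed)
  have mF: "(\<lambda>x. indicator \<Omega> x *\<^sub>R F x) \<in> borel_measurable lebesgue"
    using F borel_measurable_restrict_space_iff[of \<Omega> lebesgue F] by (simp add: sq_int_def)
  have i2: "integrable lebesgue (\<lambda>x. indicator \<Omega> x *\<^sub>R (norm (F x))\<^sup>2)"
    using F by (simp add: sq_int_def integrable_restrict_space)
  have i1: "integrable lebesgue (indicator K :: 'a \<Rightarrow> real)"
    using K(1) emeasure_compact_finite[OF K(1)] Ks by (intro integrable_real_indicator) (auto simp: compact_imp_closed)
  have eqK: "indicator K x *\<^sub>R F x = indicator K x *\<^sub>R (indicator \<Omega> x *\<^sub>R F x)" for x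
    using K(2) by (auto simp: indicator_def)
  have "integrable lebesgue (\<lambda>x. indicator K x *\<^sub>R F x)"
  proof (rule Bochner_Integration.integrable_bound[OF Bochner_Integration.integrable_add[OF i1 i2]])
    show "(\<lambda>x. indicator K x *\<^sub>R F x) \<in> borel_measurable lebesgue"
      unfolding eqK by (intro borel_measurable_scaleR borel_measurable_indicator Ks mF)
    show "AE x in lebesgue. norm (indicator K x *\<^sub>R F x) \<le> norm (indicator K x + indicator \<Omega> x *\<^sub>R (norm (F x))\<^sup>2)"
    proof (intro AE_I2)
      fix x
      have "norm (F x) \<le> 1 + (norm (F x))\<^sup>2"
        using sum_squares_bound[of "norm (F x)" 1] by (simp add: power2_eq_square) (metis add.commute add_mono_thms_linordered_semiring(1) mult_2 norm_ge_zero order_trans le_add_same_cancel1)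
      then show "norm (indicator K x *\<^sub>R F x) \<le> norm (indicator K x + indicator \<Omega> x *\<^sub>R (norm (F x))\<^sup>2)"
        using K(2) by (auto simp: indicator_def)
    qed
  qed
  then show ?thesis using Ks by (simp add: integrable_restrict_space)
qed

lemma h10_pair_weak_gradient:
  assumes "h10_pair f g"
  shows "is_weak_gradient \<Omega> f g"
  unfolding is_weak_gradient_def
proof (intro conjI allI impI ballI)
  note d = h10_pairD[OF assms]
  show "integrable (lebesgue_on K) f" "integrable (lebesgue_on K) g" if "compact K \<and> K \<subseteq> \<Omega>" for K
    using that d sq_int_integrable_compact by blast+
  fix \<psi> and b :: 'a assume \<psi>: "\<psi> \<in> test_functions \<Omega>" and b: "b \<in> Basis"
  obtain \<phi> where \<phi>: "\<And>n. \<phi> n \<in> test_functions \<Omega>" "(\<lambda>n. nsq M (\<lambda>x. \<phi> n x - f x)) \<longlonglongrightarrow> 0"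
    "(\<lambda>n. nsq M (\<lambda>x. tgrad (\<phi> n) x - g x)) \<longlonglongrightarrow> 0" using h10_pair_sequence[OF assms(1)] by blast
  have pd: "sq_int M (partial_deriv b \<psi>)" by (rule test_M(1)[OF test_function_partial_deriv[OF \<psi> b]])
  have \<psi>b: "sq_int M (\<lambda>x. \<psi> x *\<^sub>R b)"
    using borel_measurable_M[OF test_M(7)[OF \<psi>]] b by (intro sq_int_bound(1)[OF _ test_M(1)[OF \<psi>], of _ 1]) auto
  have z: "(\<lambda>n::nat. nsq M (\<lambda>x. F x - F x)) \<longlonglongrightarrow> 0" for F :: "'a \<Rightarrow> 'c::euclidean_space" by (simp add: nsq_def)
  have "(\<lambda>n. LINT x|M. \<phi> n x \<bullet> partial_deriv b \<psi> x) \<longlonglongrightarrow> (LINT x|M. f x \<bullet> partial_deriv b \<psi> x)"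
    by (rule L2_tendsto_inner[OF test_M(1)[OF \<phi>(1)] d(1) \<phi>(2) pd pd z])
  moreover have "(\<lambda>n. LINT x|M. tgrad (\<phi> n) x \<bullet> (\<psi> x *\<^sub>R b)) \<longlonglongrightarrow> (LINT x|M. g x \<bullet> (\<psi> x *\<^sub>R b))"
    by (rule L2_tendsto_inner[OF test_M(2)[OF \<phi>(1)] d(2) \<phi>(3) \<psi>b \<psi>b z])
  then have "(\<lambda>n. - (LINT x|M. tgrad (\<phi> n) x \<bullet> (\<psi> x *\<^sub>R b))) \<longlonglongrightarrow> - (LINT x|M. g x \<bullet> (\<psi> x *\<^sub>R b))"
    by (rule tendsto_minus)
  moreover have "(LINT x|M. \<phi> n x \<bullet> partial_deriv b \<psi> x) = - (LINT x|M. tgrad (\<phi> n) x \<bullet> (\<psi> x *\<^sub>R b))" for n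
    using test_integration_by_parts[OF \<phi>(1)[of n] \<psi> b] by (simp add: mult.commute)
  ultimately have "(LINT x|M. f x \<bullet> partial_deriv b \<psi> x) = - (LINT x|M. g x \<bullet> (\<psi> x *\<^sub>R b))"
    using LIMSEQ_unique by simp
  then show "(LINT x|M. f x * partial_deriv b \<psi> x) = - (LINT x|M. (g x \<bullet> b) * \<psi> x)"
    by (simp add: mult.commute)
qed

lemma weak_grad_is_weak_gradient: "is_weak_gradient \<Omega> f g \<Longrightarrow> is_weak_gradient \<Omega> f (weak_grad \<Omega> f)"
  using someI[of "is_weak_gradient \<Omega> f" g] by (simp add: weak_grad_def)

lemma weak_grad_AE: "is_weak_gradient \<Omega> f g \<Longrightarrow> AE x in M. weak_grad \<Omega> f x = g x"
  using weak_gradient_unique[OF open_\<Omega> weak_grad_is_weak_gradient] by blast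

lemma weak_grad_measurable: "is_weak_gradient \<Omega> f g \<Longrightarrow> weak_grad \<Omega> f \<in> borel_measurable M"
  using weak_gradient_measurable(2)[OF open_\<Omega> weak_grad_is_weak_gradient] by blast

lemma L2_norm_sq: "(L2_norm \<Omega> f)\<^sup>2 = nsq M f"
  using nsq_nonneg[of M f] by (simp add: L2_norm_def nsq_def)

lemma H1_norm_sq: "(H1_norm \<Omega> f)\<^sup>2 = nsq M f + nsq M (weak_grad \<Omega> f)"
  using nsq_nonneg[of M f] nsq_nonneg[of M "weak_grad \<Omega> f"]
  by (simp add: H1_norm_def L2_norm_sq nsq_def[of _ "weak_grad \<Omega> f"])

lemma H1_norm_eq: "H1_norm \<Omega> f = sqrt (nsq M f + nsq M (weak_grad \<Omega> f))"
  by (simp add: H1_norm_def L2_norm_sq nsq_def[of _ "weak_grad \<Omega> f"])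

lemma h10_pair_imp_H10:
  assumes "h10_pair f g"
  shows "f \<in> H10 \<Omega>"
proof -
  note d = h10_pairD[OF assms] and w = h10_pair_weak_gradient[OF assms]
  have "f \<in> H1 \<Omega>" using d w by (auto simp: H1_def L2_def sq_int_def)
  moreover have "\<exists>\<phi>\<in>test_functions \<Omega>. H1_norm \<Omega> (\<lambda>x. f x - \<phi> x) < e" if e: "e > 0" for e
  proof -
    obtain \<phi> where \<phi>: "\<phi> \<in> test_functions \<Omega>" "nsq M (\<lambda>x. \<phi> x - f x) + nsq M (\<lambda>x. tgrad \<phi> x - g x) < e\<^sup>2"
    proof -
      have "0 < e\<^sup>2" using e by simp
      from assms[unfolded h10_pair_def, THEN conjunct2, THEN conjunct2, rule_format, OF this] show ?thesis
        using that by blast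
    qed
    have "h10_pair (\<lambda>x. f x + (-1) * \<phi> x) (\<lambda>x. g x + (-1) *\<^sub>R tgrad \<phi> x)"
      by (intro h10_pair_add h10_pair_scale assms h10_pair_test \<phi>)
    then have p: "h10_pair (\<lambda>x. f x - \<phi> x) (\<lambda>x. g x - tgrad \<phi> x)" by simp
    note w' = h10_pair_weak_gradient[OF p]
    have "nsq M (weak_grad \<Omega> (\<lambda>x. f x - \<phi> x)) = nsq M (\<lambda>x. g x - tgrad \<phi> x)"
      using weak_grad_AE[OF w'] weak_grad_measurable[OF w'] h10_pairD(2)[OF p] by (intro nsq_cong_AE) (auto simp: sq_int_def)
    then have "(H1_norm \<Omega> (\<lambda>x. f x - \<phi> x))\<^sup>2 < e\<^sup>2"
      using \<phi>(2) by (simp add: H1_norm_sq nsq_minus_commute[of _ f] nsq_minus_commute[of _ g])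
    then have "H1_norm \<Omega> (\<lambda>x. f x - \<phi> x) < e" using e by (rule_tac power2_less_imp_less) simp_all
    with \<phi> show ?thesis by blast
  qed
  ultimately show ?thesis by (simp add: H10_def)
qed

text \<open>\<open>weak_grad\<close> is a choice, and membership in \<open>H10\<close> speaks about
  the chosen gradient of the difference of \<open>f\<close> and a test function. Uniqueness
  identifies that gradient almost everywhere with the difference of the gradients, once the latter
  is known to be a weak gradient.\<close>

lemma H10_imp_h10_pair:
  assumes "f \<in> H10 \<Omega>"
  shows "h10_pair f (weak_grad \<Omega> f)"
proof -
  from assms obtain g where f2: "sq_int M f" and g: "is_weak_gradient \<Omega> f g" "integrable M (\<lambda>x. (norm (g x))\<^sup>2)"
    unfolding H10_def H1_def L2_def sq_int_def by auto
  have "sq_int M g" using g weak_gradient_measurable(2)[OF open_\<Omega> g(1)] by (simp add: sq_int_def)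
  then have w: "sq_int M (weak_grad \<Omega> f)"
  proof (rule sq_int_cong_AE[OF _ weak_grad_measurable[OF g(1)]])
    show "AE x in M. g x = weak_grad \<Omega> f x" using weak_grad_AE[OF g(1)] by eventually_elim simp
  qed
  show ?thesis unfolding h10_pair_def
  proof (intro conjI f2 w allI impI)
    fix e :: real assume e: "e > 0"
    then have "0 < sqrt e" by simp
    from assms[unfolded H10_def mem_Collect_eq, THEN conjunct2, rule_format, OF this]
    obtain \<phi> where \<phi>: "\<phi> \<in> test_functions \<Omega>" "H1_norm \<Omega> (\<lambda>x. f x - \<phi> x) < sqrt e" by blast
    have wf: "is_weak_gradient \<Omega> f (weak_grad \<Omega> f)" by (rule weak_grad_is_weak_gradient[OF g(1)])
    have wp: "is_weak_gradient \<Omega> \<phi> (tgrad \<phi>)" by (rule h10_pair_weak_gradient[OF h10_pair_test[OF \<phi>(1)]])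
    have wd: "is_weak_gradient \<Omega> (\<lambda>x. f x - \<phi> x) (\<lambda>x. weak_grad \<Omega> f x - tgrad \<phi> x)"
      unfolding is_weak_gradient_def
    proof (intro conjI allI impI ballI)
      show "integrable (lebesgue_on K) (\<lambda>x. f x - \<phi> x)" "integrable (lebesgue_on K) (\<lambda>x. weak_grad \<Omega> f x - tgrad \<phi> x)"
        if "compact K \<and> K \<subseteq> \<Omega>" for K using that wf wp unfolding is_weak_gradient_def by auto
      fix \<psi> and b :: 'a assume \<psi>: "\<psi> \<in> test_functions \<Omega>" and b: "b \<in> Basis"
      have pd: "sq_int M (partial_deriv b \<psi>)" by (rule test_M(1)[OF test_function_partial_deriv[OF \<psi> b]])
      have ib: "sq_int M (\<lambda>x. F x \<bullet> b)" if "sq_int M F" for F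
        using that Basis_le_norm[OF b] by (intro sq_int_bound(1)[OF _ that, of _ 1]) (auto simp: sq_int_def)
      have "(LINT x|M. (f x - \<phi> x) * partial_deriv b \<psi> x) = (LINT x|M. f x * partial_deriv b \<psi> x) - (LINT x|M. \<phi> x * partial_deriv b \<psi> x)"
        using sq_int_mult[OF f2 pd] sq_int_mult[OF test_M(1)[OF \<phi>(1)] pd] by (simp add: left_diff_distrib)
      also have "\<dots> = - (LINT x|M. (weak_grad \<Omega> f x \<bullet> b) * \<psi> x) + (LINT x|M. (tgrad \<phi> x \<bullet> b) * \<psi> x)"
        using wf[unfolded is_weak_gradient_def, THEN conjunct2, rule_format, OF \<psi> b]
          wp[unfolded is_weak_gradient_def, THEN conjunct2, rule_format, OF \<psi> b] by simp
      also have "\<dots> = - (LINT x|M. ((weak_grad \<Omega> f x - tgrad \<phi> x) \<bullet> b) * \<psi> x)"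
        using sq_int_mult[OF ib[OF w] test_M(1)[OF \<psi>]] sq_int_mult[OF ib[OF test_M(2)[OF \<phi>(1)]] test_M(1)[OF \<psi>]]
        by (simp add: inner_diff_left left_diff_distrib)
      finally show "(LINT x|M. (f x - \<phi> x) * partial_deriv b \<psi> x) = - (LINT x|M. ((weak_grad \<Omega> f x - tgrad \<phi> x) \<bullet> b) * \<psi> x)" .
    qed
    have "nsq M (weak_grad \<Omega> (\<lambda>x. f x - \<phi> x)) = nsq M (\<lambda>x. weak_grad \<Omega> f x - tgrad \<phi> x)"
      using weak_grad_AE[OF wd] weak_grad_measurable[OF wd] sq_int_diff[OF w test_M(2)[OF \<phi>(1)]]
      by (intro nsq_cong_AE) (auto simp: sq_int_def)
    moreover have "(H1_norm \<Omega> (\<lambda>x. f x - \<phi> x))\<^sup>2 < (sqrt e)\<^sup>2"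
      using \<phi>(2) by (intro power_strict_mono) (auto simp: H1_norm_eq)
    ultimately have "nsq M (\<lambda>x. \<phi> x - f x) + nsq M (\<lambda>x. tgrad \<phi> x - weak_grad \<Omega> f x) < e"
      using e by (simp add: H1_norm_sq nsq_minus_commute[of _ f] nsq_minus_commute[of _ "weak_grad \<Omega> f"])
    with \<phi>(1) show "\<exists>\<phi>\<in>test_functions \<Omega>. nsq M (\<lambda>x. \<phi> x - f x) + nsq M (\<lambda>x. tgrad \<phi> x - weak_grad \<Omega> f x) < e" by blast
  qed
qed

lemma h10_pair_grad_AE: "h10_pair f g \<Longrightarrow> AE x in M. weak_grad \<Omega> f x = g x"
  by (intro weak_grad_AE h10_pair_weak_gradient)

end

section \<open>Chain rule and inequalities in the Sobolev space\<close>

lemma mean_value_bound_0: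
  fixes f :: "real \<Rightarrow> real"
  assumes "\<And>t. \<bar>t\<bar> \<le> R \<Longrightarrow> (f has_real_derivative f' t) (at t)" "\<And>t. \<bar>t\<bar> \<le> R \<Longrightarrow> \<bar>f' t\<bar> \<le> B"
    and "f 0 = 0" "\<bar>t\<bar> \<le> R"
  shows "\<bar>f t\<bar> \<le> B * \<bar>t\<bar>"
proof -
  have "norm (f t - f 0) \<le> B * norm (t - 0)"
  proof (rule field_differentiable_bound[of "{-R..R}" f f'])
    show "(f has_field_derivative f' z) (at z within {- R..R})" if "z \<in> {-R..R}" for z
      using assms(1)[of z] that by (auto intro: has_field_derivative_at_within simp: abs_le_iff)
  qed (use assms in \<open>auto simp: abs_le_iff\<close>)
  then show ?thesis using assms(3) by simp
qed

lemma Ck_power: "Ck k (\<lambda>t::real. t ^ n)"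
proof (induction n)
  case (Suc n)
  have "Ck k (\<lambda>t::real. t)" using Ck_inner[of k "1::real"] by simp
  from Ck_mult[OF this Suc] show ?case by simp
qed simp

lemma polynomial_primitive_test:
  fixes \<phi> :: "'a::euclidean_space \<Rightarrow> real" and a :: "nat \<Rightarrow> real" and n :: nat
  assumes "\<phi> \<in> test_functions \<Omega>"
  defines "P \<equiv> \<lambda>t::real. \<Sum>i\<le>n. a i / real (Suc i) * t ^ Suc i" and "p \<equiv> \<lambda>t::real. \<Sum>i\<le>n. a i * t ^ i"
  shows "(\<lambda>x. P (\<phi> x)) \<in> test_functions \<Omega>" "tgrad (\<lambda>x. P (\<phi> x)) x = p (\<phi> x) *\<^sub>R tgrad \<phi> x"
    "(P has_real_derivative p t) (at t)" "P 0 = 0"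
proof -
  show D: "(P has_real_derivative p t) (at t)" for t
  proof -
    have "((\<lambda>t. a i / real (Suc i) * t ^ Suc i) has_real_derivative a i * t ^ i) (at t)" for i
      using DERIV_cmult[OF DERIV_pow[of "Suc i" t UNIV], of "a i / real (Suc i)"] by (simp del: of_nat_Suc power_Suc)
    then show ?thesis unfolding P_def p_def by (intro DERIV_sum)
  qed
  show P0: "P 0 = 0" by (simp add: P_def)
  obtain K where K: "\<And>k. Ck k \<phi>" "compact K" "K \<subseteq> \<Omega>" "\<And>x. x \<notin> K \<Longrightarrow> \<phi> x = 0"
    using test_functionsD[OF assms(1)] by blast
  show "(\<lambda>x. P (\<phi> x)) \<in> test_functions \<Omega>"
  proof (rule test_functionsI[OF _ K(2,3)])
    have "Ck k P" for k unfolding P_def by (rule Ck_sum[OF Ck_cmult[OF Ck_power]])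
    then show "Ck k (\<lambda>x. P (\<phi> x))" for k by (rule Ck_compose[OF _ K(1)])
    show "P (\<phi> x) = 0" if "x \<notin> K" for x using K(4)[OF that] P0 by simp
  qed
  have "((\<lambda>x. P (\<phi> x)) has_derivative (\<lambda>h. p (\<phi> x) * (tgrad \<phi> x \<bullet> h))) (at x)"
    using has_derivative_compose[OF has_derivative_tgrad[OF K(1)] D[unfolded has_field_derivative_def]] .
  then show "tgrad (\<lambda>x. P (\<phi> x)) x = p (\<phi> x) *\<^sub>R tgrad \<phi> x"
    by (intro tgrad_unique) simp
qed

context open_domain
begin

text \<open>The outer function is only C1, so the composite need not be a test function. On the
  bounded range of \<phi>, Weierstrass approximates \<psi>' by a polynomial; its primitive vanishing
  at 0 composes with \<phi> to a test function, and the uniform error controls both the values and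
  the gradients.\<close>

lemma h10_pair_compose_test:
  assumes \<phi>: "\<phi> \<in> test_functions \<Omega>" and D: "\<And>t. (\<psi> has_real_derivative \<psi>' t) (at t)"
    and c: "continuous_on UNIV \<psi>'" and \<psi>0: "\<psi> 0 = 0"
  shows "h10_pair (\<lambda>x. \<psi> (\<phi> x)) (\<lambda>x. \<psi>' (\<phi> x) *\<^sub>R tgrad \<phi> x)"
proof -
  obtain R where R: "\<And>x. \<bar>\<phi> x\<bar> \<le> R" using test_function_sq_int(6)[OF \<phi>] by blast
  have "compact (\<psi>' ` {-R..R})"
    by (rule compact_continuous_image[OF continuous_on_subset[OF c subset_UNIV] compact_Icc])
  from compact_imp_bounded[OF this] obtain B where B': "\<And>y. y \<in> \<psi>' ` {-R..R} \<Longrightarrow> norm y \<le> B"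
    unfolding bounded_iff by blast
  have B: "\<bar>\<psi>' t\<bar> \<le> B" if "\<bar>t\<bar> \<le> R" for t
    using B'[of "\<psi>' t"] that by (simp add: abs_le_iff)
  note tm = test_M[OF \<phi>]
  have [measurable]: "\<phi> \<in> borel_measurable M" "tgrad \<phi> \<in> borel_measurable M" using tm(1,2) by (auto simp: sq_int_def)
  have [measurable]: "\<psi>' \<in> borel_measurable borel" by (rule borel_measurable_continuous_onI[OF c])
  have "continuous_on UNIV \<psi>" using DERIV_isCont[OF D] by (simp add: continuous_at_imp_continuous_on)
  then have [measurable]: "\<psi> \<in> borel_measurable borel" by (rule borel_measurable_continuous_onI)
  have s1: "sq_int M (\<lambda>x. \<psi> (\<phi> x))"
    by (rule sq_int_bound(1)[OF _ tm(1), of _ B]) (use mean_value_bound_0[OF D B \<psi>0 R] in auto)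
  have s2: "sq_int M (\<lambda>x. \<psi>' (\<phi> x) *\<^sub>R tgrad \<phi> x)"
    by (rule sq_int_bound(1)[OF _ tm(2), of _ B]) (use B[OF R] in \<open>auto intro!: AE_I2 mult_right_mono\<close>)
  show ?thesis unfolding h10_pair_def
  proof (intro conjI s1 s2 allI impI)
    fix e :: real assume e: "e > 0"
    define N where "N = nsq M \<phi> + nsq M (tgrad \<phi>) + 1"
    have N: "N > 0" unfolding N_def using nsq_nonneg[of M \<phi>] nsq_nonneg[of M "tgrad \<phi>"] by linarith
    \<comment> \<open>Both errors together are at most \<eta>^2 N, which is then half of the
      tolerance.\<close>
    define \<eta> where "\<eta> = sqrt (e / (2 * N))"
    have \<eta>: "\<eta> > 0" "\<eta>\<^sup>2 = e / (2 * N)" using e N by (auto simp: \<eta>_def)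
    obtain q where q: "real_polynomial_function q" "\<And>t. t \<in> {-R..R} \<Longrightarrow> \<bar>\<psi>' t - q t\<bar> < \<eta>"
      using Stone_Weierstrass_real_polynomial_function[OF compact_Icc continuous_on_subset[OF c] \<eta>(1), of "-R" R] by auto
    obtain a n where qa: "q = (\<lambda>t. \<Sum>i\<le>n. a i * t ^ i)"
      using q(1) unfolding real_polynomial_function_iff_sum by blast
    define P where "P = (\<lambda>t::real. \<Sum>i\<le>n. a i / real (Suc i) * t ^ Suc i)"
    note PP0 = polynomial_primitive_test[OF \<phi>, where a = a and n = n]
    have PP: "(\<lambda>x. P (\<phi> x)) \<in> test_functions \<Omega>" "tgrad (\<lambda>x. P (\<phi> x)) x = q (\<phi> x) *\<^sub>R tgrad \<phi> x"
      "(P has_real_derivative q t) (at t)" "P 0 = 0" for x t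
      unfolding P_def qa by (rule PP0)+
    have b1: "\<bar>P (\<phi> x) - \<psi> (\<phi> x)\<bar> \<le> \<eta> * \<bar>\<phi> x\<bar>" for x
    proof (rule mean_value_bound_0[of R "\<lambda>t. P t - \<psi> t" "\<lambda>t. q t - \<psi>' t"])
      show "((\<lambda>t. P t - \<psi> t) has_real_derivative q t - \<psi>' t) (at t)" for t by (intro DERIV_diff PP D)
      show "\<bar>q t - \<psi>' t\<bar> \<le> \<eta>" if "\<bar>t\<bar> \<le> R" for t
      proof -
        have "t \<in> {-R..R}" using that by (auto simp: abs_le_iff)
        from q(2)[OF this] show ?thesis by (simp add: abs_minus_commute)
      qed
    qed (use PP(4) \<psi>0 R in auto)
    have b2: "norm (q (\<phi> x) *\<^sub>R tgrad \<phi> x - \<psi>' (\<phi> x) *\<^sub>R tgrad \<phi> x) \<le> \<eta> * norm (tgrad \<phi> x)" for x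
    proof -
      have "\<phi> x \<in> {-R..R}" using R[of x] by (auto simp: abs_le_iff)
      then have "\<bar>q (\<phi> x) - \<psi>' (\<phi> x)\<bar> \<le> \<eta>" using q(2)[of "\<phi> x"] by (simp add: abs_minus_commute)
      then show ?thesis by (simp add: mult_right_mono flip: scaleR_diff_left)
    qed
    have m: "(\<lambda>x. P (\<phi> x)) \<in> borel_measurable M" "tgrad (\<lambda>x. P (\<phi> x)) \<in> borel_measurable M"
      using test_M(1,2)[OF PP(1)] by (auto simp: sq_int_def)
    have tP: "tgrad (\<lambda>x. P (\<phi> x)) = (\<lambda>x. q (\<phi> x) *\<^sub>R tgrad \<phi> x)" using PP(2) by blast
    have "nsq M (\<lambda>x. P (\<phi> x) - \<psi> (\<phi> x)) \<le> \<eta>\<^sup>2 * nsq M \<phi>"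
      by (rule sq_int_bound(2)[OF _ tm(1)]) (use m(1) b1 in auto)
    moreover have "nsq M (\<lambda>x. tgrad (\<lambda>x. P (\<phi> x)) x - \<psi>' (\<phi> x) *\<^sub>R tgrad \<phi> x) \<le> \<eta>\<^sup>2 * nsq M (tgrad \<phi>)"
      by (rule sq_int_bound(2)[OF _ tm(2)]) (use m(2) b2 tP in auto)
    moreover have "\<eta>\<^sup>2 * nsq M \<phi> + \<eta>\<^sup>2 * nsq M (tgrad \<phi>) \<le> \<eta>\<^sup>2 * N"
      unfolding N_def distrib_left[symmetric] by (intro mult_left_mono) auto
    moreover have "\<eta>\<^sup>2 * N < e" unfolding \<eta>(2) using e N by (simp add: field_simps)
    ultimately show "\<exists>\<zeta>\<in>test_functions \<Omega>. nsq M (\<lambda>x. \<zeta> x - \<psi> (\<phi> x)) + nsq M (\<lambda>x. tgrad \<zeta> x - \<psi>' (\<phi> x) *\<^sub>R tgrad \<phi> x) < e"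
      by (intro bexI[OF _ PP(1)]) linarith
  qed
qed

text \<open>Along approximating test functions the gradient of the composite has two errors: a
  bounded coefficient times the gradient error, and the change of the coefficient on the fixed
  gradient \<open>g\<close>. The latter tends to zero by dominated convergence, since the
  approximation also converges almost everywhere.\<close>

theorem h10_pair_compose:
  assumes p: "h10_pair f g" and D: "\<And>t. (\<psi> has_real_derivative \<psi>' t) (at t)"
    and c: "continuous_on UNIV \<psi>'" and \<psi>0: "\<psi> 0 = 0" and B: "\<And>t. \<bar>\<psi>' t\<bar> \<le> B"
  shows "h10_pair (\<lambda>x. \<psi> (f x)) (\<lambda>x. \<psi>' (f x) *\<^sub>R g x)"
proof -
  obtain \<phi> where \<phi>: "\<And>n. \<phi> n \<in> test_functions \<Omega>" "(\<lambda>n. nsq M (\<lambda>x. \<phi> n x - f x)) \<longlonglongrightarrow> 0"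
    "(\<lambda>n. nsq M (\<lambda>x. tgrad (\<phi> n) x - g x)) \<longlonglongrightarrow> 0" "AE x in M. (\<lambda>n. \<phi> n x) \<longlonglongrightarrow> f x"
    using h10_pair_sequence[OF p] by blast
  note d = h10_pairD[OF p]
  have [measurable]: "f \<in> borel_measurable M" "g \<in> borel_measurable M" "\<phi> n \<in> borel_measurable M" "tgrad (\<phi> n) \<in> borel_measurable M" for n
    using d test_M(1,2)[OF \<phi>(1)] by (auto simp: sq_int_def)
  have [measurable]: "\<psi>' \<in> borel_measurable borel" by (rule borel_measurable_continuous_onI[OF c])
  have c\<psi>: "continuous_on UNIV \<psi>" using DERIV_isCont[OF D] by (simp add: continuous_at_imp_continuous_on)
  then have [measurable]: "\<psi> \<in> borel_measurable borel" by (rule borel_measurable_continuous_onI)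
  have lip: "\<bar>\<psi> s - \<psi> t\<bar> \<le> B * \<bar>s - t\<bar>" for s t
    using field_differentiable_bound[of UNIV \<psi> \<psi>' B s t] D B by auto
  have B0: "0 \<le> B" using B[of 0] abs_ge_zero order_trans by blast
  have s1: "sq_int M (\<lambda>x. \<psi> (f x))"
    by (rule sq_int_bound(1)[OF _ d(1), of _ B]) (use lip[of _ 0] \<psi>0 in auto)
  have s2: "sq_int M (\<lambda>x. \<psi>' (f x) *\<^sub>R g x)"
    by (rule sq_int_bound(1)[OF _ d(2), of _ B]) (use B in \<open>auto intro!: AE_I2 mult_right_mono\<close>)
  have s3: "sq_int M (\<lambda>x. \<psi>' (\<phi> n x) *\<^sub>R g x)" for n
    by (rule sq_int_bound(1)[OF _ d(2), of _ B]) (use B in \<open>auto intro!: AE_I2 mult_right_mono\<close>)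
  have s4: "sq_int M (\<lambda>x. \<psi>' (\<phi> n x) *\<^sub>R tgrad (\<phi> n) x)" for n
    by (rule sq_int_bound(1)[OF _ test_M(2)[OF \<phi>(1)], of _ B]) (use B in \<open>auto intro!: AE_I2 mult_right_mono\<close>)
  have l1: "(\<lambda>n. nsq M (\<lambda>x. \<psi> (\<phi> n x) - \<psi> (f x))) \<longlonglongrightarrow> 0"
  proof (rule tendsto_sandwich[OF _ _ tendsto_const])
    have "nsq M (\<lambda>x. \<psi> (\<phi> n x) - \<psi> (f x)) \<le> B\<^sup>2 * nsq M (\<lambda>x. \<phi> n x - f x)" for n
      by (rule sq_int_bound(2)[OF _ sq_int_diff[OF test_M(1)[OF \<phi>(1)] d(1)]]) (use lip in auto)
    then show "eventually (\<lambda>n. nsq M (\<lambda>x. \<psi> (\<phi> n x) - \<psi> (f x)) \<le> B\<^sup>2 * nsq M (\<lambda>x. \<phi> n x - f x)) sequentially" by simp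
    show "(\<lambda>n. B\<^sup>2 * nsq M (\<lambda>x. \<phi> n x - f x)) \<longlonglongrightarrow> 0" using tendsto_mult[OF tendsto_const \<phi>(2), of "B\<^sup>2"] by simp
  qed simp
  have l2: "(\<lambda>n. nsq M (\<lambda>x. \<psi>' (\<phi> n x) *\<^sub>R g x - \<psi>' (f x) *\<^sub>R g x)) \<longlonglongrightarrow> 0"
  proof (rule L2_dominated_convergence(2)[where g = "\<lambda>x. B * norm (g x)"])
    show "sq_int M (\<lambda>x. B * norm (g x))"
      by (rule sq_int_bound(1)[OF _ d(2), of _ B]) (use B0 in auto)
    show "AE x in M. (\<lambda>n. \<psi>' (\<phi> n x) *\<^sub>R g x) \<longlonglongrightarrow> \<psi>' (f x) *\<^sub>R g x"
      using \<phi>(4)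
    proof eventually_elim
      case (elim x)
      have "isCont \<psi>' (f x)" using c by (simp add: continuous_on_eq_continuous_at)
      from isCont_tendsto_compose[OF this elim] show ?case by (intro tendsto_scaleR tendsto_const)
    qed
  qed (use B in \<open>auto intro!: AE_I2 mult_right_mono\<close>)
  have l3: "(\<lambda>n. nsq M (\<lambda>x. \<psi>' (\<phi> n x) *\<^sub>R tgrad (\<phi> n) x - \<psi>' (f x) *\<^sub>R g x)) \<longlonglongrightarrow> 0"
  proof (rule tendsto_sandwich[OF _ _ tendsto_const])
    have "nsq M (\<lambda>x. \<psi>' (\<phi> n x) *\<^sub>R tgrad (\<phi> n) x - \<psi>' (f x) *\<^sub>R g x) \<le>
       2 * nsq M (\<lambda>x. \<psi>' (\<phi> n x) *\<^sub>R tgrad (\<phi> n) x - \<psi>' (\<phi> n x) *\<^sub>R g x) + 2 * nsq M (\<lambda>x. \<psi>' (\<phi> n x) *\<^sub>R g x - \<psi>' (f x) *\<^sub>R g x)" for n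
      by (rule nsq_triangle[OF s4 s3 s2])
    moreover have "nsq M (\<lambda>x. \<psi>' (\<phi> n x) *\<^sub>R tgrad (\<phi> n) x - \<psi>' (\<phi> n x) *\<^sub>R g x) \<le> B\<^sup>2 * nsq M (\<lambda>x. tgrad (\<phi> n) x - g x)" for n
      by (rule sq_int_bound(2)[OF _ sq_int_diff[OF test_M(2)[OF \<phi>(1)] d(2)]])
        (use B in \<open>auto intro!: AE_I2 mult_right_mono simp flip: scaleR_diff_right\<close>)
    ultimately show "eventually (\<lambda>n. nsq M (\<lambda>x. \<psi>' (\<phi> n x) *\<^sub>R tgrad (\<phi> n) x - \<psi>' (f x) *\<^sub>R g x) \<le>
       2 * (B\<^sup>2 * nsq M (\<lambda>x. tgrad (\<phi> n) x - g x)) + 2 * nsq M (\<lambda>x. \<psi>' (\<phi> n x) *\<^sub>R g x - \<psi>' (f x) *\<^sub>R g x)) sequentially"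
      by (intro always_eventually allI) (smt (verit))
    have "(\<lambda>n. 2 * (B\<^sup>2 * nsq M (\<lambda>x. tgrad (\<phi> n) x - g x)) + 2 * nsq M (\<lambda>x. \<psi>' (\<phi> n x) *\<^sub>R g x - \<psi>' (f x) *\<^sub>R g x)) \<longlonglongrightarrow> 2 * (B\<^sup>2 * 0) + 2 * 0"
      by (intro tendsto_intros \<phi>(3) l2)
    then show "(\<lambda>n. 2 * (B\<^sup>2 * nsq M (\<lambda>x. tgrad (\<phi> n) x - g x)) + 2 * nsq M (\<lambda>x. \<psi>' (\<phi> n x) *\<^sub>R g x - \<psi>' (f x) *\<^sub>R g x)) \<longlonglongrightarrow> 0" by simp
  qed simp
  show ?thesis by (rule h10_pair_limit[OF h10_pair_compose_test[OF \<phi>(1) D c \<psi>0] s1 s2 l1 l3])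
qed

lemma h10_pair_mult_test:
  assumes p: "h10_pair f g" and \<zeta>: "\<zeta> \<in> test_functions \<Omega>"
  shows "h10_pair (\<lambda>x. \<zeta> x * f x) (\<lambda>x. \<zeta> x *\<^sub>R g x + f x *\<^sub>R tgrad \<zeta> x)"
proof -
  obtain \<phi> where \<phi>: "\<And>n. \<phi> n \<in> test_functions \<Omega>" "(\<lambda>n. nsq M (\<lambda>x. \<phi> n x - f x)) \<longlonglongrightarrow> 0"
    "(\<lambda>n. nsq M (\<lambda>x. tgrad (\<phi> n) x - g x)) \<longlonglongrightarrow> 0" using h10_pair_sequence[OF p] by blast
  note d = h10_pairD[OF p]
  obtain A where A: "\<And>x. \<bar>\<zeta> x\<bar> \<le> A" using test_function_sq_int(6)[OF \<zeta>] by blast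
  obtain B where B: "\<And>x. norm (tgrad \<zeta> x) \<le> B" using test_function_sq_int(7)[OF \<zeta>] by blast
  have [measurable]: "f \<in> borel_measurable M" "g \<in> borel_measurable M" "\<phi> n \<in> borel_measurable M" "tgrad (\<phi> n) \<in> borel_measurable M"
     "\<zeta> \<in> borel_measurable M" "tgrad \<zeta> \<in> borel_measurable M" for n
    using d test_M(1,2)[OF \<phi>(1)] test_M(1,2)[OF \<zeta>] by (auto simp: sq_int_def)
  have m1: "sq_int M (\<lambda>x. \<zeta> x * u x)" "nsq M (\<lambda>x. \<zeta> x * u x) \<le> A\<^sup>2 * nsq M u" if "sq_int M u" for u
    using sq_int_bound[OF _ that, of "\<lambda>x. \<zeta> x * u x" A] that A by (auto simp: abs_mult mult_right_mono)
  have m2: "sq_int M (\<lambda>x. \<zeta> x *\<^sub>R u x)" "nsq M (\<lambda>x. \<zeta> x *\<^sub>R u x) \<le> A\<^sup>2 * nsq M u" if "sq_int M u" for u :: "'a \<Rightarrow> 'a"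
    using sq_int_bound[OF _ that, of "\<lambda>x. \<zeta> x *\<^sub>R u x" A] that A by (auto simp: abs_mult mult_right_mono)
  have m3: "sq_int M (\<lambda>x. u x *\<^sub>R tgrad \<zeta> x)" "nsq M (\<lambda>x. u x *\<^sub>R tgrad \<zeta> x) \<le> B\<^sup>2 * nsq M u" if "sq_int M u" for u :: "'a \<Rightarrow> real"
    using sq_int_bound[OF _ that, of "\<lambda>x. u x *\<^sub>R tgrad \<zeta> x" B] that B by (auto simp: abs_mult mult.commute[of B] mult_left_mono)
  note f1 = sq_int_diff[OF test_M(1)[OF \<phi>(1)] d(1)] and f2 = sq_int_diff[OF test_M(2)[OF \<phi>(1)] d(2)]
  have tg: "tgrad (\<lambda>x. \<zeta> x * \<phi> n x) x = \<zeta> x *\<^sub>R tgrad (\<phi> n) x + \<phi> n x *\<^sub>R tgrad \<zeta> x" for n x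
    by (rule tgrad_mult[OF test_function_Ck[OF \<zeta>] test_function_Ck[OF \<phi>(1)]])
  show ?thesis
  proof (rule h10_pair_limit)
    show "h10_pair (\<lambda>x. \<zeta> x * \<phi> n x) (tgrad (\<lambda>x. \<zeta> x * \<phi> n x))" for n
      by (intro h10_pair_test test_function_mult \<zeta> \<phi>)
    show "sq_int M (\<lambda>x. \<zeta> x * f x)" "sq_int M (\<lambda>x. \<zeta> x *\<^sub>R g x + f x *\<^sub>R tgrad \<zeta> x)"
      by (intro m1 m2 m3 d sq_int_add)+
    show "(\<lambda>n. nsq M (\<lambda>x. \<zeta> x * \<phi> n x - \<zeta> x * f x)) \<longlonglongrightarrow> 0"
    proof (rule tendsto_sandwich[OF _ _ tendsto_const])
      show "eventually (\<lambda>n. nsq M (\<lambda>x. \<zeta> x * \<phi> n x - \<zeta> x * f x) \<le> A\<^sup>2 * nsq M (\<lambda>x. \<phi> n x - f x)) sequentially"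
        using m1(2)[OF f1] by (simp add: right_diff_distrib)
      show "(\<lambda>n. A\<^sup>2 * nsq M (\<lambda>x. \<phi> n x - f x)) \<longlonglongrightarrow> 0" using tendsto_mult[OF tendsto_const \<phi>(2), of "A\<^sup>2"] by simp
    qed simp
    show "(\<lambda>n. nsq M (\<lambda>x. tgrad (\<lambda>x. \<zeta> x * \<phi> n x) x - (\<zeta> x *\<^sub>R g x + f x *\<^sub>R tgrad \<zeta> x))) \<longlonglongrightarrow> 0"
    proof (rule tendsto_sandwich[OF _ _ tendsto_const])
      show "eventually (\<lambda>n. nsq M (\<lambda>x. tgrad (\<lambda>x. \<zeta> x * \<phi> n x) x - (\<zeta> x *\<^sub>R g x + f x *\<^sub>R tgrad \<zeta> x)) \<le>
          2 * (A\<^sup>2 * nsq M (\<lambda>x. tgrad (\<phi> n) x - g x)) + 2 * (B\<^sup>2 * nsq M (\<lambda>x. \<phi> n x - f x))) sequentially"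
      proof (intro always_eventually allI)
        fix n
        have "(\<lambda>x. tgrad (\<lambda>x. \<zeta> x * \<phi> n x) x - (\<zeta> x *\<^sub>R g x + f x *\<^sub>R tgrad \<zeta> x)) =
          (\<lambda>x. \<zeta> x *\<^sub>R (tgrad (\<phi> n) x - g x) + (\<phi> n x - f x) *\<^sub>R tgrad \<zeta> x)"
          unfolding tg by (simp add: fun_eq_iff algebra_simps)
        then have "nsq M (\<lambda>x. tgrad (\<lambda>x. \<zeta> x * \<phi> n x) x - (\<zeta> x *\<^sub>R g x + f x *\<^sub>R tgrad \<zeta> x)) \<le>
          2 * nsq M (\<lambda>x. \<zeta> x *\<^sub>R (tgrad (\<phi> n) x - g x)) + 2 * nsq M (\<lambda>x. (\<phi> n x - f x) *\<^sub>R tgrad \<zeta> x)"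
          using nsq_add_le[OF m2(1)[OF f2] m3(1)[OF f1]] by simp
        then show "nsq M (\<lambda>x. tgrad (\<lambda>x. \<zeta> x * \<phi> n x) x - (\<zeta> x *\<^sub>R g x + f x *\<^sub>R tgrad \<zeta> x)) \<le>
          2 * (A\<^sup>2 * nsq M (\<lambda>x. tgrad (\<phi> n) x - g x)) + 2 * (B\<^sup>2 * nsq M (\<lambda>x. \<phi> n x - f x))"
          using m2(2)[OF f2, of n] m3(2)[OF f1, of n] by linarith
      qed
      have "(\<lambda>n. 2 * (A\<^sup>2 * nsq M (\<lambda>x. tgrad (\<phi> n) x - g x)) + 2 * (B\<^sup>2 * nsq M (\<lambda>x. \<phi> n x - f x))) \<longlonglongrightarrow> 2 * (A\<^sup>2 * 0) + 2 * (B\<^sup>2 * 0)"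
        by (intro tendsto_intros \<phi>)
      then show "(\<lambda>n. 2 * (A\<^sup>2 * nsq M (\<lambda>x. tgrad (\<phi> n) x - g x)) + 2 * (B\<^sup>2 * nsq M (\<lambda>x. \<phi> n x - f x))) \<longlonglongrightarrow> 0" by simp
    qed simp
  qed
qed

lemma nn_integral_M_eq: "(\<integral>\<^sup>+ x. F x \<partial>M) = (\<integral>\<^sup>+ x. F x * indicator \<Omega> x \<partial>lborel)"
  by (subst nn_integral_restrict_space) (simp_all add: nn_integral_completion)

lemma nn_integral_M_le: "(\<integral>\<^sup>+ x. F x \<partial>M) \<le> (\<integral>\<^sup>+ x. F x \<partial>lborel)"
  unfolding nn_integral_M_eq by (intro nn_integral_mono) (simp add: indicator_def)

text \<open>Fatou's lemma carries the inequality for test functions to their limits; integrability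
  is part of what it delivers.\<close>

lemma h10_pair_L4:
  assumes dim: "DIM('a) \<in> {1, 2, 3}" and p: "h10_pair f g"
  shows "integrable M (\<lambda>x. f x ^ 4)" "(LINT x|M. f x ^ 4) \<le> 16 * (nsq M f + nsq M g)\<^sup>2"
proof -
  obtain \<phi> where \<phi>: "\<And>n. \<phi> n \<in> test_functions \<Omega>" "(\<lambda>n. nsq M (\<lambda>x. \<phi> n x - f x)) \<longlonglongrightarrow> 0"
    "(\<lambda>n. nsq M (\<lambda>x. tgrad (\<phi> n) x - g x)) \<longlonglongrightarrow> 0" "AE x in M. (\<lambda>n. \<phi> n x) \<longlonglongrightarrow> f x"
    using h10_pair_sequence[OF p] by blast
  note d = h10_pairD[OF p]
  have [measurable]: "f \<in> borel_measurable M" "\<phi> n \<in> borel_measurable M" for n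
    using d test_M(1,2)[OF \<phi>(1)] by (auto simp: sq_int_def)
  define N where "N n = nsq M (\<phi> n) + nsq M (tgrad (\<phi> n))" for n
  have bn: "(\<integral>\<^sup>+ x. ennreal (\<phi> n x ^ 4) \<partial>M) \<le> ennreal (16 * (N n)\<^sup>2)" for n
  proof -
    note t = test_function_sq_int[OF \<phi>(1)[of n]]
    have "(\<integral>\<^sup>+ x. ennreal ((\<phi> n x)\<^sup>2 + (norm (tgrad (\<phi> n) x))\<^sup>2) \<partial>lborel) = ennreal (LINT x|lborel. (\<phi> n x)\<^sup>2 + (norm (tgrad (\<phi> n) x))\<^sup>2)"
      using t(1,2) by (intro nn_integral_eq_integral) (auto simp: sq_int_def)
    also have "\<dots> = ennreal (N n)"
      using t(1,2) test_M(3,4)[OF \<phi>(1)[of n]] by (simp add: sq_int_def N_def nsq_def)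
    finally have e: "(\<integral>\<^sup>+ x. ennreal ((\<phi> n x)\<^sup>2 + (norm (tgrad (\<phi> n) x))\<^sup>2) \<partial>lborel) = ennreal (N n)" .
    have "(\<integral>\<^sup>+ x. ennreal (\<phi> n x ^ 4) \<partial>M) \<le> 16 * (ennreal (N n))\<^sup>2"
      using order_trans[OF nn_integral_M_le L4_bound_test_function[OF dim \<phi>(1)[of n]]] unfolding e .
    also have "\<dots> = ennreal (16 * (N n)\<^sup>2)"
    proof -
      have "0 \<le> N n" by (simp add: N_def)
      then show ?thesis by (simp add: ennreal_power ennreal_mult)
    qed
    finally show ?thesis .
  qed
  have Nl: "(\<lambda>n. 16 * (N n)\<^sup>2) \<longlonglongrightarrow> 16 * (nsq M f + nsq M g)\<^sup>2"
    unfolding N_def by (intro tendsto_intros L2_tendsto_nsq test_M d \<phi>)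
  have "(\<integral>\<^sup>+ x. ennreal (f x ^ 4) \<partial>M) \<le> (\<integral>\<^sup>+ x. liminf (\<lambda>n. ennreal (\<phi> n x ^ 4)) \<partial>M)"
  proof (rule nn_integral_mono_AE)
    show "AE x in M. ennreal (f x ^ 4) \<le> liminf (\<lambda>n. ennreal (\<phi> n x ^ 4))"
      using \<phi>(4)
    proof eventually_elim
      case (elim x)
      have "(\<lambda>n. ennreal (\<phi> n x ^ 4)) \<longlonglongrightarrow> ennreal (f x ^ 4)" by (intro tendsto_ennrealI tendsto_power elim)
      from lim_imp_Liminf[OF trivial_limit_sequentially this] show ?case by (simp only: order_refl)
    qed
  qed
  also have "\<dots> \<le> liminf (\<lambda>n. \<integral>\<^sup>+ x. ennreal (\<phi> n x ^ 4) \<partial>M)" by (rule nn_integral_liminf) measurable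
  also have "\<dots> \<le> liminf (\<lambda>n. ennreal (16 * (N n)\<^sup>2))" by (intro Liminf_mono always_eventually allI bn)
  also have "\<dots> = ennreal (16 * (nsq M f + nsq M g)\<^sup>2)"
    by (rule lim_imp_Liminf[OF trivial_limit_sequentially tendsto_ennrealI[OF Nl]])
  finally have le: "(\<integral>\<^sup>+ x. ennreal (f x ^ 4) \<partial>M) \<le> ennreal (16 * (nsq M f + nsq M g)\<^sup>2)" .
  show i: "integrable M (\<lambda>x. f x ^ 4)"
    using le_less_trans[OF le] by (intro integrableI_bounded) (auto simp: power_even_abs)
  have "(\<integral>\<^sup>+ x. ennreal (f x ^ 4) \<partial>M) = ennreal (LINT x|M. f x ^ 4)"
    by (rule nn_integral_eq_integral[OF i]) simp
  with le show "(LINT x|M. f x ^ 4) \<le> 16 * (nsq M f + nsq M g)\<^sup>2" by simp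
qed

text \<open>The Poincare inequality is stated for double differences, so no mean value occurs and
  the limit can be taken by Fatou's lemma in each variable. Segments between points of a box stay
  inside it, hence only the gradient on the box enters.\<close>

lemma h10_pair_Poincare_box:
  assumes p: "h10_pair f g" and ab: "cbox a b \<subseteq> \<Omega>"
  defines "\<rho> \<equiv> norm (b - a)"
  shows "(\<integral>\<^sup>+ x. \<integral>\<^sup>+ y. indicator (box a b) x * indicator (box a b) y * ennreal ((f x - f y)\<^sup>2) \<partial>lebesgue \<partial>lebesgue) \<le>
    ennreal (\<rho>\<^sup>2) * emeasure lborel (cball (0::'a) \<rho>) * ennreal (nsq M (\<lambda>x. indicator (box a b) x *\<^sub>R g x))"
proof -
  let ?B = "box a b"
  obtain \<phi> where \<phi>: "\<And>n. \<phi> n \<in> test_functions \<Omega>" "(\<lambda>n. nsq M (\<lambda>x. \<phi> n x - f x)) \<longlonglongrightarrow> 0"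
    "(\<lambda>n. nsq M (\<lambda>x. tgrad (\<phi> n) x - g x)) \<longlonglongrightarrow> 0" "AE x in M. (\<lambda>n. \<phi> n x) \<longlonglongrightarrow> f x"
    using h10_pair_sequence[OF p] by blast
  note d = h10_pairD[OF p]
  have B\<Omega>: "?B \<subseteq> \<Omega>" using ab box_subset_cbox by blast
  have ae: "AE x in lebesgue. x \<in> ?B \<longrightarrow> (\<lambda>n. \<phi> n x) \<longlonglongrightarrow> f x"
    using \<phi>(4) unfolding AE_lebesgue_on_iff[OF lebesgue_\<Omega>] by eventually_elim (use B\<Omega> in auto)
  have [measurable]: "\<phi> n \<in> borel_measurable borel" "tgrad (\<phi> n) \<in> borel_measurable borel" for n
    using test_M(7,8)[OF \<phi>(1)] by auto
  have [measurable]: "?B \<in> sets borel" by simp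
  define D where "D n x = (\<integral>\<^sup>+ y. indicator ?B x * indicator ?B y * ennreal ((\<phi> n x - \<phi> n y)\<^sup>2) \<partial>lborel)" for n x
  have [measurable]: "D n \<in> borel_measurable borel" for n unfolding D_def by measurable
  have inner: "AE x in lebesgue. (\<integral>\<^sup>+ y. indicator ?B x * indicator ?B y * ennreal ((f x - f y)\<^sup>2) \<partial>lebesgue) \<le> liminf (\<lambda>n. D n x)"
    using ae
  proof eventually_elim
    case (elim x)
    show ?case
    proof (cases "x \<in> ?B")
      case True
      have "(\<integral>\<^sup>+ y. indicator ?B x * indicator ?B y * ennreal ((f x - f y)\<^sup>2) \<partial>lebesgue) \<le>
          (\<integral>\<^sup>+ y. liminf (\<lambda>n. indicator ?B x * indicator ?B y * ennreal ((\<phi> n x - \<phi> n y)\<^sup>2)) \<partial>lebesgue)"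
      proof (rule nn_integral_mono_AE)
        show "AE y in lebesgue. indicator ?B x * indicator ?B y * ennreal ((f x - f y)\<^sup>2) \<le>
            liminf (\<lambda>n. indicator ?B x * indicator ?B y * ennreal ((\<phi> n x - \<phi> n y)\<^sup>2))"
          using ae
        proof eventually_elim
          case y: (elim y)
          show ?case
          proof (cases "y \<in> ?B")
            case yB: True
            have "(\<lambda>n. ennreal ((\<phi> n x - \<phi> n y)\<^sup>2)) \<longlonglongrightarrow> ennreal ((f x - f y)\<^sup>2)"
              using elim y True yB by (intro tendsto_ennrealI tendsto_power tendsto_diff) auto
            from lim_imp_Liminf[OF trivial_limit_sequentially this] show ?thesis using True yB by simp
          qed simp
        qed
      qed
      also have "\<dots> = (\<integral>\<^sup>+ y. liminf (\<lambda>n. indicator ?B x * indicator ?B y * ennreal ((\<phi> n x - \<phi> n y)\<^sup>2)) \<partial>lborel)"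
        by (rule nn_integral_completion)
      also have "\<dots> \<le> liminf (\<lambda>n. D n x)" unfolding D_def by (rule nn_integral_liminf) measurable
      finally show ?thesis .
    qed simp
  qed
  have Dn: "(\<integral>\<^sup>+ x. D n x \<partial>lborel) \<le> ennreal (\<rho>\<^sup>2) * emeasure lborel (cball (0::'a) \<rho>) * ennreal (nsq M (\<lambda>x. indicator ?B x *\<^sub>R tgrad (\<phi> n) x))" for n
  proof -
    have "(\<integral>\<^sup>+ x. D n x \<partial>lborel) = (\<integral>\<^sup>+ x. \<integral>\<^sup>+ y. indicator (?B \<times> ?B) (x, y) * ennreal ((\<phi> n x - \<phi> n y)\<^sup>2) \<partial>lborel \<partial>lborel)"
      unfolding D_def by (intro nn_integral_cong) (simp add: indicator_def)
    also have "\<dots> \<le> ennreal (\<rho>\<^sup>2) * emeasure lborel (cball (0::'a) \<rho>) * (\<integral>\<^sup>+ x. indicator ?B x * ennreal ((norm (tgrad (\<phi> n) x))\<^sup>2) \<partial>lborel)"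
    proof (rule double_integral_increment_le[OF \<phi>(1)])
      show "?B \<times> ?B \<in> sets (borel \<Otimes>\<^sub>M borel)" by measurable
      show "x + t *\<^sub>R (y - x) \<in> ?B" if "(x, y) \<in> ?B \<times> ?B" "0 \<le> t" "t \<le> 1" for x y t
      proof -
        have "(1 - t) *\<^sub>R x + t *\<^sub>R y \<in> ?B"
          using that convex_box(2)[of a b] by (auto simp: convex_alt)
        moreover have "(1 - t) *\<^sub>R x + t *\<^sub>R y = x + t *\<^sub>R (y - x)" by (simp add: algebra_simps)
        ultimately show ?thesis by simp
      qed
      show "norm (y - x) \<le> \<rho>" if "(x, y) \<in> ?B \<times> ?B" for x y
        unfolding \<rho>_def
      proof (rule norm_le_componentwise)
        fix i :: 'a assume i: "i \<in> Basis"
        have "a \<bullet> i < x \<bullet> i" "x \<bullet> i < b \<bullet> i" "a \<bullet> i < y \<bullet> i" "y \<bullet> i < b \<bullet> i"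
          using that i by (auto simp: mem_box)
        then show "\<bar>(y - x) \<bullet> i\<bar> \<le> \<bar>(b - a) \<bullet> i\<bar>" by (simp add: inner_simps)
      qed
    qed simp
    also have "(\<integral>\<^sup>+ x. indicator ?B x * ennreal ((norm (tgrad (\<phi> n) x))\<^sup>2) \<partial>lborel) = (\<integral>\<^sup>+ x. ennreal ((norm (indicator ?B x *\<^sub>R tgrad (\<phi> n) x))\<^sup>2) \<partial>M)"
      unfolding nn_integral_M_eq using B\<Omega> by (intro nn_integral_cong) (auto simp: indicator_def)
    also have "\<dots> = ennreal (nsq M (\<lambda>x. indicator ?B x *\<^sub>R tgrad (\<phi> n) x))"
    proof (rule nn_integral_norm_sq)
      have "(\<lambda>x. indicator ?B x *\<^sub>R tgrad (\<phi> n) x) \<in> borel_measurable M" by (rule borel_measurable_M) measurable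
      then show "sq_int M (\<lambda>x. indicator ?B x *\<^sub>R tgrad (\<phi> n) x)"
        by (rule sq_int_bound(1)[OF _ test_M(2)[OF \<phi>(1)], of _ 1]) (auto simp: indicator_def)
    qed
    finally show ?thesis .
  qed
  have mB: "(indicator ?B :: 'a \<Rightarrow> real) \<in> borel_measurable M" by (rule borel_measurable_M) measurable
  have sqB: "sq_int M (\<lambda>x. indicator ?B x *\<^sub>R u x)" "nsq M (\<lambda>x. indicator ?B x *\<^sub>R u x) \<le> 1\<^sup>2 * nsq M u" if "sq_int M u" for u :: "'a \<Rightarrow> 'a"
    using sq_int_bound[OF borel_measurable_scaleR[OF mB] that, of u 1] that by (auto simp: indicator_def sq_int_def)
  have "(\<lambda>n. nsq M (\<lambda>x. indicator ?B x *\<^sub>R tgrad (\<phi> n) x)) \<longlonglongrightarrow> nsq M (\<lambda>x. indicator ?B x *\<^sub>R g x)"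
  proof (rule L2_tendsto_nsq[OF sqB(1)[OF test_M(2)[OF \<phi>(1)]] sqB(1)[OF d(2)]])
    show "(\<lambda>n. nsq M (\<lambda>x. indicator ?B x *\<^sub>R tgrad (\<phi> n) x - indicator ?B x *\<^sub>R g x)) \<longlonglongrightarrow> 0"
    proof (rule tendsto_sandwich[OF _ _ tendsto_const \<phi>(3)])
      show "eventually (\<lambda>n. nsq M (\<lambda>x. indicator ?B x *\<^sub>R tgrad (\<phi> n) x - indicator ?B x *\<^sub>R g x) \<le> nsq M (\<lambda>x. tgrad (\<phi> n) x - g x)) sequentially"
        using sqB(2)[OF sq_int_diff[OF test_M(2)[OF \<phi>(1)] d(2)]] by (simp add: scaleR_diff_right)
    qed simp
  qed
  then have lim: "(\<lambda>n. ennreal (\<rho>\<^sup>2) * emeasure lborel (cball (0::'a) \<rho>) * ennreal (nsq M (\<lambda>x. indicator ?B x *\<^sub>R tgrad (\<phi> n) x)))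
      \<longlonglongrightarrow> ennreal (\<rho>\<^sup>2) * emeasure lborel (cball (0::'a) \<rho>) * ennreal (nsq M (\<lambda>x. indicator ?B x *\<^sub>R g x))"
    using emeasure_lborel_cball_finite[of "0::'a" \<rho>]
    by (intro ennreal_tendsto_cmult tendsto_ennrealI) (simp_all add: ennreal_mult_less_top)
  have "(\<integral>\<^sup>+ x. \<integral>\<^sup>+ y. indicator ?B x * indicator ?B y * ennreal ((f x - f y)\<^sup>2) \<partial>lebesgue \<partial>lebesgue) \<le> (\<integral>\<^sup>+ x. liminf (\<lambda>n. D n x) \<partial>lebesgue)"
    by (rule nn_integral_mono_AE[OF inner])
  also have "\<dots> = (\<integral>\<^sup>+ x. liminf (\<lambda>n. D n x) \<partial>lborel)" by (rule nn_integral_completion)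
  also have "\<dots> \<le> liminf (\<lambda>n. \<integral>\<^sup>+ x. D n x \<partial>lborel)" by (rule nn_integral_liminf) measurable
  also have "\<dots> \<le> liminf (\<lambda>n. ennreal (\<rho>\<^sup>2) * emeasure lborel (cball (0::'a) \<rho>) * ennreal (nsq M (\<lambda>x. indicator ?B x *\<^sub>R tgrad (\<phi> n) x)))"
    by (intro Liminf_mono always_eventually allI Dn)
  also have "\<dots> = ennreal (\<rho>\<^sup>2) * emeasure lborel (cball (0::'a) \<rho>) * ennreal (nsq M (\<lambda>x. indicator ?B x *\<^sub>R g x))"
    by (rule lim_imp_Liminf[OF trivial_limit_sequentially lim])
  finally show ?thesis .
qed

end

section \<open>Bilinear forms on the Sobolev space\<close>

lemma psd_form_combine:
  assumes "psd_form H A" "psd_form H B" "0 \<le> a" "0 \<le> b"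
  shows "psd_form H (\<lambda>x y. a * A x y + b * B x y)"
proof -
  interpret A: psd_form H A by fact
  interpret B: psd_form H B by fact
  show ?thesis
    by unfold_locales
      (use A.sub assms(3,4) in \<open>auto simp: A.sym B.sym A.linear_simps B.linear_simps A.nonneg B.nonneg algebra_simps\<close>)
qed

lemma psd_form_subspace:
  assumes "psd_form H A" "subspace K" "K \<subseteq> H"
  shows "psd_form K A"
proof -
  interpret A: psd_form H A by fact
  show ?thesis
  proof
    show "subspace K" by (rule assms)
    show "A x y = A y x" if "x \<in> K" "y \<in> K" for x y
      by (rule A.sym) (use that assms(3) in blast)+
    show "A (x + y) z = A x z + A y z" if "x \<in> K" "y \<in> K" "z \<in> K" for x y z
      by (rule A.add_left) (use that assms(3) in blast)+
    show "A (c *\<^sub>R x) y = c * A x y" if "x \<in> K" "y \<in> K" for c x y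
      by (rule A.scale_left) (use that assms(3) in blast)+
    show "0 \<le> A x x" if "x \<in> K" for x
      by (rule A.nonneg) (use that assms(3) in blast)
  qed
qed

context open_domain
begin

lemma H10_sq_int: "f \<in> H10 \<Omega> \<Longrightarrow> sq_int M f" "f \<in> H10 \<Omega> \<Longrightarrow> sq_int M (weak_grad \<Omega> f)"
  using h10_pairD H10_imp_h10_pair by blast+

lemma H10_add:
  assumes "f \<in> H10 \<Omega>" "g \<in> H10 \<Omega>"
  shows "f + g \<in> H10 \<Omega>" "AE x in M. weak_grad \<Omega> (f + g) x = weak_grad \<Omega> f x + weak_grad \<Omega> g x"
proof -
  have eq: "(\<lambda>x. f x + g x) = f + g" by (simp add: fun_eq_iff)
  note p = h10_pair_add[OF assms[THEN H10_imp_h10_pair], unfolded eq]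
  show "f + g \<in> H10 \<Omega>" "AE x in M. weak_grad \<Omega> (f + g) x = weak_grad \<Omega> f x + weak_grad \<Omega> g x"
    by (rule h10_pair_imp_H10[OF p], rule h10_pair_grad_AE[OF p])
qed

lemma H10_scale:
  assumes "f \<in> H10 \<Omega>"
  shows "c *\<^sub>R f \<in> H10 \<Omega>" "AE x in M. weak_grad \<Omega> (c *\<^sub>R f) x = c *\<^sub>R weak_grad \<Omega> f x"
proof -
  have eq: "(\<lambda>x. c * f x) = c *\<^sub>R f" by (simp add: fun_eq_iff)
  note p = h10_pair_scale[OF assms[THEN H10_imp_h10_pair], of c, unfolded eq]
  show "c *\<^sub>R f \<in> H10 \<Omega>" "AE x in M. weak_grad \<Omega> (c *\<^sub>R f) x = c *\<^sub>R weak_grad \<Omega> f x"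
    by (rule h10_pair_imp_H10[OF p], rule h10_pair_grad_AE[OF p])
qed

lemma H10_zero: "0 \<in> H10 \<Omega>"
  using h10_pair_imp_H10[OF h10_pair_test[OF test_function_zero]] by (simp add: zero_fun_def)

lemma subspace_H10: "subspace (H10 \<Omega>)"
  unfolding subspace_def using H10_zero H10_add(1) H10_scale(1) by blast

lemma H10_diff_AE:
  assumes "f \<in> H10 \<Omega>" "g \<in> H10 \<Omega>"
  shows "f - g \<in> H10 \<Omega>" "AE x in M. weak_grad \<Omega> (f - g) x = weak_grad \<Omega> f x - weak_grad \<Omega> g x"
proof -
  have eq: "f - g = f + (-1) *\<^sub>R g" by simp
  show "f - g \<in> H10 \<Omega>" unfolding eq by (intro H10_add H10_scale assms)
  show "AE x in M. weak_grad \<Omega> (f - g) x = weak_grad \<Omega> f x - weak_grad \<Omega> g x"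
    using H10_add(2)[OF assms(1) H10_scale(1)[OF assms(2), of "-1"]] H10_scale(2)[OF assms(2), of "-1"]
    unfolding eq by eventually_elim simp
qed

lemma weighted_L2_psd:
  assumes W: "AE x in M. 0 \<le> W x"
    and int: "\<And>f g. f \<in> H10 \<Omega> \<Longrightarrow> g \<in> H10 \<Omega> \<Longrightarrow> integrable M (\<lambda>x. W x * f x * g x)"
  shows "psd_form (H10 \<Omega>) (\<lambda>f g. LINT x|M. W x * f x * g x)"
proof
  fix f g h :: "'a \<Rightarrow> real" and c :: real
  assume f: "f \<in> H10 \<Omega>" and g: "g \<in> H10 \<Omega>"
  show "(LINT x|M. W x * f x * g x) = (LINT x|M. W x * g x * f x)" by (simp add: mult_ac)
  show "(LINT x|M. W x * (f + g) x * h x) = (LINT x|M. W x * f x * h x) + (LINT x|M. W x * g x * h x)"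
    if h: "h \<in> H10 \<Omega>"
    using int[OF f h] int[OF g h] by (simp add: algebra_simps)
  show "(LINT x|M. W x * (c *\<^sub>R f) x * g x) = c * (LINT x|M. W x * f x * g x)"
    using int[OF f g] by (simp add: mult_ac flip: integral_mult_right)
  show "0 \<le> (LINT x|M. W x * f x * f x)"
  proof (rule integral_nonneg_AE)
    show "AE x in M. 0 \<le> W x * f x * f x" using W by eventually_elim (simp add: mult.assoc)
  qed
qed (rule subspace_H10)

lemma psd_L2_inner: "psd_form (H10 \<Omega>) (L2_inner \<Omega>)"
  using weighted_L2_psd[of "\<lambda>x. 1"] sq_int_mult[OF H10_sq_int(1) H10_sq_int(1)]
  by (simp add: L2_inner_def[abs_def])

lemma grad_inner_psd: "psd_form (H10 \<Omega>) (grad_inner \<Omega>)"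
proof
  let ?w = "weak_grad \<Omega>"
  fix f g h :: "'a \<Rightarrow> real" and c :: real
  assume f: "f \<in> H10 \<Omega>" and g: "g \<in> H10 \<Omega>"
  note m = borel_measurable_integrable[OF sq_int_inner[OF H10_sq_int(2) H10_sq_int(2)]]
  show "grad_inner \<Omega> f g = grad_inner \<Omega> g f" by (simp add: grad_inner_def inner_commute)
  show "grad_inner \<Omega> (f + g) h = grad_inner \<Omega> f h + grad_inner \<Omega> g h" if h: "h \<in> H10 \<Omega>"
  proof -
    have "grad_inner \<Omega> (f + g) h = (LINT x|M. ?w f x \<bullet> ?w h x + ?w g x \<bullet> ?w h x)"
      unfolding grad_inner_def
    proof (rule integral_cong_AE)
      show "AE x in M. ?w (f + g) x \<bullet> ?w h x = ?w f x \<bullet> ?w h x + ?w g x \<bullet> ?w h x"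
        using H10_add(2)[OF f g] by eventually_elim (simp add: inner_add_left)
    qed (intro m f g h H10_add(1) borel_measurable_add)+
    then show ?thesis
      using sq_int_inner[OF H10_sq_int(2)[OF f] H10_sq_int(2)[OF h]] sq_int_inner[OF H10_sq_int(2)[OF g] H10_sq_int(2)[OF h]]
      by (simp add: grad_inner_def)
  qed
  show "grad_inner \<Omega> (c *\<^sub>R f) g = c * grad_inner \<Omega> f g"
  proof -
    have "grad_inner \<Omega> (c *\<^sub>R f) g = (LINT x|M. c * (?w f x \<bullet> ?w g x))"
      unfolding grad_inner_def
    proof (rule integral_cong_AE)
      show "AE x in M. ?w (c *\<^sub>R f) x \<bullet> ?w g x = c * (?w f x \<bullet> ?w g x)"
        using H10_scale(2)[OF f, of c] by eventually_elim simp
    qed (intro m f g H10_scale(1) borel_measurable_times borel_measurable_const)+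
    then show ?thesis by (simp add: grad_inner_def)
  qed
  show "0 \<le> grad_inner \<Omega> f f" by (simp add: grad_inner_def)
qed (rule subspace_H10)

definition H1_inner :: "('a \<Rightarrow> real) \<Rightarrow> ('a \<Rightarrow> real) \<Rightarrow> real" where
  "H1_inner f g = 1 * L2_inner \<Omega> f g + 1 * grad_inner \<Omega> f g"

lemma psd_H1_inner: "psd_form (H10 \<Omega>) H1_inner"
  unfolding H1_inner_def[abs_def] by (intro psd_form_combine psd_L2_inner grad_inner_psd) auto

lemma L2_inner_self: "L2_inner \<Omega> f f = nsq M f"
  by (simp add: L2_inner_def nsq_def power2_eq_square)

lemma grad_inner_self: "grad_inner \<Omega> f f = nsq M (weak_grad \<Omega> f)"
  by (simp add: grad_inner_def nsq_def power2_norm_eq_inner)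

lemma H1_inner_self: "H1_inner f f = nsq M f + nsq M (weak_grad \<Omega> f)"
  by (simp add: H1_inner_def L2_inner_self grad_inner_self)

lemma H1_norm_inner: "H1_norm \<Omega> f = sqrt (H1_inner f f)"
  by (simp add: H1_norm_eq H1_inner_self)

lemma L2_norm_inner: "L2_norm \<Omega> f = sqrt (L2_inner \<Omega> f f)"
  by (simp add: L2_inner_self L2_norm_def nsq_def)

lemma nsq_weak_grad_diff:
  assumes "f \<in> H10 \<Omega>" "h10_pair g g'"
  shows "nsq M (weak_grad \<Omega> (f - g)) = nsq M (\<lambda>x. weak_grad \<Omega> f x - g' x)"
proof (rule nsq_cong_AE)
  have g: "g \<in> H10 \<Omega>" using assms(2) by (rule h10_pair_imp_H10)
  show "weak_grad \<Omega> (f - g) \<in> borel_measurable M" "(\<lambda>x. weak_grad \<Omega> f x - g' x) \<in> borel_measurable M"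
    using H10_sq_int(2)[OF H10_diff_AE(1)[OF assms(1) g]] sq_int_diff[OF H10_sq_int(2)[OF assms(1)] h10_pairD(2)[OF assms(2)]]
    by (auto simp: sq_int_def)
  show "AE x in M. weak_grad \<Omega> (f - g) x = weak_grad \<Omega> f x - g' x"
    using H10_diff_AE(2)[OF assms(1) g] h10_pair_grad_AE[OF assms(2)] by eventually_elim simp
qed

section \<open>Completeness and compactness\<close>

lemma H10_complete:
  assumes X: "\<And>n. X n \<in> H10 \<Omega>"
    and Cauchy: "\<And>e. e > 0 \<Longrightarrow> \<exists>N. \<forall>m\<ge>N. \<forall>n\<ge>N. H1_inner (X m - X n) (X m - X n) < e"
  shows "\<exists>x\<in>H10 \<Omega>. (\<lambda>n. H1_inner (X n - x) (X n - x)) \<longlonglongrightarrow> 0"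
proof -
  have split: "H1_inner (X m - X n) (X m - X n) =
      nsq M (\<lambda>x. X m x - X n x) + nsq M (\<lambda>x. weak_grad \<Omega> (X m) x - weak_grad \<Omega> (X n) x)" for m n
    using nsq_weak_grad_diff[OF X H10_imp_h10_pair[OF X]] by (simp add: H1_inner_self fun_diff_def)
  have C: "\<exists>N. \<forall>m\<ge>N. \<forall>n\<ge>N. F m n < e"
    if F: "\<And>m n. F m n \<le> H1_inner (X m - X n) (X m - X n)" and e: "e > 0" for F :: "nat \<Rightarrow> nat \<Rightarrow> real" and e
  proof -
    obtain N where "\<forall>m\<ge>N. \<forall>n\<ge>N. H1_inner (X m - X n) (X m - X n) < e" using Cauchy[OF e] by blast
    then show ?thesis using F le_less_trans by blast
  qed
  obtain f where f: "sq_int M f" "(\<lambda>n. nsq M (\<lambda>x. X n x - f x)) \<longlonglongrightarrow> 0"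
    using L2_complete[of M X, OF H10_sq_int(1)[OF X]] C[of "\<lambda>m n. nsq M (\<lambda>x. X m x - X n x)"] split by auto
  obtain g where g: "sq_int M g" "(\<lambda>n. nsq M (\<lambda>x. weak_grad \<Omega> (X n) x - g x)) \<longlonglongrightarrow> 0"
    using L2_complete[of M "\<lambda>n. weak_grad \<Omega> (X n)", OF H10_sq_int(2)[OF X]] C[of "\<lambda>m n. nsq M (\<lambda>x. weak_grad \<Omega> (X m) x - weak_grad \<Omega> (X n) x)"] split by auto
  have p: "h10_pair f g" by (rule h10_pair_limit[OF H10_imp_h10_pair[OF X] f(1) g(1) f(2) g(2)])
  have "H1_inner (X n - f) (X n - f) = nsq M (\<lambda>x. X n x - f x) + nsq M (\<lambda>x. weak_grad \<Omega> (X n) x - g x)" for n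
    using nsq_weak_grad_diff[OF X p] by (simp add: H1_inner_self fun_diff_def)
  then have "(\<lambda>n. H1_inner (X n - f) (X n - f)) \<longlonglongrightarrow> 0 + 0"
    by (simp only:) (intro tendsto_add f g)
  then show ?thesis using h10_pair_imp_H10[OF p] by auto
qed

text \<open>Each member is replaced by a test function at squared H1 distance below 1/(n+1). This
  error vanishes along any subsequence, so a Cauchy subsequence of the test functions serves for the
  original sequence.\<close>

lemma H10_Rellich:
  assumes bnd: "bounded \<Omega>" and X: "\<And>n. X n \<in> H10 \<Omega>" and R: "\<And>n. H1_inner (X n) (X n) \<le> R"
  shows "\<exists>r. strict_mono (r :: nat \<Rightarrow> nat) \<and>
    (\<forall>e>0. \<exists>N. \<forall>m\<ge>N. \<forall>n\<ge>N. L2_inner \<Omega> (X (r m) - X (r n)) (X (r m) - X (r n)) < e)"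
proof -
  have "\<exists>\<phi>\<in>test_functions \<Omega>. nsq M (\<lambda>x. \<phi> x - X n x) + nsq M (\<lambda>x. tgrad \<phi> x - weak_grad \<Omega> (X n) x) < 1 / real (Suc n)" for n
    using H10_imp_h10_pair[OF X[of n]] unfolding h10_pair_def by simp
  then obtain \<phi> where \<phi>: "\<And>n. \<phi> n \<in> test_functions \<Omega>"
    "\<And>n. nsq M (\<lambda>x. \<phi> n x - X n x) + nsq M (\<lambda>x. tgrad (\<phi> n) x - weak_grad \<Omega> (X n) x) < 1 / real (Suc n)" by metis
  note s = H10_sq_int(1)[OF X] and w = H10_sq_int(2)[OF X]
  have "nsq lborel (\<phi> n) + nsq lborel (tgrad (\<phi> n)) \<le> 2 * R + 2" for n
  proof -
    have "nsq M (\<phi> n) \<le> 2 * nsq M (\<lambda>x. \<phi> n x - X n x) + 2 * nsq M (X n)"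
      using nsq_add_le[OF sq_int_diff[OF test_M(1)[OF \<phi>(1)] s] s, of n n n] by simp
    moreover have "nsq M (tgrad (\<phi> n)) \<le> 2 * nsq M (\<lambda>x. tgrad (\<phi> n) x - weak_grad \<Omega> (X n) x) + 2 * nsq M (weak_grad \<Omega> (X n))"
      using nsq_add_le[OF sq_int_diff[OF test_M(2)[OF \<phi>(1)] w] w, of n n n] by simp
    moreover have "1 / real (Suc n) \<le> 1" by simp
    ultimately show ?thesis
      using \<phi>(2)[of n] R[of n] test_M(3,4)[OF \<phi>(1)[of n]] unfolding H1_inner_self by linarith
  qed
  from Rellich_test_functions[of \<phi>, OF \<phi>(1) bnd this] obtain r where r0:
    "strict_mono (r :: nat \<Rightarrow> nat) \<and> (\<forall>e>0. \<exists>N. \<forall>m\<ge>N. \<forall>n\<ge>N. nsq lborel (\<lambda>x. \<phi> (r m) x - \<phi> (r n) x) < e)"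
    by (rule exE)
  have r: "strict_mono (r :: nat \<Rightarrow> nat)"
    "\<And>e. e > 0 \<Longrightarrow> \<exists>N. \<forall>m\<ge>N. \<forall>n\<ge>N. nsq lborel (\<lambda>x. \<phi> (r m) x - \<phi> (r n) x) < e"
    using conjunct1[OF r0] conjunct2[OF r0, rule_format] by auto
  have "\<exists>N. \<forall>m\<ge>N. \<forall>n\<ge>N. L2_inner \<Omega> (X (r m) - X (r n)) (X (r m) - X (r n)) < e" if e: "e > 0" for e
  proof -
    obtain N1 where N1: "\<And>m n. m \<ge> N1 \<Longrightarrow> n \<ge> N1 \<Longrightarrow> nsq lborel (\<lambda>x. \<phi> (r m) x - \<phi> (r n) x) < e / 8"
      using r(2)[of "e / 8"] e by auto
    obtain N2 :: nat where N2: "16 / e < real N2" using reals_Archimedean2 by blast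
    have "L2_inner \<Omega> (X (r m) - X (r n)) (X (r m) - X (r n)) < e" if mn: "m \<ge> max N1 N2" "n \<ge> max N1 N2" for m n
    proof -
      have small: "nsq M (\<lambda>x. \<phi> (r k) x - X (r k) x) < e / 16" if "k \<ge> N2" for k
      proof -
        have "N2 \<le> r k" using seq_suble[OF r(1), of k] that by linarith
        then have "16 / e < real (Suc (r k))" using N2 by linarith
        then have "1 / real (Suc (r k)) < e / 16" using e by (simp add: field_simps)
        then show ?thesis using \<phi>(2)[of "r k"] nsq_nonneg[of M "\<lambda>x. tgrad (\<phi> (r k)) x - weak_grad \<Omega> (X (r k)) x"] by linarith
      qed
      have "nsq M (\<lambda>x. X (r m) x - X (r n) x) \<le> 2 * nsq M (\<lambda>x. X (r m) x - \<phi> (r m) x) + 2 * nsq M (\<lambda>x. \<phi> (r m) x - X (r n) x)"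
        by (rule nsq_triangle[OF s test_M(1)[OF \<phi>(1)] s])
      moreover have "nsq M (\<lambda>x. \<phi> (r m) x - X (r n) x) \<le> 2 * nsq M (\<lambda>x. \<phi> (r m) x - \<phi> (r n) x) + 2 * nsq M (\<lambda>x. \<phi> (r n) x - X (r n) x)"
        by (rule nsq_triangle[OF test_M(1)[OF \<phi>(1)] test_M(1)[OF \<phi>(1)] s])
      moreover have "nsq M (\<lambda>x. \<phi> (r m) x - \<phi> (r n) x) < e / 8"
        using N1[of m n] mn test_M(3)[OF test_function_diff[OF \<phi>(1) \<phi>(1)], of "r m" "r n"] by simp
      moreover have "nsq M (\<lambda>x. X (r m) x - \<phi> (r m) x) < e / 16"
        using small[of m] mn by (simp add: nsq_minus_commute[of M "X (r m)"])
      moreover have "nsq M (\<lambda>x. \<phi> (r n) x - X (r n) x) < e / 16" using small[of n] mn by simp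
      ultimately show ?thesis using e by (simp add: L2_inner_self fun_diff_def)
    qed
    then show ?thesis by blast
  qed
  with r(1) show ?thesis by blast
qed

lemma compact_pair_H10:
  assumes "bounded \<Omega>"
  shows "compact_pair (H10 \<Omega>) H1_inner (L2_inner \<Omega>)"
proof -
  interpret G: psd_form "H10 \<Omega>" H1_inner by (rule psd_H1_inner)
  interpret ip: psd_form "H10 \<Omega>" "L2_inner \<Omega>" by (rule psd_L2_inner)
  show ?thesis
  proof
    show "L2_inner \<Omega> f f \<le> H1_inner f f" for f by (simp add: H1_inner_self L2_inner_self)
  qed (fact H10_complete H10_Rellich[OF assms])+
qed

text \<open>Prepares the Rayleigh argument on the orthogonal complement of \<open>u\<close>, which
  produces the second eigenvalue. The complement is complete because the condition is continuous
  already for the weaker inner product.\<close>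

lemma compact_pair_orthogonal:
  assumes bnd: "bounded \<Omega>" and u: "u \<in> H10 \<Omega>"
  shows "compact_pair {v \<in> H10 \<Omega>. L2_inner \<Omega> v u = 0} H1_inner (L2_inner \<Omega>)"
proof -
  let ?K = "{v \<in> H10 \<Omega>. L2_inner \<Omega> v u = 0}"
  interpret P: compact_pair "H10 \<Omega>" H1_inner "L2_inner \<Omega>" by (rule compact_pair_H10[OF bnd])
  have z: "L2_inner \<Omega> 0 u = 0" by (simp add: L2_inner_def)
  have sK: "subspace ?K"
    unfolding subspace_def using H10_zero z u by (auto simp: P.ip.linear_simps)
  interpret G: psd_form ?K H1_inner by (rule psd_form_subspace[OF psd_H1_inner sK]) blast
  interpret ip: psd_form ?K "L2_inner \<Omega>" by (rule psd_form_subspace[OF psd_L2_inner sK]) blast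
  show ?thesis
  proof
    show "L2_inner \<Omega> f f \<le> H1_inner f f" for f by (simp add: H1_inner_self L2_inner_self)
    show "\<exists>x\<in>?K. (\<lambda>n. H1_inner (X n - x) (X n - x)) \<longlonglongrightarrow> 0"
      if X: "\<And>n. X n \<in> ?K" and C: "\<And>e. e > 0 \<Longrightarrow> \<exists>N. \<forall>m\<ge>N. \<forall>n\<ge>N. H1_inner (X m - X n) (X m - X n) < e" for X
    proof -
      have XH: "\<And>n. X n \<in> H10 \<Omega>" using X by blast
      obtain x where x: "x \<in> H10 \<Omega>" "(\<lambda>n. H1_inner (X n - x) (X n - x)) \<longlonglongrightarrow> 0"
        using H10_complete[of X, OF XH C] by blast
      have "(\<lambda>n. L2_inner \<Omega> (X n - x) (X n - x)) \<longlonglongrightarrow> 0"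
        by (rule tendsto_sandwich[OF _ _ tendsto_const x(2)])
          (use P.ip.nonneg P.ip_le XH x(1) in auto)
      from P.ip.tendsto_left[OF XH x(1) u this] have "L2_inner \<Omega> x u = 0"
        using X by (simp add: LIMSEQ_const_iff)
      with x show ?thesis by blast
    qed
    show "\<exists>r. strict_mono (r :: nat \<Rightarrow> nat) \<and>
       (\<forall>e>0. \<exists>N. \<forall>m\<ge>N. \<forall>n\<ge>N. L2_inner \<Omega> (X (r m) - X (r n)) (X (r m) - X (r n)) < e)"
      if X: "\<And>n. X n \<in> ?K" and R: "\<And>n. H1_inner (X n) (X n) \<le> R" for X R
      by (rule H10_Rellich[OF bnd _ R]) (use X in blast)
  qed
qed

section \<open>The quartic form\<close>

definition quad :: "('a \<Rightarrow> real) \<Rightarrow> ('a \<Rightarrow> real) \<Rightarrow> ('a \<Rightarrow> real) \<Rightarrow> ('a \<Rightarrow> real) \<Rightarrow> real" where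
  "quad a b c d = (LINT x|M. a x * b x * c x * d x)"

lemma product_sq_int:
  assumes dim: "DIM('a) \<in> {1, 2, 3}" and ab: "a \<in> H10 \<Omega>" "b \<in> H10 \<Omega>"
  shows "sq_int M (\<lambda>x. a x * b x)" "nsq M (\<lambda>x. a x * b x) \<le> 16 * H1_inner a a * H1_inner b b"
proof -
  have sq: "sq_int M (\<lambda>x. (f x)\<^sup>2)" "sqrt (nsq M (\<lambda>x. (f x)\<^sup>2)) \<le> 4 * H1_inner f f" if f: "f \<in> H10 \<Omega>" for f
  proof -
    note L = h10_pair_L4[OF dim H10_imp_h10_pair[OF f]]
    have [measurable]: "f \<in> borel_measurable M" using H10_sq_int(1)[OF f] by (simp add: sq_int_def)
    show "sq_int M (\<lambda>x. (f x)\<^sup>2)" using L(1) by (simp add: sq_int_def flip: power_mult)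
    have "nsq M (\<lambda>x. (f x)\<^sup>2) \<le> (4 * H1_inner f f)\<^sup>2"
      unfolding H1_inner_self power_mult_distrib using L(2) by (simp add: nsq_def[of M "\<lambda>x. (f x)\<^sup>2"] flip: power_mult)
    then show "sqrt (nsq M (\<lambda>x. (f x)\<^sup>2)) \<le> 4 * H1_inner f f"
      by (intro real_le_lsqrt) (auto simp: H1_inner_self)
  qed
  have [measurable]: "a \<in> borel_measurable M" "b \<in> borel_measurable M" using H10_sq_int(1) ab by (auto simp: sq_int_def)
  have i: "integrable M (\<lambda>x. (a x)\<^sup>2 * (b x)\<^sup>2)" by (rule sq_int_mult[OF sq(1)[OF ab(1)] sq(1)[OF ab(2)]])
  then show "sq_int M (\<lambda>x. a x * b x)" by (simp add: sq_int_def power_mult_distrib)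
  have "nsq M (\<lambda>x. a x * b x) = (LINT x|M. (a x)\<^sup>2 \<bullet> (b x)\<^sup>2)" by (simp add: nsq_def power_mult_distrib)
  also have "\<dots> \<le> sqrt (nsq M (\<lambda>x. (a x)\<^sup>2)) * sqrt (nsq M (\<lambda>x. (b x)\<^sup>2))"
    using L2_Cauchy_Schwarz_sqrt[OF sq(1)[OF ab(1)] sq(1)[OF ab(2)]] by linarith
  also have "\<dots> \<le> (4 * H1_inner a a) * (4 * H1_inner b b)"
    using sq(2)[OF ab(1)] sq(2)[OF ab(2)] by (intro mult_mono) (auto simp: H1_inner_self)
  finally show "nsq M (\<lambda>x. a x * b x) \<le> 16 * H1_inner a a * H1_inner b b" by simp
qed

lemma quad_integrable:
  assumes dim: "DIM('a) \<in> {1, 2, 3}" and "a \<in> H10 \<Omega>" "b \<in> H10 \<Omega>" "c \<in> H10 \<Omega>" "d \<in> H10 \<Omega>"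
  shows "integrable M (\<lambda>x. a x * b x * c x * d x)"
  using sq_int_mult[OF product_sq_int(1)[OF dim assms(2,3)] product_sq_int(1)[OF dim assms(4,5)]]
  by (simp add: mult.assoc)

lemma quad_bound:
  assumes dim: "DIM('a) \<in> {1, 2, 3}" and "a \<in> H10 \<Omega>" "b \<in> H10 \<Omega>" "c \<in> H10 \<Omega>" "d \<in> H10 \<Omega>"
  shows "\<bar>quad a b c d\<bar> \<le> 16 * sqrt (H1_inner a a) * sqrt (H1_inner b b) * sqrt (H1_inner c c) * sqrt (H1_inner d d)"
proof -
  note p = product_sq_int[OF dim assms(2,3)] and q = product_sq_int[OF dim assms(4,5)]
  have "\<bar>quad a b c d\<bar> \<le> sqrt (nsq M (\<lambda>x. a x * b x)) * sqrt (nsq M (\<lambda>x. c x * d x))"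
    using L2_Cauchy_Schwarz_sqrt[OF p(1) q(1)] by (simp add: quad_def mult.assoc)
  also have "\<dots> \<le> sqrt (16 * H1_inner a a * H1_inner b b) * sqrt (16 * H1_inner c c * H1_inner d d)"
    using p(2) q(2) by (intro mult_mono) (auto simp: H1_inner_self)
  also have "\<dots> = 16 * sqrt (H1_inner a a) * sqrt (H1_inner b b) * sqrt (H1_inner c c) * sqrt (H1_inner d d)"
    by (simp add: real_sqrt_mult)
  finally show ?thesis .
qed

lemma quad_add:
  assumes dim: "DIM('a) \<in> {1, 2, 3}" and "a \<in> H10 \<Omega>" "b \<in> H10 \<Omega>" "c \<in> H10 \<Omega>" "d \<in> H10 \<Omega>" "e \<in> H10 \<Omega>"
  shows "quad (a + b) c d e = quad a c d e + quad b c d e"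
  using quad_integrable[OF dim assms(2,4,5,6)] quad_integrable[OF dim assms(3,4,5,6)]
  by (simp add: quad_def distrib_right)

lemma quad_scale: "quad (r *\<^sub>R a) b c d = r * quad a b c d"
  by (simp add: quad_def mult.assoc)

lemma quad_12: "quad a b c d = quad b a c d" and quad_13: "quad a b c d = quad c b a d"
  and quad_34: "quad a b c d = quad a b d c"
  by (simp_all add: quad_def mult_ac)

end

section \<open>The ground state\<close>

text \<open>The positive part is not C1 but its square is, and the chain rule asks for a C1
  function.\<close>

lemma DERIV_max_0_sq: "((\<lambda>t. (max 0 t)\<^sup>2) has_real_derivative 2 * max 0 t) (at (t::real))"
proof -
  consider "t < 0" | "t = 0" | "t > 0" by linarith
  then show ?thesis
  proof cases
    case 1
    have "((\<lambda>t. 0) has_real_derivative 0) (at t)" by simp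
    then have "((\<lambda>t. (max 0 t)\<^sup>2) has_real_derivative 0) (at t)"
      by (rule has_field_derivative_transform_within_open[of _ _ _ "{..<0}"]) (use 1 in auto)
    then show ?thesis using 1 by simp
  next
    case 2
    have "(\<lambda>h. (max 0 h)\<^sup>2 / h) \<midarrow>0\<rightarrow> (0::real)"
    proof (rule Lim_null_comparison)
      show "\<forall>\<^sub>F h in at (0::real). norm ((max 0 h)\<^sup>2 / h) \<le> \<bar>h\<bar>"
        by (rule always_eventually) (auto simp: max_def power2_eq_square)
      show "(\<lambda>h. \<bar>h\<bar>) \<midarrow>0\<rightarrow> (0::real)" by (rule tendsto_eq_intros | simp)+
    qed
    then show ?thesis using 2 by (simp add: DERIV_def)
  next
    case 3
    have "((\<lambda>t. t\<^sup>2) has_real_derivative 2 * t) (at t)" by (auto intro!: derivative_eq_intros)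
    then have "((\<lambda>t. (max 0 t)\<^sup>2) has_real_derivative 2 * t) (at t)"
      by (rule has_field_derivative_transform_within_open[of _ _ _ "{0<..}"]) (use 3 in auto)
    then show ?thesis using 3 by simp
  qed
qed

locale ground_state = open_domain \<Omega> for \<Omega> :: "'a::euclidean_space set" +
  fixes V u :: "'a \<Rightarrow> real" and \<beta> \<tau> :: real
  assumes dim: "DIM('a) \<in> {1, 2, 3}" and bnd: "bounded \<Omega>" and conv: "convex \<Omega>"
    and V: "V \<in> Linf \<Omega>" and V_nonneg: "AE x in M. 0 \<le> V x" and \<beta>: "0 \<le> \<beta>" and \<tau>: "0 < \<tau>"
    and gs: "positive_ground_state \<Omega> V \<beta> u"
begin

sublocale compact_pair "H10 \<Omega>" H1_inner "L2_inner \<Omega>"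
  by (rule compact_pair_H10[OF bnd])

lemma u_mem: "u \<in> H10 \<Omega>" and u_pos: "AE x in M. 0 < u x" and u_norm: "L2_inner \<Omega> u u = 1"
  using gs by (auto simp: positive_ground_state_def L2_norm_inner)

lemma V_measurable [measurable]: "V \<in> borel_measurable M"
  using V by (simp add: Linf_def)

lemma V_bound: "\<exists>C\<ge>0. AE x in M. \<bar>V x\<bar> \<le> C"
proof -
  obtain n :: nat where n: "Linf_norm \<Omega> V < ereal (real n)"
    using V less_PInf_Ex_of_nat[of "Linf_norm \<Omega> V"] by (auto simp: Linf_def)
  have "AE x in M. ereal \<bar>V x\<bar> \<le> Linf_norm \<Omega> V"
    unfolding Linf_norm_def by (rule esssup_AE)
  then have "AE x in M. \<bar>V x\<bar> \<le> real n"
  proof eventually_elim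
    case (elim x)
    then have "ereal \<bar>V x\<bar> < ereal (real n)" using n by (rule le_less_trans)
    then show ?case by simp
  qed
  then show ?thesis by (intro exI[of _ "real n"]) auto
qed

lemma H10_measurable: "f \<in> H10 \<Omega> \<Longrightarrow> f \<in> borel_measurable M"
  using H10_sq_int(1) by (simp add: sq_int_def)

lemma V_integrable:
  assumes "f \<in> H10 \<Omega>" "g \<in> H10 \<Omega>"
  shows "integrable M (\<lambda>x. V x * f x * g x)"
proof -
  obtain C where C: "C \<ge> 0" "AE x in M. \<bar>V x\<bar> \<le> C" using V_bound by blast
  have i: "integrable M (\<lambda>x. C * (f x * g x))"
    using sq_int_mult[OF H10_sq_int(1)[OF assms(1)] H10_sq_int(1)[OF assms(2)]] by simp
  show ?thesis
  proof (rule Bochner_Integration.integrable_bound[OF i])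
    show "(\<lambda>x. V x * f x * g x) \<in> borel_measurable M"
      using H10_measurable[OF assms(1)] H10_measurable[OF assms(2)] by measurable
    show "AE x in M. norm (V x * f x * g x) \<le> norm (C * (f x * g x))"
      using C(2)
    proof eventually_elim
      case (elim x)
      then have "\<bar>V x\<bar> * \<bar>f x * g x\<bar> \<le> C * \<bar>f x * g x\<bar>" by (rule mult_right_mono) simp
      then show ?case using C(1) by (simp add: abs_mult mult.assoc)
    qed
  qed
qed

definition vform :: "('a \<Rightarrow> real) \<Rightarrow> ('a \<Rightarrow> real) \<Rightarrow> real" where
  "vform f g = (LINT x|M. V x * f x * g x)"

sublocale vf: psd_form "H10 \<Omega>" vform
  unfolding vform_def by (rule weighted_L2_psd[OF V_nonneg V_integrable])

sublocale gr: psd_form "H10 \<Omega>" "grad_inner \<Omega>"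
  by (rule grad_inner_psd)

lemma vform_le: "\<exists>C\<ge>0. \<forall>f\<in>H10 \<Omega>. vform f f \<le> C * L2_inner \<Omega> f f"
proof -
  obtain C where C: "C \<ge> 0" "AE x in M. \<bar>V x\<bar> \<le> C" using V_bound by blast
  have "vform f f \<le> C * L2_inner \<Omega> f f" if f: "f \<in> H10 \<Omega>" for f
  proof -
    have "vform f f \<le> (LINT x|M. C * (f x * f x))"
      unfolding vform_def
    proof (rule integral_mono_AE[OF V_integrable[OF f f]])
      show "integrable M (\<lambda>x. C * (f x * f x))" using sq_int_mult[OF H10_sq_int(1)[OF f] H10_sq_int(1)[OF f]] by simp
      show "AE x in M. V x * f x * f x \<le> C * (f x * f x)"
        using C(2)
      proof eventually_elim
        case (elim x)
        then have "V x * (f x * f x) \<le> C * (f x * f x)" by (intro mult_right_mono) auto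
        then show ?case by (simp add: mult.assoc)
      qed
    qed
    then show ?thesis by (simp add: L2_inner_def)
  qed
  with C(1) show ?thesis by blast
qed

lemma a_form_eq: "a_form \<Omega> V \<beta> z w v = 1/2 * grad_inner \<Omega> w v + vform w v + \<beta> * quad z z w v"
  by (simp add: a_form_def L2_inner_def vform_def quad_def power2_eq_square)

lemma psd_quad: "z \<in> H10 \<Omega> \<Longrightarrow> psd_form (H10 \<Omega>) (quad z z)"
  using weighted_L2_psd[of "\<lambda>x. z x * z x"] quad_integrable[OF dim, of z z]
  by (simp add: quad_def[abs_def])

lemma psd_a_form:
  assumes "z \<in> H10 \<Omega>"
  shows "psd_form (H10 \<Omega>) (a_form \<Omega> V \<beta> z)"
proof -
  have "psd_form (H10 \<Omega>) (\<lambda>w v. 1/2 * grad_inner \<Omega> w v + 1 * vform w v)"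
    by (rule psd_form_combine[OF gr.psd_form_axioms vf.psd_form_axioms]) auto
  from psd_form_combine[OF this psd_quad[OF assms], of 1 \<beta>] show ?thesis
    using \<beta> by (simp add: a_form_eq[abs_def])
qed

sublocale a: psd_form "H10 \<Omega>" "a_form \<Omega> V \<beta> u"
  by (rule psd_a_form[OF u_mem])

section \<open>The form of one implicit step\<close>

definition B :: "('a \<Rightarrow> real) \<Rightarrow> ('a \<Rightarrow> real) \<Rightarrow> ('a \<Rightarrow> real) \<Rightarrow> real" where
  "B z w v = L2_inner \<Omega> w v + \<tau> * a_form \<Omega> V \<beta> z w v"

lemma psd_B: "z \<in> H10 \<Omega> \<Longrightarrow> psd_form (H10 \<Omega>) (B z)"
  using psd_form_combine[OF psd_L2_inner psd_a_form, of z 1 \<tau>] \<tau> by (simp add: B_def[abs_def])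

sublocale B: psd_form "H10 \<Omega>" "B u"
  by (rule psd_B[OF u_mem])

text \<open>The smaller of the coefficients of the L2 part and the gradient part of
  \<open>B\<close>.\<close>

definition cB :: real where "cB = min 1 (\<tau> / 2)"

lemma cB_pos: "cB > 0"
  using \<tau> by (simp add: cB_def)

lemma B_lower:
  assumes "z \<in> H10 \<Omega>" "f \<in> H10 \<Omega>"
  shows "cB * H1_inner f f \<le> B z f f"
proof -
  interpret q: psd_form "H10 \<Omega>" "quad z z" by (rule psd_quad[OF assms(1)])
  have "cB * L2_inner \<Omega> f f \<le> 1 * L2_inner \<Omega> f f"
    by (intro mult_right_mono) (auto simp: cB_def L2_inner_self)
  moreover have "cB * grad_inner \<Omega> f f \<le> \<tau> / 2 * grad_inner \<Omega> f f"
    by (intro mult_right_mono) (auto simp: cB_def grad_inner_self)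
  moreover have "0 \<le> \<tau> * vform f f" "0 \<le> \<tau> * (\<beta> * quad z z f f)"
    using vf.nonneg q.nonneg assms(2) \<tau> \<beta> by simp_all
  ultimately show ?thesis by (simp add: B_def a_form_eq H1_inner_def algebra_simps)
qed

lemma B_upper:
  assumes "z \<in> H10 \<Omega>"
  shows "\<exists>C. \<forall>f\<in>H10 \<Omega>. B z f f \<le> C * H1_inner f f"
proof -
  obtain C where C: "C \<ge> 0" "\<And>f. f \<in> H10 \<Omega> \<Longrightarrow> vform f f \<le> C * L2_inner \<Omega> f f" using vform_le by blast
  have "B z f f \<le> (1 + \<tau> * (1/2 + C + \<beta> * (16 * H1_inner z z))) * H1_inner f f" if f: "f \<in> H10 \<Omega>" for f
  proof -
    have le: "L2_inner \<Omega> f f \<le> H1_inner f f" "grad_inner \<Omega> f f \<le> H1_inner f f"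
      by (auto simp: H1_inner_def L2_inner_self grad_inner_self)
    have "vform f f \<le> C * H1_inner f f" using C(2)[OF f] mult_left_mono[OF le(1) C(1)] by linarith
    moreover have "quad z z f f \<le> 16 * H1_inner z z * H1_inner f f"
      using quad_bound[OF dim assms assms f f] by (simp add: H1_inner_self mult.assoc)
    then have "\<beta> * quad z z f f \<le> \<beta> * (16 * H1_inner z z * H1_inner f f)" using \<beta> by (rule mult_left_mono)
    ultimately have "a_form \<Omega> V \<beta> z f f \<le> 1/2 * H1_inner f f + C * H1_inner f f + \<beta> * (16 * H1_inner z z * H1_inner f f)"
      unfolding a_form_eq using le(2) by linarith
    then have "\<tau> * a_form \<Omega> V \<beta> z f f \<le> \<tau> * (1/2 * H1_inner f f + C * H1_inner f f + \<beta> * (16 * H1_inner z z * H1_inner f f))"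
      using \<tau> by (intro mult_left_mono) auto
    then show ?thesis using le(1) by (simp add: B_def algebra_simps)
  qed
  then show ?thesis by blast
qed

text \<open>\<open>inv_into\<close> is meaningful only where the right-hand side is attained;
  \<open>Riesz\<close> provides a preimage. Whichever representative is selected, it satisfies the
  variational equation, and this equation is what the convergence proof builds on.\<close>

lemma gfdn_step_equation:
  assumes z: "z \<in> H10 \<Omega>"
  shows "\<exists>w\<in>H10 \<Omega>. (\<forall>v\<in>H10 \<Omega>. B z w v = L2_inner \<Omega> z v) \<and>
    gfdn_step \<Omega> V \<beta> \<tau> z = (1 / sqrt (L2_inner \<Omega> w w)) *\<^sub>R w"
proof -
  let ?I = "I_plus_tau_A \<Omega> V \<beta> \<tau> z"
  obtain C where C: "\<And>f. f \<in> H10 \<Omega> \<Longrightarrow> B z f f \<le> C * H1_inner f f" using B_upper[OF z] by blast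
  have "\<exists>w\<in>H10 \<Omega>. \<forall>v\<in>H10 \<Omega>. B z w v = L2_inner \<Omega> z v"
  proof (rule Riesz[OF psd_B[OF z] cB_pos B_lower[OF z] C, where K = "sqrt (L2_inner \<Omega> z z)"])
    show "\<bar>L2_inner \<Omega> z x\<bar> \<le> sqrt (L2_inner \<Omega> z z) * sqrt (H1_inner x x)" if "x \<in> H10 \<Omega>" for x
    proof -
      have "sqrt (L2_inner \<Omega> x x) \<le> sqrt (H1_inner x x)" using ip_le[OF that] by simp
      then have "sqrt (L2_inner \<Omega> z z) * sqrt (L2_inner \<Omega> x x) \<le> sqrt (L2_inner \<Omega> z z) * sqrt (H1_inner x x)"
        by (rule mult_left_mono) (simp add: L2_inner_self)
      then show ?thesis using ip.Cauchy_Schwarz_sqrt[OF z that] by linarith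
    qed
  qed (use z in \<open>simp_all add: ip.linear_simps\<close>)
  then obtain w0 where w0: "w0 \<in> H10 \<Omega>" "\<And>v. v \<in> H10 \<Omega> \<Longrightarrow> B z w0 v = L2_inner \<Omega> z v" by blast
  have I: "?I w = restrict (B z w) (H10 \<Omega>)" for w
    by (simp add: I_plus_tau_A_def I_op_def A_op_def B_def fun_eq_iff)
  have "?I w0 = I_op \<Omega> z" unfolding I I_op_def by (intro restrict_ext w0)
  then have im: "I_op \<Omega> z \<in> ?I ` H10 \<Omega>" using w0(1) by (metis imageI)
  define w where "w = inv_into (H10 \<Omega>) ?I (I_op \<Omega> z)"
  have w: "w \<in> H10 \<Omega>" "?I w = I_op \<Omega> z"
    unfolding w_def by (rule inv_into_into[OF im], rule f_inv_into_f[OF im])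
  have "B z w v = L2_inner \<Omega> z v" if "v \<in> H10 \<Omega>" for v
    using fun_cong[OF w(2), of v] that by (simp add: I I_op_def)
  moreover have "gfdn_step \<Omega> V \<beta> \<tau> z = (1 / sqrt (L2_inner \<Omega> w w)) *\<^sub>R w"
    by (simp add: gfdn_step_def Let_def w_def[symmetric] L2_norm_inner fun_eq_iff)
  ultimately show ?thesis using w(1) by blast
qed

section \<open>The Euler-Lagrange equation\<close>

lemma energy_eq:
  assumes v: "v \<in> H10 \<Omega>"
  shows "energy \<Omega> V \<beta> v = 1/2 * (1/2 * grad_inner \<Omega> v v + vform v v + \<beta>/2 * quad v v v v)"
proof -
  have "integrable M (\<lambda>x. 1/2 * (norm (weak_grad \<Omega> v x))\<^sup>2)" using sq_int_integrable[OF H10_sq_int(2)[OF v]] by simp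
  moreover have "integrable M (\<lambda>x. V x * v x * v x)" by (rule V_integrable[OF v v])
  moreover have "integrable M (\<lambda>x. \<beta>/2 * (v x * v x * v x * v x))" using quad_integrable[OF dim v v v v] by simp
  ultimately have "(LINT x|M. 1/2 * (norm (weak_grad \<Omega> v x))\<^sup>2 + V x * v x * v x + \<beta>/2 * (v x * v x * v x * v x)) =
      (LINT x|M. 1/2 * (norm (weak_grad \<Omega> v x))\<^sup>2) + (LINT x|M. V x * v x * v x) + (LINT x|M. \<beta>/2 * (v x * v x * v x * v x))"
    by (simp only: Bochner_Integration.integral_add Bochner_Integration.integrable_add)
  moreover have "(\<lambda>x. 1/2 * (norm (weak_grad \<Omega> v x))\<^sup>2 + V x * \<bar>v x\<bar>\<^sup>2 + \<beta>/2 * \<bar>v x\<bar>^4) =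
     (\<lambda>x. 1/2 * (norm (weak_grad \<Omega> v x))\<^sup>2 + V x * v x * v x + \<beta>/2 * (v x * v x * v x * v x))"
    by (simp add: power4_eq_xxxx power2_eq_square mult.assoc)
  ultimately show ?thesis
    unfolding energy_def by (simp only: grad_inner_self vform_def quad_def nsq_def integral_mult_right_zero)
qed

lemma quad_expand:
  assumes w: "w \<in> H10 \<Omega>" and v: "v \<in> H10 \<Omega>"
  shows "quad (w + t *\<^sub>R v) (w + t *\<^sub>R v) (w + t *\<^sub>R v) (w + t *\<^sub>R v) =
    quad w w w w + 4 * t * quad w w w v + 6 * t\<^sup>2 * quad w w v v + 4 * t ^ 3 * quad w v v v + t ^ 4 * quad v v v v"
proof -
  note i = quad_integrable[OF dim]
  have "quad (w + t *\<^sub>R v) (w + t *\<^sub>R v) (w + t *\<^sub>R v) (w + t *\<^sub>R v) =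
     (LINT x|M. w x * w x * w x * w x + 4 * t * (w x * w x * w x * v x) + 6 * t\<^sup>2 * (w x * w x * v x * v x)
        + 4 * t ^ 3 * (w x * v x * v x * v x) + t ^ 4 * (v x * v x * v x * v x))"
    unfolding quad_def by (rule Bochner_Integration.integral_cong) (auto simp: algebra_simps eval_nat_numeral)
  then show ?thesis
    using i[OF w w w w] i[OF w w w v] i[OF w w v v] i[OF w v v v] i[OF v v v v] by (simp add: quad_def)
qed

text \<open>Every term of the energy is nonnegative and homogeneous of degree 2 or 4, so scaling
  down to norm 1 does not increase it. Thus \<open>u\<close> is minimal among all functions of norm
  at least 1, a set that contains u + t v for every v orthogonal to u.\<close>

lemma energy_normalized_le:
  assumes w: "w \<in> H10 \<Omega>" and s: "1 \<le> L2_inner \<Omega> w w"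
  shows "energy \<Omega> V \<beta> u \<le> energy \<Omega> V \<beta> w"
proof -
  define s where "s = L2_inner \<Omega> w w"
  define r where "r = 1 / sqrt s"
  have s1: "1 \<le> s" and r: "r\<^sup>2 = 1 / s" "0 \<le> r" "r\<^sup>2 \<le> 1" "r ^ 4 \<le> 1"
    using s by (auto simp: s_def[symmetric] r_def power_divide power_le_one)
  have "r *\<^sub>R w \<in> H10 \<Omega>" using w by simp
  moreover have "L2_inner \<Omega> (r *\<^sub>R w) (r *\<^sub>R w) = r\<^sup>2 * s"
    using w by (simp add: ip.linear_simps s_def power2_eq_square)
  then have "L2_norm \<Omega> (r *\<^sub>R w) = 1" using r(1) s1 by (simp add: L2_norm_inner)
  ultimately have "energy \<Omega> V \<beta> u \<le> energy \<Omega> V \<beta> (r *\<^sub>R w)"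
    using gs by (simp add: positive_ground_state_def)
  also have "\<dots> = 1/2 * (1/2 * (r\<^sup>2 * grad_inner \<Omega> w w) + r\<^sup>2 * vform w w + \<beta>/2 * (r ^ 4 * quad w w w w))"
  proof -
    have "quad (r *\<^sub>R w) (r *\<^sub>R w) (r *\<^sub>R w) (r *\<^sub>R w) = r ^ 4 * quad w w w w"
      unfolding quad_def by (subst integral_mult_right_zero[symmetric]) (simp add: mult_ac eval_nat_numeral)
    then show ?thesis using w by (simp add: energy_eq gr.linear_simps vf.linear_simps power2_eq_square)
  qed
  also have "\<dots> \<le> 1/2 * (1/2 * grad_inner \<Omega> w w + vform w w + \<beta>/2 * quad w w w w)"
  proof -
    have "r\<^sup>2 * grad_inner \<Omega> w w \<le> grad_inner \<Omega> w w" "r\<^sup>2 * vform w w \<le> vform w w"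
      using r(3) gr.nonneg[OF w] vf.nonneg[OF w] by (intro mult_left_le_one_le; simp)+
    moreover have "0 \<le> quad w w w w" unfolding quad_def by (intro integral_nonneg_AE AE_I2) (metis mult.assoc zero_le_square)
    then have "\<beta>/2 * (r ^ 4 * quad w w w w) \<le> \<beta>/2 * quad w w w w"
      using r \<beta> by (intro mult_left_mono mult_left_le_one_le) auto
    ultimately have "1/2 * (r\<^sup>2 * grad_inner \<Omega> w w) + r\<^sup>2 * vform w w + \<beta>/2 * (r ^ 4 * quad w w w w) \<le>
        1/2 * grad_inner \<Omega> w w + vform w w + \<beta>/2 * quad w w w w"
      by (intro add_mono) auto
    then show ?thesis by (rule mult_left_mono) simp
  qed
  also have "\<dots> = energy \<Omega> V \<beta> w" using w by (simp add: energy_eq)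
  finally show ?thesis .
qed

text \<open>In an orthogonal direction the norm does not drop below 1, so the polynomial
  \<open>F\<close> has a minimum at 0 and no multiplier appears. Its derivative there is the
  linearized form: the four equal contributions of the quartic term cancel the factor 1/4 in the
  energy.\<close>

lemma Euler_Lagrange_orthogonal:
  assumes v: "v \<in> H10 \<Omega>" "L2_inner \<Omega> u v = 0"
  shows "a_form \<Omega> V \<beta> u u v = 0"
proof -
  define F where "F t = 1/2 * (1/2 * (grad_inner \<Omega> u u + 2 * t * grad_inner \<Omega> u v + t\<^sup>2 * grad_inner \<Omega> v v)
    + (vform u u + 2 * t * vform u v + t\<^sup>2 * vform v v)
    + \<beta>/2 * (quad u u u u + 4 * t * quad u u u v + 6 * t\<^sup>2 * quad u u v v + 4 * t ^ 3 * quad u v v v + t ^ 4 * quad v v v v))" for t :: real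
  have F: "F t = energy \<Omega> V \<beta> (u + t *\<^sub>R v)" for t
    using u_mem v(1) by (simp add: F_def energy_eq gr.expand vf.expand quad_expand)
  have "F 0 \<le> F t" for t
  proof -
    have "energy \<Omega> V \<beta> u \<le> energy \<Omega> V \<beta> (u + t *\<^sub>R v)"
    proof (rule energy_normalized_le)
      show "1 \<le> L2_inner \<Omega> (u + t *\<^sub>R v) (u + t *\<^sub>R v)"
        using u_mem v u_norm ip.nonneg[OF v(1)] by (simp add: ip.expand)
    qed (use u_mem v in simp)
    then show ?thesis unfolding F by simp
  qed
  moreover have "(F has_real_derivative a_form \<Omega> V \<beta> u u v) (at 0)"
    unfolding F_def a_form_eq by (auto intro!: derivative_eq_intros simp: algebra_simps)
  ultimately show ?thesis by (intro DERIV_local_min[of F _ 0 1]) auto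
qed

text \<open>The multiplier, read off by testing with the normalized \<open>u\<close> itself.\<close>

definition lam0 :: real where "lam0 = a_form \<Omega> V \<beta> u u u"

lemma lam0_nonneg: "0 \<le> lam0"
  unfolding lam0_def by (rule a.nonneg[OF u_mem])

lemma Euler_Lagrange:
  assumes v: "v \<in> H10 \<Omega>"
  shows "a_form \<Omega> V \<beta> u u v = lam0 * L2_inner \<Omega> u v"
proof -
  define w where "w = v - L2_inner \<Omega> u v *\<^sub>R u"
  have "w \<in> H10 \<Omega>" using v u_mem by (simp add: w_def)
  moreover have "L2_inner \<Omega> u w = 0" using v u_mem u_norm by (simp add: w_def ip.linear_simps)
  ultimately have "a_form \<Omega> V \<beta> u u w = 0" by (rule Euler_Lagrange_orthogonal)
  then show ?thesis using v u_mem by (simp add: w_def a.linear_simps lam0_def)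
qed

definition L1 :: real where "L1 = 1 + \<tau> * lam0"

lemma L1_ge_1: "1 \<le> L1"
  using lam0_nonneg \<tau> by (simp add: L1_def)

lemma B_u_eigen: "v \<in> H10 \<Omega> \<Longrightarrow> B u u v = L1 * L2_inner \<Omega> u v"
  by (simp add: B_def Euler_Lagrange L1_def algebra_simps)

lemma ip_le_B:
  assumes f: "f \<in> H10 \<Omega>"
  shows "L2_inner \<Omega> f f \<le> B u f f"
  using a.nonneg[OF f] \<tau> by (simp add: B_def)

text \<open>Tested with a nonnegative nondecreasing function of \<open>u\<close>, the gradient term
  and the potential term are nonnegative and may be dropped. What remains says that the integral of
  w u (u^2 - k^2) is at most 0. If \<open>w\<close> vanishes exactly for u \<le> k, the integrand is
  nonnegative, hence zero, and \<open>u\<close> does not exceed k = sqrt (lam0 / \<beta>).\<close>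

lemma u_sq_bound: "AE x in M. \<beta> * (u x)\<^sup>2 \<le> lam0"
proof (cases "\<beta> = 0")
  case True
  then show ?thesis using lam0_nonneg by simp
next
  case False
  then have \<beta>p: "\<beta> > 0" using \<beta> by simp
  define k where "k = sqrt (lam0 / \<beta>)"
  have k: "0 \<le> k" "lam0 = \<beta> * k\<^sup>2" using \<beta>p lam0_nonneg by (auto simp: k_def)
  \<comment> \<open>Substitute for the positive part of t - k: it is C1 with derivative in [0, 1],
    and it vanishes exactly for t \<le> k.\<close>
  define \<psi> where "\<psi> t = sqrt (1 + (max 0 (t - k))\<^sup>2) - 1" for t
  define \<psi>' where "\<psi>' t = max 0 (t - k) / sqrt (1 + (max 0 (t - k))\<^sup>2)" for t
  have pos: "1 + (max 0 (t - k))\<^sup>2 > 0" for t :: real by (smt (verit) zero_le_power2)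
  have D: "(\<psi> has_real_derivative \<psi>' t) (at t)" for t
  proof -
    have "((\<lambda>t. (max 0 (t - k))\<^sup>2) has_real_derivative 2 * max 0 (t - k)) (at t)" (is ?d)
    proof -
      have "((\<lambda>t. t - k) has_real_derivative 1) (at t)" by (auto intro!: derivative_eq_intros)
      from DERIV_chain2[OF DERIV_max_0_sq this] show ?thesis by simp
    qed
    have arith: "inverse S / 2 * (0 + 2 * m) - 0 = m / S" for S m :: real by (cases "S = 0") (simp_all add: field_simps)
    have "((\<lambda>t. 1 + (max 0 (t - k))\<^sup>2) has_real_derivative 0 + 2 * max 0 (t - k)) (at t)"
      by (rule DERIV_add[OF DERIV_const \<open>?d\<close>])
    from DERIV_diff[OF DERIV_chain2[OF DERIV_real_sqrt[OF pos[of t]] this] DERIV_const[of 1]] show ?thesis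
      unfolding \<psi>_def[abs_def] \<psi>'_def by (rule DERIV_cong) (rule arith)
  qed
  have c: "continuous_on UNIV \<psi>'"
    unfolding \<psi>'_def by (intro continuous_intros) (metis less_irrefl pos real_sqrt_eq_0_iff)
  have \<psi>0: "\<psi> 0 = 0" using k by (simp add: \<psi>_def)
  have b: "0 \<le> \<psi>' t" "\<psi>' t \<le> 1" for t
  proof -
    show "0 \<le> \<psi>' t" by (simp add: \<psi>'_def)
    have "max 0 (t - k) \<le> sqrt (1 + (max 0 (t - k))\<^sup>2)" by (rule real_le_rsqrt) simp
    then show "\<psi>' t \<le> 1" using pos[of t] by (simp add: \<psi>'_def)
  qed
  have n: "0 \<le> \<psi> t" for t by (simp add: \<psi>_def)
  define w where "w = (\<lambda>x. \<psi> (u x))"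
  have p: "h10_pair w (\<lambda>x. \<psi>' (u x) *\<^sub>R weak_grad \<Omega> u x)"
    unfolding w_def by (rule h10_pair_compose[OF H10_imp_h10_pair[OF u_mem] D c \<psi>0, of 1]) (use b in auto)
  have w: "w \<in> H10 \<Omega>" by (rule h10_pair_imp_H10[OF p])
  have "grad_inner \<Omega> u w \<ge> 0"
    unfolding grad_inner_def
  proof (rule integral_nonneg_AE)
    show "AE x in M. 0 \<le> weak_grad \<Omega> u x \<bullet> weak_grad \<Omega> w x"
      using h10_pair_grad_AE[OF p] by eventually_elim (simp add: b)
  qed
  moreover have "vform u w \<ge> 0"
    unfolding vform_def
  proof (rule integral_nonneg_AE)
    show "AE x in M. 0 \<le> V x * u x * w x"
      using V_nonneg u_pos by eventually_elim (simp add: n w_def)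
  qed
  ultimately have "\<beta> * quad u u u w \<le> lam0 * L2_inner \<Omega> u w"
    using Euler_Lagrange[OF w] unfolding a_form_eq by linarith
  then have le: "quad u u u w \<le> k\<^sup>2 * L2_inner \<Omega> u w" using \<beta>p k(2) by simp
  have iq: "integrable M (\<lambda>x. u x * u x * u x * w x)" by (rule quad_integrable[OF dim u_mem u_mem u_mem w])
  have ii: "integrable M (\<lambda>x. k\<^sup>2 * (u x * w x))"
    using sq_int_mult[OF H10_sq_int(1)[OF u_mem] H10_sq_int(1)[OF w]] by simp
  have int0: "(LINT x|M. u x * u x * u x * w x - k\<^sup>2 * (u x * w x)) \<le> 0"
    using le by (simp add: Bochner_Integration.integral_diff[OF iq ii] quad_def L2_inner_def)
  have i0: "integrable M (\<lambda>x. u x * u x * u x * w x - k\<^sup>2 * (u x * w x))"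
    by (rule Bochner_Integration.integrable_diff[OF iq ii])
  have key: "0 \<le> t * t * t * \<psi> t - k\<^sup>2 * (t * \<psi> t)" "t * t * t * \<psi> t - k\<^sup>2 * (t * \<psi> t) = 0 \<Longrightarrow> \<beta> * t\<^sup>2 \<le> lam0" if t: "t > 0" for t
  proof -
    have eq: "t * t * t * \<psi> t - k\<^sup>2 * (t * \<psi> t) = (t\<^sup>2 - k\<^sup>2) * (t * \<psi> t)" by (simp add: power2_eq_square algebra_simps)
    have "\<psi> t = 0 \<and> t\<^sup>2 \<le> k\<^sup>2 \<or> 0 < \<psi> t \<and> k\<^sup>2 < t\<^sup>2"
    proof (cases "t \<le> k")
      case True
      then show ?thesis using t by (auto simp: \<psi>_def intro!: power_mono)
    next
      case False
      then have "k\<^sup>2 < t\<^sup>2" using k by (intro power_strict_mono) auto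
      then show ?thesis using False by (auto simp: \<psi>_def)
    qed
    then have "0 \<le> (t\<^sup>2 - k\<^sup>2) * (t * \<psi> t) \<and> ((t\<^sup>2 - k\<^sup>2) * (t * \<psi> t) = 0 \<longrightarrow> \<beta> * t\<^sup>2 \<le> lam0)"
    proof (elim disjE conjE)
      assume "\<psi> t = 0" "t\<^sup>2 \<le> k\<^sup>2"
      then show ?thesis unfolding k(2) using \<beta> by (simp add: mult_left_mono del: power_mono_iff)
    next
      assume "0 < \<psi> t" "k\<^sup>2 < t\<^sup>2"
      then have "0 < (t\<^sup>2 - k\<^sup>2) * (t * \<psi> t)" by (intro mult_pos_pos) (use t in linarith)+
      then show ?thesis by (intro conjI impI) linarith+
    qed
    then show "0 \<le> t * t * t * \<psi> t - k\<^sup>2 * (t * \<psi> t)" "t * t * t * \<psi> t - k\<^sup>2 * (t * \<psi> t) = 0 \<Longrightarrow> \<beta> * t\<^sup>2 \<le> lam0"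
      unfolding eq by blast+
  qed
  have nn: "AE x in M. 0 \<le> u x * u x * u x * w x - k\<^sup>2 * (u x * w x)"
    using u_pos unfolding w_def by eventually_elim (rule key)
  have "(LINT x|M. u x * u x * u x * w x - k\<^sup>2 * (u x * w x)) = 0"
    using int0 integral_nonneg_AE[OF nn] by linarith
  then have "AE x in M. u x * u x * u x * w x - k\<^sup>2 * (u x * w x) = 0"
    using integral_nonneg_eq_0_iff_AE[OF i0 nn] by blast
  then show ?thesis using u_pos unfolding w_def by eventually_elim (rule key)
qed

text \<open>The left-hand side is the integral of \<open>W r s\<close>, so Cauchy-Schwarz suffices
  once \<open>W\<close> has values in [-1, 1]. By \<open>u_sq_bound\<close> the product \<tau>
  \<beta> u^2 lies between 0 and \<tau> lam0, which is below L1 whatever the size of \<tau>.\<close>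

lemma linearization_bound:
  assumes r: "r \<in> H10 \<Omega>" and s: "s \<in> H10 \<Omega>"
  shows "\<bar>L2_inner \<Omega> r s - 2 / L1 * (\<tau> * \<beta> * quad u u r s)\<bar> \<le> sqrt (L2_inner \<Omega> r r) * sqrt (L2_inner \<Omega> s s)"
proof -
  define W where "W x = 1 - 2 / L1 * (\<tau> * \<beta> * (u x * u x))" for x
  have W: "AE x in M. norm (W x * r x) \<le> 1 * norm (r x)"
    using u_sq_bound
  proof eventually_elim
    case (elim x)
    have "0 \<le> \<tau> * (\<beta> * (u x)\<^sup>2)" using \<tau> \<beta> by simp
    moreover have "\<tau> * (\<beta> * (u x)\<^sup>2) \<le> \<tau> * lam0" using elim \<tau> by (intro mult_left_mono) auto
    ultimately have "0 \<le> \<tau> * \<beta> * (u x * u x)" "\<tau> * \<beta> * (u x * u x) \<le> L1"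
      by (simp_all add: L1_def power2_eq_square mult.assoc)
    then have "\<bar>W x\<bar> \<le> 1" using L1_ge_1 by (auto simp: W_def abs_le_iff field_simps)
    then show ?case by (simp add: abs_mult mult_left_le_one_le)
  qed
  have m: "(\<lambda>x. W x * r x) \<in> borel_measurable M"
    using H10_measurable[OF u_mem] H10_measurable[OF r] unfolding W_def by measurable
  note Wr = sq_int_bound[OF m H10_sq_int(1)[OF r] W]
  have i: "integrable M (\<lambda>x. r x * s x)" "integrable M (\<lambda>x. 2 / L1 * (\<tau> * \<beta> * (u x * u x * r x * s x)))"
    using sq_int_mult[OF H10_sq_int(1)[OF r] H10_sq_int(1)[OF s]] quad_integrable[OF dim u_mem u_mem r s] by simp_all
  have "(LINT x|M. (W x * r x) \<bullet> s x) = (LINT x|M. r x * s x - 2 / L1 * (\<tau> * \<beta> * (u x * u x * r x * s x)))"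
    by (rule Bochner_Integration.integral_cong) (auto simp: W_def algebra_simps)
  also have "\<dots> = L2_inner \<Omega> r s - 2 / L1 * (\<tau> * \<beta> * quad u u r s)"
    unfolding Bochner_Integration.integral_diff[OF i] by (simp add: L2_inner_def quad_def)
  finally have "\<bar>L2_inner \<Omega> r s - 2 / L1 * (\<tau> * \<beta> * quad u u r s)\<bar> \<le> sqrt (nsq M (\<lambda>x. W x * r x)) * sqrt (nsq M s)"
    using L2_Cauchy_Schwarz_sqrt[OF Wr(1) H10_sq_int(1)[OF s]] by simp
  also have "\<dots> \<le> sqrt (nsq M r) * sqrt (nsq M s)"
    using Wr(2) by (intro mult_right_mono) auto
  finally show ?thesis by (simp add: L2_inner_self)
qed

end

section \<open>The strong maximum principle\<close>

text \<open>Here g = 1 / (s + t), the factor of the test function that depends on the solution. The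
  fourth fact is the formula for its derivative -g/s. The fifth absorbs the mixed gradient term, and
  the last recovers the square of the logarithmic gradient.\<close>

lemma sqrt_profile:
  fixes t \<epsilon> :: real
  assumes t: "0 \<le> t" and \<epsilon>: "0 < \<epsilon>"
  defines "s \<equiv> sqrt (t\<^sup>2 + \<epsilon>\<^sup>2)"
  defines "g \<equiv> (s - t) / \<epsilon>\<^sup>2"
  shows "0 < s" "0 \<le> g" "t * g \<le> 1" "(t / s - 1) / \<epsilon>\<^sup>2 = - (g / s)" "g\<^sup>2 \<le> g / s" "1 / s\<^sup>2 \<le> 2 * (g / s)"
proof -
  have p: "0 < t\<^sup>2 + \<epsilon>\<^sup>2" using \<epsilon> by (simp add: add_nonneg_pos)
  then show s: "0 < s" by (simp add: s_def)
  have s2: "s\<^sup>2 = t\<^sup>2 + \<epsilon>\<^sup>2" using p by (simp add: s_def)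
  have st: "t \<le> s" using s2 s t by (intro power2_le_imp_le[of t s]) auto
  have e: "(s - t) * (s + t) = \<epsilon>\<^sup>2" using s2 by (simp add: power2_eq_square algebra_simps)
  have "s + t \<noteq> 0" "\<epsilon>\<^sup>2 \<noteq> 0" using s t \<epsilon> by auto
  then have g: "g = 1 / (s + t)" unfolding g_def e[symmetric] by (simp add: divide_simps)
  show "0 \<le> g" unfolding g using s t by simp
  show "t * g \<le> 1" unfolding g using s t by simp
  show "(t / s - 1) / \<epsilon>\<^sup>2 = - (g / s)" unfolding g_def using s \<epsilon> by (simp add: field_simps)
  show "g\<^sup>2 \<le> g / s" unfolding g using s t by (simp add: power2_eq_square frac_le)
  have "1 / s \<le> 2 / (s + t)" using s st t by (simp add: field_simps)
  then have "1 / s * (1 / s) \<le> 2 / (s + t) * (1 / s)" using s by (intro mult_right_mono) auto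
  then show "1 / s\<^sup>2 \<le> 2 * (g / s)" unfolding g by (simp add: power2_eq_square)
qed

section \<open>From local to global statements almost everywhere\<close>

context open_domain
begin

lemma AE_locally:
  assumes "\<And>x. x \<in> \<Omega> \<Longrightarrow> \<exists>S. open S \<and> x \<in> S \<and> (AE y in M. y \<in> S \<longrightarrow> P y)"
  shows "AE y in M. P y"
proof -
  define F where "F = {S. open S \<and> (AE y in M. y \<in> S \<longrightarrow> P y)}"
  obtain F' where F': "F' \<subseteq> F" "countable F'" "\<Union>F' = \<Union>F"
    using Lindelof[of F] by (auto simp: F_def)
  have "AE y in M. \<forall>S\<in>F'. y \<in> S \<longrightarrow> P y"
    using F' by (subst AE_ball_countable) (auto simp: F_def)
  moreover have "y \<in> \<Union>F'" if "y \<in> \<Omega>" for y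
    unfolding F'(3) using assms[OF that] by (auto simp: F_def)
  ultimately show ?thesis by (auto simp: AE_lebesgue_on_iff elim!: eventually_mono)
qed

lemma AE_False_open:
  assumes "open S" "S \<subseteq> \<Omega>" "AE y in M. y \<notin> S"
  shows "S = {}"
proof (rule ccontr)
  assume "S \<noteq> {}"
  have "AE y in lebesgue. y \<notin> S"
    using assms(2,3) by (auto simp: AE_lebesgue_on_iff elim!: eventually_mono)
  then have "S \<in> null_sets lebesgue"
    using assms(1) by (subst AE_iff_null_sets) auto
  then show False using open_not_negligible[OF assms(1) \<open>S \<noteq> {}\<close>] by (simp add: negligible_iff_null_sets)
qed

text \<open>The points near which P, respectively Q, holds almost everywhere form two open sets that
  cover the domain. They are disjoint because a nonempty open set is not null, so connectedness
  leaves only one of them.\<close>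

lemma AE_connected_dichotomy:
  assumes conn: "connected \<Omega>" and excl: "\<And>y. \<not> (P y \<and> Q y)"
    and loc: "\<And>x. x \<in> \<Omega> \<Longrightarrow> \<exists>S. open S \<and> S \<subseteq> \<Omega> \<and> x \<in> S \<and>
      ((AE y in M. y \<in> S \<longrightarrow> P y) \<or> (AE y in M. y \<in> S \<longrightarrow> Q y))"
  shows "(AE y in M. P y) \<or> (AE y in M. Q y)"
proof -
  define U where "U P = \<Union>{S. open S \<and> S \<subseteq> \<Omega> \<and> (AE y in M. y \<in> S \<longrightarrow> P y)}" for P :: "'a \<Rightarrow> bool"
  have op: "open (U P)" for P unfolding U_def by (rule open_Union) auto
  have all: "AE y in M. R y" if "\<Omega> \<subseteq> U R" for R
    by (rule AE_locally) (use that in \<open>auto simp: U_def\<close>)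
  have disj: "U P \<inter> U Q = {}"
  proof (rule ccontr)
    assume "U P \<inter> U Q \<noteq> {}"
    then obtain x S T where S: "open S" "S \<subseteq> \<Omega>" "AE y in M. y \<in> S \<longrightarrow> P y" "x \<in> S"
      and T: "open T" "AE y in M. y \<in> T \<longrightarrow> Q y" "x \<in> T" by (auto simp: U_def)
    have "AE y in M. y \<notin> S \<inter> T" using S(3) T(2) by eventually_elim (use excl in auto)
    then have "S \<inter> T = {}" using S T by (intro AE_False_open) auto
    then show False using S T by auto
  qed
  have "\<Omega> \<subseteq> U P \<union> U Q"
  proof
    fix x assume "x \<in> \<Omega>"
    from loc[OF this] show "x \<in> U P \<union> U Q" by (auto simp: U_def)
  qed
  with connectedD[OF conn op op, of P Q] disj have "U P \<inter> \<Omega> = {} \<or> U Q \<inter> \<Omega> = {}" by blast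
  then have "\<Omega> \<subseteq> U P \<or> \<Omega> \<subseteq> U Q" using \<open>\<Omega> \<subseteq> U P \<union> U Q\<close> by blast
  then show ?thesis using all by blast
qed

lemma box_between:
  assumes x: "x \<in> \<Omega>"
  shows "\<exists>a b a' b'. x \<in> box a b \<and> cbox a b \<subseteq> box a' b' \<and> cbox a' b' \<subseteq> \<Omega>"
proof -
  obtain a' b' where 1: "cbox a' b' \<subseteq> \<Omega>" "x \<in> box a' b'" "\<forall>i\<in>Basis. a' \<bullet> i < b' \<bullet> i"
    by (rule open_contains_cbox[OF open_\<Omega> x])
  obtain a b where 2: "cbox a b \<subseteq> box a' b'" "x \<in> box a b" "\<forall>i\<in>Basis. a \<bullet> i < b \<bullet> i"
    by (rule open_contains_cbox[OF open_box 1(2)])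
  from 1(1) 2(1,2) show ?thesis by blast
qed

end

context ground_state
begin

text \<open>The test function is \<open>\<phi>\<^sup>2 / (v + sqrt (v\<^sup>2 + \<epsilon>\<^sup>2))\<close>; the quotient is a smooth function of \<open>v\<close>
  because it equals \<open>(sqrt (v\<^sup>2 + \<epsilon>\<^sup>2) - v) / \<epsilon>\<^sup>2\<close>.\<close>

lemma log_gradient_bound:
  assumes v: "v \<in> H10 \<Omega>" "AE x in M. 0 \<le> v x" "\<And>w. w \<in> H10 \<Omega> \<Longrightarrow> a_form \<Omega> V \<beta> u v w = lam0 * L2_inner \<Omega> v w"
    and \<phi>: "\<phi> \<in> test_functions \<Omega>" "\<And>x. 0 \<le> \<phi> x"
  shows "\<exists>C. \<forall>\<epsilon>>0. nsq M (\<lambda>x. (\<phi> x / sqrt ((v x)\<^sup>2 + \<epsilon>\<^sup>2)) *\<^sub>R weak_grad \<Omega> v x) \<le> C"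
proof -
  let ?X = "weak_grad \<Omega> v" and ?Y = "tgrad \<phi>"
  note \<phi>H = h10_pair_imp_H10[OF h10_pair_test[OF \<phi>(1)]]
  note Ck\<phi> = test_function_Ck[OF \<phi>(1)]
  note vm = H10_measurable[OF v(1)] and Xm = sq_int_measurable[OF H10_sq_int(2)[OF v(1)]] and \<phi>m = H10_measurable[OF \<phi>H]
  define R where "R x = (norm (?Y x))\<^sup>2 + V x * \<phi> x * \<phi> x + \<beta> * (u x * u x * \<phi> x * \<phi> x)" for x
  have Ri: "integrable M R"
    unfolding R_def using sq_int_integrable[OF test_M(2)[OF \<phi>(1)]] V_integrable[OF \<phi>H \<phi>H]
      quad_integrable[OF dim u_mem u_mem \<phi>H \<phi>H] by simp
  have "nsq M (\<lambda>x. (\<phi> x / sqrt ((v x)\<^sup>2 + \<epsilon>\<^sup>2)) *\<^sub>R ?X x) \<le> 8 * (LINT x|M. R x)" if \<epsilon>: "\<epsilon> > 0" for \<epsilon>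
  proof -
    define s where "s t = sqrt (t\<^sup>2 + \<epsilon>\<^sup>2)" for t
    define \<psi> where "\<psi> t = (s t - t - \<epsilon>) / \<epsilon>\<^sup>2" for t
    define \<psi>' where "\<psi>' t = (t / s t - 1) / \<epsilon>\<^sup>2" for t
    have pos: "0 < t\<^sup>2 + \<epsilon>\<^sup>2" for t using \<epsilon> by (simp add: add_nonneg_pos)
    have s_pos: "0 < s t" for t using pos by (simp add: s_def)
    have t_le: "\<bar>t\<bar> \<le> s t" for t unfolding s_def by (rule real_le_rsqrt) simp
    have Ds: "(s has_real_derivative t / s t) (at t)" for t
    proof -
      have "((\<lambda>t. t\<^sup>2 + \<epsilon>\<^sup>2) has_real_derivative 2 * t) (at t)" by (auto intro!: derivative_eq_intros)
      from DERIV_chain2[OF DERIV_real_sqrt[OF pos] this] show ?thesis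
        unfolding s_def[abs_def] by (rule DERIV_cong) (simp add: field_simps)
    qed
    have D: "(\<psi> has_real_derivative \<psi>' t) (at t)" for t
    proof -
      have "((\<lambda>t. s t - t - \<epsilon>) has_real_derivative t / s t - 1 - 0) (at t)" by (intro DERIV_diff Ds DERIV_ident DERIV_const)
      from DERIV_cdivide[OF this, of "\<epsilon>\<^sup>2"] show ?thesis unfolding \<psi>_def[abs_def] \<psi>'_def by simp
    qed
    have cs: "continuous_on UNIV s" using DERIV_isCont[OF Ds] by (simp add: continuous_at_imp_continuous_on)
    have c: "continuous_on UNIV \<psi>'"
      unfolding \<psi>'_def[abs_def] by (intro continuous_intros cs) (use s_pos \<epsilon> in \<open>auto simp: less_imp_neq[THEN not_sym]\<close>)
    have b: "\<bar>\<psi>' t\<bar> \<le> 2 / \<epsilon>\<^sup>2" for t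
    proof -
      have "\<bar>t / s t\<bar> \<le> 1" using t_le[of t] s_pos[of t] by (simp add: abs_divide)
      then have "\<bar>t / s t - 1\<bar> \<le> 2" by linarith
      then show ?thesis using \<epsilon> by (simp add: \<psi>'_def abs_divide divide_right_mono)
    qed
    have \<psi>0: "\<psi> 0 = 0" using \<epsilon> by (simp add: \<psi>_def s_def)
    \<comment> \<open>The chain rule needs \<psi> 0 = 0, so \<psi> is the profile g shifted by
      1/\<epsilon>. Adding \<phi>^2/\<epsilon> undoes the shift, and \<open>w\<close> equals
      \<phi>^2 g(v).\<close>
    define w where "w x = \<phi> x * \<phi> x * \<psi> (v x) + 1 / \<epsilon> * (\<phi> x * \<phi> x)" for x
    have \<zeta>: "(\<lambda>x. \<phi> x * \<phi> x) \<in> test_functions \<Omega>" by (rule test_function_mult[OF \<phi>(1) \<phi>(1)])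
    have p: "h10_pair w (\<lambda>x. ((\<phi> x * \<phi> x) *\<^sub>R (\<psi>' (v x) *\<^sub>R ?X x) + \<psi> (v x) *\<^sub>R tgrad (\<lambda>x. \<phi> x * \<phi> x) x)
        + (1 / \<epsilon>) *\<^sub>R tgrad (\<lambda>x. \<phi> x * \<phi> x) x)"
      unfolding w_def
      by (rule h10_pair_add[OF h10_pair_mult_test[OF h10_pair_compose[OF H10_imp_h10_pair[OF v(1)] D c \<psi>0 b] \<zeta>]
          h10_pair_scale[OF h10_pair_test[OF \<zeta>]]])
    have w: "w \<in> H10 \<Omega>" by (rule h10_pair_imp_H10[OF p])
    define F where "F x = 1/2 * (?X x \<bullet> weak_grad \<Omega> w x) + V x * v x * w x + \<beta> * (u x * u x * v x * w x) - lam0 * (v x * w x)" for x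
    note ints = sq_int_inner[OF H10_sq_int(2)[OF v(1)] H10_sq_int(2)[OF w]] V_integrable[OF v(1) w]
      quad_integrable[OF dim u_mem u_mem v(1) w] sq_int_mult[OF H10_sq_int(1)[OF v(1)] H10_sq_int(1)[OF w]]
    have Fi: "integrable M F" unfolding F_def using ints by simp
    have "(LINT x|M. F x) = a_form \<Omega> V \<beta> u v w - lam0 * L2_inner \<Omega> v w"
      unfolding F_def a_form_eq grad_inner_def vform_def quad_def L2_inner_def using ints by simp
    then have F0: "(LINT x|M. F x) = 0" using v(3)[OF w] by simp
    let ?q = "\<lambda>x. (\<phi> x / s (v x)) *\<^sub>R ?X x"
    have qs: "sq_int M ?q"
    proof -
      have "sq_int M (\<lambda>x. \<phi> x *\<^sub>R ?X x)"
      proof -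
        obtain C where C: "\<And>x. \<bar>\<phi> x\<bar> \<le> C" using test_function_sq_int(6)[OF \<phi>(1)] by (auto simp: bounded_iff)
        show ?thesis
          by (rule sq_int_bound(1)[OF _ H10_sq_int(2)[OF v(1)], of _ C])
            (use \<phi>m Xm C in \<open>auto intro!: AE_I2 mult_right_mono\<close>)
      qed
      moreover have "\<bar>\<phi> x / s (v x)\<bar> * norm (?X x) \<le> 1 / \<epsilon> * (\<bar>\<phi> x\<bar> * norm (?X x))" for x
      proof -
        have "\<epsilon> \<le> s (v x)" unfolding s_def by (rule real_le_rsqrt) simp
        then have "\<bar>\<phi> x\<bar> / s (v x) \<le> \<bar>\<phi> x\<bar> / \<epsilon>" using \<epsilon> by (intro divide_left_mono mult_pos_pos s_pos) auto
        then have "\<bar>\<phi> x / s (v x)\<bar> \<le> 1 / \<epsilon> * \<bar>\<phi> x\<bar>" using s_pos[of "v x"] by (simp add: abs_divide)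
        from mult_right_mono[OF this, of "norm (?X x)"] show ?thesis by (simp add: mult.assoc)
      qed
      moreover have "?q \<in> borel_measurable M" unfolding s_def using vm Xm \<phi>m by measurable
      ultimately show ?thesis by (intro sq_int_bound(1)[of ?q M "\<lambda>x. \<phi> x *\<^sub>R ?X x" "1 / \<epsilon>"]) auto
    qed
    \<comment> \<open>\<open>F\<close> integrates to zero. It contains -1/2 of the good term p^2
      (g/s) n^2; the mixed term costs 1/4 of it, by g^2 \<le> g/s, and leaves \<open>m\<close>^2,
      which is part of \<open>R\<close>. Since 1/s^2 \<le> 2 g/s, the remaining quarter dominates
      1/8 of the squared logarithmic gradient. The term with \<open>lam0\<close> has a favourable
      sign.\<close>
    have pt: "1/8 * (norm (?q x))\<^sup>2 \<le> R x - F x"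
      if vx: "0 \<le> v x" "0 \<le> V x"
        and W: "weak_grad \<Omega> w x = ((\<phi> x * \<phi> x) *\<^sub>R (\<psi>' (v x) *\<^sub>R ?X x) + \<psi> (v x) *\<^sub>R tgrad (\<lambda>x. \<phi> x * \<phi> x) x)
        + (1 / \<epsilon>) *\<^sub>R tgrad (\<lambda>x. \<phi> x * \<phi> x) x" for x
    proof -
      define t where "t = v x"
      define g where "g = (s t - t) / \<epsilon>\<^sup>2"
      define p where "p = \<phi> x"
      define n where "n = norm (?X x)"
      define m where "m = norm (?Y x)"
      have g0: "\<psi> t + 1 / \<epsilon> = g" using \<epsilon> by (simp add: \<psi>_def g_def power2_eq_square field_simps)
      note G = sqrt_profile[of t \<epsilon>, folded s_def, folded g_def, OF _ \<epsilon>]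
      have t0: "0 \<le> t" using vx by (simp add: t_def)
      have "tgrad (\<lambda>x. \<phi> x * \<phi> x) x = (2 * p) *\<^sub>R ?Y x"
        by (subst tgrad_mult[OF Ck\<phi> Ck\<phi>]) (simp add: p_def flip: scaleR_add_left)
      then have Weq: "weak_grad \<Omega> w x = (p * p * \<psi>' t) *\<^sub>R ?X x + (\<psi> t + 1 / \<epsilon>) *\<^sub>R ((2 * p) *\<^sub>R ?Y x)"
        unfolding W by (simp add: p_def t_def distrib_right scaleR_add_left)
      have nn: "?X x \<bullet> ?X x = n\<^sup>2" by (simp add: n_def power2_norm_eq_inner)
      have XW: "?X x \<bullet> weak_grad \<Omega> w x = - (p\<^sup>2 * (g / s t) * n\<^sup>2) + 2 * (p * g) * (?X x \<bullet> ?Y x)"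
        unfolding Weq g0 \<psi>'_def G(4)[OF t0] inner_add_right inner_scaleR_right nn
        by (simp add: power2_eq_square algebra_simps)
      have wx: "w x = p\<^sup>2 * g" unfolding w_def g0[symmetric] by (simp add: p_def t_def power2_eq_square algebra_simps)
      have tw: "t * w x \<le> p\<^sup>2" "0 \<le> t * w x"
      proof -
        show "t * w x \<le> p\<^sup>2" unfolding wx using mult_left_mono[OF G(3)[OF t0], of "p\<^sup>2"] by (simp add: mult_ac)
        show "0 \<le> t * w x" unfolding wx using t0 G(2)[OF t0] by simp
      qed
      have 1: "V x * v x * w x \<le> V x * \<phi> x * \<phi> x"
        using mult_left_mono[OF tw(1) vx(2)] by (simp add: t_def p_def power2_eq_square mult.assoc)
      have 2: "\<beta> * (u x * u x * v x * w x) \<le> \<beta> * (u x * u x * \<phi> x * \<phi> x)"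
      proof -
        have "(u x * u x) * (t * w x) \<le> (u x * u x) * p\<^sup>2" by (rule mult_left_mono[OF tw(1)]) simp
        then show ?thesis using \<beta> by (intro mult_left_mono) (simp_all add: t_def p_def power2_eq_square mult.assoc)
      qed
      have 3: "0 \<le> lam0 * (v x * w x)" using tw(2) lam0_nonneg by (simp add: t_def)
      have 4: "p * g * (?X x \<bullet> ?Y x) \<le> 1/4 * (p\<^sup>2 * g\<^sup>2 * n\<^sup>2) + m\<^sup>2"
      proof -
        have "?X x \<bullet> ?Y x \<le> n * m" unfolding n_def m_def by (rule norm_cauchy_schwarz)
        then have "p * g * (?X x \<bullet> ?Y x) \<le> p * g * (n * m)"
          using \<phi>(2)[of x] G(2)[OF t0] by (intro mult_left_mono) (auto simp: p_def)
        also have "\<dots> \<le> 1/4 * (p\<^sup>2 * g\<^sup>2 * n\<^sup>2) + m\<^sup>2"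
          using zero_le_power2[of "1/2 * (p * g * n) - m"] by (simp add: power2_diff power_mult_distrib field_simps)
        finally show ?thesis .
      qed
      have pn: "0 \<le> p\<^sup>2 * n\<^sup>2" by simp
      have 5: "p\<^sup>2 * g\<^sup>2 * n\<^sup>2 \<le> p\<^sup>2 * (g / s t) * n\<^sup>2"
        using mult_left_mono[OF G(5)[OF t0] pn] by (simp only: mult_ac)
      have 6: "(norm (?q x))\<^sup>2 \<le> 2 * (p\<^sup>2 * (g / s t) * n\<^sup>2)"
      proof -
        have "(norm (?q x))\<^sup>2 = p\<^sup>2 * n\<^sup>2 * (1 / (s t)\<^sup>2)"
          by (simp add: p_def n_def t_def power_mult_distrib power_divide)
        also have "\<dots> \<le> p\<^sup>2 * n\<^sup>2 * (2 * (g / s t))" by (rule mult_left_mono[OF G(6)[OF t0] pn])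
        finally show ?thesis by (simp only: mult_ac)
      qed
      have "R x - F x = m\<^sup>2 + V x * \<phi> x * \<phi> x + \<beta> * (u x * u x * \<phi> x * \<phi> x)
          - (1/2 * (?X x \<bullet> weak_grad \<Omega> w x) + V x * v x * w x + \<beta> * (u x * u x * v x * w x) - lam0 * (v x * w x))"
        by (simp only: R_def F_def m_def)
      then show ?thesis using 1 2 3 4 5 6 XW by linarith
    qed
    have "(LINT x|M. 1/8 * (norm (?q x))\<^sup>2) \<le> (LINT x|M. R x - F x)"
    proof (rule integral_mono_AE)
      show "integrable M (\<lambda>x. 1/8 * (norm (?q x))\<^sup>2)" using sq_int_integrable[OF qs] by simp
      show "integrable M (\<lambda>x. R x - F x)" using Ri Fi by simp
      show "AE x in M. 1/8 * (norm (?q x))\<^sup>2 \<le> R x - F x"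
        using v(2) V_nonneg h10_pair_grad_AE[OF p] by eventually_elim (rule pt)
    qed
    then have "1/8 * nsq M ?q \<le> (LINT x|M. R x) - 0"
      unfolding Bochner_Integration.integral_diff[OF Ri Fi] F0 nsq_def by (simp only: integral_mult_right_zero)
    then show ?thesis by (simp add: s_def)
  qed
  then show ?thesis by blast
qed

text \<open>The derivative of arsinh (t/\<epsilon>) is 1 / sqrt (t^2 + \<epsilon>^2), so the
  logarithmic estimate and the Poincare inequality bound the double differences of arsinh
  (v/\<epsilon>) on the box uniformly in \<epsilon>. Pairs from the zero set and from {v > \<eta>}
  contribute at least arsinh (\<eta>/\<epsilon>)^2 times the product of the measures, which is
  unbounded as \<epsilon> tends to 0 unless one of the sets is null.\<close>

lemma box_dichotomy:
  assumes v: "v \<in> H10 \<Omega>" "AE x in M. 0 \<le> v x" "\<And>w. w \<in> H10 \<Omega> \<Longrightarrow> a_form \<Omega> V \<beta> u v w = lam0 * L2_inner \<Omega> v w"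
    and ab: "cbox a b \<subseteq> box a' b'" "cbox a' b' \<subseteq> \<Omega>"
  shows "(AE x in M. x \<in> box a b \<longrightarrow> v x = 0) \<or> (AE x in M. x \<in> box a b \<longrightarrow> 0 < v x)"
proof -
  let ?X = "weak_grad \<Omega> v" and ?b = "box a b"
  define \<phi> where "\<phi> = box_bump a' b'"
  have \<phi>: "\<phi> \<in> test_functions \<Omega>" "0 \<le> \<phi> x" for x
    using test_function_box_bump[OF ab(2)] box_bump_range(1) by (auto simp: \<phi>_def)
  have sub: "?b \<subseteq> \<Omega>" "cbox a b \<subseteq> \<Omega>" using ab box_subset_cbox by blast+
  obtain C where C: "\<And>\<epsilon>. \<epsilon> > 0 \<Longrightarrow> nsq M (\<lambda>x. (\<phi> x / sqrt ((v x)\<^sup>2 + \<epsilon>\<^sup>2)) *\<^sub>R ?X x) \<le> C"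
    using log_gradient_bound[OF v \<phi>] by blast
  \<comment> \<open>The cut-off lives on the larger box and is bounded away from zero on the smaller
    one; this is the purpose of the nested boxes.\<close>
  obtain m where m: "m > 0" "\<And>x. x \<in> cbox a b \<Longrightarrow> m \<le> \<phi> x"
  proof (cases "cbox a b = {}")
    case True
    then show ?thesis using that[of 1] by auto
  next
    case False
    have "continuous_on (cbox a b) \<phi>" using test_function_sq_int(4)[OF \<phi>(1)] continuous_on_subset by blast
    then obtain x0 where x0: "x0 \<in> cbox a b" "\<forall>x\<in>cbox a b. \<phi> x0 \<le> \<phi> x"
      using continuous_attains_inf[OF compact_cbox False] by blast
    have "\<phi> x0 > 0" using x0(1) ab(1) box_bump_pos by (auto simp: \<phi>_def)
    then show ?thesis using that[of "\<phi> x0"] x0(2) by blast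
  qed
  define \<rho> where "\<rho> = norm (b - a)"
  define K where "K = ennreal (\<rho>\<^sup>2) * emeasure lborel (cball (0::'a) \<rho>) * ennreal ((1 / m)\<^sup>2 * C)"
  have K: "K < top"
    using emeasure_bounded_finite[of "cball (0::'a) \<rho>"] by (simp add: K_def ennreal_mult_less_top)
  have vm: "v \<in> borel_measurable M" and Xm: "?X \<in> borel_measurable M"
    using H10_measurable[OF v(1)] sq_int_measurable[OF H10_sq_int(2)[OF v(1)]] by auto
  have log_bound: "(\<integral>\<^sup>+ x. \<integral>\<^sup>+ y. indicator ?b x * indicator ?b y *
      ennreal ((arsinh (v x / \<epsilon>) - arsinh (v y / \<epsilon>))\<^sup>2) \<partial>lebesgue \<partial>lebesgue) \<le> K" if \<epsilon>: "\<epsilon> > 0" for \<epsilon>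
  proof -
    define s where "s t = sqrt (t\<^sup>2 + \<epsilon>\<^sup>2)" for t
    have pos: "0 < t\<^sup>2 + \<epsilon>\<^sup>2" for t using \<epsilon> by (simp add: add_nonneg_pos)
    have s_pos: "0 < s t" and s_ge: "\<epsilon> \<le> s t" for t
      using pos[of t] by (simp_all add: s_def real_le_rsqrt)
    have se: "s t = \<epsilon> * sqrt ((t / \<epsilon>)\<^sup>2 + 1)" for t
    proof -
      have "t\<^sup>2 + \<epsilon>\<^sup>2 = \<epsilon>\<^sup>2 * ((t / \<epsilon>)\<^sup>2 + 1)" using \<epsilon> by (simp add: power_divide field_simps)
      then show ?thesis using \<epsilon> by (simp add: s_def real_sqrt_mult)
    qed
    have D: "((\<lambda>t. arsinh (t / \<epsilon>)) has_real_derivative 1 / s t) (at t)" for t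
    proof -
      have "((\<lambda>t. t / \<epsilon>) has_real_derivative 1 / \<epsilon>) (at t)" by (rule DERIV_cdivide) simp
      from DERIV_chain2[OF arsinh_real_has_field_derivative this] show ?thesis
        by (rule DERIV_cong) (simp add: se)
    qed
    have cs: "continuous_on UNIV s" unfolding s_def[abs_def] by (intro continuous_intros)
    have "continuous_on UNIV (\<lambda>t. 1 / s t)" by (intro continuous_intros cs) (use s_pos in \<open>auto simp: less_imp_neq[THEN not_sym]\<close>)
    moreover have "\<bar>1 / s t\<bar> \<le> 1 / \<epsilon>" for t using s_ge[of t] s_pos[of t] \<epsilon> by (simp add: abs_divide frac_le)
    ultimately have p: "h10_pair (\<lambda>x. arsinh (v x / \<epsilon>)) (\<lambda>x. (1 / s (v x)) *\<^sub>R ?X x)"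
      by (intro h10_pair_compose[OF H10_imp_h10_pair[OF v(1)] D]) auto
    let ?q = "\<lambda>x. (\<phi> x / s (v x)) *\<^sub>R ?X x"
    have "sq_int M (\<lambda>x. \<phi> x *\<^sub>R ((1 / s (v x)) *\<^sub>R ?X x))"
    proof (rule sq_int_bound(1)[OF _ h10_pairD(2)[OF p], of _ 1])
      show "(\<lambda>x. \<phi> x *\<^sub>R ((1 / s (v x)) *\<^sub>R ?X x)) \<in> borel_measurable M"
        using sq_int_measurable[OF test_M(1)[OF \<phi>(1)]] sq_int_measurable[OF h10_pairD(2)[OF p]] by measurable
      show "AE x in M. norm (\<phi> x *\<^sub>R ((1 / s (v x)) *\<^sub>R ?X x)) \<le> 1 * norm ((1 / s (v x)) *\<^sub>R ?X x)"
        unfolding norm_scaleR[of "\<phi> _"] by (rule AE_I2, rule mult_right_mono) (auto simp: \<phi>_def box_bump_range)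
    qed
    then have qs: "sq_int M ?q" by simp
    have "nsq M (\<lambda>x. indicator ?b x *\<^sub>R ((1 / s (v x)) *\<^sub>R ?X x)) \<le> (1 / m)\<^sup>2 * nsq M ?q"
    proof (rule sq_int_bound(2)[OF _ qs])
      have "?b \<inter> \<Omega> \<in> sets M"
        using sets.Int[OF fmeasurableD[OF lmeasurable_box] lebesgue_\<Omega>] by (simp add: sets_restrict_space_iff)
      moreover have "{x \<in> space M. x \<in> ?b} = ?b \<inter> \<Omega>" by (auto simp: space_restrict_space)
      ultimately have "(indicator ?b :: 'a \<Rightarrow> real) \<in> borel_measurable M" by (intro borel_measurable_indicator') simp
      then show "(\<lambda>x. indicator ?b x *\<^sub>R ((1 / s (v x)) *\<^sub>R ?X x)) \<in> borel_measurable M"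
        by (rule borel_measurable_scaleR[OF _ sq_int_measurable[OF h10_pairD(2)[OF p]]])
      have "norm (indicator ?b x *\<^sub>R ((1 / s (v x)) *\<^sub>R ?X x)) \<le> 1 / m * norm (?q x)" for x
      proof (cases "x \<in> ?b")
        case True
        then have "m \<le> \<phi> x" using m(2) box_subset_cbox by blast
        then have "1 * (norm (?X x) / s (v x)) \<le> (\<phi> x / m) * (norm (?X x) / s (v x))"
          using m(1) s_pos[of "v x"] by (intro mult_right_mono) (auto simp: field_simps)
        then show ?thesis using True s_pos[of "v x"] \<phi>(2)[of x] by (simp add: field_simps)
      qed (use m in simp)
      then show "AE x in M. norm (indicator ?b x *\<^sub>R ((1 / s (v x)) *\<^sub>R ?X x)) \<le> 1 / m * norm (?q x)" by simp
    qed
    also have "\<dots> \<le> (1 / m)\<^sup>2 * C" using C[OF \<epsilon>] by (intro mult_left_mono) (auto simp: s_def)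
    finally have "ennreal (nsq M (\<lambda>x. indicator ?b x *\<^sub>R ((1 / s (v x)) *\<^sub>R ?X x))) \<le> ennreal ((1 / m)\<^sup>2 * C)" by (rule ennreal_leI)
    then have "ennreal (\<rho>\<^sup>2) * emeasure lborel (cball (0::'a) \<rho>) * ennreal (nsq M (\<lambda>x. indicator ?b x *\<^sub>R ((1 / s (v x)) *\<^sub>R ?X x))) \<le> K"
      unfolding K_def by (rule mult_left_mono) simp
    then show ?thesis using h10_pair_Poincare_box[OF p sub(2), folded \<rho>_def] by (rule order_trans[rotated])
  qed
  have set: "{x \<in> ?b. Q (v x)} \<in> sets lebesgue" if "Measurable.pred borel Q" for Q :: "real \<Rightarrow> bool"
  proof -
    have "{x \<in> space M. Q (v x)} \<in> sets M" using vm that by measurable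
    then have "{x \<in> \<Omega>. Q (v x)} \<in> sets lebesgue" by (simp add: sets_restrict_space_iff space_restrict_space)
    moreover have "{x \<in> ?b. Q (v x)} = ?b \<inter> {x \<in> \<Omega>. Q (v x)}" using sub(1) by blast
    ultimately show ?thesis by auto
  qed
  define Z where "Z = {x \<in> ?b. v x = 0}"
  define P where "P \<eta> = {x \<in> ?b. \<eta> < v x}" for \<eta>
  have Z: "Z \<in> sets lebesgue" and P: "P \<eta> \<in> sets lebesgue" for \<eta>
    unfolding Z_def P_def by (rule set, simp)+
  have prod: "emeasure lebesgue Z * emeasure lebesgue (P \<eta>) * ennreal (real n) \<le> K" if \<eta>: "\<eta> > 0" and n: "n \<ge> 1" for \<eta> n
  proof -
    \<comment> \<open>Makes arsinh (\<eta>/\<epsilon>) equal to n.\<close>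
    define \<epsilon> where "\<epsilon> = \<eta> / sinh (real n)"
    have \<epsilon>: "\<epsilon> > 0" using \<eta> n by (simp add: \<epsilon>_def)
    have big: "real n \<le> (arsinh (t / \<epsilon>))\<^sup>2" if "\<eta> < t" for t
    proof -
      have "sinh (real n) = \<eta> / \<epsilon>" using \<eta> \<epsilon> n by (simp add: \<epsilon>_def)
      also have "\<dots> < t / \<epsilon>" using that \<epsilon> by (simp add: divide_strict_right_mono)
      finally have "arsinh (sinh (real n)) < arsinh (t / \<epsilon>)" by simp
      then have "real n \<le> arsinh (t / \<epsilon>)" by (simp add: arsinh_sinh_real)
      then have "real n * 1 \<le> arsinh (t / \<epsilon>) * arsinh (t / \<epsilon>)" using n by (intro mult_mono) auto
      then show ?thesis by (simp add: power2_eq_square)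
    qed
    have "emeasure lebesgue Z * emeasure lebesgue (P \<eta>) * ennreal (real n) =
        (\<integral>\<^sup>+ x. indicator Z x * (\<integral>\<^sup>+ y. indicator (P \<eta>) y * ennreal (real n) \<partial>lebesgue) \<partial>lebesgue)"
    proof -
      have mc: "(\<integral>\<^sup>+ x. indicator S x * c \<partial>lebesgue) = emeasure lebesgue S * c" if "S \<in> sets lebesgue" for S :: "'a set" and c
        by (subst nn_integral_multc) (simp_all only: borel_measurable_indicator[OF that] nn_integral_indicator[OF that])
      show ?thesis by (simp only: mc[OF Z] mc[OF P] mult.assoc)
    qed
    also have "\<dots> = (\<integral>\<^sup>+ x. \<integral>\<^sup>+ y. indicator Z x * (indicator (P \<eta>) y * ennreal (real n)) \<partial>lebesgue \<partial>lebesgue)"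
      using P by (simp add: nn_integral_cmult)
    also have "\<dots> \<le> (\<integral>\<^sup>+ x. \<integral>\<^sup>+ y. indicator ?b x * indicator ?b y *
      ennreal ((arsinh (v x / \<epsilon>) - arsinh (v y / \<epsilon>))\<^sup>2) \<partial>lebesgue \<partial>lebesgue)"
      using big by (intro nn_integral_mono) (auto simp: indicator_def Z_def P_def intro!: ennreal_leI)
    also have "\<dots> \<le> K" by (rule log_bound[OF \<epsilon>])
    finally show ?thesis .
  qed
  have null: "emeasure lebesgue Z = 0 \<or> emeasure lebesgue (P \<eta>) = 0" if \<eta>: "\<eta> > 0" for \<eta>
  proof (rule ccontr)
    let ?e = "emeasure lebesgue Z * emeasure lebesgue (P \<eta>)"
    assume "\<not> ?thesis"
    then have e: "?e \<noteq> 0" by simp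
    have "?e * ennreal (real 1) \<le> K" by (rule prod[OF \<eta>]) simp
    then have "?e < top" using K by (simp add: le_less_trans)
    then obtain r where r: "?e = ennreal r" "r \<ge> 0" by (cases ?e) auto
    obtain k where k: "K = ennreal k" "k \<ge> 0" using K by (cases K) auto
    have rp: "r > 0" using e r by (cases "r = 0") auto
    obtain n where n: "k < real n * r" using reals_Archimedean3[OF rp] by blast
    have n1: "n \<ge> 1" using n k(2) by (cases n) auto
    have "ennreal r * ennreal (real n) \<le> ennreal k" using prod[OF \<eta> n1] unfolding r(1) k(1) .
    then have "r * real n \<le> k" using r(2) k(2) by (simp flip: ennreal_mult)
    then show False using n by (simp add: mult.commute)
  qed
  have AE_null: "AE x in M. x \<notin> S" if "S \<in> sets lebesgue" "emeasure lebesgue S = 0" for S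
  proof -
    have "AE x in lebesgue. x \<notin> S" using that by (intro AE_not_in) auto
    then show ?thesis by (auto simp: AE_lebesgue_on_iff elim!: eventually_mono)
  qed
  show ?thesis
  proof (cases "emeasure lebesgue Z = 0")
    case True
    have "AE x in M. x \<in> ?b \<longrightarrow> 0 < v x"
      using AE_null[OF Z True] v(2) by eventually_elim (auto simp: Z_def less_le)
    then show ?thesis by blast
  next
    case False
    then have "\<forall>n. AE x in M. x \<notin> P (1 / real (Suc n))" using null AE_null[OF P] by auto
    then have "AE x in M. \<forall>n. x \<notin> P (1 / real (Suc n))" by (subst AE_all_countable)
    then have "AE x in M. x \<in> ?b \<longrightarrow> v x = 0"
      using v(2)
    proof eventually_elim
      case (elim x)
      show ?case
      proof
        assume x: "x \<in> ?b"
        show "v x = 0"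
        proof (rule ccontr)
          assume "v x \<noteq> 0"
          then have "v x > 0" using elim by simp
          then obtain n where "1 / real (Suc n) < v x" using nat_approx_posE by blast
          then show False using elim x by (auto simp: P_def)
        qed
      qed
    qed
    then show ?thesis by blast
  qed
qed

theorem strong_maximum_principle:
  assumes v: "v \<in> H10 \<Omega>" "AE x in M. 0 \<le> v x" "\<And>w. w \<in> H10 \<Omega> \<Longrightarrow> a_form \<Omega> V \<beta> u v w = lam0 * L2_inner \<Omega> v w"
  shows "(AE x in M. v x = 0) \<or> (AE x in M. 0 < v x)"
proof (rule AE_connected_dichotomy[OF convex_connected[OF conv]])
  fix x assume "x \<in> \<Omega>"
  then obtain a b a' b' where ab: "x \<in> box a b" "cbox a b \<subseteq> box a' b'" "cbox a' b' \<subseteq> \<Omega>"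
    using box_between by blast
  then have "box a b \<subseteq> \<Omega>" using box_subset_cbox by blast
  with box_dichotomy[OF v ab(2,3)] ab(1)
  show "\<exists>S. open S \<and> S \<subseteq> \<Omega> \<and> x \<in> S \<and> ((AE y in M. y \<in> S \<longrightarrow> v y = 0) \<or> (AE y in M. y \<in> S \<longrightarrow> 0 < v y))"
    by (intro exI[of _ "box a b"]) auto
qed auto

section \<open>The spectral gap\<close>

lemma ip_eq_0_iff: "f \<in> H10 \<Omega> \<Longrightarrow> L2_inner \<Omega> f f = 0 \<longleftrightarrow> (AE x in M. f x = 0)"
  unfolding L2_inner_self by (rule nsq_eq_0_iff[OF H10_sq_int(1)])

lemma nonneg_orthogonal_imp_0:
  assumes f: "f \<in> H10 \<Omega>" "AE x in M. 0 \<le> f x" and 0: "L2_inner \<Omega> f u = 0"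
  shows "AE x in M. f x = 0"
proof -
  have i: "integrable M (\<lambda>x. f x * u x)" by (rule sq_int_mult[OF H10_sq_int(1)[OF f(1)] H10_sq_int(1)[OF u_mem]])
  have "AE x in M. 0 \<le> f x * u x" using f(2) u_pos by eventually_elim simp
  then have "AE x in M. f x * u x = 0"
    using integral_nonneg_eq_0_iff_AE[OF i] 0 by (simp add: L2_inner_def)
  then show ?thesis using u_pos by eventually_elim simp
qed

text \<open>\<open>\<bar>x\<bar>\<close> is approximated by \<open>sqrt (x\<^sup>2 + \<epsilon>\<^sup>2) - \<epsilon>\<close>, which does not increase the energy; hence this is a
  minimizing family for the Rayleigh quotient.\<close>

lemma abs_eigenfunction:
  assumes x: "x \<in> H10 \<Omega>" and m: "\<And>f. f \<in> H10 \<Omega> \<Longrightarrow> m * L2_inner \<Omega> f f \<le> B u f f"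
    and eig: "\<And>v. v \<in> H10 \<Omega> \<Longrightarrow> B u x v = m * L2_inner \<Omega> x v"
  shows "\<exists>y\<in>H10 \<Omega>. (AE z in M. y z = \<bar>x z\<bar>) \<and> (\<forall>v\<in>H10 \<Omega>. B u y v = m * L2_inner \<Omega> y v)"
proof -
  define s where "s \<epsilon> t = sqrt (t\<^sup>2 + \<epsilon>\<^sup>2) - \<epsilon>" for \<epsilon> t :: real
  have s_le: "\<bar>s \<epsilon> t\<bar> \<le> \<bar>t\<bar>" if \<epsilon>: "\<epsilon> > 0" for \<epsilon> t
  proof -
    have "sqrt (t\<^sup>2 + \<epsilon>\<^sup>2) \<le> \<bar>t\<bar> + \<epsilon>" using sqrt_sum_squares_le_sum_abs[of t \<epsilon>] \<epsilon> by simp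
    moreover have "\<epsilon> \<le> sqrt (t\<^sup>2 + \<epsilon>\<^sup>2)" by (rule real_le_rsqrt) simp
    ultimately show ?thesis by (simp add: s_def)
  qed
  define \<epsilon> where "\<epsilon> n = 1 / real (Suc n)" for n
  have \<epsilon>: "\<epsilon> n > 0" for n by (simp add: \<epsilon>_def)
  define X where "X n = (\<lambda>z. s (\<epsilon> n) (x z))" for n
  define q where "q n z = x z / sqrt ((x z)\<^sup>2 + (\<epsilon> n)\<^sup>2)" for n z
  have p: "h10_pair (X n) (\<lambda>z. q n z *\<^sub>R weak_grad \<Omega> x z)" and q: "\<bar>q n z\<bar> \<le> 1" for n z
  proof -
    have pos: "0 < t\<^sup>2 + (\<epsilon> n)\<^sup>2" for t using \<epsilon>[of n] by (simp add: add_nonneg_pos)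
    have b: "\<bar>t / sqrt (t\<^sup>2 + (\<epsilon> n)\<^sup>2)\<bar> \<le> 1" for t
    proof -
      have "\<bar>t\<bar> \<le> sqrt (t\<^sup>2 + (\<epsilon> n)\<^sup>2)" by (rule real_le_rsqrt) simp
      then show ?thesis using pos[of t] by (simp add: abs_divide)
    qed
    then show "\<bar>q n z\<bar> \<le> 1" by (simp add: q_def)
    have D: "(s (\<epsilon> n) has_real_derivative t / sqrt (t\<^sup>2 + (\<epsilon> n)\<^sup>2)) (at t)" for t
    proof -
      have "((\<lambda>t. t\<^sup>2 + (\<epsilon> n)\<^sup>2) has_real_derivative 2 * t) (at t)" by (auto intro!: derivative_eq_intros)
      from DERIV_diff[OF DERIV_chain2[OF DERIV_real_sqrt[OF pos] this] DERIV_const] show ?thesis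
        unfolding s_def[abs_def] by (rule DERIV_cong) (simp add: field_simps)
    qed
    have c: "continuous_on UNIV (\<lambda>t. t / sqrt (t\<^sup>2 + (\<epsilon> n)\<^sup>2))"
      by (intro continuous_intros) (use pos in \<open>metis less_irrefl real_sqrt_eq_0_iff\<close>)
    have "s (\<epsilon> n) 0 = 0" using \<epsilon>[of n] by (simp add: s_def)
    from h10_pair_compose[OF H10_imp_h10_pair[OF x] D c this b]
    show "h10_pair (X n) (\<lambda>z. q n z *\<^sub>R weak_grad \<Omega> x z)" by (simp add: X_def q_def)
  qed
  have X: "X n \<in> H10 \<Omega>" for n by (rule h10_pair_imp_H10[OF p])
  have X_le: "\<bar>X n z\<bar> \<le> \<bar>x z\<bar>" for n z using s_le[OF \<epsilon>] by (simp add: X_def)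
  have weighted: "(LINT z|M. W z * X n z * X n z) \<le> (LINT z|M. W z * x z * x z)"
    if W: "AE z in M. 0 \<le> W z" and i: "\<And>f. f \<in> H10 \<Omega> \<Longrightarrow> integrable M (\<lambda>z. W z * f z * f z)" for W n
  proof (rule integral_mono_AE[OF i[OF X] i[OF x]])
    show "AE z in M. W z * X n z * X n z \<le> W z * x z * x z"
      using W
    proof eventually_elim
      case (elim z)
      have "X n z * X n z \<le> x z * x z" using X_le[of n z] by (simp add: abs_le_square_iff power2_eq_square)
      from mult_left_mono[OF this elim] show ?case by (simp add: mult.assoc)
    qed
  qed
  have ip_X: "L2_inner \<Omega> (X n) (X n) \<le> L2_inner \<Omega> x x" for n
    using weighted[of "\<lambda>z. 1"] sq_int_mult[OF H10_sq_int(1) H10_sq_int(1)] by (simp add: L2_inner_def)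
  have B_X: "B u (X n) (X n) \<le> B u x x" for n
  proof -
    have "nsq M (weak_grad \<Omega> (X n)) = nsq M (\<lambda>z. q n z *\<^sub>R weak_grad \<Omega> x z)"
      using h10_pair_grad_AE[OF p] sq_int_measurable[OF H10_sq_int(2)[OF X]] sq_int_measurable[OF h10_pairD(2)[OF p]]
      by (intro nsq_cong_AE) auto
    also have "\<dots> \<le> 1\<^sup>2 * nsq M (weak_grad \<Omega> x)"
      by (rule sq_int_bound(2)[OF sq_int_measurable[OF h10_pairD(2)[OF p]] H10_sq_int(2)[OF x]])
        (use mult_right_mono[OF q norm_ge_zero] in auto)
    finally have "1/2 * grad_inner \<Omega> (X n) (X n) \<le> 1/2 * grad_inner \<Omega> x x" by (simp add: grad_inner_self)
    moreover have "vform (X n) (X n) \<le> vform x x"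
      unfolding vform_def by (rule weighted[OF V_nonneg V_integrable])
    moreover have "quad u u (X n) (X n) \<le> quad u u x x"
      unfolding quad_def by (rule weighted[OF _ quad_integrable[OF dim u_mem u_mem]]) auto
    then have "\<beta> * quad u u (X n) (X n) \<le> \<beta> * quad u u x x" using \<beta> by (rule mult_left_mono)
    ultimately have "a_form \<Omega> V \<beta> u (X n) (X n) \<le> a_form \<Omega> V \<beta> u x x" unfolding a_form_eq by linarith
    then show ?thesis unfolding B_def using \<tau> by (intro add_mono ip_X mult_left_mono) auto
  qed
  have ax: "sq_int M (\<lambda>z. \<bar>x z\<bar>)"
    by (rule sq_int_bound(1)[OF _ H10_sq_int(1)[OF x], of _ 1]) (use H10_measurable[OF x] in auto)
  have lim: "(\<lambda>n. nsq M (\<lambda>z. X n z - \<bar>x z\<bar>)) \<longlonglongrightarrow> 0"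
  proof (rule L2_dominated_convergence(2)[OF H10_measurable[OF X] sq_int_measurable[OF ax] ax])
    show "AE z in M. norm (X n z) \<le> \<bar>x z\<bar>" for n using X_le by simp
    have "(\<lambda>n. X n z) \<longlonglongrightarrow> \<bar>x z\<bar>" for z
    proof -
      have e0: "\<epsilon> \<longlonglongrightarrow> 0" unfolding \<epsilon>_def[abs_def] by (rule LIMSEQ_Suc[OF lim_1_over_n])
      have "(\<lambda>n. sqrt ((x z)\<^sup>2 + (\<epsilon> n)\<^sup>2) - \<epsilon> n) \<longlonglongrightarrow> sqrt ((x z)\<^sup>2 + 0\<^sup>2) - 0"
        by (intro tendsto_intros e0)
      then show ?thesis by (simp add: X_def s_def)
    qed
    then show "AE z in M. (\<lambda>n. X n z) \<longlonglongrightarrow> \<bar>x z\<bar>" by simp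
  qed
  have Cauchy: "\<exists>N. \<forall>i\<ge>N. \<forall>j\<ge>N. L2_inner \<Omega> (X i - X j) (X i - X j) < e" if e: "e > 0" for e
  proof -
    have "\<forall>\<^sub>F n in sequentially. nsq M (\<lambda>z. X n z - \<bar>x z\<bar>) < e / 4"
      using order_tendstoD(2)[OF lim, of "e / 4"] e by simp
    then obtain N where N: "\<And>n. n \<ge> N \<Longrightarrow> nsq M (\<lambda>z. X n z - \<bar>x z\<bar>) < e / 4" by (auto simp: eventually_sequentially)
    have "L2_inner \<Omega> (X i - X j) (X i - X j) < e" if ij: "i \<ge> N" "j \<ge> N" for i j
      using nsq_triangle[OF H10_sq_int(1)[OF X[of i]] ax H10_sq_int(1)[OF X[of j]]] N[OF ij(1)] N[OF ij(2)]
        nsq_minus_commute[of M "X j" "\<lambda>z. \<bar>x z\<bar>"] by (simp add: L2_inner_self fun_diff_def)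
    then show ?thesis by blast
  qed
  have ip_lim: "(\<lambda>n. L2_inner \<Omega> (X n) (X n)) \<longlonglongrightarrow> L2_inner \<Omega> x x"
    using L2_tendsto_nsq[OF H10_sq_int(1)[OF X] ax lim] by (simp add: L2_inner_self nsq_def)
  \<comment> \<open>Nonnegative because \<open>m\<close> is minimal. From above, the energy of
    \<open>X n\<close> does not exceed that of \<open>x\<close>, which is m times its squared norm,
    and the norms converge.\<close>
  have Q: "(\<lambda>n. B u (X n) (X n) - m * L2_inner \<Omega> (X n) (X n)) \<longlonglongrightarrow> 0"
  proof (rule tendsto_sandwich[where f = "\<lambda>n. 0"])
    show "(\<lambda>n. m * L2_inner \<Omega> x x - m * L2_inner \<Omega> (X n) (X n)) \<longlonglongrightarrow> 0"
      using tendsto_diff[OF tendsto_const tendsto_mult[OF tendsto_const ip_lim], of "m * L2_inner \<Omega> x x" m] by simp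
    show "\<forall>\<^sub>F n in sequentially. B u (X n) (X n) - m * L2_inner \<Omega> (X n) (X n) \<le> m * L2_inner \<Omega> x x - m * L2_inner \<Omega> (X n) (X n)"
      using B_X eig[OF x] by simp
    show "\<forall>\<^sub>F n in sequentially. 0 \<le> B u (X n) (X n) - m * L2_inner \<Omega> (X n) (X n)" using m[OF X] by simp
  qed (rule tendsto_const)
  obtain C where C: "\<And>f. f \<in> H10 \<Omega> \<Longrightarrow> B u f f \<le> C * H1_inner f f" using B_upper[OF u_mem] by blast
  have "\<exists>y\<in>H10 \<Omega>. (\<lambda>n. L2_inner \<Omega> (X n - y) (X n - y)) \<longlonglongrightarrow> 0 \<and> (\<forall>v\<in>H10 \<Omega>. B u y v = m * L2_inner \<Omega> y v)"
    by (rule minimizing_limit[where X = X, OF psd_B[OF u_mem] cB_pos B_lower[OF u_mem] C m X Q Cauchy])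
  then obtain y where y: "y \<in> H10 \<Omega>" "(\<lambda>n. L2_inner \<Omega> (X n - y) (X n - y)) \<longlonglongrightarrow> 0" "\<forall>v\<in>H10 \<Omega>. B u y v = m * L2_inner \<Omega> y v"
    by blast
  have "nsq M (\<lambda>z. y z - \<bar>x z\<bar>) \<le> 0"
  proof (rule LIMSEQ_le_const)
    show "(\<lambda>n. 2 * L2_inner \<Omega> (X n - y) (X n - y) + 2 * nsq M (\<lambda>z. X n z - \<bar>x z\<bar>)) \<longlonglongrightarrow> 0"
      using tendsto_add[OF tendsto_mult[OF tendsto_const y(2)] tendsto_mult[OF tendsto_const lim], of 2 2] by simp
    show "\<exists>N. \<forall>n\<ge>N. nsq M (\<lambda>z. y z - \<bar>x z\<bar>) \<le> 2 * L2_inner \<Omega> (X n - y) (X n - y) + 2 * nsq M (\<lambda>z. X n z - \<bar>x z\<bar>)"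
      using nsq_triangle[OF H10_sq_int(1)[OF y(1)] H10_sq_int(1)[OF X] ax] nsq_minus_commute[of M y]
      by (simp add: L2_inner_self fun_diff_def)
  qed
  then have "nsq M (\<lambda>z. y z - \<bar>x z\<bar>) = 0" using nsq_nonneg[of M "\<lambda>z. y z - \<bar>x z\<bar>"] by linarith
  then have "AE z in M. y z - \<bar>x z\<bar> = 0"
    using nsq_eq_0_iff[OF sq_int_diff[OF H10_sq_int(1)[OF y(1)] ax]] by blast
  then have "AE z in M. y z = \<bar>x z\<bar>" by eventually_elim simp
  with y show ?thesis by blast
qed

text \<open>The modulus of a Rayleigh minimizer is an eigenfunction for the same value. Being
  nonnegative and nonzero, it is not orthogonal to the positive \<open>u\<close>; eigenfunctions of
  a symmetric form for different values are orthogonal, so the minimal value is L1.\<close>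

lemma L1_minimal:
  assumes f: "f \<in> H10 \<Omega>"
  shows "L1 * L2_inner \<Omega> f f \<le> B u f f"
proof -
  obtain C where C: "\<And>f. f \<in> H10 \<Omega> \<Longrightarrow> B u f f \<le> C * H1_inner f f" using B_upper[OF u_mem] by blast
  have "L2_inner \<Omega> u u > 0" using u_norm by simp
  from Rayleigh_minimizer[OF psd_B[OF u_mem] cB_pos B_lower[OF u_mem] C u_mem this]
  obtain x m where x: "x \<in> H10 \<Omega>" "L2_inner \<Omega> x x = 1" and m: "\<And>v. v \<in> H10 \<Omega> \<Longrightarrow> m * L2_inner \<Omega> v v \<le> B u v v"
    and eig: "\<And>v. v \<in> H10 \<Omega> \<Longrightarrow> B u x v = m * L2_inner \<Omega> x v" by blast
  obtain y where y: "y \<in> H10 \<Omega>" "AE z in M. y z = \<bar>x z\<bar>" "\<And>v. v \<in> H10 \<Omega> \<Longrightarrow> B u y v = m * L2_inner \<Omega> y v"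
    using abs_eigenfunction[OF x(1) m eig] by blast
  have "L2_inner \<Omega> y u \<noteq> 0"
  proof
    assume "L2_inner \<Omega> y u = 0"
    moreover have "AE z in M. 0 \<le> y z" using y(2) by eventually_elim simp
    ultimately have "AE z in M. y z = 0" using y(1) by (intro nonneg_orthogonal_imp_0)
    then have "AE z in M. x z = 0" using y(2) by eventually_elim simp
    then show False using ip_eq_0_iff[OF x(1)] x(2) by simp
  qed
  moreover have "m * L2_inner \<Omega> y u = L1 * L2_inner \<Omega> y u"
    using y(3)[OF u_mem] B_u_eigen[OF y(1)] unfolding B.sym[OF y(1) u_mem] ip.sym[OF y(1) u_mem] by linarith
  ultimately have "m = L1" by simp
  then show ?thesis using m[OF f] by simp
qed

text \<open>Suppose the minimum on the complement were L1, with minimizer h. By minimality of L1 the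
  modulus of h is then an eigenfunction as well, and so is the nonnegative sum of h and its modulus.
  By the strong maximum principle this sum is zero or positive almost everywhere, so h has one sign,
  which is incompatible with being orthogonal to \<open>u\<close> and nonzero. The vector
  \<open>v0\<close> guarantees that the complement is not trivial.\<close>

lemma spectral_gap:
  assumes v0: "v0 \<in> H10 \<Omega>" "L2_inner \<Omega> v0 u = 0" "0 < L2_inner \<Omega> v0 v0"
  shows "\<exists>h\<in>H10 \<Omega>. \<exists>L2. L1 < L2 \<and> L2_inner \<Omega> h h = 1 \<and> (\<forall>v\<in>H10 \<Omega>. B u h v = L2 * L2_inner \<Omega> h v) \<and>
    (\<forall>r\<in>H10 \<Omega>. L2_inner \<Omega> r u = 0 \<longrightarrow> L2 * L2_inner \<Omega> r r \<le> B u r r)"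
proof -
  let ?K = "{v \<in> H10 \<Omega>. L2_inner \<Omega> v u = 0}"
  interpret K: compact_pair ?K H1_inner "L2_inner \<Omega>" by (rule compact_pair_orthogonal[OF bnd u_mem])
  obtain C where C: "\<And>f. f \<in> H10 \<Omega> \<Longrightarrow> B u f f \<le> C * H1_inner f f" using B_upper[OF u_mem] by blast
  have "\<exists>x\<in>?K. \<exists>m. L2_inner \<Omega> x x = 1 \<and> (\<forall>v\<in>?K. m * L2_inner \<Omega> v v \<le> B u v v) \<and> (\<forall>v\<in>?K. B u x v = m * L2_inner \<Omega> x v)"
  proof (rule K.Rayleigh_minimizer[where C = C])
    show "psd_form ?K (B u)" by (rule psd_form_subspace[OF psd_B[OF u_mem] K.G.sub]) blast
    show "cB * H1_inner x x \<le> B u x x" "B u x x \<le> C * H1_inner x x" if "x \<in> ?K" for x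
      using that B_lower[OF u_mem] C by auto
  qed (use v0 cB_pos in auto)
  then obtain h m where h: "h \<in> H10 \<Omega>" "L2_inner \<Omega> h u = 0" "L2_inner \<Omega> h h = 1"
    and m: "\<And>r. r \<in> H10 \<Omega> \<Longrightarrow> L2_inner \<Omega> r u = 0 \<Longrightarrow> m * L2_inner \<Omega> r r \<le> B u r r"
    and eigK: "\<And>v. v \<in> H10 \<Omega> \<Longrightarrow> L2_inner \<Omega> v u = 0 \<Longrightarrow> B u h v = m * L2_inner \<Omega> h v" by blast
  have hu: "B u h u = 0" using B_u_eigen[OF h(1)] B.sym[OF h(1) u_mem] ip.sym[OF h(1) u_mem] h(2) by simp
  \<comment> \<open>The minimization gives the equation for orthogonal \<open>v\<close> only; it
    extends to all \<open>v\<close> because both sides vanish at \<open>u\<close>.\<close>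
  have eig: "B u h v = m * L2_inner \<Omega> h v" if v: "v \<in> H10 \<Omega>" for v
  proof -
    define w where "w = v - L2_inner \<Omega> v u *\<^sub>R u"
    have w: "w \<in> H10 \<Omega>" "L2_inner \<Omega> w u = 0" using v u_mem u_norm by (simp_all add: w_def ip.linear_simps)
    from eigK[OF w] show ?thesis using v u_mem h(1,2) hu by (simp add: w_def B.linear_simps ip.linear_simps)
  qed
  have "L1 \<le> m" using L1_minimal[OF h(1)] eig[OF h(1)] h(3) by simp
  moreover have "L1 \<noteq> m"
  proof
    assume L: "L1 = m"
    have eig1: "B u h v = L1 * L2_inner \<Omega> h v" if "v \<in> H10 \<Omega>" for v using eig[OF that] L by simp
    obtain y where y: "y \<in> H10 \<Omega>" "AE z in M. y z = \<bar>h z\<bar>" "\<And>v. v \<in> H10 \<Omega> \<Longrightarrow> B u y v = L1 * L2_inner \<Omega> y v"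
      using abs_eigenfunction[OF h(1) L1_minimal eig1] by blast
    have hy: "h + y \<in> H10 \<Omega>" using h(1) y(1) by simp
    have nn: "AE z in M. 0 \<le> (h + y) z" using y(2) by eventually_elim simp
    have a: "a_form \<Omega> V \<beta> u (h + y) w = lam0 * L2_inner \<Omega> (h + y) w" if w: "w \<in> H10 \<Omega>" for w
    proof -
      have "B u (h + y) w = L1 * L2_inner \<Omega> (h + y) w"
        using eig[OF w] y(3)[OF w] h(1) y(1) w L by (simp add: B.linear_simps ip.linear_simps algebra_simps)
      then show ?thesis using \<tau> by (simp add: B_def L1_def algebra_simps)
    qed
    from strong_maximum_principle[OF hy nn a] have "AE z in M. h z = 0"
    proof
      assume "AE z in M. (h + y) z = 0"
      then have "AE z in M. 0 \<le> ((-1) *\<^sub>R h) z" using y(2) by eventually_elim auto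
      moreover have "L2_inner \<Omega> ((-1) *\<^sub>R h) u = 0" using h u_mem by (simp only: ip.scale_left)
      ultimately have "AE z in M. ((-1) *\<^sub>R h) z = 0"
        by (intro nonneg_orthogonal_imp_0[OF ip.mem(3)[OF h(1)]])
      then show ?thesis by eventually_elim simp
    next
      assume "AE z in M. 0 < (h + y) z"
      then have "AE z in M. 0 \<le> h z" using y(2) by eventually_elim auto
      then show ?thesis using h by (intro nonneg_orthogonal_imp_0)
    qed
    then show False using ip_eq_0_iff[OF h(1)] h(3) by simp
  qed
  ultimately have "L1 < m" by simp
  then show ?thesis using h m eig by blast
qed

section \<open>Counted eigenvalues and the final estimate\<close>

lemma eigenspace_nontrivial_iff:
  assumes "has_dimension_ae \<Omega> W m"
  shows "m \<ge> 1 \<longleftrightarrow> (\<exists>w\<in>W. \<not> (AE x in M. w x = 0))"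
proof
  obtain e :: "nat \<Rightarrow> 'a \<Rightarrow> real" where e: "\<forall>i<m. e i \<in> W"
    "\<forall>c :: nat \<Rightarrow> real. (AE x in M. (\<Sum>i<m. c i * e i x) = 0) \<longrightarrow> (\<forall>i<m. c i = 0)"
    "\<forall>w\<in>W. \<exists>c :: nat \<Rightarrow> real. AE x in M. w x = (\<Sum>i<m. c i * e i x)"
    using assms unfolding has_dimension_ae_def by blast
  {
    assume m: "m \<ge> 1"
    have "(\<Sum>i<m. (if i = 0 then 1 else 0) * e i x) = e 0 x" for x
      using m by (simp add: if_distrib[of "\<lambda>c. c * _"] sum.delta cong: if_cong)
    with e(2)[rule_format, of "\<lambda>i. if i = 0 then 1 else 0" 0] m have "\<not> (AE x in M. e 0 x = 0)" by auto
    then show "\<exists>w\<in>W. \<not> (AE x in M. w x = 0)" using e(1) m by auto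
  }
  assume "\<exists>w\<in>W. \<not> (AE x in M. w x = 0)"
  then obtain w where w: "w \<in> W" "\<not> (AE x in M. w x = 0)" by blast
  show "m \<ge> 1"
  proof (rule ccontr)
    assume "\<not> m \<ge> 1"
    then have "m = 0" by simp
    then show False using e(3) w by simp
  qed
qed

text \<open>Translates between the minimum L2 and the list \<open>lam\<close>. The chain of
  inequalities yields that L1/L2 is at most the quotient in the theorem.\<close>

lemma second_eigenvalue:
  assumes ev: "ordered_eigenvalues \<Omega> V \<beta> u lam"
  shows "\<exists>L2. L1 < L2 \<and> (\<forall>r\<in>H10 \<Omega>. L2_inner \<Omega> r u = 0 \<longrightarrow> L2 * L2_inner \<Omega> r r \<le> B u r r) \<and>
    L1 \<le> 1 + \<tau> * lam 1 \<and> 1 + \<tau> * lam 1 \<le> 1 + \<tau> * lam 2 \<and> 1 + \<tau> * lam 2 \<le> L2"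
proof -
  define N where "N \<mu> = {i. 1 \<le> i \<and> lam i = \<mu>}" for \<mu>
  have mono: "\<And>i j. 1 \<le> i \<Longrightarrow> i \<le> j \<Longrightarrow> lam i \<le> lam j" and fin: "finite (N \<mu>)"
    and dimN: "has_dimension_ae \<Omega> (eigenspace \<Omega> V \<beta> u \<mu>) (card (N \<mu>))" for \<mu>
    using ev by (auto simp: ordered_eigenvalues_def N_def mono_on_def)
  have ev_iff: "N \<mu> \<noteq> {} \<longleftrightarrow> (\<exists>w\<in>eigenspace \<Omega> V \<beta> u \<mu>. L2_inner \<Omega> w w \<noteq> 0)" for \<mu>
  proof -
    have "N \<mu> \<noteq> {} \<longleftrightarrow> card (N \<mu>) \<ge> 1" using fin[of \<mu>] by (auto simp: card_gt_0_iff Suc_le_eq)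
    also have "\<dots> \<longleftrightarrow> (\<exists>w\<in>eigenspace \<Omega> V \<beta> u \<mu>. L2_inner \<Omega> w w \<noteq> 0)"
      unfolding eigenspace_nontrivial_iff[OF dimN] using ip_eq_0_iff by (auto simp: eigenspace_def)
    finally show ?thesis .
  qed
  have evD: "\<exists>w\<in>H10 \<Omega>. L2_inner \<Omega> w w > 0 \<and> (\<forall>v\<in>H10 \<Omega>. a_form \<Omega> V \<beta> u w v = lam i * L2_inner \<Omega> w v)" if "i \<ge> 1" for i
  proof -
    have "N (lam i) \<noteq> {}" using that by (auto simp: N_def)
    then obtain w where w: "w \<in> eigenspace \<Omega> V \<beta> u (lam i)" "L2_inner \<Omega> w w \<noteq> 0" unfolding ev_iff by blast
    then have "w \<in> H10 \<Omega>" by (simp add: eigenspace_def)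
    moreover from this w(2) have "L2_inner \<Omega> w w > 0" using ip.nonneg[of w] by simp
    ultimately show ?thesis using w(1) by (auto simp: eigenspace_def)
  qed
  \<comment> \<open>Every value has finitely many indices, so the infinite list is not constant. An
    eigenvector for another value is orthogonal to \<open>u\<close> and opens the way to
    \<open>spectral_gap\<close>.\<close>
  have "\<exists>i\<ge>1. lam i \<noteq> lam0"
  proof (rule ccontr)
    assume "\<not> ?thesis"
    then have "{1..} \<subseteq> N lam0" by (auto simp: N_def)
    then show False using fin[of lam0] finite_subset infinite_Ici by blast
  qed
  then obtain i where i: "i \<ge> 1" "lam i \<noteq> lam0" by blast
  obtain w where w: "w \<in> H10 \<Omega>" "L2_inner \<Omega> w w > 0" "\<And>v. v \<in> H10 \<Omega> \<Longrightarrow> a_form \<Omega> V \<beta> u w v = lam i * L2_inner \<Omega> w v"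
    using evD[OF i(1)] by blast
  have "lam i * L2_inner \<Omega> w u = lam0 * L2_inner \<Omega> w u"
    using w(3)[OF u_mem] Euler_Lagrange[OF w(1)] unfolding a.sym[OF w(1) u_mem] ip.sym[OF w(1) u_mem] by linarith
  then have "L2_inner \<Omega> w u = 0" using i(2) by simp
  from spectral_gap[OF w(1) this w(2)] obtain h L2 where h: "h \<in> H10 \<Omega>" "L2_inner \<Omega> h h = 1" "\<And>v. v \<in> H10 \<Omega> \<Longrightarrow> B u h v = L2 * L2_inner \<Omega> h v"
    and L2: "L1 < L2" "\<forall>r\<in>H10 \<Omega>. L2_inner \<Omega> r u = 0 \<longrightarrow> L2 * L2_inner \<Omega> r r \<le> B u r r" by blast
  define \<mu> where "\<mu> = (L2 - 1) / \<tau>"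
  have L2\<mu>: "L2 = 1 + \<tau> * \<mu>" using \<tau> by (simp add: \<mu>_def)
  have \<mu>: "lam0 < \<mu>" using L2(1) \<tau> unfolding L2\<mu> L1_def by simp
  have "a_form \<Omega> V \<beta> u h v = \<mu> * L2_inner \<Omega> h v" if "v \<in> H10 \<Omega>" for v
  proof -
    have "\<tau> * a_form \<Omega> V \<beta> u h v = \<tau> * (\<mu> * L2_inner \<Omega> h v)"
      using h(3)[OF that] by (simp add: B_def L2\<mu> algebra_simps)
    then show ?thesis using \<tau> by simp
  qed
  then have "N \<mu> \<noteq> {}" unfolding ev_iff by (intro bexI[of _ h]) (use h in \<open>auto simp: eigenspace_def\<close>)
  then obtain j where j: "j \<ge> 1" "lam j = \<mu>" by (auto simp: N_def)
  have "N lam0 \<noteq> {}" unfolding ev_iff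
    by (intro bexI[of _ u]) (use u_mem u_norm Euler_Lagrange in \<open>auto simp: eigenspace_def\<close>)
  then obtain k where k: "k \<ge> 1" "lam k = lam0" by (auto simp: N_def)
  \<comment> \<open>Both \<mu> and the smaller value \<open>lam0\<close> occur in the list, so one
    of the two indices is at least 2; monotonicity does the rest.\<close>
  have "lam 2 \<le> \<mu>"
  proof (cases "j \<ge> 2")
    case True
    then show ?thesis using mono[of 2 j] j by simp
  next
    case False
    then have "j = 1" using j by simp
    moreover have "k \<noteq> j" using j k \<mu> by auto
    ultimately have "k \<ge> 2" using k by simp
    then show ?thesis using mono[of 2 k] k \<mu> by simp
  qed
  moreover have "lam0 \<le> lam 1"
  proof -
    obtain w where w: "w \<in> H10 \<Omega>" "L2_inner \<Omega> w w > 0" "\<And>v. v \<in> H10 \<Omega> \<Longrightarrow> a_form \<Omega> V \<beta> u w v = lam 1 * L2_inner \<Omega> w v"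
      using evD[of 1] by auto
    have "L1 * L2_inner \<Omega> w w \<le> (1 + \<tau> * lam 1) * L2_inner \<Omega> w w"
      using L1_minimal[OF w(1)] w(3)[OF w(1)] by (simp add: B_def algebra_simps)
    then show ?thesis using w(2) \<tau> by (simp add: L1_def)
  qed
  moreover have "lam 1 \<le> lam 2" by (rule mono) auto
  ultimately show ?thesis using L2 \<tau> by (intro exI[of _ L2]) (simp add: L1_def L2\<mu>)
qed

text \<open>The energy norm and the H1 norm are equivalent with constants \<open>cB\<close> and
  \<open>CB\<close>, so the abstract theorem transfers. It applies because the form at an iterate z
  is the form at \<open>u\<close> plus T z z - T u u.\<close>

theorem gfdn_converges:
  assumes ev: "ordered_eigenvalues \<Omega> V \<beta> u lam"
  shows "\<exists>S C. H10_neighborhood \<Omega> u S \<and> C > 0 \<and>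
    (\<forall>u0\<in>S. L2_norm \<Omega> u0 = 1 \<longrightarrow>
      (\<forall>n. H1_norm \<Omega> (gfdn \<Omega> V \<beta> \<tau> u0 n - u)
        \<le> C * \<bar>(1 + \<tau> * lam 1) / (1 + \<tau> * lam 2)\<bar> ^ n * H1_norm \<Omega> (u0 - u)))"
proof -
  obtain L2 where L2: "L1 < L2" "\<And>r. r \<in> H10 \<Omega> \<Longrightarrow> L2_inner \<Omega> r u = 0 \<Longrightarrow> L2 * L2_inner \<Omega> r r \<le> B u r r"
    and lam: "L1 \<le> 1 + \<tau> * lam 1" "1 + \<tau> * lam 1 \<le> 1 + \<tau> * lam 2" "1 + \<tau> * lam 2 \<le> L2"
    using second_eigenvalue[OF ev] by blast
  obtain C0 where C0: "\<And>f. f \<in> H10 \<Omega> \<Longrightarrow> B u f f \<le> C0 * H1_inner f f" using B_upper[OF u_mem] by blast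
  \<comment> \<open>The upper constant comes without a sign; the maximum with 1 makes it positive,
    so that one may divide by its root.\<close>
  define CB where "CB = max 1 C0"
  have CB: "CB > 0" by (simp add: CB_def)
  have upper: "sqrt (B u f f) \<le> sqrt CB * H1_norm \<Omega> f" if f: "f \<in> H10 \<Omega>" for f
  proof -
    have "C0 * H1_inner f f \<le> CB * H1_inner f f" by (intro mult_right_mono) (auto simp: CB_def H1_inner_self)
    with C0[OF f] show ?thesis by (simp add: H1_norm_inner flip: real_sqrt_mult)
  qed
  have lower: "sqrt cB * sqrt (H1_inner f f) \<le> sqrt (B u f f)" if f: "f \<in> H10 \<Omega>" for f
    using B_lower[OF u_mem f] by (simp flip: real_sqrt_mult)
  define T where "T a b c d = \<tau> * \<beta> * quad a b c d" for a b c d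
  interpret flow: normalized_flow "H10 \<Omega>" "B u" "L2_inner \<Omega>" T u L1 L2 "16 * (\<tau> * \<beta>) * (1 / sqrt cB) ^ 4"
  proof
    show "T (a + b) c d e = T a c d e + T b c d e"
      if "a \<in> H10 \<Omega>" "b \<in> H10 \<Omega>" "c \<in> H10 \<Omega>" "d \<in> H10 \<Omega>" "e \<in> H10 \<Omega>" for a b c d e
      using quad_add[OF dim that] by (simp add: T_def distrib_left)
    show "T (r *\<^sub>R a) b c d = r * T a b c d" for r a b c d by (simp add: T_def quad_scale)
    show "T a b c d = T b a c d" for a b c d unfolding T_def by (subst quad_12) (rule refl)
    show "T a b c d = T c b a d" for a b c d unfolding T_def by (subst quad_13) (rule refl)
    show "\<bar>T a b c d\<bar> \<le> 16 * (\<tau> * \<beta>) * (1 / sqrt cB) ^ 4 * sqrt (B u a a) * sqrt (B u b b) * sqrt (B u c c) * sqrt (B u d d)"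
      if H: "a \<in> H10 \<Omega>" "b \<in> H10 \<Omega>" "c \<in> H10 \<Omega>" "d \<in> H10 \<Omega>" for a b c d
    proof -
      define n where "n f = 1 / sqrt cB * sqrt (B u f f)" for f
      have le: "0 \<le> sqrt (H1_inner f f)" "sqrt (H1_inner f f) \<le> n f" "0 \<le> n f" if "f \<in> H10 \<Omega>" for f
        using lower[OF that] cB_pos B.nonneg[OF that] by (simp_all add: n_def field_simps H1_inner_self)
      have "\<bar>quad a b c d\<bar> \<le> 16 * sqrt (H1_inner a a) * sqrt (H1_inner b b) * sqrt (H1_inner c c) * sqrt (H1_inner d d)"
        by (rule quad_bound[OF dim H])
      also have "\<dots> \<le> 16 * n a * n b * n c * n d"
        by (intro mult_mono mult_nonneg_nonneg order_refl le H) simp_all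
      finally have "\<tau> * \<beta> * \<bar>quad a b c d\<bar> \<le> \<tau> * \<beta> * (16 * n a * n b * n c * n d)"
        using \<tau> \<beta> by (intro mult_left_mono) auto
      moreover have "\<tau> * \<beta> * (16 * n a * n b * n c * n d) =
        16 * (\<tau> * \<beta>) * (1 / sqrt cB) ^ 4 * sqrt (B u a a) * sqrt (B u b b) * sqrt (B u c c) * sqrt (B u d d)"
        unfolding n_def power4_eq_xxxx by (simp only: mult_ac)
      ultimately show ?thesis using \<tau> \<beta> by (simp add: T_def abs_mult)
    qed
    show "0 \<le> 16 * (\<tau> * \<beta>) * (1 / sqrt cB) ^ 4" using \<tau> \<beta> cB_pos by simp
    show "\<bar>L2_inner \<Omega> r s - 2 / L1 * T u u r s\<bar> \<le> sqrt (L2_inner \<Omega> r r) * sqrt (L2_inner \<Omega> s s)"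
      if "r \<in> H10 \<Omega>" "s \<in> H10 \<Omega>" for r s
      unfolding T_def by (rule linearization_bound[OF that])
  qed (use u_mem u_norm B_u_eigen L1_ge_1 L2 ip_le_B in auto)
  obtain d C where d: "d > 0" "C > 0" and conv: "\<And>z n. z 0 \<in> H10 \<Omega> \<Longrightarrow> L2_inner \<Omega> (z 0) (z 0) = 1 \<Longrightarrow>
      sqrt (B u (z 0 - u) (z 0 - u)) < d \<Longrightarrow>
     (\<forall>n. z n \<in> H10 \<Omega> \<longrightarrow> L2_inner \<Omega> (z n) (z n) = 1 \<longrightarrow>
        (\<exists>w\<in>H10 \<Omega>. (\<forall>v\<in>H10 \<Omega>. B u w v + (T (z n) (z n) w v - T u u w v) = L2_inner \<Omega> (z n) v) \<and>
           z (Suc n) = (1 / sqrt (L2_inner \<Omega> w w)) *\<^sub>R w)) \<Longrightarrow>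
     z n \<in> H10 \<Omega> \<and> sqrt (B u (z n - u) (z n - u)) \<le> C * (L1 / L2) ^ n * sqrt (B u (z 0 - u) (z 0 - u))"
    using flow.normalized_flow_converges by blast
  \<comment> \<open>The radius is such that the energy norm of the initial error is below
    \<open>d\<close>.\<close>
  define S where "S = {v \<in> H10 \<Omega>. H1_norm \<Omega> (v - u) < d / sqrt CB}"
  define C' where "C' = 1 / sqrt cB * (C * sqrt CB)"
  have nbh: "H10_neighborhood \<Omega> u S"
    unfolding H10_neighborhood_def
    by (intro conjI exI[of _ "d / sqrt CB"]) (use d(1) CB in \<open>auto simp: S_def fun_diff_def\<close>)
  have B_T: "B u w v + (T z z w v - T u u w v) = B z w v" for z w v
    by (simp add: B_def a_form_eq T_def algebra_simps)
  have main: "H1_norm \<Omega> (gfdn \<Omega> V \<beta> \<tau> u0 n - u) \<le> C' * \<bar>(1 + \<tau> * lam 1) / (1 + \<tau> * lam 2)\<bar> ^ n * H1_norm \<Omega> (u0 - u)"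
    if u0: "u0 \<in> S" "L2_norm \<Omega> u0 = 1" for u0 n
  proof -
    let ?z = "gfdn \<Omega> V \<beta> \<tau> u0"
    have u0H: "u0 \<in> H10 \<Omega>" using u0 by (simp add: S_def)
    have ip0: "L2_inner \<Omega> u0 u0 = 1" using u0(2) by (simp add: L2_norm_inner)
    have up0: "sqrt (B u (u0 - u) (u0 - u)) \<le> sqrt CB * H1_norm \<Omega> (u0 - u)" using u0H u_mem by (intro upper) auto
    moreover have "sqrt CB * H1_norm \<Omega> (u0 - u) < d" using u0 CB by (simp add: S_def field_simps)
    ultimately have small: "sqrt (B u (u0 - u) (u0 - u)) < d" by linarith
    have step: "\<forall>n. ?z n \<in> H10 \<Omega> \<longrightarrow> L2_inner \<Omega> (?z n) (?z n) = 1 \<longrightarrow>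
        (\<exists>w\<in>H10 \<Omega>. (\<forall>v\<in>H10 \<Omega>. B u w v + (T (?z n) (?z n) w v - T u u w v) = L2_inner \<Omega> (?z n) v) \<and>
           ?z (Suc n) = (1 / sqrt (L2_inner \<Omega> w w)) *\<^sub>R w)"
      unfolding B_T gfdn.simps(2) using gfdn_step_equation by blast
    have z: "?z n \<in> H10 \<Omega>" "sqrt (B u (?z n - u) (?z n - u)) \<le> C * (L1 / L2) ^ n * sqrt (B u (u0 - u) (u0 - u))"
      using conv[of ?z n, OF _ _ _ step] u0H ip0 small by simp_all
    have "L1 / L2 \<le> (1 + \<tau> * lam 1) / (1 + \<tau> * lam 2)"
      using L1_ge_1 lam by (intro frac_le) auto
    then have "(L1 / L2) ^ n \<le> \<bar>(1 + \<tau> * lam 1) / (1 + \<tau> * lam 2)\<bar> ^ n"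
      using L1_ge_1 L2(1) by (intro power_mono order_trans[OF _ abs_ge_self]) auto
    then have "C * (L1 / L2) ^ n * sqrt (B u (u0 - u) (u0 - u)) \<le>
        C * \<bar>(1 + \<tau> * lam 1) / (1 + \<tau> * lam 2)\<bar> ^ n * (sqrt CB * H1_norm \<Omega> (u0 - u))"
      using d(2) L1_ge_1 L2(1) B.nonneg[of "u0 - u"] u0H u_mem by (intro mult_mono up0 order_refl) auto
    with z(2) have 1: "sqrt (B u (?z n - u) (?z n - u)) \<le> C * \<bar>(1 + \<tau> * lam 1) / (1 + \<tau> * lam 2)\<bar> ^ n * (sqrt CB * H1_norm \<Omega> (u0 - u))"
      by linarith
    have "H1_norm \<Omega> (?z n - u) = 1 / sqrt cB * (sqrt cB * sqrt (H1_inner (?z n - u) (?z n - u)))"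
      using cB_pos by (simp add: H1_norm_inner)
    also have "\<dots> \<le> 1 / sqrt cB * (C * \<bar>(1 + \<tau> * lam 1) / (1 + \<tau> * lam 2)\<bar> ^ n * (sqrt CB * H1_norm \<Omega> (u0 - u)))"
      using order_trans[OF lower 1] z(1) u_mem cB_pos by (intro mult_left_mono) auto
    also have "\<dots> = C' * \<bar>(1 + \<tau> * lam 1) / (1 + \<tau> * lam 2)\<bar> ^ n * H1_norm \<Omega> (u0 - u)"
      unfolding C'_def by (simp only: mult_ac)
    finally show ?thesis .
  qed
  have "C' > 0" using d(2) CB cB_pos by (simp add: C'_def)
  with nbh main show ?thesis by blast
qed

end

theorem theorem4p2:
  fixes \<Omega> :: "'a::euclidean_space set"
    and V u :: "'a \<Rightarrow> real"
    and \<beta> \<tau> :: real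
    and lam :: "nat \<Rightarrow> real"
  assumes "DIM('a) \<in> {1, 2, 3}"
    and "open \<Omega>" and "\<Omega> \<noteq> {}" and "bounded \<Omega>" and "convex \<Omega>"
    and "V \<in> Linf \<Omega>" and "AE x in lebesgue_on \<Omega>. V x \<ge> 0"
    and "\<beta> \<ge> 0"
    and "\<And>x \<epsilon>. x \<in> \<Omega> \<Longrightarrow> \<epsilon> > 0 \<Longrightarrow> Linf_norm (\<Omega> \<inter> ball x \<epsilon>) V > 0"
    and "positive_ground_state \<Omega> V \<beta> u"
    and "\<tau> > 0"
    and "ordered_eigenvalues \<Omega> V \<beta> u lam"
  shows "\<exists>S C. H10_neighborhood \<Omega> u S \<and> C > 0 \<and>
    (\<forall>u0\<in>S. L2_norm \<Omega> u0 = 1 \<longrightarrow>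
      (\<forall>n\<ge>1. H1_norm \<Omega> (\<lambda>x. gfdn \<Omega> V \<beta> \<tau> u0 n x - u x)
        \<le> C * \<bar>(1 + \<tau> * lam 1) / (1 + \<tau> * lam 2)\<bar> ^ n * H1_norm \<Omega> (\<lambda>x. u0 x - u x)))"
proof -
  interpret ground_state \<Omega> V u \<beta> \<tau> by unfold_locales fact+
  show ?thesis using gfdn_converges[OF assms(12)] unfolding fun_diff_def by blast
qed

end
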